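(* Assume the standing assumption (A), Assumption (F1) and Assumption (F2). Then the process $(X,\Lambda)$ has the Feller property: for every $t>0$ and every bounded continuous $f:\mathbb R^d\times\mathbb S\to\mathbb R$, the map $(x,k)\mapsto\mathbb E_{x,k}[f(X(t),\Lambda(t))]$ is continuous on $\mathbb R^d\times\mathbb S$.
   Context: Let $d,n_0\ge1$ be integers, $\mathbb S=\{1,\dots,n_0\}$ (discrete topology), $\mathbb R^d_0=\mathbb R^d\setminus\{0\}$, $B(0,r)=\{x\in\mathbb R^d:|x|<r\}$, and fix $\varepsilon_0>0$. For each $(x,k)\in\mathbb R^d\times\mathbb S$ let $a(x,k)$ be a symmetric nonnegative definite real $d\times d$ matrix, $b(x,k)\in\mathbb R^d$, and $\nu(x,k,\cdot)$ a $\sigma$-finite measure on $\mathbb R^d_0$ with $\int|u|^2\mathbf 1_{B(0,\varepsilon_0)}(u)\nu(x,k,du)<\infty$ and $\nu(x,k,\mathbb R^d\setminus B(0,\varepsilon_0))<\infty$, all measurable in $(x,k)$. For $k\in\mathbb S$ and $g\in C^2(\mathbb R^d)$ let $\mathcal L_kg(x)=\frac12\mathrm{tr}(a(x,k)\nabla^2g(x))+\langle b(x,k),\nabla g(x)\rangle+\int_{\mathbb R^d_0}\big(g(x+u)-g(x)-\langle\nabla g(x),u\rangle\mathbf 1_{B(0,\varepsilon_0)}(u)\big)\nu(x,k,du)$. Let $Q(x)=(q_{kl}(x))_{k,l\in\mathbb S}$ be measurable in $x$, with $q_{kl}(x)\ge0$ for $k\ne l$ and $\sum_{l}q_{kl}(x)=0$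 for each $k$. For $f:\mathbb R^d\times\mathbb S\to\mathbb R$ with each $f(\cdot,k)\in C^2(\mathbb R^d)$, put $\mathcal Af(x,k)=\mathcal L_kf(\cdot,k)(x)+\sum_{l\in\mathbb S}q_{kl}(x)(f(x,l)-f(x,k))$. Let $\Omega=D([0,\infty),\mathbb R^d\times\mathbb S)$ (càdlàg paths, Skorohod topology), $(X(t),\Lambda(t))=\omega(t)$ the coordinate process, $\mathcal F_t$ the $\sigma$-field generated by the coordinates up to time $t$, $\mathcal F=\bigvee_t\mathcal F_t$. A probability $P$ on $(\Omega,\mathcal F)$ is a martingale solution for $\mathcal A$ starting from $(x,k)$ if $P((X(0),\Lambda(0))=(x,k))=1$ and, for every $f$ with $f(\cdot,k)\in C_c^\infty(\mathbb R^d)$ for all $k$, $f(X(t),\Lambda(t))-f(X(0),\Lambda(0))-\int_0^t\mathcal Af(X(s),\Lambda(s))ds$ is an $\{\mathcal F_t\}$-martingale under $P$. Martingale solutions for $\mathcal L_k$ starting from $x$ are defined analogously on $D([0,\infty),\mathbb R^d)$ with coordinate process $X$ and test functions $g\in C_c^\infty(\mathbb R^d)$. Standing assumption (A): (i) for each $k\in\mathbb S$ and $x\in\mathbb R^d$ the martingale problem for $\mathcal L_k$ starting from $x$ has a unique solution; (ii) each $q_{kk}$ is bounded from below; (iii) $\sup_{(x,k)}\int_{\mathbb R^d_0}(1\wedge|y|^2)\nu(x,k,dy)<\infty$. Under (A) the martingale problem for $\mathcal A$ has a unique solution $P^{(x,k)}$ from each $(x,k)$; $\mathbb E_{x,k}$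 denotes expectation under $P^{(x,k)}$. Assumption (F1): there exist a constant $H>0$ and a nondecreasing concave $\rho:[0,\infty)\to[0,\infty)$ with $\rho(r)>0$ for $r>0$ and $\int_{0+}dr/\rho(r)=\infty$, such that for all $k\in\mathbb S$ and $x,z\in\mathbb R^d$: $\|\sigma(x,k)-\sigma(z,k)\|^2+2\langle x-z,b(x,k)-b(z,k)\rangle\le H|x-z|\rho(|x-z|)$ and $\int_{\mathbb R^d_0}|u|\,\|\nu(x,k,\cdot)-\nu(z,k,\cdot)\|(du)\le H\rho(|x-z|)$, where $\sigma(x,k)$ is a $d\times d$ matrix with $\sigma\sigma^T=a$, $\|\cdot\|$ is the Hilbert–Schmidt norm for matrices and $\|\mu\|$ denotes the total variation measure of a signed measure $\mu$. Assumption (F2): $|q_{kl}(x)-q_{kl}(z)|\le H|x-z|$ for all $x,z\in\mathbb R^d$ and $k\ne l$, with the same $H$. *)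

theory Defs
  imports "HOL-Probability.Probability"
begin

definition partial_dir :: "'d::finite \<Rightarrow> (real^'d \<Rightarrow> real) \<Rightarrow> real^'d \<Rightarrow> real" where
  "partial_dir i g = (\<lambda>x. deriv (\<lambda>t. g (x + t *\<^sub>R axis i 1)) 0)"

fun iter_partial :: "'d::finite list \<Rightarrow> (real^'d \<Rightarrow> real) \<Rightarrow> real^'d \<Rightarrow> real" where
  "iter_partial [] g = g"
| "iter_partial (i # is) g = partial_dir i (iter_partial is g)"

definition smooth_fun :: "(real^'d::finite \<Rightarrow> real) \<Rightarrow> bool" where
  "smooth_fun g \<longleftrightarrow> (\<forall>is. continuous_on UNIV (iter_partial is g) \<and>
      (\<forall>i x. (\<lambda>t. iter_partial is g (x + t *\<^sub>R axis i 1)) differentiable (at 0)))"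

definition C_c_inf :: "(real^'d::finite \<Rightarrow> real) set" where
  "C_c_inf = {g. smooth_fun g \<and> compact (closure {x. g x \<noteq> 0})}"

definition grad :: "(real^'d::finite \<Rightarrow> real) \<Rightarrow> real^'d \<Rightarrow> real^'d" where
  "grad g x = (\<chi> i. partial_dir i g x)"

definition hess :: "(real^'d::finite \<Rightarrow> real) \<Rightarrow> real^'d \<Rightarrow> real^'d^'d" where
  "hess g x = (\<chi> i j. partial_dir i (partial_dir j g) x)"

definition gen_L ::
  "(real^'d::finite \<Rightarrow> nat \<Rightarrow> real^'d^'d) \<Rightarrow> (real^'d \<Rightarrow> nat \<Rightarrow> real^'d) \<Rightarrow>
   (real^'d \<Rightarrow> nat \<Rightarrow> (real^'d) measure) \<Rightarrow> real \<Rightarrow> nat \<Rightarrow> (real^'d \<Rightarrow> real) \<Rightarrow> real^'d \<Rightarrow> real" where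
  "gen_L a b \<nu> \<epsilon>0 k g x =
     (1/2) * trace (a x k ** hess g x) + b x k \<bullet> grad g x
     + (\<integral>u. (g (x + u) - g x - (grad g x \<bullet> u) * indicator (ball 0 \<epsilon>0) u) \<partial>(\<nu> x k))"

definition gen_A ::
  "nat \<Rightarrow> (real^'d::finite \<Rightarrow> nat \<Rightarrow> real^'d^'d) \<Rightarrow> (real^'d \<Rightarrow> nat \<Rightarrow> real^'d) \<Rightarrow>
   (real^'d \<Rightarrow> nat \<Rightarrow> (real^'d) measure) \<Rightarrow> real \<Rightarrow> (real^'d \<Rightarrow> nat \<Rightarrow> nat \<Rightarrow> real) \<Rightarrow>
   ((real^'d) \<times> nat \<Rightarrow> real) \<Rightarrow> (real^'d) \<times> nat \<Rightarrow> real" where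
  "gen_A n0 a b \<nu> \<epsilon>0 q f = (\<lambda>(x, k).
     gen_L a b \<nu> \<epsilon>0 k (\<lambda>y. f (y, k)) x + (\<Sum>l\<in>{1..n0}. q x k l * (f (x, l) - f (x, k))))"

definition test_A :: "nat \<Rightarrow> ((real^'d::finite) \<times> nat \<Rightarrow> real) set" where
  "test_A n0 = {f. \<forall>k\<in>{1..n0}. (\<lambda>y. f (y, k)) \<in> C_c_inf}"

text \<open>Cadlag paths on [0,infinity) with values in E; a path is extended to t<0 by its
  value at 0, so that these functions correspond bijectively to D([0,infinity),E).\<close>
definition cadlag_paths :: "'e::topological_space set \<Rightarrow> (real \<Rightarrow> 'e) set" where
  "cadlag_paths E = {\<omega>. (\<forall>t. \<omega> t \<in> E) \<and> (\<forall>t<0. \<omega> t = \<omega> 0) \<and>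
      (\<forall>t\<ge>0. continuous (at_right t) \<omega>) \<and> (\<forall>t>0. \<exists>l\<in>E. (\<omega> \<longlongrightarrow> l) (at_left t))}"

definition path_filt :: "'e::topological_space set \<Rightarrow> real \<Rightarrow> (real \<Rightarrow> 'e) measure" where
  "path_filt E t = sigma (cadlag_paths E)
     {{\<omega> \<in> cadlag_paths E. \<omega> s \<in> A} | s A. 0 \<le> s \<and> s \<le> t \<and> A \<in> sets borel}"

definition path_space :: "'e::topological_space set \<Rightarrow> (real \<Rightarrow> 'e) measure" where
  "path_space E = sigma (cadlag_paths E)
     {{\<omega> \<in> cadlag_paths E. \<omega> s \<in> A} | s A. 0 \<le> s \<and> A \<in> sets borel}"

definition is_martingale :: "'a measure \<Rightarrow> (real \<Rightarrow> 'a measure) \<Rightarrow> (real \<Rightarrow> 'a \<Rightarrow> real) \<Rightarrow> bool" where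
  "is_martingale P F M \<longleftrightarrow>
     (\<forall>t\<ge>0. M t \<in> borel_measurable (F t) \<and> integrable P (M t)) \<and>
     (\<forall>s t A. 0 \<le> s \<longrightarrow> s \<le> t \<longrightarrow> A \<in> sets (F s) \<longrightarrow>
        (\<integral>\<omega>. indicator A \<omega> * M t \<omega> \<partial>P) = (\<integral>\<omega>. indicator A \<omega> * M s \<omega> \<partial>P))"

definition mp_solution ::
  "'e::topological_space set \<Rightarrow> ('e \<Rightarrow> real) set \<Rightarrow> (('e \<Rightarrow> real) \<Rightarrow> 'e \<Rightarrow> real) \<Rightarrow> 'e \<Rightarrow>
   (real \<Rightarrow> 'e) measure \<Rightarrow> bool" where
  "mp_solution E T G e0 P \<longleftrightarrow>
     sets P = sets (path_space E) \<and> prob_space P \<and>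
     emeasure P {\<omega> \<in> space P. \<omega> 0 = e0} = 1 \<and>
     (\<forall>f\<in>T. is_martingale P (path_filt E)
        (\<lambda>t \<omega>. f (\<omega> t) - f (\<omega> 0) - (LINT s:{0..t}|lborel. G f (\<omega> s))))"

text \<open>integral of g against the total variation measure of mu1 - mu2 (sigma-finite measures),
  computed via densities with respect to the dominating measure mu1 + mu2.\<close>
definition tv_nn_integral :: "('a \<Rightarrow> ennreal) \<Rightarrow> 'a measure \<Rightarrow> 'a measure \<Rightarrow> ennreal" where
  "tv_nn_integral g \<mu>1 \<mu>2 =
    (let m = measure_of (space \<mu>1) (sets \<mu>1) (\<lambda>A. emeasure \<mu>1 A + emeasure \<mu>2 A);
         f1 = RN_deriv m \<mu>1; f2 = RN_deriv m \<mu>2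
     in \<integral>\<^sup>+u. g u * ((f1 u - f2 u) + (f2 u - f1 u)) \<partial>m)"

end

theory Submission
  imports Defs "HOL-Computational_Algebra.Polynomial"
begin

text \<open>
  The martingale problem enters only through the identity \<open>E f(X t, \<Lambda> t) = f(x, k) + E (\<integral>s\<le>t. A f (X s, \<Lambda> s))\<close>
  for test functions \<open>f\<close>. Instead of a coupling of two processes, two runs of a monotone finite-difference scheme are
  coupled.

  The scheme replaces the generator by that of a random walk with bounded rates: difference quotients along the
  drift and along the columns of \<open>\<sigma>\<close>, jumps of size at least \<open>r\<close>, and switching, with the local coefficients cut off
  outside a ball. Following Krylov, one time step takes a supremum over coefficients frozen at nearby points (shaking
  of the coefficients), so that mollifying the iterates of a Lipschitz function \<open>g\<close> gives smooth supersolutions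
  up to a small error; testing the martingale problem with them bounds \<open>E g(X t, \<Lambda> t)\<close> from above by the iterate.
  With \<open>E g\<close> started from \<open>x\<close> and \<open>E (1 - g)\<close> started from \<open>z\<close> bounded in this way, it remains to show that the
  sum of the two iterates exceeds 1 by little when \<open>x\<close> and \<open>z\<close> are close.

  By induction over the time steps, this excess is dominated by an affine function of \<open>D = sqrt (|x - z|\<^sup>2 + \<delta>\<^sup>2)\<close>
  plus a logarithmic Lyapunov function that controls the cut-off. One step of the coupled scheme increases \<open>D\<close> by at
  most \<open>h C \<rho>(D)\<close>, and the concave \<open>\<rho>\<close> is replaced by its tangent at the current term of the Euler sequence of
  \<open>s' = C \<rho>(s)\<close>; by Osgood's condition this sequence stays small when it starts small. Bounded continuous functions
  are then reached through inf-convolutions.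
\<close>


section \<open>Smooth functions with bounded derivatives\<close>

lemma GDERIV_along_line:
  assumes "GDERIV g (x + t *\<^sub>R v) :> D"
  shows "((\<lambda>t. g (x + t *\<^sub>R v)) has_real_derivative v \<bullet> D) (at t)"
proof -
  have "((\<lambda>t. x + t *\<^sub>R v) has_derivative (\<lambda>s. s *\<^sub>R v)) (at t)"
    by (auto intro!: derivative_eq_intros)
  from has_derivative_compose[OF this assms[unfolded gderiv_def]] show ?thesis
    unfolding has_field_derivative_def
    by (rule has_derivative_eq_rhs) (simp add: fun_eq_iff mult.commute)
qed

lemma GDERIV_sum:
  assumes "\<And>j. j \<in> J \<Longrightarrow> GDERIV (f j) x :> D j"
  shows "GDERIV (\<lambda>x. \<Sum>j\<in>J. c j * f j x) x :> (\<Sum>j\<in>J. c j *\<^sub>R D j)"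
proof -
  have "((\<lambda>x. \<Sum>j\<in>J. c j * f j x) has_derivative (\<lambda>h. \<Sum>j\<in>J. c j * (h \<bullet> D j))) (at x)"
    using assms unfolding gderiv_def by (intro has_derivative_sum has_derivative_mult_right)
  then show ?thesis
    by (simp add: gderiv_def inner_sum_right)
qed

lemma GDERIVI_quadratic:
  assumes "\<And>v. \<bar>f (x + v) - f x - v \<bullet> D\<bar> \<le> C * (norm v)\<^sup>2"
  shows "GDERIV f x :> D"
  unfolding gderiv_def
proof (rule has_derivative_at[THEN iffD2], intro conjI bounded_linear_inner_left)
  have "((\<lambda>v::'a. C * norm v) \<longlongrightarrow> C * norm (0::'a)) (at 0)"
    by (intro tendsto_mult tendsto_const tendsto_norm tendsto_ident_at)
  then have lim: "((\<lambda>v::'a. C * norm v) \<longlongrightarrow> 0) (at 0)" by simp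
  have "norm (norm (f (x + v) - f x - v \<bullet> D) / norm v) \<le> C * norm v" for v
  proof (cases "v = 0")
    case False
    then show ?thesis using assms[of v] by (simp add: divide_le_eq power2_eq_square mult.assoc)
  qed simp
  then show "((\<lambda>v. norm (f (x + v) - f x - v \<bullet> D) / norm v) \<longlongrightarrow> 0) (at 0)"
    by (intro Lim_null_comparison[OF _ lim] always_eventually allI)
qed

lemma GDERIV_imp_partial_dir:
  assumes "GDERIV g x :> D"
  shows "partial_dir i g x = D $ i"
    and "(\<lambda>t. g (x + t *\<^sub>R axis i 1)) differentiable (at 0)"
proof -
  have line: "((\<lambda>t. g (x + t *\<^sub>R axis i 1)) has_real_derivative D $ i) (at 0)"
    using GDERIV_along_line[of g x 0 "axis i 1" D] assms by (simp add: inner_axis')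
  then show "partial_dir i g x = D $ i"
    unfolding partial_dir_def by (rule DERIV_imp_deriv)
  show "(\<lambda>t. g (x + t *\<^sub>R axis i 1)) differentiable (at 0)"
    using line real_differentiable_def by blast
qed

lemma GDERIV_imp_grad: "GDERIV g x :> D \<Longrightarrow> grad g x = D"
  by (simp add: grad_def GDERIV_imp_partial_dir vec_eq_iff)

lemma iter_partial_append: "iter_partial (is @ js) g = iter_partial is (iter_partial js g)"
  by (induction "is") auto

lemma iter_partial_eq_0:
  assumes "open S" "\<And>x. x \<in> S \<Longrightarrow> g x = 0" "x \<in> S"
  shows "iter_partial is g x = 0"
  using assms(3)
proof (induction "is" arbitrary: x)
  case (Cons i "is")
  have "((\<lambda>t. x + t *\<^sub>R axis i 1) \<longlongrightarrow> x + 0 *\<^sub>R axis i 1) (nhds (0::real))"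
    by (intro tendsto_intros filterlim_ident)
  then have "\<forall>\<^sub>F t in nhds (0::real). x + t *\<^sub>R axis i 1 \<in> S"
    using assms(1) Cons.prems by (auto dest!: topological_tendstoD)
  then have "\<forall>\<^sub>F t in nhds (0::real). iter_partial is g (x + t *\<^sub>R axis i 1) = 0"
    by (rule eventually_mono) (use Cons.IH in auto)
  then have "deriv (\<lambda>t. iter_partial is g (x + t *\<^sub>R axis i 1)) 0 = deriv (\<lambda>t. 0) 0"
    by (rule deriv_cong_ev) simp
  then show ?case by (simp add: partial_dir_def)
qed (use assms(2) in simp)

definition smooth_bounded :: "(real^'d::finite \<Rightarrow> real) \<Rightarrow> bool" where
  "smooth_bounded g \<longleftrightarrow> (\<forall>is. bounded (range (iter_partial is g)) \<and>
    (\<forall>x. GDERIV (iter_partial is g) x :> grad (iter_partial is g) x))"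

lemma smooth_boundedI:
  assumes "\<And>is x. GDERIV (iter_partial is g) x :> D is x"
    and "\<And>is. bounded (range (iter_partial is g))"
  shows "smooth_bounded g"
  unfolding smooth_bounded_def using assms by (auto simp: GDERIV_imp_grad[OF assms(1)])

lemma smooth_bounded_GDERIV_iter:
  "smooth_bounded g \<Longrightarrow> GDERIV (iter_partial is g) x :> grad (iter_partial is g) x"
  by (simp add: smooth_bounded_def)

lemma smooth_bounded_iter_partial:
  assumes "smooth_bounded g" shows "smooth_bounded (iter_partial js g)"
  using assms by (simp add: smooth_bounded_def flip: iter_partial_append)

lemma smooth_bounded_GDERIV: "smooth_bounded g \<Longrightarrow> GDERIV g x :> grad g x"
  using smooth_bounded_GDERIV_iter[of g "[]"] by simp

lemma smooth_bounded_continuous: "smooth_bounded g \<Longrightarrow> continuous_on UNIV g"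
  by (intro continuous_at_imp_continuous_on ballI
      has_derivative_continuous[OF smooth_bounded_GDERIV[unfolded gderiv_def]])

lemma smooth_bounded_measurable [measurable (raw)]:
  "smooth_bounded g \<Longrightarrow> g \<in> borel_measurable borel"
  by (intro borel_measurable_continuous_onI smooth_bounded_continuous)

lemma smooth_bounded_uniform_bound:
  fixes g :: "real^'d::finite \<Rightarrow> real"
  assumes "smooth_bounded g"
  obtains M where "0 \<le> M" "\<And>is x. length is \<le> n \<Longrightarrow> \<bar>iter_partial is g x\<bar> \<le> M"
proof -
  have "\<exists>M. \<forall>x. \<bar>iter_partial is g x\<bar> \<le> M" for "is"
    using assms unfolding smooth_bounded_def bounded_iff by auto
  then obtain M where partials_le: "\<And>is x. \<bar>iter_partial is g x\<bar> \<le> M is" by metis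
  let ?L = "{is :: 'd list. length is \<le> n}"
  have "finite ?L" using finite_lists_length_le[of "UNIV :: 'd set" n] by simp
  then have "M is \<le> (\<Sum>is\<in>?L. \<bar>M is\<bar>)" if "length is \<le> n" for "is"
    using that member_le_sum[of "is" ?L "\<lambda>is. \<bar>M is\<bar>"] by force
  with partials_le show ?thesis
    by (intro that[of "\<Sum>is\<in>?L. \<bar>M is\<bar>"]) (auto intro: sum_nonneg order.trans)
qed

lemma smooth_bounded_imp_C_c_inf:
  assumes "smooth_bounded g" "\<And>x. x \<notin> cball 0 R \<Longrightarrow> g x = 0"
  shows "g \<in> C_c_inf"
proof -
  note smooth = smooth_bounded_iter_partial[OF assms(1)]
  have "smooth_fun g"
    unfolding smooth_fun_def
    using smooth_bounded_continuous[OF smooth] GDERIV_imp_partial_dir(2)[OF smooth_bounded_GDERIV[OF smooth]]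
    by blast
  moreover have "closure {x. g x \<noteq> 0} \<subseteq> cball 0 R"
    by (rule closure_minimal) (use assms(2) in blast, simp)
  then have "compact (closure {x. g x \<noteq> 0})"
    using compact_cball closed_closure compact_eq_bounded_closed bounded_subset by blast
  ultimately show ?thesis by (simp add: C_c_inf_def)
qed

lemma
  fixes f :: "'j \<Rightarrow> real^'d::finite \<Rightarrow> real"
  assumes smooth: "\<And>j. j \<in> J \<Longrightarrow> smooth_bounded (f j)"
  shows iter_partial_sum:
      "iter_partial is (\<lambda>x. \<Sum>j\<in>J. c j * f j x) = (\<lambda>x. \<Sum>j\<in>J. c j * iter_partial is (f j) x)"
    and smooth_bounded_sum: "smooth_bounded (\<lambda>x. \<Sum>j\<in>J. c j * f j x)"
proof -
  have gderiv: "GDERIV (\<lambda>x. \<Sum>j\<in>J. c j * iter_partial is (f j) x) x :> (\<Sum>j\<in>J. c j *\<^sub>R grad (iter_partial is (f j)) x)"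
    for "is" x by (intro GDERIV_sum smooth_bounded_GDERIV_iter smooth)
  show commute: "iter_partial is (\<lambda>x. \<Sum>j\<in>J. c j * f j x) = (\<lambda>x. \<Sum>j\<in>J. c j * iter_partial is (f j) x)" for "is"
  proof (induction "is")
    case (Cons i "is")
    have "partial_dir i (\<lambda>x. \<Sum>j\<in>J. c j * iter_partial is (f j) x) x = (\<Sum>j\<in>J. c j * partial_dir i (iter_partial is (f j)) x)"
      for x using GDERIV_imp_partial_dir(1)[OF gderiv] by (simp add: grad_def)
    then show ?case using Cons by auto
  qed simp
  have "bounded (range (\<lambda>x. \<Sum>j\<in>J. c j * iter_partial is (f j) x))" for "is"
  proof -
    have "\<exists>B. \<forall>x. \<bar>iter_partial is (f j) x\<bar> \<le> B" if "j \<in> J" for j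
      using smooth[OF that] unfolding smooth_bounded_def bounded_iff by auto
    then obtain B where "\<And>j x. j \<in> J \<Longrightarrow> \<bar>iter_partial is (f j) x\<bar> \<le> B j" by metis
    then have "\<bar>\<Sum>j\<in>J. c j * iter_partial is (f j) x\<bar> \<le> (\<Sum>j\<in>J. \<bar>c j\<bar> * B j)" for x
      by (intro order.trans[OF sum_abs] sum_mono) (simp add: abs_mult mult_left_mono)
    then show ?thesis unfolding bounded_iff by auto
  qed
  with gderiv show "smooth_bounded (\<lambda>x. \<Sum>j\<in>J. c j * f j x)"
    by (intro smooth_boundedI) (simp_all only: commute)
qed

section \<open>Taylor expansion along a direction\<close>

definition dir_deriv :: "real^'d::finite \<Rightarrow> (real^'d \<Rightarrow> real) \<Rightarrow> real^'d \<Rightarrow> real" where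
  "dir_deriv v g x = v \<bullet> grad g x"

lemma dir_deriv_eq_sum: "dir_deriv v g x = (\<Sum>i\<in>UNIV. v $ i * partial_dir i g x)"
  by (simp add: dir_deriv_def inner_vec_def grad_def)

lemma
  assumes "smooth_bounded g"
  shows iter_partial_dir_deriv: "iter_partial is (dir_deriv v g) x = (\<Sum>j\<in>UNIV. v $ j * iter_partial (is @ [j]) g x)"
    and smooth_bounded_dir_deriv: "smooth_bounded (dir_deriv v g)"
proof -
  have sum: "dir_deriv v g = (\<lambda>x. \<Sum>j\<in>UNIV. v $ j * iter_partial [j] g x)"
    by (simp add: fun_eq_iff dir_deriv_eq_sum)
  show "iter_partial is (dir_deriv v g) x = (\<Sum>j\<in>UNIV. v $ j * iter_partial (is @ [j]) g x)"
    unfolding sum iter_partial_append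
    by (simp add: iter_partial_sum[OF smooth_bounded_iter_partial[OF assms]] del: iter_partial.simps)
  show "smooth_bounded (dir_deriv v g)"
    unfolding sum by (intro smooth_bounded_sum smooth_bounded_iter_partial assms)
qed

lemma dir_deriv_twice:
  "smooth_bounded g \<Longrightarrow>
    dir_deriv v (dir_deriv v g) x = (\<Sum>i\<in>UNIV. v $ i * (\<Sum>j\<in>UNIV. v $ j * partial_dir i (partial_dir j g) x))"
  using iter_partial_dir_deriv[of g "[_]" v x] by (simp add: dir_deriv_eq_sum[of v "dir_deriv v g"])

lemma smooth_bounded_dir_deriv_iterate: "smooth_bounded g \<Longrightarrow> smooth_bounded ((dir_deriv v ^^ n) g)"
  by (induction n) (auto intro: smooth_bounded_dir_deriv)

lemma abs_sum_cart_le: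
  fixes v :: "real^'d::finite"
  assumes "\<And>i. \<bar>c i\<bar> \<le> M"
  shows "\<bar>\<Sum>i\<in>UNIV. v $ i * c i\<bar> \<le> real CARD('d) * norm v * M"
proof -
  have "\<bar>\<Sum>i\<in>UNIV. v $ i * c i\<bar> \<le> (\<Sum>i\<in>(UNIV::'d set). norm v * M)"
    using assms by (intro order.trans[OF sum_abs] sum_mono)
      (auto simp: abs_mult intro!: mult_mono component_le_norm_cart)
  then show ?thesis by simp
qed

lemma abs_dir_deriv_iterate_le:
  fixes g :: "real^'d::finite \<Rightarrow> real"
  assumes "smooth_bounded g" "\<And>is x. length is = n \<Longrightarrow> \<bar>iter_partial is g x\<bar> \<le> M"
  shows "\<bar>(dir_deriv v ^^ n) g x\<bar> \<le> (real CARD('d) * norm v) ^ n * M"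
  using assms
proof (induction n arbitrary: g M)
  case 0
  then show ?case using "0.prems"(2)[of "[]"] by simp
next
  case (Suc n)
  have "\<bar>iter_partial is (dir_deriv v g) x\<bar> \<le> real CARD('d) * norm v * M" if "length is = n" for "is" x
    unfolding iter_partial_dir_deriv[OF Suc.prems(1)] using that by (intro abs_sum_cart_le Suc.prems(2)) simp
  from Suc.IH[OF smooth_bounded_dir_deriv[OF Suc.prems(1)] this] show ?case
    by (simp add: mult_ac flip: funpow_swap1)
qed

lemma smooth_bounded_taylor:
  fixes g :: "real^'d::finite \<Rightarrow> real"
  assumes g_smooth: "smooth_bounded g" and partials_le: "\<And>is x. length is = n \<Longrightarrow> \<bar>iter_partial is g x\<bar> \<le> M"
  shows "\<bar>g (x + s *\<^sub>R v) - (\<Sum>m<n. (dir_deriv v ^^ m) g x / fact m * s ^ m)\<bar>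
    \<le> (real CARD('d) * norm v) ^ n * M / fact n * \<bar>s\<bar> ^ n"
proof -
  define line where "line m t = (dir_deriv v ^^ m) g (x + t *\<^sub>R v)" for m t
  have "(line m has_real_derivative line (Suc m) t) (at t)" for m t
    using GDERIV_along_line[OF smooth_bounded_GDERIV[OF smooth_bounded_dir_deriv_iterate[OF g_smooth]]]
    by (simp add: line_def[abs_def] dir_deriv_def)
  then obtain t where "line 0 s = (\<Sum>m<n. line m 0 / fact m * s ^ m) + line n t / fact n * s ^ n"
    using Maclaurin_bi_le[of line "line 0" n s] by auto
  then have "g (x + s *\<^sub>R v) - (\<Sum>m<n. (dir_deriv v ^^ m) g x / fact m * s ^ m) = line n t / fact n * s ^ n"
    by (simp add: line_def)
  also have "\<bar>\<dots>\<bar> \<le> (real CARD('d) * norm v) ^ n * M / fact n * \<bar>s\<bar> ^ n"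
    using abs_dir_deriv_iterate_le[OF g_smooth partials_le, of n v "x + t *\<^sub>R v"]
    by (simp add: line_def abs_mult power_abs mult_right_mono divide_right_mono)
  finally show ?thesis .
qed

corollary smooth_bounded_taylor2:
  fixes g :: "real^'d::finite \<Rightarrow> real"
  assumes "smooth_bounded g" "\<And>is x. length is = 2 \<Longrightarrow> \<bar>iter_partial is g x\<bar> \<le> M"
  shows "\<bar>g (x + s *\<^sub>R v) - g x - s * dir_deriv v g x\<bar> \<le> (real CARD('d))\<^sup>2 * (norm v)\<^sup>2 * M * s\<^sup>2"
proof -
  have "0 \<le> M" using assms(2)[of "[undefined, undefined]" undefined] by force
  then have "(real CARD('d) * norm v)\<^sup>2 * M / fact 2 * \<bar>s\<bar>\<^sup>2 \<le> (real CARD('d))\<^sup>2 * (norm v)\<^sup>2 * M * s\<^sup>2"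
    by (simp add: power_mult_distrib divide_le_eq)
  then show ?thesis
    using smooth_bounded_taylor[OF assms, of 2 x s v] by (simp add: lessThan_nat_numeral algebra_simps)
qed

corollary smooth_bounded_symmetric_taylor3:
  fixes g :: "real^'d::finite \<Rightarrow> real"
  assumes "smooth_bounded g" "\<And>is x. length is = 3 \<Longrightarrow> \<bar>iter_partial is g x\<bar> \<le> M"
  shows "\<bar>g (x + s *\<^sub>R v) + g (x - s *\<^sub>R v) - 2 * g x - s\<^sup>2 * dir_deriv v (dir_deriv v g) x\<bar>
    \<le> (real CARD('d))^3 * (norm v)^3 * M * \<bar>s\<bar>^3"
proof -
  define err where "err s = g (x + s *\<^sub>R v) - (\<Sum>m<3. (dir_deriv v ^^ m) g x / fact m * s ^ m)" for s
  have err: "\<bar>err s\<bar> \<le> (real CARD('d) * norm v)^3 * M / 6 * \<bar>s\<bar>^3" for s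
    unfolding err_def using smooth_bounded_taylor[OF assms, of 3 x s v] by (simp add: fact_numeral)
  have "0 \<le> M" using assms(2)[of "[undefined, undefined, undefined]" undefined] by force
  then have "0 \<le> (real CARD('d) * norm v)^3 * M / 6 * \<bar>s\<bar>^3" by simp
  then have "\<bar>err s + err (- s)\<bar> \<le> (real CARD('d))^3 * (norm v)^3 * M * \<bar>s\<bar>^3"
    using err[of s] err[of "- s"] by (simp add: power_mult_distrib)
  moreover have "err s + err (- s) = g (x + s *\<^sub>R v) + g (x - s *\<^sub>R v) - 2 * g x - s\<^sup>2 * dir_deriv v (dir_deriv v g) x"
    by (simp add: err_def lessThan_nat_numeral eval_nat_numeral)
  ultimately show ?thesis by simp
qed

section \<open>Convolution\<close>

definition conv :: "('a::euclidean_space \<Rightarrow> real) \<Rightarrow> ('a \<Rightarrow> real) \<Rightarrow> 'a \<Rightarrow> real" where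
  "conv \<zeta> \<phi> x = (\<integral>y. \<zeta> y * \<phi> (x - y) \<partial>lborel)"

lemma integrable_conv:
  fixes \<zeta> \<phi> :: "'a::euclidean_space \<Rightarrow> real"
  assumes "integrable lborel \<zeta>" "\<phi> \<in> borel_measurable borel" "\<And>y. \<bar>\<phi> y\<bar> \<le> M"
  shows "integrable lborel (\<lambda>y. \<zeta> y * \<phi> (x - y))"
proof (rule Bochner_Integration.integrable_bound[OF integrable_mult_left[OF assms(1), of M]])
  note [measurable] = borel_measurable_integrable[OF assms(1)] assms(2)
  show "(\<lambda>y. \<zeta> y * \<phi> (x - y)) \<in> borel_measurable lborel" by measurable
  have "0 \<le> M" using assms(3)[of 0] by linarith
  then show "AE y in lborel. norm (\<zeta> y * \<phi> (x - y)) \<le> norm (\<zeta> y * M)"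
    using assms(3) by (intro AE_I2) (auto simp: abs_mult intro!: mult_left_mono)
qed

lemma abs_conv_le:
  fixes \<zeta> \<phi> :: "'a::euclidean_space \<Rightarrow> real"
  assumes "integrable lborel \<zeta>" "\<phi> \<in> borel_measurable borel" "\<And>y. \<bar>\<phi> y\<bar> \<le> M"
  shows "\<bar>conv \<zeta> \<phi> x\<bar> \<le> (\<integral>y. \<bar>\<zeta> y\<bar> \<partial>lborel) * M"
proof -
  have "\<bar>conv \<zeta> \<phi> x\<bar> \<le> (\<integral>y. \<bar>\<zeta> y * \<phi> (x - y)\<bar> \<partial>lborel)"
    unfolding conv_def by (rule integral_abs_bound)
  also have "\<dots> \<le> (\<integral>y. \<bar>\<zeta> y\<bar> * M \<partial>lborel)"
    using assms(3)
    by (intro integral_mono integrable_abs integrable_conv[OF assms] integrable_mult_left assms(1))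
      (auto simp: abs_mult intro!: mult_left_mono)
  finally show ?thesis by simp
qed

lemma conv_commute:
  fixes \<zeta> \<phi> :: "'a::euclidean_space \<Rightarrow> real"
  assumes [measurable]: "\<zeta> \<in> borel_measurable borel" "\<phi> \<in> borel_measurable borel"
  shows "conv \<zeta> \<phi> = conv \<phi> \<zeta>"
proof
  fix x
  have "distr lborel borel (\<lambda>w. x + (-1) *\<^sub>R w) = (lborel :: 'a measure)"
    using lborel_affine[of "-1" x] by (simp add: density_1)
  then have "conv \<zeta> \<phi> x = (\<integral>y. \<zeta> y * \<phi> (x - y) \<partial>distr lborel borel (\<lambda>w. x + (-1) *\<^sub>R w))"
    by (simp add: conv_def)
  also have "\<dots> = (\<integral>w. \<zeta> (x - w) * \<phi> w \<partial>lborel)"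
    by (subst integral_distr) simp_all
  finally show "conv \<zeta> \<phi> x = conv \<phi> \<zeta> x" by (simp add: conv_def mult.commute)
qed

lemma integrable_bounded_support:
  fixes \<zeta> :: "'a::euclidean_space \<Rightarrow> real"
  assumes [measurable]: "\<zeta> \<in> borel_measurable borel"
    and bound: "\<And>y. \<bar>\<zeta> y\<bar> \<le> s" and supp: "\<And>y. y \<notin> cball 0 R \<Longrightarrow> \<zeta> y = 0"
  shows "integrable lborel \<zeta>" "(\<integral>y. \<bar>\<zeta> y\<bar> \<partial>lborel) \<le> s * measure lborel (cball 0 R :: 'a set)"
proof -
  have indicator_bound: "\<bar>\<zeta> y\<bar> \<le> s * indicator (cball 0 R) y" for y
    using bound[of y] supp[of y] by (cases "y \<in> cball 0 R") auto
  have box: "integrable lborel (\<lambda>y::'a. s * indicator (cball 0 R) y)"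
    by (intro integrable_mult_right integrable_real_indicator)
      (auto simp: emeasure_bounded_finite[unfolded infinity_ennreal_def])
  show int: "integrable lborel \<zeta>"
    by (rule Bochner_Integration.integrable_bound[OF box])
      (use indicator_bound in \<open>auto intro!: AE_I2 intro: order.trans[OF _ abs_ge_self]\<close>)
  have "(\<integral>y. \<bar>\<zeta> y\<bar> \<partial>lborel) \<le> (\<integral>y. s * indicator (cball 0 R) y \<partial>(lborel :: 'a measure))"
    by (intro integral_mono integrable_abs int box indicator_bound)
  then show "(\<integral>y. \<bar>\<zeta> y\<bar> \<partial>lborel) \<le> s * measure lborel (cball 0 R :: 'a set)" by simp
qed

lemma GDERIV_conv:
  fixes g :: "real^'d::finite \<Rightarrow> real"
  assumes \<zeta>_integrable: "integrable lborel \<zeta>" and g_smooth: "smooth_bounded g"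
  shows "GDERIV (conv \<zeta> g) x :> (\<chi> i. conv \<zeta> (partial_dir i g) x)"
proof -
  obtain M where partials_le: "0 \<le> M" "\<And>is x. length is \<le> 2 \<Longrightarrow> \<bar>iter_partial is g x\<bar> \<le> M"
    using smooth_bounded_uniform_bound[OF g_smooth] by blast
  have smooth: "smooth_bounded (partial_dir i g)" for i
    using smooth_bounded_iter_partial[OF g_smooth, of "[i]"] by simp
  have [measurable]: "g \<in> borel_measurable borel" "\<And>i. partial_dir i g \<in> borel_measurable borel"
    using g_smooth smooth by (auto intro: smooth_bounded_measurable)
  have integrable_g: "integrable lborel (\<lambda>y. \<zeta> y * g (x - y))" for x
    by (rule integrable_conv[OF \<zeta>_integrable, of _ M]) (use partials_le(2)[of "[]"] in auto)
  have integrable_partial: "integrable lborel (\<lambda>y. \<zeta> y * partial_dir i g (x - y))" for x i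
    by (rule integrable_conv[OF \<zeta>_integrable, of _ M]) (use partials_le(2)[of "[i]"] in auto)
  have "\<bar>conv \<zeta> g (x + v) - conv \<zeta> g x - v \<bullet> (\<chi> i. conv \<zeta> (partial_dir i g) x)\<bar>
      \<le> (\<integral>y. \<bar>\<zeta> y\<bar> \<partial>lborel) * ((real CARD('d))\<^sup>2 * M) * (norm v)\<^sup>2" for v
  proof -
    let ?rem = "\<lambda>p. g (p + v) - g p - (\<Sum>i\<in>UNIV. v $ i * partial_dir i g p)"
    have "conv \<zeta> g (x + v) - conv \<zeta> g x - v \<bullet> (\<chi> i. conv \<zeta> (partial_dir i g) x)
      = (\<integral>y. \<zeta> y * g (x + v - y) - \<zeta> y * g (x - y) - (\<Sum>i\<in>UNIV. v $ i * (\<zeta> y * partial_dir i g (x - y))) \<partial>lborel)"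
      unfolding conv_def using integrable_g integrable_partial
      by (simp add: Bochner_Integration.integral_sum inner_vec_def)
    also have "\<dots> = conv \<zeta> ?rem x"
      unfolding conv_def by (intro Bochner_Integration.integral_cong) (simp_all add: algebra_simps sum_distrib_left)
    finally show ?thesis
      using abs_conv_le[OF \<zeta>_integrable, of ?rem "(real CARD('d))\<^sup>2 * (norm v)\<^sup>2 * M" x]
        smooth_bounded_taylor2[OF g_smooth partials_le(2), of _ 1 v] by (simp add: dir_deriv_eq_sum mult_ac)
  qed
  then show ?thesis by (rule GDERIVI_quadratic)
qed

lemma
  fixes g :: "real^'d::finite \<Rightarrow> real"
  assumes \<zeta>_integrable: "integrable lborel \<zeta>" and g_smooth: "smooth_bounded g"
  shows iter_partial_conv: "iter_partial is (conv \<zeta> g) = conv \<zeta> (iter_partial is g)"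
    and smooth_bounded_conv: "smooth_bounded (conv \<zeta> g)"
proof -
  note gderiv = GDERIV_conv[OF \<zeta>_integrable smooth_bounded_iter_partial[OF g_smooth]]
  show commute: "iter_partial is (conv \<zeta> g) = conv \<zeta> (iter_partial is g)" for "is"
  proof (induction "is")
    case (Cons i "is")
    have "partial_dir i (conv \<zeta> (iter_partial is g)) x = conv \<zeta> (partial_dir i (iter_partial is g)) x" for x
      using GDERIV_imp_partial_dir(1)[OF gderiv] by simp
    then show ?case using Cons by auto
  qed simp
  show "smooth_bounded (conv \<zeta> g)"
  proof (rule smooth_boundedI)
    show "GDERIV (iter_partial is (conv \<zeta> g)) x :> (\<chi> i. conv \<zeta> (partial_dir i (iter_partial is g)) x)" for "is" x
      unfolding commute by (rule gderiv)
    fix "is"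
    obtain M where "\<And>x. \<bar>iter_partial is g x\<bar> \<le> M"
      using smooth_bounded_uniform_bound[OF g_smooth, of "length is"] by (metis order.refl)
    from abs_conv_le[OF \<zeta>_integrable smooth_bounded_measurable[OF smooth_bounded_iter_partial[OF g_smooth]] this]
    show "bounded (range (iter_partial is (conv \<zeta> g)))"
      unfolding commute bounded_iff by auto
  qed
qed

section \<open>Mollifiers\<close>

definition expinv :: "real poly \<Rightarrow> real \<Rightarrow> real" where
  "expinv p t = (if t > 0 then poly p (1 / t) * exp (- (1 / t)) else 0)"

lemma poly_times_exp_neg_tendsto_0:
  "((\<lambda>s. poly p s * exp (- s)) \<longlongrightarrow> (0::real)) at_top"
proof -
  have "((\<lambda>s. \<Sum>i\<le>degree p. coeff p i * (s ^ i / exp s)) \<longlongrightarrow> (\<Sum>i\<le>degree p. coeff p i * 0)) at_top"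
    by (intro tendsto_intros tendsto_power_div_exp_0)
  then show ?thesis
    by (simp add: poly_altdef sum_distrib_right exp_minus divide_inverse mult.assoc)
qed

lemma expinv_has_derivative_at_0: "(expinv p has_real_derivative 0) (at 0)"
proof -
  have "((\<lambda>s. poly ([:0,1:] * p) (inverse s) * exp (- inverse s)) \<longlongrightarrow> (0::real)) (at_right 0)"
    by (rule filterlim_compose[OF poly_times_exp_neg_tendsto_0 filterlim_inverse_at_top_right])
  then have "((\<lambda>s. expinv p s / s) \<longlongrightarrow> 0) (at_right 0)"
    by (rule Lim_transform_eventually)
      (auto simp: eventually_at_filter expinv_def field_simps intro!: always_eventually)
  moreover have "((\<lambda>s. expinv p s / s) \<longlongrightarrow> 0) (at_left 0)"
    by (rule Lim_transform_eventually[OF tendsto_const])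
      (auto simp: eventually_at_filter expinv_def intro!: always_eventually)
  ultimately have "((\<lambda>s. expinv p s / s) \<longlongrightarrow> 0) (at 0)"
    by (simp add: filterlim_split_at)
  then show ?thesis by (simp add: DERIV_def expinv_def)
qed

lemma expinv_has_derivative:
  "(expinv p has_real_derivative expinv ([:0,0,1:] * (p - pderiv p)) t) (at t)"
proof (cases t "0::real" rule: linorder_cases)
  case less
  have "((\<lambda>_. 0) has_real_derivative 0) (at t)" by simp
  then have "(expinv p has_real_derivative 0) (at t)"
    by (rule has_field_derivative_transform_within_open[where S="{..<0}"])
      (use less in \<open>auto simp: expinv_def\<close>)
  then show ?thesis using less by (simp add: expinv_def)
next
  case equal
  then show ?thesis using expinv_has_derivative_at_0 by (simp add: expinv_def)
next
  case greater
  have inv: "((\<lambda>t. 1 / t) has_real_derivative - (1 / t\<^sup>2)) (at t)"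
    using greater by (auto intro!: derivative_eq_intros simp: power2_eq_square)
  have "((\<lambda>t. poly p (1 / t) * exp (- (1 / t))) has_real_derivative
      expinv ([:0,0,1:] * (p - pderiv p)) t) (at t)"
    by (rule DERIV_cong[OF DERIV_mult[OF DERIV_chain2[OF poly_DERIV inv]
      DERIV_chain2[OF DERIV_exp DERIV_minus[OF inv]]]])
      (use greater in \<open>simp add: expinv_def field_simps power2_eq_square\<close>)
  then show ?thesis
    by (rule has_field_derivative_transform_within_open[where S="{0<..}"])
      (use greater in \<open>auto simp: expinv_def\<close>)
qed

lemma expinv_1_pos: "t > 0 \<Longrightarrow> expinv 1 t > 0" and expinv_1_nonneg: "expinv 1 t \<ge> 0"
  and expinv_nonpos: "t \<le> 0 \<Longrightarrow> expinv p t = 0"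
  by (auto simp: expinv_def)

inductive_set expinv_algebra :: "(real^'d::finite \<Rightarrow> real) set" where
  base: "(\<lambda>x. expinv p (c + s * x $ i)) \<in> expinv_algebra"
| add: "f \<in> expinv_algebra \<Longrightarrow> g \<in> expinv_algebra \<Longrightarrow> (\<lambda>x. f x + g x) \<in> expinv_algebra"
| mult: "f \<in> expinv_algebra \<Longrightarrow> g \<in> expinv_algebra \<Longrightarrow> (\<lambda>x. f x * g x) \<in> expinv_algebra"
| scale: "f \<in> expinv_algebra \<Longrightarrow> (\<lambda>x. c * f x) \<in> expinv_algebra"

lemma prod_in_expinv_algebra:
  assumes "finite I" "I \<noteq> {}" "\<And>i. i \<in> I \<Longrightarrow> f i \<in> expinv_algebra"
  shows "(\<lambda>x. \<Prod>i\<in>I. f i x) \<in> expinv_algebra"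
  using assms by (induction I rule: finite_ne_induct) (auto intro: expinv_algebra.mult)

lemma expinv_algebra_GDERIV:
  fixes g :: "real^'d::finite \<Rightarrow> real"
  assumes "g \<in> expinv_algebra"
  shows "\<exists>D. (\<forall>i. (\<lambda>x. D x $ i) \<in> expinv_algebra) \<and> (\<forall>x. GDERIV g x :> D x)"
  using assms
proof induction
  case (base p c s i)
  obtain p' where derivative: "\<And>t. (expinv p has_real_derivative expinv p' t) (at t)"
    using expinv_has_derivative by blast
  have "GDERIV (\<lambda>x. c + s * x $ i) x :> s *\<^sub>R axis i 1" for x :: "real^'d"
    unfolding gderiv_def
    by (auto intro!: derivative_eq_intros bounded_linear.has_derivative[OF bounded_linear_vec_nth]
        simp: inner_axis fun_eq_iff)
  note gderiv = GDERIV_DERIV_compose[OF this derivative]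
  have "(\<lambda>x :: real^'d. (expinv p' (c + s * x $ i) *\<^sub>R s *\<^sub>R axis i 1) $ j) \<in> expinv_algebra" for j
    using expinv_algebra.scale[OF expinv_algebra.base, of "s * axis i 1 $ j"] by (simp add: mult_ac)
  with gderiv show ?case by (intro exI[of _ "\<lambda>x. expinv p' (c + s * x $ i) *\<^sub>R s *\<^sub>R axis i 1"]) blast
next
  case (add f g)
  then obtain F G where "\<And>i. (\<lambda>x. F x $ i) \<in> expinv_algebra" "\<And>x. GDERIV f x :> F x"
    "\<And>i. (\<lambda>x. G x $ i) \<in> expinv_algebra" "\<And>x. GDERIV g x :> G x" by metis
  then show ?case
    by (intro exI[of _ "\<lambda>x. F x + G x"]) (auto intro: expinv_algebra.add GDERIV_add)
next
  case (mult f g)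
  then obtain F G where "\<And>i. (\<lambda>x. F x $ i) \<in> expinv_algebra" "\<And>x. GDERIV f x :> F x"
    "\<And>i. (\<lambda>x. G x $ i) \<in> expinv_algebra" "\<And>x. GDERIV g x :> G x" by metis
  then show ?case using mult.hyps
    by (intro exI[of _ "\<lambda>x. f x *\<^sub>R G x + g x *\<^sub>R F x"])
      (auto intro!: GDERIV_mult expinv_algebra.add[OF expinv_algebra.mult expinv_algebra.mult])
next
  case (scale f c)
  then obtain F where "\<And>i. (\<lambda>x. F x $ i) \<in> expinv_algebra" "\<And>x. GDERIV f x :> F x" by metis
  then show ?case
    using GDERIV_mult[OF GDERIV_const] by (intro exI[of _ "\<lambda>x. c *\<^sub>R F x"]) (force intro: expinv_algebra.scale)
qed

lemma expinv_algebra_smooth_bounded: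
  fixes g :: "real^'d::finite \<Rightarrow> real"
  assumes g_in_algebra: "g \<in> expinv_algebra" and supp: "\<And>x. x \<notin> cball 0 R \<Longrightarrow> g x = 0"
  shows "smooth_bounded g"
proof -
  have alg: "iter_partial is g \<in> expinv_algebra" for "is"
  proof (induction "is")
    case (Cons i "is")
    obtain D where gderiv: "\<And>i. (\<lambda>x. D x $ i) \<in> expinv_algebra" "\<And>x. GDERIV (iter_partial is g) x :> D x"
      using expinv_algebra_GDERIV[OF Cons] by blast
    have "iter_partial (i # is) g = (\<lambda>x. D x $ i)" using GDERIV_imp_partial_dir(1)[OF gderiv(2)] by auto
    then show ?case using gderiv(1) by simp
  qed (use g_in_algebra in simp)
  have gderiv: "GDERIV (iter_partial is g) x :> grad (iter_partial is g) x" for "is" x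
  proof -
    obtain D where gderiv: "\<And>x. GDERIV (iter_partial is g) x :> D x" using expinv_algebra_GDERIV[OF alg] by blast
    then show ?thesis by (simp add: GDERIV_imp_grad[OF gderiv])
  qed
  have "bounded (range (iter_partial is g))" for "is"
  proof -
    have "continuous_on (cball 0 R) (iter_partial is g)"
      by (intro continuous_at_imp_continuous_on ballI has_derivative_continuous[OF gderiv[unfolded gderiv_def]])
    then have "bounded (insert 0 (iter_partial is g ` cball 0 R))"
      by (simp add: compact_imp_bounded compact_continuous_image)
    moreover have "iter_partial is g x = 0" if "x \<notin> cball 0 R" for x
      using that by (intro iter_partial_eq_0[of "- cball 0 R"] supp) auto
    ultimately show ?thesis by (elim bounded_subset) blast
  qed
  with gderiv show ?thesis by (rule smooth_boundedI)
qed

lemma exists_bump_function: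
  assumes "\<epsilon> > 0"
  obtains \<phi> :: "real^'d::finite \<Rightarrow> real" where "\<phi> \<in> expinv_algebra" "\<And>x. 0 \<le> \<phi> x" "0 < \<phi> 0"
    "\<And>x. \<epsilon> \<le> norm x \<Longrightarrow> \<phi> x = 0"
proof -
  define c where "c = \<epsilon> / real CARD('d)"
  have "c > 0" using assms by (simp add: c_def)
  define \<phi> :: "real^'d \<Rightarrow> real"
    where "\<phi> = (\<lambda>x. \<Prod>i\<in>UNIV. expinv 1 (c + 1 * x $ i) * expinv 1 (c + (-1) * x $ i))"
  have "\<phi> \<in> expinv_algebra"
    unfolding \<phi>_def by (intro prod_in_expinv_algebra expinv_algebra.mult expinv_algebra.base) auto
  moreover have "\<phi> x \<ge> 0" for x
    unfolding \<phi>_def by (intro prod_nonneg) (simp add: expinv_1_nonneg)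
  moreover have "\<phi> 0 > 0"
    unfolding \<phi>_def using \<open>c > 0\<close> by (intro prod_pos) (simp add: expinv_1_pos)
  moreover have "\<phi> x = 0" if "\<epsilon> \<le> norm x" for x
  proof -
    have "\<exists>i. c \<le> \<bar>x $ i\<bar>"
    proof (rule ccontr)
      assume "\<nexists>i. c \<le> \<bar>x $ i\<bar>"
      then have "(\<Sum>i\<in>UNIV. \<bar>x $ i\<bar>) < (\<Sum>i\<in>(UNIV::'d set). c)"
        by (intro sum_strict_mono) (auto simp: not_le)
      then show False using that norm_le_l1_cart[of x] by (simp add: c_def)
    qed
    then obtain i where "c \<le> \<bar>x $ i\<bar>" by auto
    then have "expinv 1 (c + 1 * x $ i) * expinv 1 (c + (-1) * x $ i) = 0"
      by (cases "x $ i \<ge> 0") (auto simp: expinv_nonpos)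
    then show ?thesis unfolding \<phi>_def by (intro prod_zero) auto
  qed
  ultimately show ?thesis using that by blast
qed

lemma integral_continuous_pos:
  fixes \<phi> :: "'a::euclidean_space \<Rightarrow> real"
  assumes "integrable lborel \<phi>" "continuous_on UNIV \<phi>" "\<And>x. 0 \<le> \<phi> x" "0 < \<phi> x0"
  shows "0 < (\<integral>x. \<phi> x \<partial>lborel)"
proof -
  have open_pos: "open {x. 0 < \<phi> x}" by (intro open_Collect_less continuous_on_const assms)
  have "(\<integral>x. \<phi> x \<partial>lborel) \<noteq> 0"
  proof
    assume "(\<integral>x. \<phi> x \<partial>lborel) = 0"
    then have "AE x in lborel. \<phi> x = 0"
      using integral_nonneg_eq_0_iff_AE[OF assms(1)] assms(3) by simp
    then have "AE x in lborel. x \<notin> {x. 0 < \<phi> x}" by auto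
    then have "negligible {x. 0 < \<phi> x}"
      using open_pos AE_iff_null_sets[of "{x. 0 < \<phi> x}" lborel]
      by (simp add: negligible_iff_null_sets null_sets_completionI)
    then show False using open_not_negligible[OF open_pos] assms(4) by auto
  qed
  moreover have "0 \<le> (\<integral>x. \<phi> x \<partial>lborel)" by (simp add: assms(3))
  ultimately show ?thesis by simp
qed

lemma exists_mollifier:
  assumes "\<epsilon> > 0"
  obtains \<eta> :: "real^'d::finite \<Rightarrow> real" where "smooth_bounded \<eta>" "\<And>x. 0 \<le> \<eta> x"
    "\<And>x. \<epsilon> \<le> norm x \<Longrightarrow> \<eta> x = 0" "integrable lborel \<eta>" "(\<integral>x. \<eta> x \<partial>lborel) = 1"
proof -
  obtain \<phi> :: "real^'d \<Rightarrow> real" where bump: "\<phi> \<in> expinv_algebra" "\<And>x. 0 \<le> \<phi> x" "0 < \<phi> 0"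
    "\<And>x. \<epsilon> \<le> norm x \<Longrightarrow> \<phi> x = 0" using exists_bump_function[OF assms] by blast
  have smooth: "smooth_bounded \<phi>"
    by (rule expinv_algebra_smooth_bounded[OF bump(1), of \<epsilon>]) (auto intro: bump(4))
  obtain M where "\<And>is x. length is \<le> 0 \<Longrightarrow> \<bar>iter_partial is \<phi> x\<bar> \<le> M"
    using smooth_bounded_uniform_bound[OF smooth, of 0] by blast
  from this[of "[]"] have int: "integrable lborel \<phi>"
    using smooth bump(4) by (intro integrable_bounded_support(1)[of _ M \<epsilon>] smooth_bounded_measurable) auto
  define m where "m = (\<integral>x. \<phi> x \<partial>lborel)"
  have "0 < m"
    unfolding m_def by (rule integral_continuous_pos[OF int smooth_bounded_continuous[OF smooth] bump(2,3)])
  let ?\<eta> = "\<lambda>x. (1 / m) * \<phi> x"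
  have "smooth_bounded ?\<eta>"
    by (rule expinv_algebra_smooth_bounded[of _ \<epsilon>]) (intro expinv_algebra.scale bump, auto intro: bump(4))
  moreover have "(\<integral>x. ?\<eta> x \<partial>lborel) = 1" using \<open>0 < m\<close> by (simp add: m_def)
  moreover have "integrable lborel ?\<eta>" by (intro integrable_mult_right int)
  ultimately show ?thesis using that[of ?\<eta>] bump \<open>0 < m\<close> by auto
qed

section \<open>Martingale solutions\<close>

lemma space_path_space [simp]: "space (path_space E) = cadlag_paths E"
  unfolding path_space_def by (rule space_measure_of) auto

lemma space_path_filt [simp]: "space (path_filt E t) = cadlag_paths E"
  unfolding path_filt_def by (rule space_measure_of) auto

lemma measurable_coordinate:
  assumes "0 \<le> s" shows "(\<lambda>\<omega>. \<omega> s) \<in> path_space E \<rightarrow>\<^sub>M borel"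
proof (rule measurableI)
  fix A :: "'a set" assume "A \<in> sets borel"
  then have "{\<omega> \<in> cadlag_paths E. \<omega> s \<in> A} \<in> sets (path_space E)"
    unfolding path_space_def using assms by (subst sets_measure_of) auto
  moreover have "(\<lambda>\<omega>. \<omega> s) -` A \<inter> space (path_space E) = {\<omega> \<in> cadlag_paths E. \<omega> s \<in> A}" by auto
  ultimately show "(\<lambda>\<omega>. \<omega> s) -` A \<inter> space (path_space E) \<in> sets (path_space E)" by simp
qed simp

definition grid_right :: "nat \<Rightarrow> real \<Rightarrow> real" where
  "grid_right n s = (real_of_int \<lfloor>real (Suc n) * s\<rfloor> + 1) / real (Suc n)"

lemma grid_right_gt: "s < grid_right n s"
proof -
  have "real (Suc n) * s < real_of_int \<lfloor>real (Suc n) * s\<rfloor> + 1" by linarith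
  then show ?thesis by (simp add: grid_right_def pos_less_divide_eq mult.commute del: of_nat_Suc)
qed

lemma grid_right_le: "grid_right n s \<le> s + 1 / real (Suc n)"
proof -
  have "real_of_int \<lfloor>real (Suc n) * s\<rfloor> + 1 \<le> real (Suc n) * s + 1" by linarith
  also have "\<dots> = (s + 1 / real (Suc n)) * real (Suc n)" by (simp add: field_simps)
  finally show ?thesis by (simp add: grid_right_def pos_divide_le_eq del: of_nat_Suc)
qed

lemma filterlim_grid_right: "filterlim (\<lambda>n. grid_right n s) (at_right s) sequentially"
proof -
  have "(\<lambda>n. grid_right n s) \<longlonglongrightarrow> s"
  proof (rule tendsto_sandwich[OF always_eventually always_eventually tendsto_const])
    show "\<forall>n. s \<le> grid_right n s" by (intro allI less_imp_le grid_right_gt)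
    show "\<forall>n. grid_right n s \<le> s + 1 / real (Suc n)" by (intro allI grid_right_le)
    have "(\<lambda>n. s + 1 / real (Suc n)) \<longlonglongrightarrow> s + 0"
      by (intro tendsto_intros LIMSEQ_Suc[OF lim_1_over_n])
    then show "(\<lambda>n. s + 1 / real (Suc n)) \<longlonglongrightarrow> s" by simp
  qed
  then show ?thesis
    using grid_right_gt by (auto simp: filterlim_at intro!: always_eventually simp: less_imp_neq[symmetric])
qed

text \<open>By right continuity a path is the limit of its values on ever finer grids, approached from the right.\<close>
lemma measurable_evaluation_continuous:
  fixes E :: "'e::t2_space set" and \<phi> :: "'e \<Rightarrow> 'f::metric_space"
  assumes \<phi>_continuous: "continuous_on UNIV \<phi>"
  shows "(\<lambda>(s, \<omega>). \<phi> (\<omega> (max 0 s))) \<in> borel \<Otimes>\<^sub>M path_space E \<rightarrow>\<^sub>M borel"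
proof (rule borel_measurable_LIMSEQ_metric)
  fix n :: nat
  let ?value = "\<lambda>i (p :: real \<times> (real \<Rightarrow> 'e)). \<phi> (snd p ((real_of_int \<bar>i\<bar> + 1) / real (Suc n)))"
  have "?value i \<in> borel \<Otimes>\<^sub>M path_space E \<rightarrow>\<^sub>M borel" for i
    by (intro measurable_compose[OF measurable_snd] measurable_compose[OF measurable_coordinate]
        borel_measurable_continuous_onI[OF \<phi>_continuous]) simp
  then have "(\<lambda>p. ?value \<lfloor>real (Suc n) * max 0 (fst p)\<rfloor> p) \<in> borel \<Otimes>\<^sub>M path_space E \<rightarrow>\<^sub>M borel"
    by (rule measurable_compose_countable) measurable
  then show "(\<lambda>p. \<phi> (snd p (grid_right n (max 0 (fst p))))) \<in> borel \<Otimes>\<^sub>M path_space E \<rightarrow>\<^sub>M borel"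
    by (simp add: grid_right_def)
next
  fix p :: "real \<times> (real \<Rightarrow> 'e)" assume "p \<in> space (borel \<Otimes>\<^sub>M path_space E)"
  then obtain s \<omega> where p_eq: "p = (s, \<omega>)" and \<omega>_cadlag: "\<omega> \<in> cadlag_paths E" by (auto simp: space_pair_measure)
  have "(\<omega> \<longlongrightarrow> \<omega> (max 0 s)) (at_right (max 0 s))"
    using \<omega>_cadlag by (simp add: cadlag_paths_def continuous_within)
  then have "(\<lambda>n. \<omega> (grid_right n (max 0 s))) \<longlonglongrightarrow> \<omega> (max 0 s)"
    by (rule filterlim_compose[OF _ filterlim_grid_right])
  moreover have "isCont \<phi> (\<omega> (max 0 s))" using \<phi>_continuous by (simp add: continuous_on_eq_continuous_at)
  ultimately have "(\<lambda>n. \<phi> (\<omega> (grid_right n (max 0 s)))) \<longlonglongrightarrow> \<phi> (\<omega> (max 0 s))"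
    by (rule isCont_tendsto_compose[rotated])
  then show "(\<lambda>n. \<phi> (snd p (grid_right n (max 0 (fst p))))) \<longlonglongrightarrow> (case p of (s, \<omega>) \<Rightarrow> \<phi> (\<omega> (max 0 s)))"
    using p_eq by simp
qed

lemma measurable_evaluation_pair_nat:
  fixes E :: "('a::{metric_space, second_countable_topology} \<times> nat) set"
  shows "(\<lambda>(s, \<omega>). \<omega> (max 0 s)) \<in> borel \<Otimes>\<^sub>M path_space E \<rightarrow>\<^sub>M borel"
proof -
  let ?embed = "\<lambda>p :: 'a \<times> nat. (fst p, real (snd p))"
  let ?retract = "\<lambda>p :: 'a \<times> real. (fst p, nat \<lfloor>snd p\<rfloor>)"
  have "continuous_on UNIV (real :: nat \<Rightarrow> real)" by (simp add: Topological_Spaces.continuous_on_discrete)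
  then have "continuous_on UNIV ?embed"
    by (intro continuous_on_Pair continuous_on_fst continuous_on_id
        continuous_on_compose2[of UNIV real _ snd] continuous_on_snd) auto
  note embedded = measurable_evaluation_continuous[OF this, of E]
  have "(\<lambda>p :: 'a \<times> real. nat \<lfloor>snd p\<rfloor>) \<in> borel \<rightarrow>\<^sub>M borel"
    by (rule measurable_compose[OF measurable_compose[OF borel_measurable_continuous_onI[of snd]
      measurable_real_floor]])
      (auto intro: continuous_intros)
  then have "?retract \<in> borel \<rightarrow>\<^sub>M borel"
    by (intro borel_measurable_Pair borel_measurable_continuous_onI[of fst]) (auto intro: continuous_intros)
  from measurable_compose[OF embedded this] show ?thesis by (simp add: case_prod_beta)
qed

locale martingale_solution =
  fixes E :: "'e::topological_space set" and T G e0 P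
  assumes solution: "mp_solution E T G e0 P"
    and evaluation: "(\<lambda>(s, \<omega>). \<omega> (max 0 s)) \<in> borel \<Otimes>\<^sub>M path_space E \<rightarrow>\<^sub>M borel"
begin

lemma sets_P: "sets P = sets (path_space E)"
  using solution by (simp add: mp_solution_def)

lemma space_P: "space P = cadlag_paths E"
  using sets_eq_imp_space_eq[OF sets_P] by simp

sublocale prob_space P
  using solution by (simp add: mp_solution_def)

lemma value_in: "\<omega> \<in> space P \<Longrightarrow> \<omega> s \<in> E"
  by (simp add: space_P cadlag_paths_def)

lemma coordinate_measurable [measurable]: "0 \<le> s \<Longrightarrow> (\<lambda>\<omega>. \<omega> s) \<in> P \<rightarrow>\<^sub>M borel"
  using measurable_coordinate[of s E] measurable_cong_sets[OF sets_P refl] by blast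

lemma integrable_coordinate:
  assumes "f \<in> borel_measurable borel" "\<And>e. e \<in> E \<Longrightarrow> \<bar>f e\<bar> \<le> (B::real)" "0 \<le> t"
  shows "integrable P (\<lambda>\<omega>. f (\<omega> t))"
  using assms by (intro integrable_const_bound[of _ B]) (auto intro!: AE_I2 value_in)

lemma expectation_start:
  assumes [measurable]: "f \<in> borel_measurable borel"
  shows "expectation (\<lambda>\<omega>. f (\<omega> 0)) = (f e0 :: real)"
proof -
  have prob: "prob {\<omega> \<in> space P. \<omega> 0 = e0} = 1"
    using solution by (simp add: mp_solution_def emeasure_eq_measure)
  then have "{\<omega> \<in> space P. \<omega> 0 = e0} \<in> sets P"
    using measure_notin_sets by fastforce
  then have "AE \<omega> in P. \<omega> 0 = e0" using prob_Collect_eq_1[of "\<lambda>\<omega>. \<omega> 0 = e0"] prob by simp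
  then have "expectation (\<lambda>\<omega>. f (\<omega> 0)) = expectation (\<lambda>\<omega>. f e0)"
    by (intro integral_cong_AE) auto
  then show ?thesis by (simp add: prob_space)
qed

lemma expectation_martingale:
  assumes "f \<in> T" "0 \<le> t"
  shows "expectation (\<lambda>\<omega>. f (\<omega> t) - f (\<omega> 0) - (LINT s:{0..t}|lborel. G f (\<omega> s))) = 0"
proof -
  let ?M = "\<lambda>t \<omega>. f (\<omega> t) - f (\<omega> 0) - (LINT s:{0..t}|lborel. G f (\<omega> s))"
  have top: "space P \<in> sets (path_filt E 0)"
    using sets.top[of "path_filt E 0"] by (simp add: space_P)
  have "is_martingale P (path_filt E) ?M"
    using solution assms(1) by (simp add: mp_solution_def)
  then have "(\<integral>\<omega>. indicator (space P) \<omega> * ?M t \<omega> \<partial>P) = (\<integral>\<omega>. indicator (space P) \<omega> * ?M 0 \<omega> \<partial>P)"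
    unfolding is_martingale_def using assms(2) top by blast
  moreover have "?M 0 \<omega> = 0" for \<omega> :: "real \<Rightarrow> 'e"
  proof -
    have "AE s in lborel. indicator {0..0} s *\<^sub>R G f (\<omega> s) = 0"
      using AE_lborel_singleton[of 0] by eventually_elim (auto simp: indicator_def)
    from integral_eq_zero_AE[OF this] show ?thesis by (simp add: set_lebesgue_integral_def)
  qed
  moreover have "(\<integral>\<omega>. indicator (space P) \<omega> * ?M t \<omega> \<partial>P) = expectation (?M t)"
    by (intro Bochner_Integration.integral_cong) auto
  ultimately show ?thesis by simp
qed

end

locale martingale_test = martingale_solution E T G e0 P
  for E :: "'e::topological_space set" and T G e0 P +
  fixes f g :: "'e \<Rightarrow> real" and B C :: real
  assumes test: "f \<in> T" and test_measurable: "f \<in> borel_measurable borel"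
    and test_bound: "e \<in> E \<Longrightarrow> \<bar>f e\<bar> \<le> B"
    and generator: "e \<in> E \<Longrightarrow> G f e = g e" and generator_measurable: "g \<in> borel_measurable borel"
    and generator_bound: "e \<in> E \<Longrightarrow> \<bar>g e\<bar> \<le> C"
begin

lemma integrable_test: "0 \<le> t \<Longrightarrow> integrable P (\<lambda>\<omega>. f (\<omega> t))"
  by (rule integrable_coordinate[OF test_measurable test_bound])

lemma integrable_generator: "0 \<le> t \<Longrightarrow> integrable P (\<lambda>\<omega>. g (\<omega> t))"
  by (rule integrable_coordinate[OF generator_measurable generator_bound])

lemma abs_expectation_generator_le:
  assumes "0 \<le> t" shows "\<bar>expectation (\<lambda>\<omega>. g (\<omega> t))\<bar> \<le> C"
proof -
  have "\<bar>expectation (\<lambda>\<omega>. g (\<omega> t))\<bar> \<le> expectation (\<lambda>\<omega>. \<bar>g (\<omega> t)\<bar>)" by (rule integral_abs_bound)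
  also have "\<dots> \<le> expectation (\<lambda>_. C)"
    by (intro integral_mono integrable_abs integrable_generator assms) (auto intro: generator_bound value_in)
  finally show ?thesis by (simp add: prob_space)
qed

lemma integrable_generator_prod:
  assumes "0 \<le> t"
  shows "integrable (lborel \<Otimes>\<^sub>M P) (\<lambda>(s, \<omega>). indicator {0..t} s * g (\<omega> (max 0 s)))"
proof (rule Bochner_Integration.integrable_bound)
  have "(\<lambda>(s, \<omega>). \<omega> (max 0 s)) \<in> lborel \<Otimes>\<^sub>M P \<rightarrow>\<^sub>M borel"
    using evaluation measurable_cong_sets[OF sets_pair_measure_cong[OF sets_lborel sets_P] refl] by blast
  from measurable_compose[OF this generator_measurable]
  show "(\<lambda>(s, \<omega>). indicator {0..t} s * g (\<omega> (max 0 s))) \<in> borel_measurable (lborel \<Otimes>\<^sub>M P)"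
    unfolding case_prod_beta by measurable
  have "emeasure (lborel \<Otimes>\<^sub>M P) ({0..t} \<times> space P) = emeasure lborel {0..t} * emeasure P (space P)"
    by (rule emeasure_pair_measure_Times) auto
  then show "integrable (lborel \<Otimes>\<^sub>M P) (\<lambda>p. C * indicator ({0..t} \<times> space P) p)"
    by (intro integrable_mult_right integrable_real_indicator) (auto simp: emeasure_space_1 assms)
  have "\<bar>C\<bar> = C" using abs_expectation_generator_le[OF assms] by linarith
  then show "AE p in lborel \<Otimes>\<^sub>M P. norm (case p of (s, \<omega>) \<Rightarrow> indicator {0..t} s * g (\<omega> (max 0 s)))
      \<le> norm (C * indicator ({0..t} \<times> space P) p)"
    by (intro AE_I2) (auto simp: space_pair_measure abs_mult indicator_def intro!: generator_bound value_in)
qed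

lemma set_integrable_expectation_generator:
  assumes "0 \<le> t" shows "set_integrable lborel {0..t} (\<lambda>s. expectation (\<lambda>\<omega>. g (\<omega> (max 0 s))))"
proof -
  interpret pair_sigma_finite lborel P ..
  show ?thesis
    using integrable_fst[OF integrable_generator_prod[OF assms]] by (simp add: case_prod_beta set_integrable_def)
qed

lemma dynkin_formula:
  assumes t_nonneg: "0 \<le> t"
  shows "expectation (\<lambda>\<omega>. f (\<omega> t)) = f e0 + (LINT s:{0..t}|lborel. expectation (\<lambda>\<omega>. g (\<omega> (max 0 s))))"
proof -
  interpret pair: pair_sigma_finite lborel P ..
  let ?h = "\<lambda>s \<omega>. indicator {0..t} s * g (\<omega> (max 0 s))"
  note integrable_h = integrable_generator_prod[OF t_nonneg]
  have "(LINT s:{0..t}|lborel. G f (\<omega> s)) = (\<integral>s. ?h s \<omega> \<partial>lborel)" if "\<omega> \<in> space P" for \<omega>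
    unfolding set_lebesgue_integral_def using that
    by (auto intro!: Bochner_Integration.integral_cong simp: indicator_def generator value_in max_def)
  then have "0 = (\<integral>\<omega>. f (\<omega> t) - f (\<omega> 0) - (\<integral>s. ?h s \<omega> \<partial>lborel) \<partial>P)"
    by (subst expectation_martingale[OF test t_nonneg, symmetric]) (intro Bochner_Integration.integral_cong, auto)
  also have "\<dots> = expectation (\<lambda>\<omega>. f (\<omega> t)) - f e0 - (\<integral>\<omega>. (\<integral>s. ?h s \<omega> \<partial>lborel) \<partial>P)"
    using integrable_test[OF t_nonneg] integrable_test[of 0] pair.integrable_snd[OF integrable_h]
      expectation_start[OF test_measurable]
    by (simp add: case_prod_beta)
  also have "(\<integral>\<omega>. (\<integral>s. ?h s \<omega> \<partial>lborel) \<partial>P) = (\<integral>s. (\<integral>\<omega>. ?h s \<omega> \<partial>P) \<partial>lborel)"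
    using pair.Fubini_integral[of ?h] integrable_h by simp
  finally show ?thesis by (simp add: set_lebesgue_integral_def)
qed

lemma expectation_increment:
  assumes "0 \<le> t" "0 \<le> h"
  shows "expectation (\<lambda>\<omega>. f (\<omega> (t + h))) - expectation (\<lambda>\<omega>. f (\<omega> t))
      = (LINT s:{t..t+h}|lborel. expectation (\<lambda>\<omega>. g (\<omega> (max 0 s))))"
    and "set_integrable lborel {t..t+h} (\<lambda>s. expectation (\<lambda>\<omega>. g (\<omega> (max 0 s))))"
proof -
  let ?e = "\<lambda>s. expectation (\<lambda>\<omega>. g (\<omega> (max 0 s)))"
  show int: "set_integrable lborel {t..t+h} ?e"
    by (rule set_integrable_subset[OF set_integrable_expectation_generator[of "t + h"]]) (use assms in auto)
  have "(LINT s:{0..t} \<union> {t..t+h}|lborel. ?e s) = (LINT s:{0..t}|lborel. ?e s) + (LINT s:{t..t+h}|lborel. ?e s)"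
  proof (rule set_integral_Un_AE)
    show "AE x in lborel. \<not> (x \<in> {0..t} \<and> x \<in> {t..t+h})"
      using AE_lborel_singleton[of t] by eventually_elim auto
  qed (use set_integrable_expectation_generator[OF assms(1)] int in auto)
  moreover have "{0..t} \<union> {t..t+h} = {0..t+h}" using assms by auto
  ultimately show "expectation (\<lambda>\<omega>. f (\<omega> (t + h))) - expectation (\<lambda>\<omega>. f (\<omega> t)) = (LINT s:{t..t+h}|lborel. ?e s)"
    using dynkin_formula[of "t + h"] dynkin_formula[of t] assms by simp
qed

lemma expectation_increment_ge:
  assumes "0 \<le> t" "0 \<le> h" and generator_ge: "\<And>s. t \<le> s \<Longrightarrow> s \<le> t + h \<Longrightarrow> c \<le> expectation (\<lambda>\<omega>. g (\<omega> s))"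
  shows "c * h \<le> expectation (\<lambda>\<omega>. f (\<omega> (t + h))) - expectation (\<lambda>\<omega>. f (\<omega> t))"
proof -
  have "(LINT s:{t..t+h}|lborel. c) \<le> (LINT s:{t..t+h}|lborel. expectation (\<lambda>\<omega>. g (\<omega> (max 0 s))))"
    by (rule set_integral_mono)
      (use expectation_increment(2)[OF assms(1,2)] generator_ge assms in \<open>auto simp: max_def set_integrable_def\<close>)
  moreover have "(LINT s:{t..t+h}|lborel. c) = c * h" using assms by (simp add: set_lebesgue_integral_def)
  ultimately show ?thesis using expectation_increment(1)[OF assms(1,2)] by simp
qed

lemma abs_expectation_increment_le:
  assumes "0 \<le> t" "0 \<le> h"
  shows "\<bar>expectation (\<lambda>\<omega>. f (\<omega> (t + h))) - expectation (\<lambda>\<omega>. f (\<omega> t))\<bar> \<le> C * h"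
proof -
  have "(LINT s:{t..t+h}|lborel. expectation (\<lambda>\<omega>. g (\<omega> (max 0 s)))) \<le> (LINT s:{t..t+h}|lborel. C)"
    by (rule set_integral_mono)
      (use expectation_increment(2)[OF assms(1,2)] abs_expectation_generator_le assms
        in \<open>auto simp: abs_le_iff set_integrable_def\<close>)
  moreover have "(LINT s:{t..t+h}|lborel. C) = C * h" using assms by (simp add: set_lebesgue_integral_def)
  moreover have "- C * h \<le> expectation (\<lambda>\<omega>. f (\<omega> (t + h))) - expectation (\<lambda>\<omega>. f (\<omega> t))"
    by (rule expectation_increment_ge)
      (use abs_expectation_generator_le assms in \<open>auto simp: abs_le_iff minus_le_iff\<close>)
  ultimately show ?thesis using expectation_increment(1)[OF assms(1,2)] by simp
qed

end

section \<open>Concave moduli of continuity\<close>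

locale concave_modulus =
  fixes \<rho> :: "real \<Rightarrow> real"
  assumes rho_mono: "mono_on {0..} \<rho>" and rho_concave: "concave_on {0..} \<rho>"
    and rho_nonneg: "0 \<le> r \<Longrightarrow> 0 \<le> \<rho> r" and rho_pos: "0 < r \<Longrightarrow> 0 < \<rho> r"
begin

lemma rho_le: "0 \<le> r \<Longrightarrow> r \<le> s \<Longrightarrow> \<rho> r \<le> \<rho> s"
  using rho_mono by (auto simp: mono_on_def)

lemma rho_le_slope:
  assumes "0 < r" "r \<le> s" shows "\<rho> s \<le> s / r * \<rho> r"
proof -
  have "convex_on {0..} (\<lambda>x. - \<rho> x)" using rho_concave by (simp add: concave_on_def)
  from convex_onD[OF this, of "r / s" 0 s] assms
  have "- \<rho> r \<le> (1 - r / s) * - \<rho> 0 + (r / s) * - \<rho> s" by simp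
  moreover have "(1 - r / s) * - \<rho> 0 \<le> 0" using assms rho_nonneg[of 0] by (simp add: mult_le_0_iff divide_le_eq)
  ultimately have "(r / s) * \<rho> s \<le> \<rho> r" by linarith
  then show ?thesis using assms by (simp add: field_simps)
qed

lemma rho_double_le: "0 < r \<Longrightarrow> \<rho> (2 * r) \<le> 2 * \<rho> r"
  using rho_le_slope[of r "2 * r"] by simp

lemma rho_linear_growth:
  assumes "0 \<le> r" shows "\<rho> r \<le> \<rho> 1 * (1 + r)"
proof (cases "r \<le> 1")
  case True
  then have "\<rho> r \<le> \<rho> 1" using rho_le assms by simp
  also have "\<dots> \<le> \<rho> 1 * (1 + r)" using rho_nonneg[of 1] assms by (simp add: mult_le_cancel_left1)
  finally show ?thesis .
next
  case False
  then have "\<rho> r \<le> r / 1 * \<rho> 1" by (intro rho_le_slope) auto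
  then show ?thesis using rho_nonneg[of 1] by (simp add: algebra_simps)
qed

lemma rho_supergradient:
  assumes s_pos: "0 < s"
  obtains p where "0 \<le> p" "p \<le> \<rho> s / s" "\<And>r. 0 \<le> r \<Longrightarrow> \<rho> r \<le> \<rho> s + p * (r - s)"
proof -
  have convex: "convex_on {0..} (\<lambda>x. - \<rho> x)" using rho_concave by (simp add: concave_on_def)
  define p where "p = - Inf ((\<lambda>t. (- \<rho> s - - \<rho> t) / (s - t)) ` ({s<..} \<inter> {0..}))"
  have tangent: "\<rho> r \<le> \<rho> s + p * (r - s)" if "0 \<le> r" for r
    using convex_le_Inf_differential[OF convex, of s r] s_pos that by (simp add: p_def)
  have "0 \<le> p" using tangent[of "s + 1"] rho_le[of s "s + 1"] s_pos by simp
  moreover have "p \<le> \<rho> s / s" using tangent[of 0] rho_nonneg[of 0] s_pos by (simp add: field_simps)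
  ultimately show ?thesis using that tangent by blast
qed

definition reciprocal_measure :: "real measure" where
  "reciprocal_measure = density lborel (\<lambda>r. ennreal (1 / \<rho> (max 0 r)))"

lemma sets_reciprocal_measure [simp]: "sets reciprocal_measure = sets borel"
  by (simp add: reciprocal_measure_def)

lemma emeasure_reciprocal_interval:
  "emeasure reciprocal_measure {x<..y} = (\<integral>\<^sup>+r. indicator {x<..y} r * ennreal (1 / \<rho> (max 0 r)) \<partial>lborel)"
proof -
  have "mono (\<lambda>r. \<rho> (max 0 r))" by (intro monoI rho_le) auto
  then have [measurable]: "(\<lambda>r. \<rho> (max 0 r)) \<in> borel_measurable borel" by (rule borel_measurable_mono)
  show ?thesis
    unfolding reciprocal_measure_def by (subst emeasure_density) (auto simp: mult.commute)
qed

lemma emeasure_reciprocal_interval_le: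
  assumes "0 < x" "x \<le> y" shows "emeasure reciprocal_measure {x<..y} \<le> ennreal ((y - x) / \<rho> x)"
proof -
  have "1 / \<rho> (max 0 r) \<le> 1 / \<rho> x" if "x < r" for r
    using that assms rho_pos rho_le[of x r] by (intro divide_left_mono mult_pos_pos) auto
  then have "emeasure reciprocal_measure {x<..y} \<le> (\<integral>\<^sup>+r. ennreal (1 / \<rho> x) * indicator {x<..y} r \<partial>lborel)"
    unfolding emeasure_reciprocal_interval
    by (intro nn_integral_mono) (auto simp: indicator_def intro: ennreal_leI)
  also have "\<dots> = ennreal ((y - x) / \<rho> x)"
    using assms rho_pos[of x] by (simp add: nn_integral_cmult_indicator flip: ennreal_mult')
  finally show ?thesis .
qed

fun euler_seq :: "real \<Rightarrow> real \<Rightarrow> nat \<Rightarrow> real" where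
  "euler_seq c s 0 = s"
| "euler_seq c s (Suc n) = euler_seq c s n + c * \<rho> (euler_seq c s n)"

lemma euler_seq_ge:
  assumes "0 \<le> c" "0 < s" shows "s \<le> euler_seq c s n"
proof (induction n)
  case (Suc n)
  then have "0 \<le> c * \<rho> (euler_seq c s n)" using assms rho_nonneg[of "euler_seq c s n"] by simp
  then show ?case using Suc by simp
qed simp

lemma emeasure_reciprocal_euler_seq_le:
  assumes "0 \<le> h" "0 < s"
  shows "emeasure reciprocal_measure {s<..euler_seq h s n} \<le> ennreal (real n * h)"
proof (induction n)
  case (Suc n)
  let ?x = "euler_seq h s n"
  have euler_seq_bounds: "s \<le> ?x" "0 < ?x" using euler_seq_ge[OF assms, of n] assms by auto
  have step: "?x \<le> euler_seq h s (Suc n)" using assms euler_seq_bounds rho_nonneg[of ?x] by simp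
  then have "{s<..euler_seq h s (Suc n)} = {s<..?x} \<union> {?x<..euler_seq h s (Suc n)}" using euler_seq_bounds
    by (intro ivl_disj_un_two(6)[symmetric])
  then have "emeasure reciprocal_measure {s<..euler_seq h s (Suc n)}
      \<le> emeasure reciprocal_measure {s<..?x} + emeasure reciprocal_measure {?x<..euler_seq h s (Suc n)}"
    using emeasure_subadditive[of "{s<..?x}" reciprocal_measure] by (simp del: euler_seq.simps)
  also have "\<dots> \<le> ennreal (real n * h) + ennreal ((euler_seq h s (Suc n) - ?x) / \<rho> ?x)"
    by (intro add_mono Suc emeasure_reciprocal_interval_le euler_seq_bounds step)
  also have "\<dots> = ennreal (real (Suc n) * h)"
    using assms rho_pos[OF euler_seq_bounds(2)] by (simp add: distrib_right flip: ennreal_plus)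
  finally show ?case .
qed simp

end

locale osgood_modulus = concave_modulus +
  assumes osgood: "0 < c \<Longrightarrow> (\<integral>\<^sup>+r. indicator {0<..c} r * ennreal (1 / \<rho> r) \<partial>lborel) = \<infinity>"
begin

lemma reciprocal_measure_exceeds:
  assumes "0 < c" obtains s where "0 < s" "ennreal T < emeasure reciprocal_measure {s<..c}"
proof -
  have "(\<Union>n. {1 / real (Suc n)<..c}) = {0<..c}"
  proof (intro equalityI subsetI)
    fix r assume "r \<in> {0<..c}"
    then show "r \<in> (\<Union>n. {1 / real (Suc n)<..c})"
      using reals_Archimedean[of r] by (auto simp: inverse_eq_divide)
  next
    fix r assume "r \<in> (\<Union>n. {1 / real (Suc n)<..c})"
    then obtain n where "1 / real (Suc n) < r" "r \<le> c" by auto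
    moreover have "0 < 1 / real (Suc n)" by simp
    ultimately show "r \<in> {0<..c}" unfolding greaterThanAtMost_iff by (metis order.strict_trans)
  qed
  moreover have "incseq (\<lambda>n. {1 / real (Suc n)<..c})"
  proof (rule incseq_SucI)
    fix n
    have "1 / real (Suc (Suc n)) \<le> 1 / real (Suc n)" by (intro divide_left_mono) auto
    then show "{1 / real (Suc n)<..c} \<subseteq> {1 / real (Suc (Suc n))<..c}" by auto
  qed
  ultimately have "(SUP n. emeasure reciprocal_measure {1 / real (Suc n)<..c}) = emeasure reciprocal_measure {0<..c}"
    using SUP_emeasure_incseq[of "\<lambda>n. {1 / real (Suc n)<..c}" reciprocal_measure]
    by (simp add: image_subset_iff)
  also have "\<dots> = (\<integral>\<^sup>+r. indicator {0<..c} r * ennreal (1 / \<rho> r) \<partial>lborel)"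
    unfolding emeasure_reciprocal_interval
    by (intro nn_integral_cong) (auto simp: indicator_def)
  finally have "ennreal T < (SUP n. emeasure reciprocal_measure {1 / real (Suc n)<..c})"
    unfolding osgood[OF assms] by (simp only: infinity_ennreal_def ennreal_less_top)
  then obtain n where "ennreal T < emeasure reciprocal_measure {1 / real (Suc n)<..c}"
    unfolding less_SUP_iff by auto
  then show ?thesis by (intro that[of "1 / real (Suc n)"]) auto
qed

lemma euler_seq_small:
  assumes "0 < c"
  obtains s where "0 < s" "\<And>h n. 0 \<le> h \<Longrightarrow> real n * h \<le> T \<Longrightarrow> euler_seq h s n \<le> c"
proof -
  obtain s where s_small: "0 < s" "ennreal T < emeasure reciprocal_measure {s<..c}"
    using reciprocal_measure_exceeds[OF assms] .
  have "euler_seq h s n \<le> c" if steps_le: "0 \<le> h" "real n * h \<le> T" for h n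
  proof (rule ccontr)
    assume "\<not> euler_seq h s n \<le> c"
    then have "emeasure reciprocal_measure {s<..c} \<le> emeasure reciprocal_measure {s<..euler_seq h s n}"
      by (intro emeasure_mono) auto
    also have "\<dots> \<le> ennreal (real n * h)" by (rule emeasure_reciprocal_euler_seq_le[OF steps_le(1) s_small(1)])
    also have "\<dots> \<le> ennreal T" by (rule ennreal_leI[OF steps_le(2)])
    finally show False using s_small(2) by simp
  qed
  then show ?thesis using that s_small(1) by blast
qed

end

section \<open>Coefficients with a one-sided modulus of continuity\<close>

lemma power2_add_le_weighted:
  fixes x y s :: real
  assumes "1 < s" shows "(x + y)\<^sup>2 \<le> s / (s - 1) * x\<^sup>2 + s * y\<^sup>2"
proof -
  have "0 \<le> (x - (s - 1) * y)\<^sup>2 / (s - 1)" using assms by simp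
  also have "\<dots> = s / (s - 1) * x\<^sup>2 + s * y\<^sup>2 - (x + y)\<^sup>2"
    using assms by (simp add: field_simps power2_eq_square)
  finally show ?thesis by simp
qed

locale one_sided_coefficients = concave_modulus \<rho>
  for \<rho> :: "real \<Rightarrow> real" +
  fixes H :: real and \<sigma> :: "real^'d::finite \<Rightarrow> 'b::real_normed_vector" and b :: "real^'d \<Rightarrow> real^'d"
  assumes H_pos: "0 < H"
    and one_sided: "(norm (\<sigma> x - \<sigma> z))\<^sup>2 + 2 * ((x - z) \<bullet> (b x - b z)) \<le> H * norm (x - z) * \<rho> (norm (x - z))"
begin

lemma one_sided_le:
  assumes "norm (x - z) \<le> S"
  shows "(norm (\<sigma> x - \<sigma> z))\<^sup>2 + 2 * ((x - z) \<bullet> (b x - b z)) \<le> H * S * \<rho> S"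
proof -
  have "0 \<le> S" using assms norm_ge_zero order.trans by blast
  then have "H * norm (x - z) * \<rho> (norm (x - z)) \<le> H * S * \<rho> S"
    using assms H_pos rho_nonneg by (intro mult_mono rho_le) auto
  with one_sided[of x z] show ?thesis by linarith
qed

text \<open>Comparing \<open>x\<close> with the points \<open>\<plusminus>c\<close> on the coordinate axes bounds each component of \<open>c b(x)\<close>
  by a constant plus \<open>|x| |b(x)|\<close>, which is absorbed if \<open>c\<close> is large.\<close>
lemma drift_bounded:
  assumes "0 < R"
  obtains B where "0 \<le> B" "\<And>x. norm x \<le> R \<Longrightarrow> norm (b x) \<le> B"
proof -
  define d where "d = real CARD('d)"
  have d_ge_1: "1 \<le> d" by (simp add: d_def Suc_le_eq)
  define c where "c = 2 * d * R"
  have c_pos: "0 < c" using d_ge_1 assms by (simp add: c_def)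
  define e where "e i s = s *\<^sub>R axis i (1::real)" for i :: 'd and s
  define B\<^sub>0 where "B\<^sub>0 = (\<Sum>i\<in>UNIV. norm (b (e i c)) + norm (b (e i (- c))))"
  have B\<^sub>0: "norm (b (e i s)) \<le> B\<^sub>0" if "s = c \<or> s = - c" for i s
  proof -
    have "norm (b (e i c)) + norm (b (e i (- c))) \<le> B\<^sub>0"
      unfolding B\<^sub>0_def by (rule member_le_sum) auto
    then show ?thesis
      using that norm_ge_zero[of "b (e i c)"] norm_ge_zero[of "b (e i (- c))"] by (elim disjE) (hypsubst, linarith)+
  qed
  define K where "K = (R + c) * B\<^sub>0 + H / 2 * (R + c) * \<rho> (R + c)"
  have "norm (b x) \<le> 2 * d * K / c" if x_le: "norm x \<le> R" for x
  proof -
    have away: "(x - e i s) \<bullet> b x \<le> K" if s_eq: "s = c \<or> s = - c" for i s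
    proof -
      have dist: "norm (x - e i s) \<le> R + c"
        using norm_triangle_ineq4[of x "e i s"] x_le c_pos s_eq by (auto simp: e_def)
      have "2 * ((x - e i s) \<bullet> (b x - b (e i s))) \<le> H * (R + c) * \<rho> (R + c)"
        using one_sided_le[OF dist] zero_le_power2[of "norm (\<sigma> x - \<sigma> (e i s))"] by linarith
      then have "(x - e i s) \<bullet> b x \<le> (x - e i s) \<bullet> b (e i s) + H / 2 * (R + c) * \<rho> (R + c)"
        by (simp add: inner_diff_right)
      also have "(x - e i s) \<bullet> b (e i s) \<le> norm (x - e i s) * norm (b (e i s))" by (rule norm_cauchy_schwarz)
      also have "\<dots> \<le> (R + c) * B\<^sub>0" using dist B\<^sub>0[OF s_eq] assms c_pos by (intro mult_mono) auto
      finally show ?thesis by (simp add: K_def)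
    qed
    have "- (x \<bullet> b x) \<le> R * norm (b x)"
      using norm_cauchy_schwarz[of "- x" "b x"] mult_right_mono[OF x_le norm_ge_zero[of "b x"]] by simp
    then have component: "c * \<bar>b x $ i\<bar> \<le> K + R * norm (b x)" for i
      using away[of c i] away[of "- c" i] c_pos
      by (auto simp: e_def inner_diff_left inner_add_left inner_axis' abs_if)
    have "c * norm (b x) \<le> c * (\<Sum>i\<in>UNIV. \<bar>b x $ i\<bar>)"
      using c_pos by (intro mult_left_mono norm_le_l1_cart) auto
    also have "\<dots> \<le> (\<Sum>i\<in>(UNIV::'d set). K + R * norm (b x))"
      unfolding sum_distrib_left by (intro sum_mono component)
    also have "\<dots> = d * K + (c / 2) * norm (b x)" by (simp add: c_def d_def algebra_simps)
    finally show ?thesis using c_pos by (simp add: field_simps)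
  qed
  from order.trans[OF norm_ge_zero this[of 0]] this assms show ?thesis by (intro that) auto
qed

lemma diffusion_bounded:
  assumes "0 < R"
  obtains B where "\<And>x. norm x \<le> R \<Longrightarrow> norm (\<sigma> x) \<le> B"
proof -
  obtain B where drift_le: "0 \<le> B" "\<And>x. norm x \<le> R \<Longrightarrow> norm (b x) \<le> B" using drift_bounded[OF assms] by blast
  have "norm (\<sigma> x) \<le> norm (\<sigma> 0) + (1 + H * R * \<rho> R + 4 * R * B)" if x_le: "norm x \<le> R" for x
  proof -
    have "- (x \<bullet> (b x - b 0)) \<le> norm x * norm (b x - b 0)"
      using norm_cauchy_schwarz[of "- x" "b x - b 0"] by simp
    also have "\<dots> \<le> R * (2 * B)"
      using x_le assms norm_triangle_ineq4[of "b x" "b 0"] drift_le(2)[OF x_le] drift_le(2)[of 0]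
      by (intro mult_mono) auto
    finally have "(norm (\<sigma> x - \<sigma> 0))\<^sup>2 \<le> H * R * \<rho> R + 4 * R * B"
      using one_sided_le[of x 0 R] x_le by simp
    moreover have "norm (\<sigma> x - \<sigma> 0) \<le> 1 + (norm (\<sigma> x - \<sigma> 0))\<^sup>2"
      using zero_le_power2[of "norm (\<sigma> x - \<sigma> 0) - 1/2"] by (simp add: power2_eq_square algebra_simps)
    ultimately show ?thesis using norm_triangle_ineq2[of "\<sigma> x" "\<sigma> 0"] by simp
  qed
  then show ?thesis using that by blast
qed

lemma locally_bounded:
  obtains B where "0 \<le> B" "\<And>x. norm x \<le> R \<Longrightarrow> norm (b x) \<le> B \<and> norm (\<sigma> x) \<le> B"
proof -
  have max_pos: "0 < max 1 R" by simp
  obtain B where "0 \<le> B" "\<And>x. norm x \<le> max 1 R \<Longrightarrow> norm (b x) \<le> B" using drift_bounded[OF max_pos] by blast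
  moreover obtain B' where "\<And>x. norm x \<le> max 1 R \<Longrightarrow> norm (\<sigma> x) \<le> B'" using diffusion_bounded[OF max_pos] by blast
  ultimately show ?thesis by (intro that[of "max B B'"]) (auto simp: le_max_iff_disj)
qed

text \<open>Comparing \<open>y\<close> with the nearest point of the unit sphere; the factor \<open>|y| / (|y| - 1)\<close> turns
  the resulting estimate for \<open>(y - y/|y|) \<bullet> b(y)\<close> into one for \<open>y \<bullet> b(y)\<close>.\<close>
lemma growth_outside_ball:
  assumes sphere_le: "1 < norm y" "\<And>x. norm x = 1 \<Longrightarrow> norm (b x) \<le> B \<and> norm (\<sigma> x) \<le> B"
  shows "2 * (y \<bullet> b y) + (norm (\<sigma> y))\<^sup>2
    \<le> H * norm y * \<rho> (norm y) + 2 * norm y * B + norm y * B\<^sup>2"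
proof -
  define s where "s = norm y"
  define e where "e = (1 / s) *\<^sub>R y"
  have s_gt_1: "1 < s" using assms(1) by (simp add: s_def)
  have coefficients_le: "norm (b e) \<le> B" "norm (\<sigma> e) \<le> B"
    using assms(2)[of e] s_gt_1 by (auto simp: e_def s_def[symmetric])
  have diff: "y - e = (1 - 1 / s) *\<^sub>R y" by (simp add: e_def algebra_simps)
  have "norm (y - e) = s - 1"
    unfolding diff norm_scaleR using s_gt_1 by (simp add: s_def[symmetric] field_simps)
  then have "(norm (\<sigma> y - \<sigma> e))\<^sup>2 + 2 * ((s - 1) / s * (y \<bullet> (b y - b e))) \<le> H * (s - 1) * \<rho> (s - 1)"
    using one_sided[of y e] s_gt_1 by (simp add: diff diff_divide_distrib)
  also have "\<dots> \<le> H * (s - 1) * \<rho> s"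
    using s_gt_1 H_pos by (intro mult_left_mono rho_le) auto
  finally have "s / (s - 1) * ((norm (\<sigma> y - \<sigma> e))\<^sup>2 + 2 * ((s - 1) / s * (y \<bullet> (b y - b e))))
      \<le> s / (s - 1) * (H * (s - 1) * \<rho> s)"
    using s_gt_1 by (intro mult_left_mono) auto
  then have "s / (s - 1) * (norm (\<sigma> y - \<sigma> e))\<^sup>2 + 2 * (y \<bullet> (b y - b e)) \<le> H * s * \<rho> s"
    using s_gt_1 by (simp add: distrib_left mult_ac)
  moreover have "y \<bullet> b e \<le> s * B"
    unfolding s_def by (intro order.trans[OF norm_cauchy_schwarz] mult_left_mono coefficients_le) auto
  moreover have "(norm (\<sigma> y))\<^sup>2 \<le> s / (s - 1) * (norm (\<sigma> y - \<sigma> e))\<^sup>2 + s * B\<^sup>2"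
  proof -
    have "(norm (\<sigma> y))\<^sup>2 \<le> (norm (\<sigma> y - \<sigma> e) + B)\<^sup>2"
      using norm_triangle_ineq2[of "\<sigma> y" "\<sigma> e"] coefficients_le(2) by (intro power_mono) auto
    then show ?thesis using power2_add_le_weighted[OF s_gt_1] order.trans by blast
  qed
  ultimately show ?thesis by (simp add: s_def[symmetric] inner_diff_right)
qed

lemma quadratic_growth:
  obtains C where "0 \<le> C" "\<And>y. 2 * (y \<bullet> b y) + (norm (\<sigma> y))\<^sup>2 \<le> C * (1 + (norm y)\<^sup>2)"
proof -
  obtain B where coefficients_le: "0 \<le> B" "\<And>x. norm x \<le> 1 \<Longrightarrow> norm (b x) \<le> B \<and> norm (\<sigma> x) \<le> B"
    using locally_bounded[of 1] by blast
  define C where "C = 2 * B + B\<^sup>2 + 2 * H * \<rho> 1"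
  have "0 \<le> C" using coefficients_le H_pos rho_nonneg[of 1] by (simp add: C_def)
  moreover have "2 * (y \<bullet> b y) + (norm (\<sigma> y))\<^sup>2 \<le> C * (1 + (norm y)\<^sup>2)" for y
  proof (cases "norm y \<le> 1")
    case True
    have "y \<bullet> b y \<le> norm y * norm (b y)" by (rule norm_cauchy_schwarz)
    also have "\<dots> \<le> 1 * B" using True coefficients_le(2)[OF True] by (intro mult_mono) auto
    finally have "2 * (y \<bullet> b y) \<le> 2 * B" by simp
    moreover have "(norm (\<sigma> y))\<^sup>2 \<le> B\<^sup>2" using coefficients_le(2)[OF True] by (intro power_mono) auto
    moreover have "2 * B + B\<^sup>2 \<le> C" using H_pos rho_nonneg[of 1] by (simp add: C_def)
    moreover have "C * 1 \<le> C * (1 + (norm y)\<^sup>2)" using \<open>0 \<le> C\<close> by (intro mult_left_mono) auto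
    ultimately show ?thesis by linarith
  next
    case False
    define s where "s = norm y"
    have s_gt_1: "1 < s" using False by (simp add: s_def)
    have s_le: "s \<le> 1 + s\<^sup>2" "s * (1 + s) \<le> 2 * (1 + s\<^sup>2)"
      using zero_le_power2[of "s - 1"] s_gt_1 by (simp_all add: power2_eq_square algebra_simps)
    have "2 * (y \<bullet> b y) + (norm (\<sigma> y))\<^sup>2 \<le> H * s * \<rho> s + 2 * s * B + s * B\<^sup>2"
      using growth_outside_ball[of y B] False coefficients_le(2) by (simp add: s_def)
    also have "\<dots> \<le> H * \<rho> 1 * (2 * (1 + s\<^sup>2)) + 2 * (1 + s\<^sup>2) * B + (1 + s\<^sup>2) * B\<^sup>2"
    proof (intro add_mono mult_right_mono mult_left_mono s_le)
      have "H * s * \<rho> s \<le> H * s * (\<rho> 1 * (1 + s))"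
        using s_gt_1 H_pos by (intro mult_left_mono rho_linear_growth) auto
      also have "\<dots> = H * \<rho> 1 * (s * (1 + s))" by (simp add: mult_ac)
      also have "\<dots> \<le> H * \<rho> 1 * (2 * (1 + s\<^sup>2))"
        using H_pos rho_nonneg[of 1] by (intro mult_left_mono s_le) auto
      finally show "H * s * \<rho> s \<le> H * \<rho> 1 * (2 * (1 + s\<^sup>2))" .
    qed (use coefficients_le in auto)
    also have "\<dots> = C * (1 + s\<^sup>2)" by (simp add: C_def algebra_simps)
    finally show ?thesis by (simp add: s_def)
  qed
  ultimately show ?thesis using that by blast
qed

end

section \<open>Levy measures\<close>

abbreviation trunc_sq :: "'a::real_normed_vector \<Rightarrow> real" where
  "trunc_sq u \<equiv> min 1 ((norm u)\<^sup>2)"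

lemma trunc_sq_ge: "0 < r \<Longrightarrow> r \<le> norm u \<Longrightarrow> min 1 (r\<^sup>2) \<le> trunc_sq u"
  by (intro min.mono power_mono) auto

definition small_jumps :: "real \<Rightarrow> 'a::euclidean_space measure \<Rightarrow> real" where
  "small_jumps r \<mu> = (\<integral>u. indicator {u. norm u < r} u * (norm u)\<^sup>2 \<partial>\<mu>)"

definition tail_mass :: "real \<Rightarrow> 'a::euclidean_space measure \<Rightarrow> real" where
  "tail_mass r \<mu> = (\<integral>u. indicator {u. r \<le> norm u} u \<partial>\<mu>)"

definition compensator :: "real \<Rightarrow> real \<Rightarrow> 'a::euclidean_space measure \<Rightarrow> 'a" where
  "compensator r \<epsilon> \<mu> = (\<integral>u. indicator {u. r \<le> norm u \<and> norm u < \<epsilon>} u *\<^sub>R u \<partial>\<mu>)"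

definition jump_op :: "real \<Rightarrow> 'a::euclidean_space measure \<Rightarrow> ('a \<Rightarrow> real) \<Rightarrow> 'a \<Rightarrow> real" where
  "jump_op r \<mu> f x = (\<integral>u. indicator {u. r \<le> norm u} u * (f (x + u) - f x) \<partial>\<mu>)"

definition tail_bound :: "real \<Rightarrow> real \<Rightarrow> real" where
  "tail_bound C r = C / min 1 (r\<^sup>2)"

lemma jump_op_compl: "jump_op r \<mu> (\<lambda>x. 1 - f x) x = - jump_op r \<mu> f x"
  unfolding jump_op_def
  by (subst Bochner_Integration.integral_minus[symmetric])
    (intro Bochner_Integration.integral_cong, auto simp: algebra_simps)

locale levy_measure = sigma_finite_measure \<mu>
  for \<mu> :: "'a::euclidean_space measure" +
  fixes C :: real
  assumes sets_mu [measurable_cong]: "sets \<mu> = sets borel"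
    and C_nonneg: "0 \<le> C"
    and trunc_sq_nn_integral_le: "(\<integral>\<^sup>+u. ennreal (trunc_sq u) \<partial>\<mu>) \<le> ennreal C"
begin

lemma space_mu: "space \<mu> = UNIV"
  using sets_eq_imp_space_eq[OF sets_mu] by simp

lemma tail_bound_nonneg: "0 < r \<Longrightarrow> 0 \<le> tail_bound C r"
  using C_nonneg by (simp add: tail_bound_def)

lemma
  shows integrable_trunc_sq: "integrable \<mu> trunc_sq"
    and integral_trunc_sq_le: "(\<integral>u. trunc_sq u \<partial>\<mu>) \<le> C"
proof -
  show int: "integrable \<mu> trunc_sq"
  proof (rule integrableI_nonneg)
    show "(\<integral>\<^sup>+u. ennreal (trunc_sq u) \<partial>\<mu>) < \<infinity>"
      using trunc_sq_nn_integral_le by (rule order.strict_trans1) simp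
  qed auto
  have "ennreal (\<integral>u. trunc_sq u \<partial>\<mu>) \<le> ennreal C"
    using trunc_sq_nn_integral_le by (subst nn_integral_eq_integral[symmetric, OF int]) auto
  then show "(\<integral>u. trunc_sq u \<partial>\<mu>) \<le> C" using C_nonneg by (simp add: ennreal_le_iff)
qed

lemma
  fixes f :: "'a \<Rightarrow> 'b::{banach, second_countable_topology}"
  assumes [measurable]: "f \<in> borel_measurable borel" and bound: "\<And>u. norm (f u) \<le> K * trunc_sq u"
  shows integrable_trunc_sq_bound: "integrable \<mu> f"
    and norm_integral_trunc_sq_bound: "norm (\<integral>u. f u \<partial>\<mu>) \<le> K * C"
proof -
  obtain u :: 'a where "norm u = 1" using vector_choose_size[of 1] by auto
  then have K_nonneg: "0 \<le> K" using order.trans[OF norm_ge_zero bound[of u]] by simp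
  show int: "integrable \<mu> f"
    by (rule Bochner_Integration.integrable_bound[OF integrable_mult_right[OF integrable_trunc_sq, of K]])
      (use bound K_nonneg in \<open>auto intro!: AE_I2 simp: abs_mult\<close>)
  have "norm (\<integral>u. f u \<partial>\<mu>) \<le> (\<integral>u. norm (f u) \<partial>\<mu>)" by (rule integral_norm_bound)
  also have "\<dots> \<le> (\<integral>u. K * trunc_sq u \<partial>\<mu>)"
    by (intro integral_mono integrable_norm int integrable_mult_right integrable_trunc_sq bound)
  also have "\<dots> \<le> K * C" using K_nonneg integral_trunc_sq_le by (simp add: mult_left_mono)
  finally show "norm (\<integral>u. f u \<partial>\<mu>) \<le> K * C" .
qed

lemma
  fixes f :: "'a \<Rightarrow> 'b::{banach, second_countable_topology}"
  assumes r_pos: "0 < r" and f_measurable: "f \<in> borel_measurable borel"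
    and bound: "\<And>u. norm (f u) \<le> M * indicator {u. r \<le> norm u} u"
  shows integrable_away_from_0: "integrable \<mu> f"
    and norm_integral_away_from_0_le: "norm (\<integral>u. f u \<partial>\<mu>) \<le> M * tail_bound C r"
proof -
  obtain u :: 'a where "norm u = r" using vector_choose_size[of r] r_pos by auto
  then have M_nonneg: "0 \<le> M" using order.trans[OF norm_ge_zero bound[of u]] by simp
  have min_pos: "0 < min 1 (r\<^sup>2)" using r_pos by simp
  have "norm (f u) \<le> M / min 1 (r\<^sup>2) * trunc_sq u" for u
  proof (cases "r \<le> norm u")
    case True
    have "norm (f u) \<le> M" using bound[of u] True by simp
    also have "\<dots> = M / min 1 (r\<^sup>2) * min 1 (r\<^sup>2)" using min_pos by (metis less_irrefl nonzero_eq_divide_eq)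
    also have "\<dots> \<le> M / min 1 (r\<^sup>2) * trunc_sq u"
      using trunc_sq_ge[OF r_pos True] M_nonneg min_pos by (intro mult_left_mono) auto
    finally show ?thesis .
  next
    case False
    then have "norm (f u) \<le> 0" using bound[of u] by simp
    also have "0 \<le> M / min 1 (r\<^sup>2) * trunc_sq u" using M_nonneg min_pos by simp
    finally show ?thesis .
  qed
  from integrable_trunc_sq_bound[OF f_measurable this] norm_integral_trunc_sq_bound[OF f_measurable this]
  show "integrable \<mu> f" "norm (\<integral>u. f u \<partial>\<mu>) \<le> M * tail_bound C r" by (auto simp: tail_bound_def)
qed

lemma
  assumes "0 < r"
  shows tail_mass_integrable: "integrable \<mu> (\<lambda>u. indicator {u. r \<le> norm u} u :: real)"
    and tail_mass_le: "tail_mass r \<mu> \<le> tail_bound C r"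
  using integrable_away_from_0[OF assms, of "indicator {u. r \<le> norm u} :: 'a \<Rightarrow> real" 1]
    norm_integral_away_from_0_le[OF assms, of "indicator {u. r \<le> norm u} :: 'a \<Rightarrow> real" 1]
  by (simp_all add: tail_mass_def)

lemma
  assumes "0 < r" "0 \<le> \<epsilon>"
  shows compensator_integrable: "integrable \<mu> (\<lambda>u. indicator {u. r \<le> norm u \<and> norm u < \<epsilon>} u *\<^sub>R u)"
    and norm_compensator_le: "norm (compensator r \<epsilon> \<mu>) \<le> \<epsilon> * tail_bound C r"
proof -
  have "norm (indicator {u. r \<le> norm u \<and> norm u < \<epsilon>} u *\<^sub>R u) \<le> \<epsilon> * indicator {u. r \<le> norm u} u" for u :: 'a
    using assms by (auto simp: indicator_def)
  from integrable_away_from_0[OF assms(1) _ this] norm_integral_away_from_0_le[OF assms(1) _ this]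
  show "integrable \<mu> (\<lambda>u. indicator {u. r \<le> norm u \<and> norm u < \<epsilon>} u *\<^sub>R u)"
    "norm (compensator r \<epsilon> \<mu>) \<le> \<epsilon> * tail_bound C r" by (auto simp: compensator_def)
qed

lemma
  assumes "0 < r" and [measurable]: "f \<in> borel_measurable borel" and bound: "\<And>x. \<bar>f x\<bar> \<le> M"
  shows jump_op_integrable: "integrable \<mu> (\<lambda>u. indicator {u. r \<le> norm u} u * (f (x + u) - f x))"
    and integral_abs_jumps_le: "(\<integral>u. \<bar>indicator {u. r \<le> norm u} u * (f (x + u) - f x)\<bar> \<partial>\<mu>) \<le> 2 * M * tail_bound C r"
proof -
  let ?jump = "\<lambda>u. indicator {u. r \<le> norm u} u * (f (x + u) - f x)"
  have bound_jump: "norm (?jump u) \<le> 2 * M * indicator {u. r \<le> norm u} u" for u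
    using bound[of "x + u"] bound[of x] by (auto simp: indicator_def)
  from integrable_away_from_0[OF assms(1) _ this] show "integrable \<mu> ?jump" by simp
  have "norm \<bar>?jump u\<bar> \<le> 2 * M * indicator {u. r \<le> norm u} u" for u using bound_jump[of u] by simp
  from norm_integral_away_from_0_le[OF assms(1) _ this] show "(\<integral>u. \<bar>?jump u\<bar> \<partial>\<mu>) \<le> 2 * M * tail_bound C r"
    by (simp add: abs_le_iff)
qed

lemma
  fixes r :: real
  shows small_jumps_integrable: "integrable \<mu> (\<lambda>u. indicator {u. norm u < r} u * (norm u)\<^sup>2)"
    and small_jumps_le: "small_jumps r \<mu> \<le> max 1 (r\<^sup>2) * C"
proof -
  have "norm (indicator {u. norm u < r} u * (norm u)\<^sup>2) \<le> max 1 (r\<^sup>2) * trunc_sq u" for u :: 'a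
  proof -
    have "(norm u)\<^sup>2 \<le> r\<^sup>2" if "norm u < r" using that by (intro power_mono) auto
    moreover have "1 * (norm u)\<^sup>2 \<le> max 1 (r\<^sup>2) * (norm u)\<^sup>2" by (intro mult_right_mono) auto
    ultimately show ?thesis by (auto simp: indicator_def min_def)
  qed
  from integrable_trunc_sq_bound[OF _ this] norm_integral_trunc_sq_bound[OF _ this]
  show "integrable \<mu> (\<lambda>u. indicator {u. norm u < r} u * (norm u)\<^sup>2)"
    "small_jumps r \<mu> \<le> max 1 (r\<^sup>2) * C" unfolding small_jumps_def by (auto simp: abs_le_iff)
qed

lemma small_jumps_mono: "r \<le> r' \<Longrightarrow> small_jumps r \<mu> \<le> small_jumps r' \<mu>"
  unfolding small_jumps_def
  by (intro integral_mono small_jumps_integrable) (auto simp: indicator_def)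

lemma tail_mass_antimono:
  assumes "0 < r" "r \<le> r'" shows "tail_mass r' \<mu> \<le> tail_mass r \<mu>"
  unfolding tail_mass_def
  by (intro integral_mono tail_mass_integrable) (use assms in \<open>auto simp: indicator_def\<close>)

lemma integral_tendsto_0:
  assumes [measurable]: "\<And>n. f n \<in> borel_measurable borel"
    and bound: "\<And>n u. \<bar>f n u :: real\<bar> \<le> trunc_sq u" and lim: "\<And>u. (\<lambda>n. f n u) \<longlonglongrightarrow> 0"
  shows "(\<lambda>n. \<integral>u. f n u \<partial>\<mu>) \<longlonglongrightarrow> 0"
proof -
  have "(\<lambda>n. \<integral>u. f n u \<partial>\<mu>) \<longlonglongrightarrow> (\<integral>u. 0 \<partial>\<mu>)"
    by (rule integral_dominated_convergence[where w=trunc_sq])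
      (use bound lim integrable_trunc_sq in \<open>auto intro!: AE_I2\<close>)
  then show ?thesis by simp
qed

lemma small_jumps_tendsto_0: "(\<lambda>n. small_jumps (1 / real (Suc n)) \<mu>) \<longlonglongrightarrow> 0"
  unfolding small_jumps_def
proof (rule integral_tendsto_0)
  fix n :: nat and u :: 'a
  have "(norm u)\<^sup>2 \<le> 1" if "norm u < 1 / real (Suc n)"
  proof (rule power_le_one[OF norm_ge_zero])
    have "1 / real (Suc n) \<le> 1" by (simp add: divide_le_eq)
    then show "norm u \<le> 1" using that by linarith
  qed
  then show "\<bar>indicator {u. norm u < 1 / real (Suc n)} u * (norm u)\<^sup>2\<bar> \<le> trunc_sq u"
    by (simp add: indicator_def)
next
  fix u :: 'a
  show "(\<lambda>n. indicator {u. norm u < 1 / real (Suc n)} u * (norm u)\<^sup>2) \<longlonglongrightarrow> 0"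
  proof (rule tendsto_sandwich[OF always_eventually always_eventually tendsto_const])
    show "\<forall>n. 0 \<le> indicator {u. norm u < 1 / real (Suc n)} u * (norm u)\<^sup>2" by simp
    show "\<forall>n. indicator {u. norm u < 1 / real (Suc n)} u * (norm u)\<^sup>2 \<le> (1 / real (Suc n))\<^sup>2"
      by (auto simp: indicator_def intro!: power_mono)
    have "(\<lambda>n. (1 / real (Suc n))\<^sup>2) \<longlonglongrightarrow> 0\<^sup>2" by (intro tendsto_power LIMSEQ_Suc[OF lim_1_over_n])
    then show "(\<lambda>n. (1 / real (Suc n))\<^sup>2) \<longlonglongrightarrow> 0" by simp
  qed
qed measurable

lemma tail_mass_tendsto_0: "(\<lambda>n. tail_mass (real (Suc n)) \<mu>) \<longlonglongrightarrow> 0"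
  unfolding tail_mass_def
proof (rule integral_tendsto_0)
  fix n :: nat and u :: 'a
  have "1 \<le> (norm u)\<^sup>2" if "real (Suc n) \<le> norm u" using that by (intro one_le_power) simp
  then show "\<bar>indicator {u. real (Suc n) \<le> norm u} u\<bar> \<le> trunc_sq u" by (simp add: indicator_def)
next
  fix u :: 'a
  obtain N where "norm u \<le> real N" using real_arch_simple by blast
  then have "\<forall>\<^sub>F n in sequentially. (indicator {u. real (Suc n) \<le> norm u} u :: real) = 0"
    unfolding eventually_sequentially by (intro exI[of _ N]) (auto simp: indicator_def)
  then show "(\<lambda>n. indicator {u. real (Suc n) \<le> norm u} u :: real) \<longlonglongrightarrow> 0" by (rule tendsto_eventually)
qed measurable

lemma jump_op_ge:
  assumes r_pos: "0 < r" and f_unit: "f \<in> borel_measurable borel" "\<And>x. 0 \<le> f x" "\<And>x. f x \<le> 1"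
  shows "- tail_bound C r * f x \<le> jump_op r \<mu> f x"
proof -
  have "tail_mass r \<mu> * f x \<le> tail_bound C r * f x"
    by (intro mult_right_mono tail_mass_le r_pos f_unit)
  moreover have "(\<integral>u. indicator {u. r \<le> norm u} u * - f x \<partial>\<mu>) \<le> jump_op r \<mu> f x"
    unfolding jump_op_def using f_unit
    by (intro integral_mono integrable_mult_left tail_mass_integrable jump_op_integrable[where M=1] r_pos)
      (auto simp: indicator_def)
  moreover have "(\<integral>u. indicator {u. r \<le> norm u} u * - f x \<partial>\<mu>) = tail_mass r \<mu> * - f x"
    by (simp add: tail_mass_def)
  ultimately show ?thesis by linarith
qed

lemma jump_op_le_shifted:
  assumes r_pos: "0 < r" and f_bounded: "f \<in> borel_measurable borel" "\<And>x. \<bar>f x\<bar> \<le> M"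
    and close: "\<And>v. \<bar>f (x + v) - f (z + v)\<bar> \<le> e"
  shows "jump_op r \<mu> f x \<le> jump_op r \<mu> f z + tail_bound C r * (2 * e)"
proof -
  have "0 \<le> e" using close[of 0] by linarith
  note int = jump_op_integrable[OF r_pos f_bounded] tail_mass_integrable[OF r_pos]
  have "jump_op r \<mu> f x \<le>
      (\<integral>u. indicator {u. r \<le> norm u} u * (f (z + u) - f z) + indicator {u. r \<le> norm u} u * (2 * e) \<partial>\<mu>)"
    unfolding jump_op_def
  proof (rule integral_mono)
    show "indicator {u. r \<le> norm u} u * (f (x + u) - f x) \<le>
      indicator {u. r \<le> norm u} u * (f (z + u) - f z) + indicator {u. r \<le> norm u} u * (2 * e)" for u
      using close[of u] close[of 0] by (auto simp: indicator_def)
  qed (intro int Bochner_Integration.integrable_add integrable_mult_left)+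
  also have "\<dots> = jump_op r \<mu> f z + tail_mass r \<mu> * (2 * e)"
    using int by (simp add: jump_op_def tail_mass_def)
  also have "tail_mass r \<mu> * (2 * e) \<le> tail_bound C r * (2 * e)"
    using tail_mass_le[OF r_pos] \<open>0 \<le> e\<close> by (intro mult_right_mono) auto
  finally show ?thesis by simp
qed

lemma integrable_mollified_jumps:
  fixes x :: 'a and \<eta> f :: "'a \<Rightarrow> real"
  assumes r_pos: "0 < r" and \<eta>_integrable: "integrable lborel \<eta>"
    and f_bounded: "f \<in> borel_measurable borel" "\<And>x. \<bar>f x\<bar> \<le> M"
  shows "integrable (lborel \<Otimes>\<^sub>M \<mu>) (\<lambda>(w, u). \<eta> w * (indicator {u. r \<le> norm u} u * (f (x - w + u) - f (x - w))))"
    (is "integrable _ (\<lambda>(w, u). ?f w u)")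
proof -
  interpret pair: pair_sigma_finite lborel \<mu> ..
  note [measurable] = borel_measurable_integrable[OF \<eta>_integrable] f_bounded(1)
  show ?thesis
  proof (rule pair.Fubini_integrable)
    show "(\<lambda>(w, u). ?f w u) \<in> borel_measurable (lborel \<Otimes>\<^sub>M \<mu>)" unfolding case_prod_beta by measurable
    show "AE w in lborel. integrable \<mu> (\<lambda>u. case (w, u) of (w, u) \<Rightarrow> ?f w u)"
      unfolding prod.case by (intro AE_I2 integrable_mult_right jump_op_integrable[OF r_pos f_bounded])
    have "integrable lborel (\<lambda>w. \<integral>u. norm (?f w u) \<partial>\<mu>)"
    proof (rule Bochner_Integration.integrable_bound)
      show "integrable lborel (\<lambda>w. \<eta> w * (2 * M * tail_bound C r))" by (intro integrable_mult_left \<eta>_integrable)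
      show "(\<lambda>w. \<integral>u. norm (?f w u) \<partial>\<mu>) \<in> borel_measurable lborel" by measurable
      have "norm (\<integral>u. norm (?f w u) \<partial>\<mu>) \<le> norm (\<eta> w * (2 * M * tail_bound C r))" for w
      proof -
        have "(\<integral>u. norm (?f w u) \<partial>\<mu>)
            = \<bar>\<eta> w\<bar> * (\<integral>u. \<bar>indicator {u. r \<le> norm u} u * (f (x - w + u) - f (x - w))\<bar> \<partial>\<mu>)"
          by (simp add: abs_mult)
        also have "\<dots> \<le> \<bar>\<eta> w\<bar> * (2 * M * tail_bound C r)"
          by (intro mult_left_mono integral_abs_jumps_le r_pos f_bounded) simp
        also have "\<dots> \<le> norm (\<eta> w * (2 * M * tail_bound C r))"
          unfolding real_norm_def abs_mult[of "\<eta> w"] by (intro mult_left_mono abs_ge_self) simp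
        finally show ?thesis by simp
      qed
      then show "AE w in lborel. norm (\<integral>u. norm (?f w u) \<partial>\<mu>) \<le> norm (\<eta> w * (2 * M * tail_bound C r))" by (rule AE_I2)
    qed
    then show "integrable lborel (\<lambda>w. \<integral>u. norm (case (w, u) of (w, u) \<Rightarrow> ?f w u) \<partial>\<mu>)" unfolding prod.case .
  qed
qed

lemma jump_op_conv:
  assumes r_pos: "0 < r" and \<eta>_integrable: "integrable lborel \<eta>"
    and f_bounded: "f \<in> borel_measurable borel" "\<And>x. \<bar>f x\<bar> \<le> M"
  shows "has_bochner_integral lborel (\<lambda>w. \<eta> w * jump_op r \<mu> f (x - w)) (jump_op r \<mu> (conv \<eta> f) x)"
proof -
  interpret pair: pair_sigma_finite lborel \<mu> ..
  let ?f = "\<lambda>w u. \<eta> w * (indicator {u. r \<le> norm u} u * (f (x - w + u) - f (x - w)))"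
  have inner: "(\<integral>u. ?f w u \<partial>\<mu>) = \<eta> w * jump_op r \<mu> f (x - w)" for w
    by (simp add: jump_op_def)
  have outer: "(\<integral>w. ?f w u \<partial>lborel) = indicator {u. r \<le> norm u} u * (conv \<eta> f (x + u) - conv \<eta> f x)" for u
  proof -
    have "?f w u = indicator {u. r \<le> norm u} u * (\<eta> w * f (x + u - w) - \<eta> w * f (x - w))" for w
      by (simp add: algebra_simps)
    then have "(\<integral>w. ?f w u \<partial>lborel)
        = (\<integral>w. indicator {u. r \<le> norm u} u * (\<eta> w * f (x + u - w) - \<eta> w * f (x - w)) \<partial>lborel)"
      by (simp only:)
    then show ?thesis
      using integrable_conv[OF \<eta>_integrable f_bounded, of "x + u"] integrable_conv[OF \<eta>_integrable f_bounded,
        of x] by (simp add: conv_def)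
  qed
  note product = integrable_mollified_jumps[OF r_pos \<eta>_integrable f_bounded, of x]
  show ?thesis
    unfolding has_bochner_integral_iff jump_op_def[of _ _ "conv \<eta> f"]
    using pair.integrable_fst[OF product] pair.Fubini_integral[OF product] by (simp only: prod.case inner outer)
qed

end

subsection \<open>Measurable families of Levy measures\<close>

locale levy_kernel =
  fixes \<nu> :: "'b::topological_space \<Rightarrow> 'a::euclidean_space measure" and C :: real
  assumes levy: "levy_measure (\<nu> x) C"
    and emeasure_measurable: "A \<in> sets borel \<Longrightarrow> (\<lambda>x. emeasure (\<nu> x) A) \<in> borel_measurable borel"
begin

lemma measurable_nu: "f \<in> borel_measurable borel \<Longrightarrow> f \<in> borel_measurable (\<nu> x)"
  using measurable_cong_sets[OF levy_measure.sets_mu[OF levy] refl] by blast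

lemma borel_measurable_nn_integral_kernel:
  assumes "g \<in> borel_measurable borel"
  shows "(\<lambda>x. \<integral>\<^sup>+u. g u \<partial>\<nu> x) \<in> borel_measurable borel"
  using assms
proof (induction rule: borel_measurable_induct)
  case (cong f g)
  then show ?case by (simp add: fun_eq_iff)
next
  case (set A)
  then show ?case using emeasure_measurable levy_measure.sets_mu[OF levy] by simp
next
  case (mult u c)
  then have "(\<integral>\<^sup>+v. c * u v \<partial>\<nu> x) = c * (\<integral>\<^sup>+v. u v \<partial>\<nu> x)" for x
    using measurable_nu[OF mult(2)] by (intro nn_integral_cmult) auto
  then show ?case using mult by simp
next
  case (add u v)
  then have "(\<integral>\<^sup>+w. v w + u w \<partial>\<nu> x) = (\<integral>\<^sup>+w. v w \<partial>\<nu> x) + (\<integral>\<^sup>+w. u w \<partial>\<nu> x)" for x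
    using measurable_nu[OF add(1)] measurable_nu[OF add(3)] by (intro nn_integral_add) auto
  then show ?case using add by simp
next
  case (seq U)
  have "(\<integral>\<^sup>+u. (SUP i. U i) u \<partial>\<nu> x) = (SUP i. \<integral>\<^sup>+u. U i u \<partial>\<nu> x)" for x
    unfolding SUP_apply using seq measurable_nu[OF seq(1)] by (intro nn_integral_monotone_convergence_SUP) auto
  then show ?case using seq by simp
qed

definition trunc_weight :: "'a \<Rightarrow> real" where
  "trunc_weight u = trunc_sq u / (C + 1)"

lemma trunc_weight_nonneg: "0 \<le> trunc_weight u"
  using levy_measure.C_nonneg[OF levy] by (simp add: trunc_weight_def)

lemma trunc_weight_measurable [measurable]: "trunc_weight \<in> borel_measurable borel"
  unfolding trunc_weight_def by measurable

lemma weighted_subprob_kernel: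
  "(\<lambda>x. density (\<nu> x) (\<lambda>u. ennreal (trunc_weight u))) \<in> borel \<rightarrow>\<^sub>M subprob_algebra borel"
proof (rule measurable_subprob_algebra)
  fix x
  interpret levy_measure "\<nu> x" C by (rule levy)
  let ?\<kappa> = "density (\<nu> x) (\<lambda>u. ennreal (trunc_weight u))"
  show "sets ?\<kappa> = sets borel" by (simp add: sets_mu)
  have "emeasure ?\<kappa> (space ?\<kappa>) = (\<integral>\<^sup>+u. ennreal (trunc_sq u) * ennreal (1 / (C + 1)) \<partial>\<nu> x)"
    using C_nonneg
    by (subst emeasure_density) (auto intro!: nn_integral_cong simp: space_mu sets_mu trunc_weight_def
      ennreal_mult'[symmetric])
  also have "\<dots> = (\<integral>\<^sup>+u. ennreal (trunc_sq u) \<partial>\<nu> x) * ennreal (1 / (C + 1))"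
    by (rule nn_integral_multc) measurable
  also have "\<dots> \<le> ennreal C * ennreal (1 / (C + 1))" by (intro mult_right_mono trunc_sq_nn_integral_le) auto
  also have "\<dots> \<le> 1" using C_nonneg by (simp add: ennreal_mult'[symmetric] ennreal_le_1)
  finally show "subprob_space ?\<kappa>"
    by (intro subprob_spaceI) (auto simp: space_mu)
next
  fix A :: "'a set" assume [measurable]: "A \<in> sets borel"
  have "emeasure (density (\<nu> x) (\<lambda>u. ennreal (trunc_weight u))) A
      = (\<integral>\<^sup>+u. ennreal (trunc_weight u) * indicator A u \<partial>\<nu> x)" for x
    by (rule emeasure_density) (auto intro: measurable_nu simp: levy_measure.sets_mu[OF levy])
  then show "(\<lambda>x. emeasure (density (\<nu> x) (\<lambda>u. ennreal (trunc_weight u))) A) \<in> borel_measurable borel"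
    by (simp add: borel_measurable_nn_integral_kernel)
qed

text \<open>Weighting by \<open>trunc_weight\<close> turns the possibly infinite measures into subprobability measures, for which
  measurability of parametric integrals is available.\<close>
lemma borel_measurable_integral_kernel:
  assumes F_measurable: "(\<lambda>(x, u). F x u) \<in> borel_measurable (borel \<Otimes>\<^sub>M borel)"
    and F_bound: "\<And>x u. \<bar>F x u :: real\<bar> \<le> K * trunc_sq u"
  shows "(\<lambda>x. \<integral>u. F x u \<partial>\<nu> x) \<in> borel_measurable borel"
proof -
  define \<kappa> where "\<kappa> x = density (\<nu> x) (\<lambda>u. ennreal (trunc_weight u))" for x
  define F' where "F' x u = F x u / trunc_weight u" for x u
  note [measurable] = F_measurable
  have F'_measurable: "(\<lambda>(x, u). F' x u) \<in> borel_measurable (borel \<Otimes>\<^sub>M borel)"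
    unfolding F'_def case_prod_beta by measurable
  have F'_section: "F' x \<in> borel_measurable (\<nu> x)" for x
    using measurable_compose_Pair1[OF _ F'_measurable, of x] by (intro measurable_nu) simp
  have unweight: "trunc_weight u * F' x u = F x u" for x u
    using F_bound[of x u] levy_measure.C_nonneg[OF levy]
    by (cases "u = 0") (auto simp: F'_def trunc_weight_def min_def add_nonneg_eq_0_iff)
  have int: "integrable (\<nu> x) (F x)" for x
    using F_bound measurable_compose_Pair1[OF _ F_measurable, of x]
    by (intro levy_measure.integrable_trunc_sq_bound[OF levy, of _ K]) auto
  have weight: "trunc_weight \<in> borel_measurable (\<nu> x)" for x by (intro measurable_nu) measurable
  have "(\<integral>u. F x u \<partial>\<nu> x) = (\<integral>u. F' x u \<partial>\<kappa> x)" for x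
    unfolding \<kappa>_def by (subst integral_density) (use F'_section weight trunc_weight_nonneg unweight in auto)
  moreover have "integrable (\<kappa> x) (F' x)" for x
    unfolding \<kappa>_def by (subst integrable_density) (use F'_section weight trunc_weight_nonneg unweight int in auto)
  ultimately have "(\<integral>u. F x u \<partial>\<nu> x) = enn2real (\<integral>\<^sup>+u. ennreal (F' x u) \<partial>\<kappa> x) - enn2real (\<integral>\<^sup>+u. ennreal (- F' x u) \<partial>\<kappa> x)" for x
    by (simp add: real_lebesgue_integral_def)
  moreover have "(\<lambda>x. \<integral>\<^sup>+u. ennreal (F' x u) \<partial>\<kappa> x) \<in> borel_measurable borel"
    "(\<lambda>x. \<integral>\<^sup>+u. ennreal (- F' x u) \<partial>\<kappa> x) \<in> borel_measurable borel"
    unfolding \<kappa>_def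
    by (rule nn_integral_measurable_subprob_algebra2[OF _ weighted_subprob_kernel]; use F'_measurable
      in \<open>simp add: case_prod_beta\<close>)+
  ultimately show ?thesis by simp
qed

end

subsection \<open>Pairs of Levy measures that are close in weighted total variation\<close>

definition plus_measure :: "'a measure \<Rightarrow> 'a measure \<Rightarrow> 'a measure" where
  "plus_measure \<mu> \<mu>' = measure_of (space \<mu>) (sets \<mu>) (\<lambda>A. emeasure \<mu> A + emeasure \<mu>' A)"

lemma sets_plus_measure [simp]: "sets (plus_measure \<mu> \<mu>') = sets \<mu>"
  by (simp add: plus_measure_def)

lemma space_plus_measure [simp]: "space (plus_measure \<mu> \<mu>') = space \<mu>"
  by (simp add: plus_measure_def space_measure_of_conv)

lemma emeasure_plus_measure:
  assumes "sets \<mu>' = sets \<mu>" "A \<in> sets \<mu>"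
  shows "emeasure (plus_measure \<mu> \<mu>') A = emeasure \<mu> A + emeasure \<mu>' A"
  unfolding plus_measure_def
proof (rule emeasure_measure_of_sigma[OF _ _ _ assms(2)])
  show "sigma_algebra (space \<mu>) (sets \<mu>)" by (rule sets.sigma_algebra_axioms)
  show "positive (sets \<mu>) (\<lambda>A. emeasure \<mu> A + emeasure \<mu>' A)" by (simp add: positive_def)
  show "countably_additive (sets \<mu>) (\<lambda>A. emeasure \<mu> A + emeasure \<mu>' A)"
  proof (rule countably_additiveI)
    fix A :: "nat \<Rightarrow> 'a set" assume "range A \<subseteq> sets \<mu>" "disjoint_family A"
    then show "(\<Sum>i. emeasure \<mu> (A i) + emeasure \<mu>' (A i)) = emeasure \<mu> (\<Union> (range A)) + emeasure \<mu>' (\<Union> (range A))"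
      using assms(1) by (subst suminf_add[symmetric]) (auto simp: suminf_emeasure)
  qed
qed

lemma sigma_finite_plus_measure:
  assumes "sigma_finite_measure \<mu>" "sigma_finite_measure \<mu>'" and sets_eq: "sets \<mu>' = sets \<mu>"
  shows "sigma_finite_measure (plus_measure \<mu> \<mu>')"
proof
  obtain A where A_exhausts: "range A \<subseteq> sets \<mu>" "(\<Union>i. A i) = space \<mu>" "\<And>i. emeasure \<mu> (A i) \<noteq> \<infinity>" "incseq A"
    using sigma_finite_measure.sigma_finite_incseq[OF assms(1)] by metis
  obtain B where B_exhausts: "range B \<subseteq> sets \<mu>'" "(\<Union>i. B i) = space \<mu>'" "\<And>i. emeasure \<mu>' (B i) \<noteq> \<infinity>" "incseq B"
    using sigma_finite_measure.sigma_finite_incseq[OF assms(2)] by metis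
  let ?F = "range (\<lambda>i. A i \<inter> B i)"
  have sets: "A i \<in> sets \<mu>" "B i \<in> sets \<mu>" for i using A_exhausts(1) B_exhausts(1) sets_eq by auto
  have "\<Union> ?F = space \<mu>"
  proof (intro equalityI subsetI)
    fix x assume "x \<in> space \<mu>"
    then obtain i j where "x \<in> A i" "x \<in> B j"
      using A_exhausts(2) B_exhausts(2) sets_eq_imp_space_eq[OF sets_eq] by (metis UN_E)
    then have "x \<in> A (max i j) \<inter> B (max i j)"
      using A_exhausts(4) B_exhausts(4) by (meson IntI incseqD max.cobounded1 max.cobounded2 subsetD)
    then show "x \<in> \<Union> ?F" by blast
  qed (use A_exhausts(2) in auto)
  moreover have "emeasure (plus_measure \<mu> \<mu>') (A i \<inter> B i) \<noteq> \<infinity>" for i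
  proof -
    have "emeasure (plus_measure \<mu> \<mu>') (A i \<inter> B i) = emeasure \<mu> (A i \<inter> B i) + emeasure \<mu>' (A i \<inter> B i)"
      by (intro emeasure_plus_measure sets_eq sets.Int sets)
    also have "\<dots> \<le> emeasure \<mu> (A i) + emeasure \<mu>' (B i)"
      using sets sets_eq by (intro add_mono emeasure_mono) auto
    also have "\<dots> < \<infinity>" using A_exhausts(3)[of i] B_exhausts(3)[of i] by (simp add: less_top)
    finally show ?thesis by simp
  qed
  ultimately show "\<exists>F. countable F \<and> F \<subseteq> sets (plus_measure \<mu> \<mu>') \<and> \<Union> F = space (plus_measure \<mu> \<mu>')
      \<and> (\<forall>a\<in>F. emeasure (plus_measure \<mu> \<mu>') a \<noteq> \<infinity>)"
    using sets by (intro exI[of _ ?F]) auto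
qed

lemma real_density_of_absolutely_continuous:
  assumes "sigma_finite_measure m" "sigma_finite_measure \<mu>" "absolutely_continuous m \<mu>" "sets \<mu> = sets m"
  obtains f where "f \<in> borel_measurable m" "\<And>u. 0 \<le> f u" "\<mu> = density m (\<lambda>u. ennreal (f u))"
    "AE u in m. RN_deriv m \<mu> u = ennreal (f u)"
proof -
  interpret m: sigma_finite_measure m by fact
  have dens: "density m (RN_deriv m \<mu>) = \<mu>" using m.density_RN_deriv assms(3,4) by blast
  define f where "f u = enn2real (RN_deriv m \<mu> u)" for u
  have f_measurable: "f \<in> borel_measurable m" unfolding f_def by measurable
  have "AE u in m. RN_deriv m \<mu> u \<noteq> \<infinity>"
    using m.sigma_finite_iff_density_finite[of "RN_deriv m \<mu>"] assms(2) by (simp add: dens)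
  then have AE_density: "AE u in m. RN_deriv m \<mu> u = ennreal (f u)"
    by (rule AE_mp) (simp add: f_def less_top)
  with f_measurable have "\<mu> = density m (\<lambda>u. ennreal (f u))"
    by (subst dens[symmetric]) (auto intro!: density_cong)
  from that[OF f_measurable _ this AE_density] show ?thesis by (simp add: f_def)
qed

lemma tv_nn_integral_densities:
  assumes "sigma_finite_measure \<mu>" "sigma_finite_measure \<mu>'" and sets_eq: "sets \<mu>' = sets \<mu>"
  obtains m f f' where "sets m = sets \<mu>" "f \<in> borel_measurable m" "f' \<in> borel_measurable m"
    "\<And>u. 0 \<le> f u" "\<And>u. 0 \<le> f' u"
    "\<mu> = density m (\<lambda>u. ennreal (f u))" "\<mu>' = density m (\<lambda>u. ennreal (f' u))"
    "\<And>g. tv_nn_integral g \<mu> \<mu>' = (\<integral>\<^sup>+u. g u * ennreal \<bar>f u - f' u\<bar> \<partial>m)"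
proof -
  define m where "m = plus_measure \<mu> \<mu>'"
  have m_sigma_finite: "sigma_finite_measure m" unfolding m_def by (intro sigma_finite_plus_measure assms)
  have sets_m: "sets \<mu> = sets m" "sets \<mu>' = sets m" by (simp_all add: m_def sets_eq)
  have abs_continuous: "absolutely_continuous m \<mu>" "absolutely_continuous m \<mu>'"
    using sets_eq by (auto simp: absolutely_continuous_def null_sets_def m_def emeasure_plus_measure)
  obtain f where f_density: "f \<in> borel_measurable m" "\<And>u. 0 \<le> f u" "\<mu> = density m (\<lambda>u. ennreal (f u))"
    "AE u in m. RN_deriv m \<mu> u = ennreal (f u)"
    using real_density_of_absolutely_continuous[OF m_sigma_finite assms(1) abs_continuous(1) sets_m(1)] by blast
  obtain f' where f'_density: "f' \<in> borel_measurable m" "\<And>u. 0 \<le> f' u" "\<mu>' = density m (\<lambda>u. ennreal (f' u))"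
    "AE u in m. RN_deriv m \<mu>' u = ennreal (f' u)"
    using real_density_of_absolutely_continuous[OF m_sigma_finite assms(2) abs_continuous(2) sets_m(2)] by blast
  have "tv_nn_integral g \<mu> \<mu>' = (\<integral>\<^sup>+u. g u * ennreal \<bar>f u - f' u\<bar> \<partial>m)" for g
  proof -
    have "tv_nn_integral g \<mu> \<mu>'
        = (\<integral>\<^sup>+u. g u * ((RN_deriv m \<mu> u - RN_deriv m \<mu>' u) + (RN_deriv m \<mu>' u - RN_deriv m \<mu> u)) \<partial>m)"
      by (simp add: tv_nn_integral_def Let_def m_def plus_measure_def)
    also have "\<dots> = (\<integral>\<^sup>+u. g u * ennreal \<bar>f u - f' u\<bar> \<partial>m)"
    proof (rule nn_integral_cong_AE)
      show "AE u in m. g u * ((RN_deriv m \<mu> u - RN_deriv m \<mu>' u) + (RN_deriv m \<mu>' u - RN_deriv m \<mu> u))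
          = g u * ennreal \<bar>f u - f' u\<bar>"
        using f_density(4) f'_density(4)
      proof eventually_elim
        case (elim u)
        then show ?case using f_density(2)[of u] f'_density(2)[of u]
          by (cases "f u \<le> f' u") (auto simp: ennreal_minus ennreal_neg)
      qed
    qed
    finally show ?thesis .
  qed
  from that[OF _ f_density(1) f'_density(1) f_density(2) f'_density(2) f_density(3) f'_density(3) this]
  show ?thesis by (simp add: m_def)
qed

text \<open>The common mass \<open>min p p'\<close> is charged with the sum \<open>X + Y\<close>, the excess \<open>|p - p'|\<close> with \<open>X\<close> or \<open>Y\<close> alone.\<close>
lemma coupled_weights_le:
  fixes p p' X Y v w K :: real
  assumes "0 \<le> p" "0 \<le> p'" "X \<le> K + v" "Y \<le> K + w" "X + Y \<le> v + w"
  shows "p * X + p' * Y \<le> K * \<bar>p - p'\<bar> + p * v + p' * w"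
proof (cases "p' \<le> p")
  case True
  have "p * X + p' * Y = p' * (X + Y) + (p - p') * X" by (simp add: algebra_simps)
  also have "\<dots> \<le> p' * (v + w) + (p - p') * (K + v)"
    using assms True by (intro add_mono[OF mult_left_mono mult_left_mono]) auto
  finally show ?thesis using True by (simp add: algebra_simps)
next
  case False
  have "p * X + p' * Y = p * (X + Y) + (p' - p) * Y" by (simp add: algebra_simps)
  also have "\<dots> \<le> p * (v + w) + (p' - p) * (K + w)"
    using assms False by (intro add_mono[OF mult_left_mono mult_left_mono]) auto
  finally show ?thesis using False by (simp add: algebra_simps)
qed

locale levy_pair = first: levy_measure \<mu> C + second: levy_measure \<mu>' C
  for \<mu> \<mu>' :: "'a::euclidean_space measure" and C :: real +
  fixes c :: real
  assumes c_nonneg: "0 \<le> c"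
    and tv_le: "tv_nn_integral (\<lambda>u. ennreal (norm u)) \<mu> \<mu>' \<le> ennreal c"
begin

lemma common_densities:
  obtains m f f' where "sets m = sets borel" "f \<in> borel_measurable m" "f' \<in> borel_measurable m"
    "\<And>u. 0 \<le> f u" "\<And>u. 0 \<le> f' u"
    "\<mu> = density m (\<lambda>u. ennreal (f u))" "\<mu>' = density m (\<lambda>u. ennreal (f' u))"
    "integrable m (\<lambda>u. norm u * \<bar>f u - f' u\<bar>)" "(\<integral>u. norm u * \<bar>f u - f' u\<bar> \<partial>m) \<le> c"
proof -
  obtain m f f' where m_sets: "sets m = sets \<mu>" "f \<in> borel_measurable m" "f' \<in> borel_measurable m"
    and dens: "\<And>u. 0 \<le> f u" "\<And>u. 0 \<le> f' u"
    "\<mu> = density m (\<lambda>u. ennreal (f u))" "\<mu>' = density m (\<lambda>u. ennreal (f' u))"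
    and tv_eq: "\<And>g. tv_nn_integral g \<mu> \<mu>' = (\<integral>\<^sup>+u. g u * ennreal \<bar>f u - f' u\<bar> \<partial>m)"
    by (rule tv_nn_integral_densities[OF first.sigma_finite_measure_axioms second.sigma_finite_measure_axioms])
      (simp only: first.sets_mu second.sets_mu, blast)
  have sets_m [measurable_cong]: "sets m = sets borel" using m_sets(1) first.sets_mu by simp
  note [measurable] = m_sets(2,3)
  have nn_le: "(\<integral>\<^sup>+u. ennreal (norm u * \<bar>f u - f' u\<bar>) \<partial>m) \<le> ennreal c"
    using tv_le tv_eq[of "\<lambda>u. ennreal (norm u)"] by (simp add: ennreal_mult)
  have int: "integrable m (\<lambda>u. norm u * \<bar>f u - f' u\<bar>)"
    by (rule integrableI_nonneg) (use order.strict_trans1[OF nn_le] in auto)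
  have "(\<integral>u. norm u * \<bar>f u - f' u\<bar> \<partial>m) \<le> c"
    using nn_le nn_integral_eq_integral[OF int] c_nonneg by (simp add: ennreal_le_iff)
  with sets_m m_sets(2,3) dens int show ?thesis by (rule that)
qed

lemma coupled_integral_le:
  fixes X Y v w :: "'a \<Rightarrow> real"
  assumes int: "integrable \<mu> X" "integrable \<mu>' Y" "integrable \<mu> v" "integrable \<mu>' w" and K_nonneg: "0 \<le> K"
    and increments_le: "\<And>u. X u \<le> K * norm u + v u" "\<And>u. Y u \<le> K * norm u + w u" "\<And>u. X u + Y u \<le> v u + w u"
  shows "(\<integral>u. X u \<partial>\<mu>) + (\<integral>u. Y u \<partial>\<mu>') \<le> K * c + (\<integral>u. v u \<partial>\<mu>) + (\<integral>u. w u \<partial>\<mu>')"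
proof -
  obtain m f f' where sets_m [measurable_cong]: "sets m = sets borel"
    and f_measurable [measurable]: "f \<in> borel_measurable m" "f' \<in> borel_measurable m"
    and nonneg: "\<And>u. 0 \<le> f u" "\<And>u. 0 \<le> f' u"
    and dens: "\<mu> = density m (\<lambda>u. ennreal (f u))" "\<mu>' = density m (\<lambda>u. ennreal (f' u))"
    and tv_bound: "integrable m (\<lambda>u. norm u * \<bar>f u - f' u\<bar>)" "(\<integral>u. norm u * \<bar>f u - f' u\<bar> \<partial>m) \<le> c"
    by (rule common_densities) (rule that)
  have first: "integrable m (\<lambda>u. f u * h u)" "(\<integral>u. h u \<partial>\<mu>) = (\<integral>u. f u * h u \<partial>m)"
    if "integrable \<mu> h" for h :: "'a \<Rightarrow> real"
  proof -
    have [measurable]: "h \<in> borel_measurable borel"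
      using borel_measurable_integrable[OF that] measurable_cong_sets[OF first.sets_mu refl] by blast
    show "integrable m (\<lambda>u. f u * h u)" "(\<integral>u. h u \<partial>\<mu>) = (\<integral>u. f u * h u \<partial>m)"
      using that nonneg(1) unfolding dens by (simp_all add: integrable_density integral_density)
  qed
  have second: "integrable m (\<lambda>u. f' u * h u)" "(\<integral>u. h u \<partial>\<mu>') = (\<integral>u. f' u * h u \<partial>m)"
    if "integrable \<mu>' h" for h :: "'a \<Rightarrow> real"
  proof -
    have [measurable]: "h \<in> borel_measurable borel"
      using borel_measurable_integrable[OF that] measurable_cong_sets[OF second.sets_mu refl] by blast
    show "integrable m (\<lambda>u. f' u * h u)" "(\<integral>u. h u \<partial>\<mu>') = (\<integral>u. f' u * h u \<partial>m)"
      using that nonneg(2) unfolding dens by (simp_all add: integrable_density integral_density)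
  qed
  note transfer = first[OF int(1)] second[OF int(2)] first[OF int(3)] second[OF int(4)]
  have "(\<integral>u. X u \<partial>\<mu>) + (\<integral>u. Y u \<partial>\<mu>') = (\<integral>u. f u * X u + f' u * Y u \<partial>m)"
    using transfer by simp
  also have "\<dots> \<le> (\<integral>u. K * (norm u * \<bar>f u - f' u\<bar>) + f u * v u + f' u * w u \<partial>m)"
  proof (rule integral_mono)
    show "f u * X u + f' u * Y u \<le> K * (norm u * \<bar>f u - f' u\<bar>) + f u * v u + f' u * w u" for u
      using coupled_weights_le[OF nonneg increments_le] by (simp add: mult.assoc)
  qed (use transfer tv_bound(1) in auto)
  also have "\<dots> = K * (\<integral>u. norm u * \<bar>f u - f' u\<bar> \<partial>m) + (\<integral>u. v u \<partial>\<mu>) + (\<integral>u. w u \<partial>\<mu>')"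
    using transfer tv_bound(1) by simp
  finally show ?thesis using mult_left_mono[OF tv_bound(2) K_nonneg] by linarith
qed

lemma integral_diff_le:
  fixes g :: "'a \<Rightarrow> real"
  assumes "integrable \<mu> g" "integrable \<mu>' g" "0 \<le> K" "\<And>u. \<bar>g u\<bar> \<le> K * norm u"
  shows "(\<integral>u. g u \<partial>\<mu>) - (\<integral>u. g u \<partial>\<mu>') \<le> K * c"
  using coupled_integral_le[of g "\<lambda>u. - g u" "\<lambda>_. 0" "\<lambda>_. 0" K] assms by (simp add: abs_le_iff)

lemma norm_compensator_diff_le:
  assumes "0 < r" "0 \<le> \<epsilon>"
  shows "norm (compensator r \<epsilon> \<mu> - compensator r \<epsilon> \<mu>') \<le> c"
proof -
  let ?d = "compensator r \<epsilon> \<mu> - compensator r \<epsilon> \<mu>'"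
  let ?g = "\<lambda>u::'a. indicator {u. r \<le> norm u \<and> norm u < \<epsilon>} u *\<^sub>R u"
  note int = first.compensator_integrable[OF assms] second.compensator_integrable[OF assms]
  have "norm ?d * norm ?d = ?d \<bullet> compensator r \<epsilon> \<mu> - ?d \<bullet> compensator r \<epsilon> \<mu>'"
    by (simp add: inner_diff_right[symmetric] flip: power2_norm_eq_inner power2_eq_square)
  also have "\<dots> = (\<integral>u. ?d \<bullet> ?g u \<partial>\<mu>) - (\<integral>u. ?d \<bullet> ?g u \<partial>\<mu>')"
    unfolding compensator_def using int by (simp only: integral_inner_right)
  also have "\<dots> \<le> norm ?d * c"
  proof (rule integral_diff_le[OF integrable_inner_right[OF int(1)] integrable_inner_right[OF int(2)]])
    show "\<bar>?d \<bullet> ?g u\<bar> \<le> norm ?d * norm u" for u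
      using Cauchy_Schwarz_ineq2[of ?d u] by (auto simp: indicator_def)
  qed simp
  finally show ?thesis using c_nonneg by (cases "?d = 0") auto
qed

lemma small_jumps_diff_le:
  assumes "0 \<le> r" shows "small_jumps r \<mu> \<le> small_jumps r \<mu>' + r * c"
proof -
  have "\<bar>indicator {u. norm u < r} u * (norm u)\<^sup>2\<bar> \<le> r * norm u" for u :: 'a
    using mult_right_mono[of "norm u" r "norm u"] assms by (auto simp: indicator_def power2_eq_square)
  from integral_diff_le[OF first.small_jumps_integrable second.small_jumps_integrable assms this]
  show ?thesis by (simp add: small_jumps_def)
qed

lemma tail_mass_diff_le:
  assumes "0 < r" shows "tail_mass r \<mu> \<le> tail_mass r \<mu>' + c / r"
proof -
  have "\<bar>indicator {u. r \<le> norm u} u :: real\<bar> \<le> 1 / r * norm u" for u :: 'a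
    using assms by (auto simp: indicator_def le_divide_eq)
  from integral_diff_le[OF first.tail_mass_integrable[OF assms] second.tail_mass_integrable[OF assms] _ this] assms
  show ?thesis by (simp add: tail_mass_def)
qed

end

section \<open>Difference quotients\<close>

definition forward_quotient :: "real \<Rightarrow> 'a::real_vector \<Rightarrow> ('a \<Rightarrow> real) \<Rightarrow> 'a \<Rightarrow> real" where
  "forward_quotient \<tau> v f x = (f (x + \<tau> *\<^sub>R v) - f x) / \<tau>"

definition central_quotient :: "real \<Rightarrow> 'a::real_vector \<Rightarrow> ('a \<Rightarrow> real) \<Rightarrow> 'a \<Rightarrow> real" where
  "central_quotient \<tau> v f x = (f (x + sqrt \<tau> *\<^sub>R v) + f (x - sqrt \<tau> *\<^sub>R v) - 2 * f x) / (2 * \<tau>)"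

lemma forward_quotient_0 [simp]: "forward_quotient \<tau> 0 f x = 0"
  and central_quotient_0 [simp]: "central_quotient \<tau> 0 f x = 0"
  by (simp_all add: forward_quotient_def central_quotient_def)

lemma forward_quotient_compl: "forward_quotient \<tau> v (\<lambda>x. 1 - f x) x = - forward_quotient \<tau> v f x"
  and central_quotient_compl: "central_quotient \<tau> v (\<lambda>x. 1 - f x) x = - central_quotient \<tau> v f x"
  by (simp_all add: forward_quotient_def central_quotient_def minus_divide_left)

lemma
  assumes "0 < \<tau>" "\<And>x. 0 \<le> f x"
  shows forward_quotient_ge: "- (1 / \<tau>) * f x \<le> forward_quotient \<tau> v f x"
    and central_quotient_ge: "- (1 / \<tau>) * f x \<le> central_quotient \<tau> v f x"
proof -
  have "- f x / \<tau> \<le> forward_quotient \<tau> v f x"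
    unfolding forward_quotient_def using assms by (intro divide_right_mono) auto
  then show "- (1 / \<tau>) * f x \<le> forward_quotient \<tau> v f x" by simp
  have "(- 2 * f x) / (2 * \<tau>) \<le> central_quotient \<tau> v f x"
    unfolding central_quotient_def using assms by (intro divide_right_mono) auto
  then show "- (1 / \<tau>) * f x \<le> central_quotient \<tau> v f x" by simp
qed

lemma
  assumes "0 < \<tau>" and close: "\<And>v. \<bar>f (x + v) - f (z + v)\<bar> \<le> e"
  shows forward_quotient_le_shifted: "forward_quotient \<tau> v f x \<le> forward_quotient \<tau> v f z + 1 / \<tau> * (2 * e)"
    and central_quotient_le_shifted: "central_quotient \<tau> v f x \<le> central_quotient \<tau> v f z + 1 / \<tau> * (2 * e)"
proof -
  have "forward_quotient \<tau> v f x \<le> (f (z + \<tau> *\<^sub>R v) - f z + 2 * e) / \<tau>"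
    unfolding forward_quotient_def using assms(1) close[of "\<tau> *\<^sub>R v"] close[of 0]
    by (intro divide_right_mono) auto
  then show "forward_quotient \<tau> v f x \<le> forward_quotient \<tau> v f z + 1 / \<tau> * (2 * e)"
    by (simp add: forward_quotient_def add_divide_distrib)
  have "central_quotient \<tau> v f x \<le> (f (z + sqrt \<tau> *\<^sub>R v) + f (z - sqrt \<tau> *\<^sub>R v) - 2 * f z + 4 * e) / (2 * \<tau>)"
    unfolding central_quotient_def
    using assms(1) close[of "sqrt \<tau> *\<^sub>R v"] close[of "- (sqrt \<tau> *\<^sub>R v)"] close[of 0]
    by (intro divide_right_mono) auto
  also have "\<dots> = central_quotient \<tau> v f z + 1 / \<tau> * (2 * e)"
    by (simp add: central_quotient_def add_divide_distrib)
  finally show "central_quotient \<tau> v f x \<le> central_quotient \<tau> v f z + 1 / \<tau> * (2 * e)" .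
qed

lemma has_bochner_integral_conv_shift:
  fixes \<eta> f :: "'a::euclidean_space \<Rightarrow> real"
  assumes "integrable lborel \<eta>" "f \<in> borel_measurable borel" "\<And>x. \<bar>f x\<bar> \<le> M"
  shows "has_bochner_integral lborel (\<lambda>w. \<eta> w * f (x - w + v)) (conv \<eta> f (x + v))"
  using integrable_conv[OF assms, of "x + v"] by (simp add: has_bochner_integral_iff conv_def algebra_simps)

lemma
  fixes \<eta> f :: "'a::euclidean_space \<Rightarrow> real"
  assumes "integrable lborel \<eta>" "f \<in> borel_measurable borel" "\<And>x. \<bar>f x\<bar> \<le> M"
  shows forward_quotient_conv:
      "has_bochner_integral lborel (\<lambda>w. \<eta> w * forward_quotient \<tau> v f (x - w)) (forward_quotient \<tau> v (conv \<eta> f) x)"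
    and central_quotient_conv:
      "has_bochner_integral lborel (\<lambda>w. \<eta> w * central_quotient \<tau> v f (x - w)) (central_quotient \<tau> v (conv \<eta> f) x)"
proof -
  note shift = has_bochner_integral_conv_shift[OF assms]
  have base: "has_bochner_integral lborel (\<lambda>w. \<eta> w * f (x - w)) (conv \<eta> f x)"
    using shift[of x 0] by simp
  have "has_bochner_integral lborel (\<lambda>w. (\<eta> w * f (x - w + \<tau> *\<^sub>R v) - \<eta> w * f (x - w)) / \<tau>) (forward_quotient \<tau> v (conv \<eta> f) x)"
    unfolding forward_quotient_def
    by (intro has_bochner_integral_divide_zero has_bochner_integral_diff shift base)
  then show "has_bochner_integral lborel (\<lambda>w. \<eta> w * forward_quotient \<tau> v f (x - w)) (forward_quotient \<tau> v (conv \<eta> f) x)"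
    by (simp add: forward_quotient_def right_diff_distrib)
  have "has_bochner_integral lborel
      (\<lambda>w. (\<eta> w * f (x - w + sqrt \<tau> *\<^sub>R v) + \<eta> w * f (x - w + - (sqrt \<tau> *\<^sub>R v)) - 2 * (\<eta> w * f (x - w))) / (2 * \<tau>))
      ((conv \<eta> f (x + sqrt \<tau> *\<^sub>R v) + conv \<eta> f (x + - (sqrt \<tau> *\<^sub>R v)) - 2 * conv \<eta> f x) / (2 * \<tau>))"
    by (intro has_bochner_integral_divide_zero has_bochner_integral_diff has_bochner_integral_add
        has_bochner_integral_mult_right shift base)
  then show "has_bochner_integral lborel (\<lambda>w. \<eta> w * central_quotient \<tau> v f (x - w)) (central_quotient \<tau> v (conv \<eta> f) x)"
    by (simp add: central_quotient_def distrib_left right_diff_distrib mult.left_commute)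
qed

lemma forward_quotient_consistent:
  fixes g :: "real^'d::finite \<Rightarrow> real"
  assumes "smooth_bounded g" "\<And>is x. length is = 2 \<Longrightarrow> \<bar>iter_partial is g x\<bar> \<le> M" and \<tau>_pos: "0 < \<tau>"
  shows "\<bar>forward_quotient \<tau> v g x - dir_deriv v g x\<bar> \<le> (real CARD('d))\<^sup>2 * (norm v)\<^sup>2 * M * \<tau>"
proof -
  have "\<bar>g (x + \<tau> *\<^sub>R v) - g x - \<tau> * dir_deriv v g x\<bar> / \<tau> \<le> (real CARD('d))\<^sup>2 * (norm v)\<^sup>2 * M * \<tau>"
    using smooth_bounded_taylor2[OF assms(1,2), of x \<tau> v] \<tau>_pos by (simp add: divide_le_eq power2_eq_square mult_ac)
  moreover have "forward_quotient \<tau> v g x - dir_deriv v g x = (g (x + \<tau> *\<^sub>R v) - g x - \<tau> * dir_deriv v g x) / \<tau>"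
    using \<tau>_pos by (simp add: forward_quotient_def diff_divide_distrib)
  ultimately show ?thesis using \<tau>_pos by (simp add: abs_divide)
qed

lemma central_quotient_consistent:
  fixes g :: "real^'d::finite \<Rightarrow> real"
  assumes "smooth_bounded g" "\<And>is x. length is = 3 \<Longrightarrow> \<bar>iter_partial is g x\<bar> \<le> M" and \<tau>_pos: "0 < \<tau>"
  shows "\<bar>central_quotient \<tau> v g x - 1/2 * dir_deriv v (dir_deriv v g) x\<bar> \<le> (real CARD('d))^3 * (norm v)^3 * M * sqrt \<tau>"
proof -
  let ?err = "g (x + sqrt \<tau> *\<^sub>R v) + g (x - sqrt \<tau> *\<^sub>R v) - 2 * g x - \<tau> * dir_deriv v (dir_deriv v g) x"
  let ?bound = "(real CARD('d))^3 * (norm v)^3 * M * sqrt \<tau>"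
  have "\<bar>?err\<bar> \<le> ?bound * \<tau>"
    using smooth_bounded_symmetric_taylor3[OF assms(1,2), of x "sqrt \<tau>" v] \<tau>_pos by (simp add: power3_eq_cube mult_ac)
  moreover from this have "0 \<le> ?bound" using \<tau>_pos zero_le_mult_iff[of ?bound \<tau>] abs_ge_zero order.trans by fastforce
  then have "?bound * \<tau> \<le> ?bound * (2 * \<tau>)" using \<tau>_pos by (intro mult_left_mono) auto
  ultimately have "\<bar>?err\<bar> / (2 * \<tau>) \<le> ?bound" using \<tau>_pos by (simp add: divide_le_eq)
  moreover have "central_quotient \<tau> v g x - 1/2 * dir_deriv v (dir_deriv v g) x = ?err / (2 * \<tau>)"
    using \<tau>_pos by (simp add: central_quotient_def diff_divide_distrib)
  ultimately show ?thesis using \<tau>_pos by (simp add: abs_divide)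
qed

subsection \<open>Functions with quadratically bounded increments\<close>

definition quadratic_increments :: "('a::real_inner \<Rightarrow> real) \<Rightarrow> 'a \<Rightarrow> real \<Rightarrow> bool" where
  "quadratic_increments f x c \<longleftrightarrow> (\<forall>v. f (x + v) - f x \<le> (2 * (x \<bullet> v) + (norm v)\<^sup>2) / c)"

lemma
  assumes quadratic: "quadratic_increments f x c" and \<tau>_pos: "0 < \<tau>"
  shows forward_quotient_quadratic_le: "forward_quotient \<tau> v f x \<le> (2 * (x \<bullet> v) + \<tau> * (norm v)\<^sup>2) / c"
    and central_quotient_quadratic_le: "central_quotient \<tau> v f x \<le> (norm v)\<^sup>2 / c"
proof -
  have inc: "f (x + v) - f x \<le> (2 * (x \<bullet> v) + (norm v)\<^sup>2) / c" for v
    using quadratic by (simp add: quadratic_increments_def)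
  have "f (x + \<tau> *\<^sub>R v) - f x \<le> \<tau> * ((2 * (x \<bullet> v) + \<tau> * (norm v)\<^sup>2) / c)"
    using inc[of "\<tau> *\<^sub>R v"] \<tau>_pos by (simp add: power_mult_distrib power2_eq_square[of \<tau>] distrib_left mult_ac)
  then show "forward_quotient \<tau> v f x \<le> (2 * (x \<bullet> v) + \<tau> * (norm v)\<^sup>2) / c"
    using \<tau>_pos by (simp add: forward_quotient_def divide_le_eq mult.commute)
  have "f (x + sqrt \<tau> *\<^sub>R v) + f (x - sqrt \<tau> *\<^sub>R v) - 2 * f x \<le> 2 * \<tau> * ((norm v)\<^sup>2 / c)"
    using inc[of "sqrt \<tau> *\<^sub>R v"] inc[of "- (sqrt \<tau> *\<^sub>R v)"] \<tau>_pos
    by (simp add: power_mult_distrib add_divide_distrib diff_divide_distrib)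
  then show "central_quotient \<tau> v f x \<le> (norm v)\<^sup>2 / c"
    using \<tau>_pos by (simp add: central_quotient_def divide_le_eq mult.commute)
qed

lemma norm_column_le: "norm (column j (s :: real^'n::finite^'m::finite)) \<le> norm s"
proof -
  have "(norm (column j s))\<^sup>2 \<le> (norm s)\<^sup>2"
    unfolding norm_vec_def L2_set_def column_def
    by (simp add: sum_nonneg) (intro sum_mono member_le_sum, auto)
  then show ?thesis by (simp add: power2_le_iff_abs_le)
qed

lemma sum_norm_column: "(\<Sum>j\<in>UNIV. (norm (column j (s :: real^'n::finite^'m::finite)))\<^sup>2) = (norm s)\<^sup>2"
  unfolding norm_vec_def L2_set_def column_def
  by (simp add: sum_nonneg) (rule sum.swap)

lemma column_diff: "column j (s - t) = column j s - column j (t :: real^'n^'m)"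
  by (simp add: column_def vec_eq_iff)

lemma sum_central_quotient_quadratic_le:
  fixes s :: "real^'d::finite^'d"
  assumes "quadratic_increments f x c" "0 < \<tau>"
  shows "(\<Sum>j\<in>UNIV. central_quotient \<tau> (column j s) f x) \<le> (norm s)\<^sup>2 / c"
proof -
  have "(\<Sum>j\<in>UNIV. central_quotient \<tau> (column j s) f x) \<le> (\<Sum>j\<in>UNIV. (norm (column j s))\<^sup>2 / c)"
    by (intro sum_mono central_quotient_quadratic_le assms)
  then show ?thesis by (simp add: sum_divide_distrib[symmetric] sum_norm_column)
qed

subsection \<open>Coupling of difference operators\<close>

definition increments_dominated ::
  "real \<Rightarrow> ('a::real_vector \<Rightarrow> real) \<Rightarrow> ('a \<Rightarrow> real) \<Rightarrow> real \<Rightarrow> ('a \<Rightarrow> real) \<Rightarrow> ('a \<Rightarrow> real) \<Rightarrow> 'a \<Rightarrow> 'a \<Rightarrow> bool" where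
  "increments_dominated A D V e f f' x z \<longleftrightarrow> (\<forall>p p'.
    (f p - f x) + (f' p' - f' z) \<le> A * (D (p - p') - D (x - z)) + (V p - V x) + (V p' - V z) + e)"

lemma increments_dominatedD:
  "increments_dominated A D V e f f' x z \<Longrightarrow>
    (f p - f x) + (f' p' - f' z) \<le> A * (D (p - p') - D (x - z)) + (V p - V x) + (V p' - V z) + e"
  by (simp add: increments_dominated_def)

lemma increments_dominated_nonneg: "increments_dominated A D V e f f' x z \<Longrightarrow> 0 \<le> e"
  using increments_dominatedD[of A D V e f f' x z x z] by simp

lemma
  assumes dom: "increments_dominated A D V e f f' x z" and \<tau>_pos: "0 < \<tau>"
  shows forward_quotient_coupling: "forward_quotient \<tau> v f x + forward_quotient \<tau> v' f' z \<le>
      A * forward_quotient \<tau> (v - v') D (x - z) + forward_quotient \<tau> v V x + forward_quotient \<tau> v' V z + 1 / \<tau> * e"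
    and central_quotient_coupling: "central_quotient \<tau> v f x + central_quotient \<tau> v' f' z \<le>
      A * central_quotient \<tau> (v - v') D (x - z) + central_quotient \<tau> v V x + central_quotient \<tau> v' V z + 1 / \<tau> * e"
proof -
  have shift: "x + s *\<^sub>R v - (z + s *\<^sub>R v') = x - z + s *\<^sub>R (v - v')" for s by (simp add: algebra_simps)
  have inc: "(f (x + s *\<^sub>R v) - f x) + (f' (z + s *\<^sub>R v') - f' z) \<le>
      A * (D (x - z + s *\<^sub>R (v - v')) - D (x - z)) + (V (x + s *\<^sub>R v) - V x) + (V (z + s *\<^sub>R v') - V z) + e" for s
    using increments_dominatedD[OF dom, of "x + s *\<^sub>R v" "z + s *\<^sub>R v'"] by (simp only: shift)
  from divide_right_mono[OF inc[of \<tau>], of \<tau>] \<tau>_pos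
  show "forward_quotient \<tau> v f x + forward_quotient \<tau> v' f' z \<le>
      A * forward_quotient \<tau> (v - v') D (x - z) + forward_quotient \<tau> v V x + forward_quotient \<tau> v' V z + 1 / \<tau> * e"
    by (simp add: forward_quotient_def add_divide_distrib)
  from divide_right_mono[OF add_mono[OF inc[of "sqrt \<tau>"] inc[of "- sqrt \<tau>"]], of "2 * \<tau>"] \<tau>_pos
  show "central_quotient \<tau> v f x + central_quotient \<tau> v' f' z \<le>
      A * central_quotient \<tau> (v - v') D (x - z) + central_quotient \<tau> v V x + central_quotient \<tau> v' V z + 1 / \<tau> * e"
    by (simp add: central_quotient_def add_divide_distrib diff_divide_distrib algebra_simps)
qed

lemma (in levy_pair) jump_op_coupling:
  assumes dom: "increments_dominated A D V e f f' x z" and A_nonneg: "0 \<le> A" and r_pos: "0 < r"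
    and lip: "\<And>v w. D (v + w) \<le> D v + norm w"
    and f_bounded: "f \<in> borel_measurable borel" "\<And>x. \<bar>f x\<bar> \<le> M"
    and f'_bounded: "f' \<in> borel_measurable borel" "\<And>x. \<bar>f' x\<bar> \<le> M"
    and V_bounded: "V \<in> borel_measurable borel" "\<And>x. \<bar>V x\<bar> \<le> M"
  shows "jump_op r \<mu> f x + jump_op r \<mu>' f' z
    \<le> A * c + jump_op r \<mu> V x + jump_op r \<mu>' V z + 2 * tail_bound C r * e"
proof -
  have e_nonneg: "0 \<le> e" by (rule increments_dominated_nonneg[OF dom])
  let ?i = "\<lambda>u::'a. indicator {u. r \<le> norm u} u :: real"
  let ?X = "\<lambda>u. ?i u * (f (x + u) - f x)" and ?Y = "\<lambda>u. ?i u * (f' (z + u) - f' z)"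
  let ?v = "\<lambda>u. ?i u * (V (x + u) - V x) + ?i u * e" and ?w = "\<lambda>u. ?i u * (V (z + u) - V z) + ?i u * e"
  note int = first.jump_op_integrable[OF r_pos f_bounded] second.jump_op_integrable[OF r_pos f'_bounded]
    first.jump_op_integrable[OF r_pos V_bounded] second.jump_op_integrable[OF r_pos V_bounded]
    first.tail_mass_integrable[OF r_pos] second.tail_mass_integrable[OF r_pos]
  have "A * (D (x - z + u) - D (x - z)) \<le> A * norm u" for u using lip[of "x - z" u] A_nonneg
    by (intro mult_left_mono) auto
  note slope = this this[of "- _", unfolded norm_minus_cancel]
  have "?X u \<le> A * norm u + ?v u" "?Y u \<le> A * norm u + ?w u" "?X u + ?Y u \<le> ?v u + ?w u" for u
    using increments_dominatedD[OF dom, of "x + u" z] increments_dominatedD[OF dom, of x "z + u"]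
      increments_dominatedD[OF dom, of "x + u" "z + u"] slope[of u] A_nonneg e_nonneg
    by (auto simp: indicator_def algebra_simps)
  then have "(\<integral>u. ?X u \<partial>\<mu>) + (\<integral>u. ?Y u \<partial>\<mu>') \<le> A * c + (\<integral>u. ?v u \<partial>\<mu>) + (\<integral>u. ?w u \<partial>\<mu>')"
    using int A_nonneg by (intro coupled_integral_le) auto
  also have "(\<integral>u. ?v u \<partial>\<mu>) = jump_op r \<mu> V x + tail_mass r \<mu> * e"
    using int by (simp add: jump_op_def tail_mass_def)
  also have "(\<integral>u. ?w u \<partial>\<mu>') = jump_op r \<mu>' V z + tail_mass r \<mu>' * e"
    using int by (simp add: jump_op_def tail_mass_def)
  finally have "jump_op r \<mu> f x + jump_op r \<mu>' f' z \<le>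
      A * c + jump_op r \<mu> V x + jump_op r \<mu>' V z + (tail_mass r \<mu> * e + tail_mass r \<mu>' * e)"
    by (simp add: jump_op_def)
  moreover have "tail_mass r \<mu> * e \<le> tail_bound C r * e" "tail_mass r \<mu>' * e \<le> tail_bound C r * e"
    using first.tail_mass_le[OF r_pos] second.tail_mass_le[OF r_pos] e_nonneg by (intro mult_right_mono; simp)+
  ultimately show ?thesis by simp
qed

section \<open>The parts of the generator\<close>

definition diffusion_op :: "real^'d^'d \<Rightarrow> (real^'d::finite \<Rightarrow> real) \<Rightarrow> real^'d \<Rightarrow> real" where
  "diffusion_op s g x = (\<Sum>j\<in>UNIV. dir_deriv (column j s) (dir_deriv (column j s) g) x)"

lemma trace_mult_hess:
  assumes "smooth_bounded g"
  shows "trace ((s ** transpose s) ** hess g x) = diffusion_op s g x"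
proof -
  have "trace ((s ** transpose s) ** hess g x)
    = (\<Sum>i\<in>UNIV. \<Sum>l\<in>UNIV. \<Sum>j\<in>UNIV. s $ i $ j * s $ l $ j * partial_dir l (partial_dir i g) x)"
    by (simp add: trace_def matrix_matrix_mult_def transpose_def hess_def sum_distrib_right)
  also have "\<dots> = (\<Sum>l\<in>UNIV. \<Sum>i\<in>UNIV. \<Sum>j\<in>UNIV. s $ i $ j * s $ l $ j * partial_dir l (partial_dir i g) x)"
    by (rule sum.swap)
  also have "\<dots> = (\<Sum>l\<in>UNIV. \<Sum>j\<in>UNIV. \<Sum>i\<in>UNIV. s $ i $ j * s $ l $ j * partial_dir l (partial_dir i g) x)"
    by (intro sum.cong refl sum.swap)
  also have "\<dots> = (\<Sum>j\<in>UNIV. \<Sum>l\<in>UNIV. \<Sum>i\<in>UNIV. s $ i $ j * s $ l $ j * partial_dir l (partial_dir i g) x)"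
    by (rule sum.swap)
  finally show ?thesis
    by (simp add: diffusion_op_def dir_deriv_twice[OF assms] column_def sum_distrib_left mult_ac)
qed

lemma dir_deriv_eq_0:
  assumes "open S" "\<And>x. x \<in> S \<Longrightarrow> g x = 0" "x \<in> S"
  shows "dir_deriv v g x = 0"
proof -
  have "iter_partial [i] g x = 0" for i by (rule iter_partial_eq_0[OF assms])
  then show ?thesis by (simp add: dir_deriv_eq_sum)
qed

lemma diffusion_op_eq_0:
  assumes "open S" "\<And>x. x \<in> S \<Longrightarrow> g x = 0" "x \<in> S"
  shows "diffusion_op s g x = 0"
  unfolding diffusion_op_def
  by (intro sum.neutral ballI dir_deriv_eq_0[OF assms(1) dir_deriv_eq_0[OF assms(1,2)] assms(3)])

lemma abs_diffusion_op_le: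
  fixes g :: "real^'d::finite \<Rightarrow> real"
  assumes g_smooth: "smooth_bounded g" and partials_le: "\<And>is x. length is = 2 \<Longrightarrow> \<bar>iter_partial is g x\<bar> \<le> M"
  shows "\<bar>diffusion_op s g x\<bar> \<le> (real CARD('d))^3 * (norm s)\<^sup>2 * M"
proof -
  have "0 \<le> M" using partials_le[of "[undefined, undefined]" undefined] by force
  have "\<bar>dir_deriv (column j s) (dir_deriv (column j s) g) x\<bar> \<le> (real CARD('d) * norm s)\<^sup>2 * M" for j
  proof -
    have "\<bar>(dir_deriv (column j s) ^^ 2) g x\<bar> \<le> (real CARD('d) * norm (column j s))\<^sup>2 * M"
      by (rule abs_dir_deriv_iterate_le[OF g_smooth partials_le])
    also have "\<dots> \<le> (real CARD('d) * norm s)\<^sup>2 * M"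
      using norm_column_le \<open>0 \<le> M\<close> by (intro mult_right_mono power_mono mult_left_mono) auto
    finally show ?thesis by (simp add: numeral_2_eq_2)
  qed
  then have "\<bar>diffusion_op s g x\<bar> \<le> (\<Sum>j\<in>(UNIV::'d set). (real CARD('d) * norm s)\<^sup>2 * M)"
    unfolding diffusion_op_def by (intro order.trans[OF sum_abs] sum_mono)
  then show ?thesis by (simp add: power_mult_distrib power2_eq_square power3_eq_cube mult_ac)
qed

lemma diffusion_op_consistent:
  fixes g :: "real^'d::finite \<Rightarrow> real"
  assumes g_smooth: "smooth_bounded g" and partials_le: "\<And>is x. length is = 3 \<Longrightarrow> \<bar>iter_partial is g x\<bar> \<le> M"
    and \<tau>_pos: "0 < \<tau>"
  shows "\<bar>(\<Sum>j\<in>UNIV. central_quotient \<tau> (column j s) g x) - 1/2 * diffusion_op s g x\<bar>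
    \<le> (real CARD('d))^4 * (norm s)^3 * M * sqrt \<tau>"
proof -
  have "0 \<le> M" using partials_le[of "[undefined, undefined, undefined]" undefined] by force
  let ?err = "\<lambda>j. central_quotient \<tau> (column j s) g x - 1/2 * dir_deriv (column j s) (dir_deriv (column j s) g) x"
  have "\<bar>?err j\<bar> \<le> (real CARD('d))^3 * (norm s)^3 * M * sqrt \<tau>" for j
  proof -
    have "\<bar>?err j\<bar> \<le> (real CARD('d))^3 * (norm (column j s))^3 * M * sqrt \<tau>"
      by (rule central_quotient_consistent[OF g_smooth partials_le \<tau>_pos])
    also have "\<dots> \<le> (real CARD('d))^3 * (norm s)^3 * M * sqrt \<tau>"
      using norm_column_le \<open>0 \<le> M\<close> \<tau>_pos by (intro mult_right_mono mult_left_mono power_mono) auto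
    finally show ?thesis .
  qed
  then have "\<bar>\<Sum>j\<in>UNIV. ?err j\<bar> \<le> (\<Sum>j\<in>(UNIV::'d set). (real CARD('d))^3 * (norm s)^3 * M * sqrt \<tau>)"
    by (intro order.trans[OF sum_abs] sum_mono)
  then show ?thesis
    by (simp add: diffusion_op_def sum_subtractf sum_divide_distrib power4_eq_xxxx power3_eq_cube mult_ac)
qed

definition jump_part :: "real \<Rightarrow> (real^'d::finite \<Rightarrow> real) \<Rightarrow> real^'d \<Rightarrow> real^'d \<Rightarrow> real" where
  "jump_part \<epsilon> g x u = g (x + u) - g x - (grad g x \<bullet> u) * indicator (ball 0 \<epsilon>) u"

definition jump_const :: "real \<Rightarrow> real \<Rightarrow> real" where
  "jump_const d \<epsilon> = d\<^sup>2 * max 1 (\<epsilon>\<^sup>2) + 2 / min 1 (\<epsilon>\<^sup>2)"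

lemma abs_jump_part_le_norm_sq:
  fixes g :: "real^'d::finite \<Rightarrow> real"
  assumes "smooth_bounded g" "\<And>is x. length is = 2 \<Longrightarrow> \<bar>iter_partial is g x\<bar> \<le> M" "norm u < \<epsilon>"
  shows "\<bar>jump_part \<epsilon> g x u\<bar> \<le> (real CARD('d))\<^sup>2 * M * (norm u)\<^sup>2"
  using smooth_bounded_taylor2[OF assms(1,2), of x 1 u] assms(3)
  by (simp add: jump_part_def dir_deriv_def inner_commute mult_ac)

lemma abs_jump_part_le:
  fixes g :: "real^'d::finite \<Rightarrow> real"
  assumes g_smooth: "smooth_bounded g" and partials_le: "\<And>is x. length is \<le> 2 \<Longrightarrow> \<bar>iter_partial is g x\<bar> \<le> M"
    and \<epsilon>_pos: "0 < \<epsilon>"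
  shows "\<bar>jump_part \<epsilon> g x u\<bar> \<le> jump_const (real CARD('d)) \<epsilon> * M * trunc_sq u"
proof -
  have g_le: "\<bar>g x\<bar> \<le> M" for x using partials_le[of "[]"] by simp
  then have "0 \<le> M" using abs_ge_zero order.trans by blast
  show ?thesis
  proof (cases "norm u < \<epsilon>")
    case True
    have "\<bar>jump_part \<epsilon> g x u\<bar> \<le> (real CARD('d))\<^sup>2 * M * (norm u)\<^sup>2"
      using True by (intro abs_jump_part_le_norm_sq g_smooth partials_le) auto
    also have "(norm u)\<^sup>2 \<le> max 1 (\<epsilon>\<^sup>2) * trunc_sq u"
    proof -
      have "(norm u)\<^sup>2 \<le> \<epsilon>\<^sup>2" using True by (intro power_mono) auto
      moreover have "1 * (norm u)\<^sup>2 \<le> max 1 (\<epsilon>\<^sup>2) * (norm u)\<^sup>2" by (intro mult_right_mono) auto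
      ultimately show ?thesis by (auto simp: min_def)
    qed
    also have "(real CARD('d))\<^sup>2 * M * (max 1 (\<epsilon>\<^sup>2) * trunc_sq u) \<le> jump_const (real CARD('d)) \<epsilon> * M * trunc_sq u"
      using \<open>0 \<le> M\<close> \<epsilon>_pos by (simp add: jump_const_def algebra_simps)
    finally show ?thesis using \<open>0 \<le> M\<close> by (simp add: mult_left_mono)
  next
    case False
    then have "\<bar>jump_part \<epsilon> g x u\<bar> \<le> 2 * M" using g_le[of "x + u"] g_le[of x] by (simp add: jump_part_def)
    also have "\<dots> = 2 / min 1 (\<epsilon>\<^sup>2) * M * min 1 (\<epsilon>\<^sup>2)" using \<epsilon>_pos by (simp add: min_def)
    also have "\<dots> \<le> 2 / min 1 (\<epsilon>\<^sup>2) * M * trunc_sq u"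
      using trunc_sq_ge[OF \<epsilon>_pos, of u] False \<open>0 \<le> M\<close> \<epsilon>_pos by (intro mult_left_mono) auto
    also have "\<dots> \<le> jump_const (real CARD('d)) \<epsilon> * M * trunc_sq u"
      using \<open>0 \<le> M\<close> by (intro mult_right_mono) (auto simp: jump_const_def)
    finally show ?thesis .
  qed
qed

lemma borel_measurable_grad_inner:
  fixes g :: "real^'d::finite \<Rightarrow> real" and v :: "'a::topological_space \<Rightarrow> real^'d"
  assumes g_smooth: "smooth_bounded g" and [measurable]: "v \<in> borel_measurable M" "p \<in> borel_measurable M"
  shows "(\<lambda>x. grad g (p x) \<bullet> v x) \<in> borel_measurable M"
proof -
  have [measurable]: "partial_dir i g \<in> borel_measurable borel" for i
    using smooth_bounded_measurable[OF smooth_bounded_iter_partial[OF g_smooth, of "[i]"]] by simp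
  have [measurable]: "(\<lambda>x :: real^'d. x $ i) \<in> borel_measurable borel" for i
    by (intro borel_measurable_continuous_onI continuous_on_component continuous_on_id)
  show ?thesis by (simp add: inner_vec_def grad_def) measurable
qed

lemma
  assumes g_smooth: "smooth_bounded g"
  shows borel_measurable_jump_part_pair: "(\<lambda>(x, u). jump_part \<epsilon> g x u) \<in> borel_measurable (borel \<Otimes>\<^sub>M borel)"
    and borel_measurable_jump_part: "jump_part \<epsilon> g x \<in> borel_measurable borel"
proof -
  have [measurable]: "g \<in> borel_measurable borel" by (rule smooth_bounded_measurable[OF g_smooth])
  have ball: "indicator (ball 0 \<epsilon>) \<in> borel_measurable (borel :: (real^'a) measure)"
    by (intro borel_measurable_indicator borel_open open_ball)
  show pair: "(\<lambda>(x, u). jump_part \<epsilon> g x u) \<in> borel_measurable (borel \<Otimes>\<^sub>M borel)"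
    unfolding jump_part_def case_prod_beta
    by (intro borel_measurable_diff borel_measurable_times borel_measurable_grad_inner g_smooth
        measurable_compose[OF measurable_snd ball]) measurable
  show "jump_part \<epsilon> g x \<in> borel_measurable borel" using measurable_compose_Pair1[OF _ pair, of x] by simp
qed

lemma
  fixes g :: "real^'d::finite \<Rightarrow> real"
  assumes "levy_measure \<mu> C" and \<epsilon>_pos: "0 < \<epsilon>" and g_smooth: "smooth_bounded g"
    and partials_le: "\<And>is x. length is \<le> 2 \<Longrightarrow> \<bar>iter_partial is g x\<bar> \<le> M"
  shows integrable_jump_part: "integrable \<mu> (jump_part \<epsilon> g x)"
    and abs_integral_jump_part_le: "\<bar>\<integral>u. jump_part \<epsilon> g x u \<partial>\<mu>\<bar> \<le> jump_const (real CARD('d)) \<epsilon> * M * C"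
proof -
  interpret levy_measure \<mu> C by fact
  have bound: "norm (jump_part \<epsilon> g x u) \<le> jump_const (real CARD('d)) \<epsilon> * M * trunc_sq u" for u
    using abs_jump_part_le[OF g_smooth partials_le \<epsilon>_pos] by simp
  from integrable_trunc_sq_bound[OF borel_measurable_jump_part[OF g_smooth] this]
    norm_integral_trunc_sq_bound[OF borel_measurable_jump_part[OF g_smooth] this]
  show "integrable \<mu> (jump_part \<epsilon> g x)" "\<bar>\<integral>u. jump_part \<epsilon> g x u \<partial>\<mu>\<bar> \<le> jump_const (real CARD('d)) \<epsilon> * M * C" by auto
qed

lemma integral_jump_part_split:
  fixes g :: "real^'d::finite \<Rightarrow> real"
  assumes levy: "levy_measure \<mu> C" and r_bounds: "0 < r" "r \<le> \<epsilon>" and g_smooth: "smooth_bounded g"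
  shows "(\<integral>u. jump_part \<epsilon> g x u \<partial>\<mu>) = (\<integral>u. indicator {u. norm u < r} u * jump_part \<epsilon> g x u \<partial>\<mu>)
    + jump_op r \<mu> g x - dir_deriv (compensator r \<epsilon> \<mu>) g x"
proof -
  interpret levy_measure \<mu> C by fact
  obtain M where partials_le: "\<And>is x. length is \<le> 2 \<Longrightarrow> \<bar>iter_partial is g x\<bar> \<le> M"
    using smooth_bounded_uniform_bound[OF g_smooth] by blast
  have bound: "\<bar>g x\<bar> \<le> M" for x using partials_le[of "[]"] by simp
  let ?small = "\<lambda>u. indicator {u. norm u < r} u * jump_part \<epsilon> g x u"
  let ?large = "\<lambda>u. indicator {u. r \<le> norm u} u * (g (x + u) - g x)"
  let ?comp = "\<lambda>u. grad g x \<bullet> (indicator {u. r \<le> norm u \<and> norm u < \<epsilon>} u *\<^sub>R u)"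
  have "integrable \<mu> ?small"
  proof (rule Bochner_Integration.integrable_bound)
    show "integrable \<mu> (jump_part \<epsilon> g x)" using r_bounds
      by (intro integrable_jump_part[OF levy _ g_smooth partials_le]) auto
    then show "?small \<in> borel_measurable \<mu>" by measurable
  qed (auto intro!: AE_I2 simp: indicator_def)
  moreover have "integrable \<mu> ?large"
    by (rule jump_op_integrable[OF r_bounds(1) smooth_bounded_measurable[OF g_smooth] bound])
  moreover have comp: "integrable \<mu> (\<lambda>u. indicator {u. r \<le> norm u \<and> norm u < \<epsilon>} u *\<^sub>R u)"
    using r_bounds by (intro compensator_integrable) auto
  note integrable_inner_right[OF comp, of "grad g x"]
  moreover have "(\<integral>u. jump_part \<epsilon> g x u \<partial>\<mu>) = (\<integral>u. ?small u + ?large u - ?comp u \<partial>\<mu>)"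
    by (intro Bochner_Integration.integral_cong refl) (use r_bounds in \<open>auto simp: jump_part_def indicator_def\<close>)
  ultimately have "(\<integral>u. jump_part \<epsilon> g x u \<partial>\<mu>) = (\<integral>u. ?small u \<partial>\<mu>) + (\<integral>u. ?large u \<partial>\<mu>) - (\<integral>u. ?comp u \<partial>\<mu>)"
    by (simp del: inner_scaleR_right)
  also have "(\<integral>u. ?comp u \<partial>\<mu>) = dir_deriv (compensator r \<epsilon> \<mu>) g x"
    using integral_inner_right[OF comp, of "grad g x"] by (simp add: compensator_def dir_deriv_def inner_commute)
  finally show ?thesis by (simp add: jump_op_def)
qed

lemma abs_integral_small_jump_part_le:
  fixes g :: "real^'d::finite \<Rightarrow> real"
  assumes "levy_measure \<mu> C" and "r \<le> \<epsilon>" and g_smooth: "smooth_bounded g"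
    and partials_le: "\<And>is x. length is \<le> 2 \<Longrightarrow> \<bar>iter_partial is g x\<bar> \<le> M"
  shows "\<bar>\<integral>u. indicator {u. norm u < r} u * jump_part \<epsilon> g x u \<partial>\<mu>\<bar> \<le> (real CARD('d))\<^sup>2 * M * small_jumps r \<mu>"
proof -
  interpret levy_measure \<mu> C by fact
  let ?small = "\<lambda>u. indicator {u. norm u < r} u * jump_part \<epsilon> g x u"
  let ?sq = "\<lambda>u. (real CARD('d))\<^sup>2 * M * (indicator {u. norm u < r} u * (norm u)\<^sup>2)"
  have small_le_sq: "\<bar>?small u\<bar> \<le> ?sq u" for u
    using abs_jump_part_le_norm_sq[OF g_smooth partials_le, of u \<epsilon> x] assms(2) by (auto simp: indicator_def)
  have sq_integrable: "integrable \<mu> ?sq" by (intro integrable_mult_right small_jumps_integrable)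
  have "integrable \<mu> ?small"
    by (rule Bochner_Integration.integrable_bound[OF sq_integrable])
      (use borel_measurable_jump_part[OF g_smooth] order.trans[OF small_le_sq abs_ge_self] in \<open>auto intro!: AE_I2\<close>)
  then have "\<bar>\<integral>u. ?small u \<partial>\<mu>\<bar> \<le> (\<integral>u. ?sq u \<partial>\<mu>)"
    by (intro order.trans[OF integral_abs_bound] integral_mono integrable_abs sq_integrable small_le_sq)
  then show ?thesis by (simp add: small_jumps_def)
qed

section \<open>Regime-switching generators\<close>

lemma finite_common_bound:
  assumes "finite K" "\<And>k. k \<in> K \<Longrightarrow> \<exists>B. P k B" "\<And>k B B'. P k B \<Longrightarrow> B \<le> B' \<Longrightarrow> P k B'"
  obtains B :: real where "0 \<le> B" "\<And>k. k \<in> K \<Longrightarrow> P k B"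
proof -
  obtain B where bound_at: "\<And>k. k \<in> K \<Longrightarrow> P k (B k)" using assms(2) by metis
  have "B k \<le> (\<Sum>k\<in>K. \<bar>B k\<bar>)" if "k \<in> K" for k
    using member_le_sum[OF that, of "\<lambda>k. \<bar>B k\<bar>"] assms(1) by simp
  from assms(3)[OF bound_at this] show ?thesis
    by (intro that[of "\<Sum>k\<in>K. \<bar>B k\<bar>"]) (auto intro: sum_nonneg)
qed

lemma borel_measurable_pair_countable:
  fixes h :: "'c::{countable, t2_space, second_countable_topology} \<Rightarrow> 'a::second_countable_topology \<Rightarrow> 'b::topological_space"
  assumes "\<And>k. h k \<in> borel_measurable borel"
  shows "(\<lambda>(x, k). h k x) \<in> borel_measurable borel"
proof -
  have fst: "fst \<in> borel_measurable (borel :: ('a \<times> 'c) measure)"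
    by (intro borel_measurable_continuous_onI continuous_on_fst continuous_on_id)
  have snd: "snd \<in> borel_measurable (borel :: ('a \<times> 'c) measure)"
    by (intro borel_measurable_continuous_onI continuous_on_snd continuous_on_id)
  have "sets (borel :: 'c measure) = sets (count_space UNIV)" by (simp add: sets_borel_eq_count_space)
  from measurable_cong_sets[OF refl this] snd have "snd \<in> (borel :: ('a \<times> 'c) measure) \<rightarrow>\<^sub>M count_space UNIV"
    by blast
  then have "(\<lambda>p. h (snd p) (fst p)) \<in> borel_measurable borel"
    by (rule measurable_compose_countable[where f="\<lambda>k p. h k (fst p)", rotated])
      (rule measurable_compose[OF fst assms])
  then show ?thesis by (simp add: case_prod_beta)
qed

locale switching = osgood_modulus \<rho>
  for \<rho> :: "real \<Rightarrow> real" +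
  fixes n0 :: nat and \<epsilon>0 H C\<nu> qmax :: real
    and a \<sigma> :: "real^'d::finite \<Rightarrow> nat \<Rightarrow> real^'d^'d"
    and b :: "real^'d \<Rightarrow> nat \<Rightarrow> real^'d"
    and \<nu> :: "real^'d \<Rightarrow> nat \<Rightarrow> (real^'d) measure"
    and q :: "real^'d \<Rightarrow> nat \<Rightarrow> nat \<Rightarrow> real"
  assumes eps0_pos: "0 < \<epsilon>0" and H_pos: "0 < H" and Cnu_nonneg: "0 \<le> C\<nu>" and qmax_nonneg: "0 \<le> qmax"
    and a_measurable: "k \<in> {1..n0} \<Longrightarrow> (\<lambda>x. a x k) \<in> borel_measurable borel"
    and b_measurable: "k \<in> {1..n0} \<Longrightarrow> (\<lambda>x. b x k) \<in> borel_measurable borel"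
    and nu_sets: "k \<in> {1..n0} \<Longrightarrow> sets (\<nu> x k) = sets borel"
    and nu_sigma_finite: "k \<in> {1..n0} \<Longrightarrow> sigma_finite_measure (\<nu> x k)"
    and nu_measurable: "k \<in> {1..n0} \<Longrightarrow> A \<in> sets borel \<Longrightarrow> (\<lambda>x. emeasure (\<nu> x k) A) \<in> borel_measurable borel"
    and nu_trunc_sq: "k \<in> {1..n0} \<Longrightarrow> (\<integral>\<^sup>+u. ennreal (trunc_sq u) \<partial>\<nu> x k) \<le> ennreal C\<nu>"
    and q_measurable: "k \<in> {1..n0} \<Longrightarrow> l \<in> {1..n0} \<Longrightarrow> (\<lambda>x. q x k l) \<in> borel_measurable borel"
    and q_nonneg: "k \<in> {1..n0} \<Longrightarrow> l \<in> {1..n0} \<Longrightarrow> k \<noteq> l \<Longrightarrow> 0 \<le> q x k l"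
    and q_bound: "k \<in> {1..n0} \<Longrightarrow> l \<in> {1..n0} \<Longrightarrow> \<bar>q x k l\<bar> \<le> qmax"
    and sigma: "k \<in> {1..n0} \<Longrightarrow> \<sigma> x k ** transpose (\<sigma> x k) = a x k"
    and one_sided: "k \<in> {1..n0} \<Longrightarrow> (norm (\<sigma> x k - \<sigma> z k))\<^sup>2 + 2 * ((x - z) \<bullet> (b x k - b z k))
      \<le> H * norm (x - z) * \<rho> (norm (x - z))"
    and nu_tv: "k \<in> {1..n0} \<Longrightarrow>
      tv_nn_integral (\<lambda>u. ennreal (norm u)) (\<nu> x k) (\<nu> z k) \<le> ennreal (H * \<rho> (norm (x - z)))"
    and q_lipschitz: "k \<in> {1..n0} \<Longrightarrow> l \<in> {1..n0} \<Longrightarrow> k \<noteq> l \<Longrightarrow> \<bar>q x k l - q z k l\<bar> \<le> H * norm (x - z)"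
begin

lemma levy_measure_nu: "k \<in> {1..n0} \<Longrightarrow> levy_measure (\<nu> x k) C\<nu>"
  by (intro levy_measure.intro nu_sigma_finite levy_measure_axioms.intro nu_sets Cnu_nonneg nu_trunc_sq)

lemma levy_kernel_nu: "k \<in> {1..n0} \<Longrightarrow> levy_kernel (\<lambda>x. \<nu> x k) C\<nu>"
  by (intro levy_kernel.intro levy_measure_nu nu_measurable)

lemma levy_pair_nu: "k \<in> {1..n0} \<Longrightarrow> levy_pair (\<nu> x k) (\<nu> z k) C\<nu> (H * \<rho> (norm (x - z)))"
  using H_pos rho_nonneg[of "norm (x - z)"]
  by (intro levy_pair.intro levy_measure_nu levy_pair_axioms.intro nu_tv) auto

lemma coefficients: "k \<in> {1..n0} \<Longrightarrow> one_sided_coefficients \<rho> H (\<lambda>x. \<sigma> x k) (\<lambda>x. b x k)"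
  by (intro one_sided_coefficients.intro concave_modulus_axioms one_sided_coefficients_axioms.intro H_pos one_sided)

lemma coefficients_locally_bounded:
  obtains B where "0 \<le> B" "\<And>k x. k \<in> {1..n0} \<Longrightarrow> norm x \<le> R \<Longrightarrow> norm (b x k) \<le> B \<and> norm (\<sigma> x k) \<le> B"
proof -
  obtain B where "0 \<le> B" "\<And>k. k \<in> {1..n0} \<Longrightarrow> \<forall>x. norm x \<le> R \<longrightarrow> norm (b x k) \<le> B \<and> norm (\<sigma> x k) \<le> B"
  proof (rule finite_common_bound[OF finite_atLeastAtMost])
    show "\<exists>B. \<forall>x. norm x \<le> R \<longrightarrow> norm (b x k) \<le> B \<and> norm (\<sigma> x k) \<le> B" if "k \<in> {1..n0}" for k
      using one_sided_coefficients.locally_bounded[OF coefficients[OF that], of R] by metis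
  qed (force, rule that)
  then show ?thesis using that by blast
qed

lemma coefficients_quadratic_growth:
  obtains C where "0 \<le> C" "\<And>k y. k \<in> {1..n0} \<Longrightarrow> 2 * (y \<bullet> b y k) + (norm (\<sigma> y k))\<^sup>2 \<le> C * (1 + (norm y)\<^sup>2)"
proof -
  obtain C where "0 \<le> C" "\<And>k. k \<in> {1..n0} \<Longrightarrow> \<forall>y. 2 * (y \<bullet> b y k) + (norm (\<sigma> y k))\<^sup>2 \<le> C * (1 + (norm y)\<^sup>2)"
  proof (rule finite_common_bound[OF finite_atLeastAtMost])
    show "\<exists>C. \<forall>y. 2 * (y \<bullet> b y k) + (norm (\<sigma> y k))\<^sup>2 \<le> C * (1 + (norm y)\<^sup>2)" if "k \<in> {1..n0}" for k
      using one_sided_coefficients.quadratic_growth[OF coefficients[OF that]] by metis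
    show "\<forall>y. 2 * (y \<bullet> b y k) + (norm (\<sigma> y k))\<^sup>2 \<le> C' * (1 + (norm y)\<^sup>2)"
      if "\<forall>y. 2 * (y \<bullet> b y k) + (norm (\<sigma> y k))\<^sup>2 \<le> C * (1 + (norm y)\<^sup>2)" "C \<le> C'" for k C C'
      using that mult_right_mono[OF that(2)] by (meson add_nonneg_nonneg order.trans zero_le_one zero_le_power2)
  qed (rule that)
  then show ?thesis using that by blast
qed

lemma eventually_small_jumps_le:
  assumes "0 < \<kappa>"
  shows "\<forall>\<^sub>F r in at_right 0. \<forall>k\<in>{1..n0}. \<forall>x. norm x \<le> R \<longrightarrow> small_jumps r (\<nu> x k) \<le> \<kappa>"
proof -
  have "\<forall>\<^sub>F n in sequentially. \<forall>k\<in>{1..n0}. small_jumps (1 / real (Suc n)) (\<nu> 0 k) < \<kappa> / 2"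
    using order_tendstoD(2)[OF levy_measure.small_jumps_tendsto_0[OF levy_measure_nu], of _ "\<kappa> / 2" 0] assms
    by (intro eventually_ball_finite) auto
  moreover have "(\<lambda>n. 1 / real (Suc n) * (H * \<rho> \<bar>R\<bar>)) \<longlonglongrightarrow> 0 * (H * \<rho> \<bar>R\<bar>)"
    by (intro tendsto_intros LIMSEQ_Suc[OF lim_1_over_n])
  then have "\<forall>\<^sub>F n in sequentially. 1 / real (Suc n) * (H * \<rho> \<bar>R\<bar>) < \<kappa> / 2"
    by (rule order_tendstoD(2)) (use assms in simp)
  ultimately have "\<forall>\<^sub>F n in sequentially. (\<forall>k\<in>{1..n0}. small_jumps (1 / real (Suc n)) (\<nu> 0 k) < \<kappa> / 2) \<and>
      1 / real (Suc n) * (H * \<rho> \<bar>R\<bar>) < \<kappa> / 2" by (rule eventually_conj)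
  then obtain n where n_large: "\<And>k. k \<in> {1..n0} \<Longrightarrow> small_jumps (1 / real (Suc n)) (\<nu> 0 k) < \<kappa> / 2"
    "1 / real (Suc n) * (H * \<rho> \<bar>R\<bar>) < \<kappa> / 2" using eventually_happens by fastforce
  have "small_jumps r (\<nu> x k) \<le> \<kappa>" if k_regime: "k \<in> {1..n0}" and "norm x \<le> R" "r < 1 / real (Suc n)" for r x k
  proof -
    have "small_jumps r (\<nu> x k) \<le> small_jumps (1 / real (Suc n)) (\<nu> x k)"
      using that by (intro levy_measure.small_jumps_mono[OF levy_measure_nu]) auto
    also have "\<dots> \<le> small_jumps (1 / real (Suc n)) (\<nu> 0 k) + 1 / real (Suc n) * (H * \<rho> (norm x))"
      using levy_pair.small_jumps_diff_le[OF levy_pair_nu[OF k_regime], of "1 / real (Suc n)" x 0] by simp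
    also have "1 / real (Suc n) * (H * \<rho> (norm x)) \<le> 1 / real (Suc n) * (H * \<rho> \<bar>R\<bar>)"
      using that(2) H_pos by (intro mult_left_mono rho_le) auto
    finally show ?thesis using n_large(1)[OF k_regime] n_large(2) by linarith
  qed
  moreover have "\<forall>\<^sub>F r in at_right (0::real). r < 1 / real (Suc n)"
    by (rule eventually_at_rightI[of 0 "1 / real (Suc n)"]) auto
  ultimately show ?thesis by (auto elim: eventually_mono)
qed

lemma eventually_tail_mass_less:
  assumes "0 < \<kappa>"
  shows "\<forall>\<^sub>F n in sequentially. \<forall>k\<in>{1..n0}. tail_mass (real (Suc n)) (\<nu> x k) < \<kappa>"
  using order_tendstoD(2)[OF levy_measure.tail_mass_tendsto_0[OF levy_measure_nu]] assms
  by (intro eventually_ball_finite) auto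

text \<open>Regimes outside \<open>{1..n0}\<close> do not occur, so the value there is irrelevant.\<close>
definition joint :: "(nat \<Rightarrow> real^'d \<Rightarrow> real) \<Rightarrow> (real^'d) \<times> nat \<Rightarrow> real" where
  "joint g = (\<lambda>(x, k). if k \<in> {1..n0} then g k x else 0)"

lemma joint_apply: "k \<in> {1..n0} \<Longrightarrow> joint g (x, k) = g k x"
  by (simp add: joint_def)

lemma joint_measurable:
  assumes "\<And>k. k \<in> {1..n0} \<Longrightarrow> g k \<in> borel_measurable borel"
  shows "joint g \<in> borel_measurable borel"
  unfolding joint_def
proof (rule borel_measurable_pair_countable)
  show "(\<lambda>x. if k \<in> {1..n0} then g k x else 0) \<in> borel_measurable borel" for k
    using assms[of k] by (cases "k \<in> {1..n0}") (auto simp del: atLeastAtMost_iff)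
qed

definition bounded_test :: "real \<Rightarrow> real \<Rightarrow> (nat \<Rightarrow> real^'d \<Rightarrow> real) \<Rightarrow> bool" where
  "bounded_test M R Z \<longleftrightarrow> (\<forall>k\<in>{1..n0}. smooth_bounded (Z k) \<and>
    (\<forall>is x. length is \<le> 3 \<longrightarrow> \<bar>iter_partial is (Z k) x\<bar> \<le> M) \<and> (\<forall>x. x \<notin> cball 0 R \<longrightarrow> Z k x = 0))"

lemma bounded_testD:
  assumes "bounded_test M R Z" "k \<in> {1..n0}"
  shows "smooth_bounded (Z k)" "length is \<le> 3 \<Longrightarrow> \<bar>iter_partial is (Z k) x\<bar> \<le> M"
    "x \<notin> cball 0 R \<Longrightarrow> Z k x = 0" "\<bar>Z k x\<bar> \<le> M" "0 \<le> M"
proof -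
  show bound: "length is \<le> 3 \<Longrightarrow> \<bar>iter_partial is (Z k) x\<bar> \<le> M" for "is" x
    using assms unfolding bounded_test_def by blast
  then show "\<bar>Z k x\<bar> \<le> M" for x using bound[of "[]"] by simp
  then show "0 \<le> M" using abs_ge_zero order.trans by blast
qed (use assms in \<open>auto simp: bounded_test_def\<close>)

definition gen :: "(nat \<Rightarrow> real^'d \<Rightarrow> real) \<Rightarrow> nat \<Rightarrow> real^'d \<Rightarrow> real" where
  "gen Z k x = gen_A n0 a b \<nu> \<epsilon>0 q (joint Z) (x, k)"

definition switch_part :: "(nat \<Rightarrow> real^'d \<Rightarrow> real) \<Rightarrow> real^'d \<Rightarrow> real^'d \<Rightarrow> nat \<Rightarrow> real" where
  "switch_part Z y x k = (\<Sum>l\<in>{1..n0}. q y k l * (Z l x - Z k x))"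

lemma gen_eq:
  assumes k_regime: "k \<in> {1..n0}" and smooth: "smooth_bounded (Z k)"
  shows "gen Z k x = 1/2 * diffusion_op (\<sigma> x k) (Z k) x + dir_deriv (b x k) (Z k) x
    + (\<integral>u. jump_part \<epsilon>0 (Z k) x u \<partial>\<nu> x k) + switch_part Z x x k"
proof -
  have "(\<lambda>y. joint Z (y, k)) = Z k" using joint_apply[OF k_regime] by auto
  moreover note joint_apply[OF k_regime]
  moreover have "(\<Sum>l\<in>{1..n0}. q x k l * (joint Z (x, l) - joint Z (x, k))) = switch_part Z x x k"
    unfolding switch_part_def by (intro sum.cong refl) (simp only: joint_apply k_regime)
  ultimately show ?thesis
    unfolding trace_mult_hess[OF smooth, symmetric] sigma[OF k_regime]
    by (simp add: gen_def gen_A_def gen_L_def jump_part_def dir_deriv_def)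
qed

lemma abs_switch_part_le:
  assumes k_regime: "k \<in> {1..n0}" and Z_le: "\<And>l. l \<in> {1..n0} \<Longrightarrow> \<bar>Z l x\<bar> \<le> M"
  shows "\<bar>switch_part Z y x k\<bar> \<le> real n0 * qmax * 2 * M"
proof -
  have "\<bar>switch_part Z y x k\<bar> \<le> (\<Sum>l\<in>{1..n0}. qmax * (2 * M))"
    unfolding switch_part_def
  proof (intro order.trans[OF sum_abs] sum_mono)
    fix l assume l_regime: "l \<in> {1..n0}"
    have "\<bar>q y k l\<bar> * \<bar>Z l x - Z k x\<bar> \<le> qmax * (2 * M)"
      using q_bound[OF k_regime l_regime, of y] Z_le[OF l_regime] Z_le[OF k_regime] qmax_nonneg
      by (intro mult_mono) auto
    then show "\<bar>q y k l * (Z l x - Z k x)\<bar> \<le> qmax * (2 * M)" by (simp add: abs_mult)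
  qed
  then show ?thesis by (simp add: mult_ac)
qed

lemma abs_local_part_le:
  assumes Z_test: "bounded_test M R Z" and k_regime: "k \<in> {1..n0}" and B_nonneg: "0 \<le> B"
    and bound: "norm x \<le> R \<Longrightarrow> norm (b x k) \<le> B \<and> norm (\<sigma> x k) \<le> B"
  shows "\<bar>1/2 * diffusion_op (\<sigma> x k) (Z k) x + dir_deriv (b x k) (Z k) x\<bar>
    \<le> ((real CARD('d))^3 * B\<^sup>2 + real CARD('d) * B) * M"
proof (cases "x \<in> cball 0 R")
  case True
  note test = bounded_testD[OF Z_test k_regime]
  have coefficients_le: "norm (b x k) \<le> B" "norm (\<sigma> x k) \<le> B" using bound True by auto
  have "\<bar>diffusion_op (\<sigma> x k) (Z k) x\<bar> \<le> (real CARD('d))^3 * (norm (\<sigma> x k))\<^sup>2 * M"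
    by (rule abs_diffusion_op_le[OF test(1)]) (simp add: test(2))
  also have "\<dots> \<le> (real CARD('d))^3 * B\<^sup>2 * M"
    using coefficients_le test(5) by (intro mult_right_mono mult_left_mono power_mono) auto
  finally have "\<bar>diffusion_op (\<sigma> x k) (Z k) x\<bar> \<le> (real CARD('d))^3 * B\<^sup>2 * M" .
  moreover have "\<bar>dir_deriv (b x k) (Z k) x\<bar> \<le> real CARD('d) * norm (b x k) * M"
    using abs_dir_deriv_iterate_le[OF test(1), of 1 M "b x k" x] test(2) by simp
  moreover have "real CARD('d) * norm (b x k) * M \<le> real CARD('d) * B * M"
    using coefficients_le test(5) by (intro mult_right_mono mult_left_mono) auto
  ultimately show ?thesis unfolding distrib_right by linarith
next
  case False
  have "open (- cball 0 R :: (real^'d) set)" by (intro open_Compl closed_cball)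
  moreover have "Z k y = 0" if "y \<in> - cball 0 R" for y using bounded_testD(3)[OF Z_test k_regime] that by simp
  ultimately show ?thesis
    using False diffusion_op_eq_0[of "- cball 0 R" "Z k" x] dir_deriv_eq_0[of "- cball 0 R" "Z k" x] B_nonneg
      bounded_testD(5)[OF Z_test k_regime]
    by simp
qed

lemma gen_bounded:
  obtains CA where "\<And>M Z k x. bounded_test M R Z \<Longrightarrow> k \<in> {1..n0} \<Longrightarrow> \<bar>gen Z k x\<bar> \<le> CA * M"
proof -
  obtain B where coefficients_le: "0 \<le> B" "\<And>k x. k \<in> {1..n0} \<Longrightarrow> norm x \<le> R \<Longrightarrow> norm (b x k) \<le> B \<and> norm (\<sigma> x k) \<le> B"
    using coefficients_locally_bounded[of R] by blast
  let ?d = "real CARD('d)"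
  define CA where "CA = (?d^3 * B\<^sup>2 + ?d * B) + jump_const ?d \<epsilon>0 * C\<nu> + real n0 * qmax * 2"
  have "\<bar>gen Z k x\<bar> \<le> CA * M" if Z_test: "bounded_test M R Z" and k_regime: "k \<in> {1..n0}" for M Z k x
  proof -
    note test = bounded_testD[OF Z_test]
    have "\<bar>\<integral>u. jump_part \<epsilon>0 (Z k) x u \<partial>\<nu> x k\<bar> \<le> jump_const ?d \<epsilon>0 * M * C\<nu>"
      by (rule abs_integral_jump_part_le[OF levy_measure_nu[OF k_regime] eps0_pos test(1)[OF k_regime]])
        (simp add: test(2)[OF k_regime])
    moreover have "\<bar>switch_part Z x x k\<bar> \<le> real n0 * qmax * 2 * M"
      by (rule abs_switch_part_le[OF k_regime test(4)])
    ultimately show ?thesis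
      unfolding gen_eq[of k Z, OF k_regime test(1)[OF k_regime]] CA_def
      using abs_local_part_le[OF Z_test k_regime coefficients_le(1) coefficients_le(2)[OF k_regime], of x]
      by (simp add: algebra_simps)
  qed
  then show ?thesis using that by blast
qed

lemma gen_measurable:
  assumes Z_test: "bounded_test M R Z" and k_regime: "k \<in> {1..n0}"
  shows "gen Z k \<in> borel_measurable borel"
proof -
  note test = bounded_testD[OF Z_test]
  note [measurable] = smooth_bounded_measurable[OF test(1)] a_measurable[OF k_regime] b_measurable[OF k_regime]
    q_measurable[OF k_regime]
  have [measurable]: "(\<lambda>x. switch_part Z x x k) \<in> borel_measurable borel"
    unfolding switch_part_def
    by (intro borel_measurable_sum borel_measurable_times borel_measurable_diff q_measurable
      smooth_bounded_measurable test k_regime)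
  have [measurable]: "(\<lambda>x. a x k $ i $ j) \<in> borel_measurable borel" for i j
    by (rule measurable_compose[OF a_measurable[OF k_regime], of "\<lambda>m. m $ i $ j"])
      (intro borel_measurable_continuous_onI continuous_on_component continuous_on_id)
  have [measurable]: "partial_dir i (partial_dir j (Z k)) \<in> borel_measurable borel" for i j
    using smooth_bounded_measurable[OF smooth_bounded_iter_partial[OF test(1)[OF k_regime], of "[i, j]"]] by simp
  have "trace (a x k ** hess (Z k) x) = (\<Sum>i\<in>UNIV. \<Sum>l\<in>UNIV. a x k $ i $ l * partial_dir l (partial_dir i (Z k)) x)" for x
    by (simp add: trace_def matrix_matrix_mult_def hess_def)
  then have diffusion: "diffusion_op (\<sigma> x k) (Z k) x
      = (\<Sum>i\<in>UNIV. \<Sum>l\<in>UNIV. a x k $ i $ l * partial_dir l (partial_dir i (Z k)) x)" for x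
    by (simp add: sigma[OF k_regime] flip: trace_mult_hess[OF test(1)[OF k_regime]])
  have [measurable]: "(\<lambda>x. dir_deriv (b x k) (Z k) x) \<in> borel_measurable borel"
    unfolding dir_deriv_def inner_commute[of "b _ k"]
    by (rule borel_measurable_grad_inner[OF test(1)[OF k_regime]]) measurable
  have [measurable]: "(\<lambda>x. \<integral>u. jump_part \<epsilon>0 (Z k) x u \<partial>\<nu> x k) \<in> borel_measurable borel"
  proof (rule levy_kernel.borel_measurable_integral_kernel[OF levy_kernel_nu[OF k_regime]])
    show "\<bar>jump_part \<epsilon>0 (Z k) x u\<bar> \<le> jump_const (real CARD('d)) \<epsilon>0 * M * trunc_sq u" for x u
      by (rule abs_jump_part_le[OF test(1)[OF k_regime] _ eps0_pos]) (simp add: test(2)[OF k_regime])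
  qed (rule borel_measurable_jump_part_pair[OF test(1)[OF k_regime]])
  have "gen Z k = (\<lambda>x. 1/2 * diffusion_op (\<sigma> x k) (Z k) x + dir_deriv (b x k) (Z k) x
    + (\<integral>u. jump_part \<epsilon>0 (Z k) x u \<partial>\<nu> x k) + switch_part Z x x k)"
    using gen_eq[of k Z, OF k_regime test(1)[OF k_regime]] by auto
  then show ?thesis unfolding diffusion by simp
qed

section \<open>Approximation by generators of bounded rate\<close>

definition drift :: "real \<Rightarrow> real \<Rightarrow> real^'d \<Rightarrow> nat \<Rightarrow> real^'d" where
  "drift r R y k = (if norm y \<le> R then b y k - compensator r \<epsilon>0 (\<nu> y k) else 0)"

definition diffusion :: "real \<Rightarrow> real^'d \<Rightarrow> nat \<Rightarrow> real^'d^'d" where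
  "diffusion R y k = (if norm y \<le> R then \<sigma> y k else 0)"

text \<open>The generator of a random walk whose coefficients are frozen at \<open>y\<close>, acting on functions of \<open>x\<close>.\<close>
definition approx_gen ::
  "real \<Rightarrow> real \<Rightarrow> real \<Rightarrow> (nat \<Rightarrow> real^'d \<Rightarrow> real) \<Rightarrow> real^'d \<Rightarrow> real^'d \<Rightarrow> nat \<Rightarrow> real" where
  "approx_gen \<tau> r R U y x k = forward_quotient \<tau> (drift r R y k) (U k) x
    + (\<Sum>j\<in>UNIV. central_quotient \<tau> (column j (diffusion R y k)) (U k) x)
    + jump_op r (\<nu> y k) (U k) x + switch_part U y x k"

lemma norm_drift_le:
  assumes "k \<in> {1..n0}" "0 < r" "0 \<le> B" "norm y \<le> R \<Longrightarrow> norm (b y k) \<le> B"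
  shows "norm (drift r R y k) \<le> B + \<epsilon>0 * tail_bound C\<nu> r"
proof -
  interpret levy_measure "\<nu> y k" C\<nu> by (rule levy_measure_nu[OF assms(1)])
  show ?thesis
    using norm_triangle_ineq4[of "b y k" "compensator r \<epsilon>0 (\<nu> y k)"] norm_compensator_le[OF assms(2), of \<epsilon>0]
      assms eps0_pos
      tail_bound_nonneg[OF assms(2)] by (auto simp: drift_def)
qed

lemma gen_eq_compensated:
  assumes k_regime: "k \<in> {1..n0}" and smooth: "smooth_bounded (Z k)" and r_bounds: "0 < r" "r \<le> \<epsilon>0"
  shows "gen Z k x = 1/2 * diffusion_op (\<sigma> x k) (Z k) x + dir_deriv (b x k - compensator r \<epsilon>0 (\<nu> x k)) (Z k) x
    + (\<integral>u. indicator {u. norm u < r} u * jump_part \<epsilon>0 (Z k) x u \<partial>\<nu> x k) + jump_op r (\<nu> x k) (Z k) x + switch_part Z x x k"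
  unfolding gen_eq[of k Z, OF k_regime smooth] integral_jump_part_split[OF levy_measure_nu[OF k_regime] r_bounds
    smooth]
  by (simp add: dir_deriv_def inner_diff_left)

lemma approx_gen_error_inside:
  assumes Z_test: "bounded_test M R Z" and k_regime: "k \<in> {1..n0}" and r_bounds: "0 < r" "r \<le> \<epsilon>0" and \<tau>_pos: "0 < \<tau>"
    and x_le: "norm x \<le> R'" and drift: "norm (drift r R' x k) \<le> B\<beta>" and diff: "norm (\<sigma> x k) \<le> B"
  shows "\<bar>gen Z k x - approx_gen \<tau> r R' Z x x k\<bar> \<le> (real CARD('d))\<^sup>2 * M * small_jumps r (\<nu> x k)
    + ((real CARD('d))\<^sup>2 * B\<beta>\<^sup>2 * M * \<tau> + (real CARD('d))^4 * B^3 * M * sqrt \<tau>)"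
proof -
  note test = bounded_testD[OF Z_test k_regime]
  let ?d = "real CARD('d)"
  have "\<bar>forward_quotient \<tau> (drift r R' x k) (Z k) x - dir_deriv (drift r R' x k) (Z k) x\<bar>
      \<le> ?d\<^sup>2 * (norm (drift r R' x k))\<^sup>2 * M * \<tau>"
    by (rule forward_quotient_consistent[OF test(1) _ \<tau>_pos]) (simp add: test(2))
  also have "\<dots> \<le> ?d\<^sup>2 * B\<beta>\<^sup>2 * M * \<tau>"
    using drift test(5) \<tau>_pos by (intro mult_right_mono mult_left_mono power_mono) auto
  finally have first_order: "\<bar>forward_quotient \<tau> (drift r R' x k) (Z k) x - dir_deriv (drift r R' x k) (Z k) x\<bar>
      \<le> ?d\<^sup>2 * B\<beta>\<^sup>2 * M * \<tau>" .
  have "\<bar>(\<Sum>j\<in>UNIV. central_quotient \<tau> (column j (\<sigma> x k)) (Z k) x) - 1/2 * diffusion_op (\<sigma> x k) (Z k) x\<bar>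
      \<le> ?d^4 * (norm (\<sigma> x k))^3 * M * sqrt \<tau>"
    by (rule diffusion_op_consistent[OF test(1) _ \<tau>_pos]) (simp add: test(2))
  also have "\<dots> \<le> ?d^4 * B^3 * M * sqrt \<tau>"
    using diff test(5) \<tau>_pos by (intro mult_right_mono mult_left_mono power_mono) auto
  finally have second_order:
    "\<bar>(\<Sum>j\<in>UNIV. central_quotient \<tau> (column j (\<sigma> x k)) (Z k) x) - 1/2 * diffusion_op (\<sigma> x k) (Z k) x\<bar>
      \<le> ?d^4 * B^3 * M * sqrt \<tau>" .
  have "\<bar>\<integral>u. indicator {u. norm u < r} u * jump_part \<epsilon>0 (Z k) x u \<partial>\<nu> x k\<bar> \<le> ?d\<^sup>2 * M * small_jumps r (\<nu> x k)"
    by (rule abs_integral_small_jump_part_le[OF levy_measure_nu[OF k_regime] r_bounds(2) test(1)]) (simp add: test(2))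
  then show ?thesis
    using first_order second_order x_le unfolding gen_eq_compensated[of k Z, OF k_regime test(1) r_bounds]
      approx_gen_def
    by (simp add: drift_def diffusion_def)
qed

lemma approx_gen_exact_outside:
  assumes Z_test: "bounded_test M R Z" and k_regime: "k \<in> {1..n0}" and r_bounds: "0 < r" "r \<le> \<epsilon>0" "r \<le> 1"
    and x_outside: "R + 1 < norm x"
  shows "gen Z k x = approx_gen \<tau> r (R + 1) Z x x k"
proof -
  note test = bounded_testD[OF Z_test k_regime]
  have open_outside: "open (- cball 0 R :: (real^'d) set)" by (intro open_Compl closed_cball)
  have vanish: "Z k y = 0" if "y \<in> - cball 0 R" for y using test(3) that by simp
  have x_in: "x \<in> - cball 0 R" using x_outside by simp
  have dir: "dir_deriv v (Z k) x = 0" for v by (rule dir_deriv_eq_0[OF open_outside vanish x_in])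
  have diff: "diffusion_op s (Z k) x = 0" for s by (rule diffusion_op_eq_0[OF open_outside vanish x_in])
  have "indicator {u. norm u < r} u * jump_part \<epsilon>0 (Z k) x u = 0" for u
  proof (cases "norm u < r")
    case True
    then have "x + u \<in> - cball 0 R" using x_outside r_bounds(3) norm_triangle_ineq4[of "x + u" u] by auto
    then show ?thesis
      using vanish[of "x + u"] vanish[OF x_in] dir[of u] by (simp add: jump_part_def dir_deriv_def inner_commute)
  qed simp
  then have "(\<integral>u. indicator {u. norm u < r} u * jump_part \<epsilon>0 (Z k) x u \<partial>\<nu> x k) = 0"
    by (simp only: Bochner_Integration.integral_zero)
  moreover have "column j (0 :: real^'d^'d) = 0" for j by (simp add: column_def vec_eq_iff)
  ultimately show ?thesis
    using x_outside
    by (simp add: gen_eq_compensated[of k Z, OF k_regime test(1) r_bounds(1,2)] approx_gen_def drift_def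
      diffusion_def dir diff)
qed

lemma approx_gen_error_le:
  assumes Z_test: "bounded_test M R Z" and k_regime: "k \<in> {1..n0}" and r_bounds: "0 < r" "r \<le> \<epsilon>0" "r \<le> 1"
    and \<tau>_pos: "0 < \<tau>" and B_nonneg: "0 \<le> B"
    and coefficients_le: "norm x \<le> R + 1 \<Longrightarrow> norm (b x k) \<le> B \<and> norm (\<sigma> x k) \<le> B"
    and small_jumps_le: "norm x \<le> R + 1 \<Longrightarrow> small_jumps r (\<nu> x k) \<le> S" and S_nonneg: "0 \<le> S"
  shows "\<bar>gen Z k x - approx_gen \<tau> r (R + 1) Z x x k\<bar> \<le> (real CARD('d))\<^sup>2 * M * S
    + ((real CARD('d))\<^sup>2 * (B + \<epsilon>0 * tail_bound C\<nu> r)\<^sup>2 * M * \<tau> + (real CARD('d))^4 * B^3 * M * sqrt \<tau>)"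
proof (cases "norm x \<le> R + 1")
  case True
  have drift_le: "norm (drift r (R + 1) x k) \<le> B + \<epsilon>0 * tail_bound C\<nu> r"
    using coefficients_le by (intro norm_drift_le k_regime r_bounds(1) B_nonneg) auto
  have \<sigma>_le: "norm (\<sigma> x k) \<le> B" using coefficients_le[OF True] by simp
  have "(real CARD('d))\<^sup>2 * M * small_jumps r (\<nu> x k) \<le> (real CARD('d))\<^sup>2 * M * S"
    using small_jumps_le[OF True] bounded_testD(5)[OF Z_test k_regime] by (intro mult_left_mono) auto
  then show ?thesis
    by (intro order.trans[OF approx_gen_error_inside[OF Z_test k_regime r_bounds(1,2) \<tau>_pos True drift_le \<sigma>_le]]
      add_right_mono)
next
  case False
  then have "gen Z k x = approx_gen \<tau> r (R + 1) Z x x k"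
    by (intro approx_gen_exact_outside[OF Z_test k_regime r_bounds]) simp
  then show ?thesis
    using bounded_testD(5)[OF Z_test k_regime] B_nonneg S_nonneg \<tau>_pos by simp
qed

lemma approx_gen_consistent:
  assumes "0 < \<kappa>" "0 \<le> M"
  shows "\<forall>\<^sub>F r in at_right 0. \<forall>\<^sub>F \<tau> in at_right 0. \<forall>Z k x. bounded_test M R Z \<longrightarrow> k \<in> {1..n0} \<longrightarrow>
    \<bar>gen Z k x - approx_gen \<tau> r (R + 1) Z x x k\<bar> \<le> \<kappa>"
proof -
  let ?d = "real CARD('d)"
  obtain B where coefficients_le: "0 \<le> B" "\<And>k x. k \<in> {1..n0} \<Longrightarrow> norm x \<le> R + 1 \<Longrightarrow> norm (b x k) \<le> B \<and> norm (\<sigma> x k) \<le> B"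
    using coefficients_locally_bounded[of "R + 1"] by blast
  define \<kappa>' where "\<kappa>' = \<kappa> / (2 * (?d\<^sup>2 * M + 1))"
  have "0 < ?d\<^sup>2 * M + 1" using assms by (simp add: add_nonneg_pos)
  then have \<kappa>'_bounds: "0 < \<kappa>'" "?d\<^sup>2 * M * \<kappa>' \<le> \<kappa> / 2" using assms by (auto simp: \<kappa>'_def field_simps)
  have "\<forall>\<^sub>F r in at_right 0. 0 < r \<and> r < min \<epsilon>0 1 \<and> (\<forall>k\<in>{1..n0}. \<forall>x. norm x \<le> R + 1 \<longrightarrow> small_jumps r (\<nu> x k) \<le> \<kappa>')"
    using eps0_pos by (intro eventually_conj eventually_small_jumps_le \<kappa>'_bounds eventually_at_right_less)
      (auto intro: eventually_at_rightI[of 0 "min \<epsilon>0 1"])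
  then show ?thesis
  proof eventually_elim
    case (elim r)
    let ?rate = "\<lambda>\<tau>. ?d\<^sup>2 * (B + \<epsilon>0 * tail_bound C\<nu> r)\<^sup>2 * M * \<tau> + ?d^4 * B^3 * M * sqrt \<tau>"
    have "(?rate \<longlongrightarrow> ?d\<^sup>2 * (B + \<epsilon>0 * tail_bound C\<nu> r)\<^sup>2 * M * 0 + ?d^4 * B^3 * M * sqrt 0) (at_right 0)"
      by (intro tendsto_intros tendsto_ident_at)
    then have "\<forall>\<^sub>F \<tau> in at_right 0. ?rate \<tau> < \<kappa> / 2" by (rule order_tendstoD(2)) (use assms in simp)
    then have "\<forall>\<^sub>F \<tau> in at_right 0. 0 < \<tau> \<and> ?rate \<tau> < \<kappa> / 2"
      by (intro eventually_conj eventually_at_right_less)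
    then show ?case
    proof eventually_elim
      case (elim \<tau>)
      have "\<bar>gen Z k x - approx_gen \<tau> r (R + 1) Z x x k\<bar> \<le> ?d\<^sup>2 * M * \<kappa>' + ?rate \<tau>"
        if "bounded_test M R Z" "k \<in> {1..n0}" for Z k x
        using that coefficients_le elim \<kappa>'_bounds(1) \<open>0 < r \<and> _\<close> by (intro approx_gen_error_le) auto
      moreover have "?d\<^sup>2 * M * \<kappa>' + ?rate \<tau> \<le> \<kappa>" using \<kappa>'_bounds(2) elim by linarith
      ultimately show ?case by (blast intro: order.trans)
    qed
  qed
qed

end

section \<open>A monotone scheme with shaken coefficients\<close>

lemma lipschitz_on_UNIV_realI:
  fixes f :: "'a::real_normed_vector \<Rightarrow> real"
  assumes "0 \<le> K" "\<And>x z. f x \<le> f z + K * norm (x - z)"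
  shows "K-lipschitz_on UNIV f"
proof (rule lipschitz_onI)
  show "dist (f x) (f z) \<le> K * dist x z" for x z
    using assms(2)[of x z] assms(2)[of z x] by (simp add: dist_norm norm_minus_commute abs_le_iff)
qed (rule assms)

lemma lipschitz_on_UNIV_abs_diff_le:
  fixes f :: "'a::real_normed_vector \<Rightarrow> real"
  shows "K-lipschitz_on UNIV f \<Longrightarrow> \<bar>f x - f z\<bar> \<le> K * norm (x - z)"
  using lipschitz_on_normD[of K UNIV f x z] by simp

lemma lipschitz_on_UNIV_measurable: "K-lipschitz_on UNIV f \<Longrightarrow> f \<in> borel_measurable borel"
  by (intro borel_measurable_continuous_onI lipschitz_on_continuous_on)

lemma lipschitz_on_compl: "K-lipschitz_on S f \<Longrightarrow> K-lipschitz_on S (\<lambda>x. 1 - f x :: real)"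
  using lipschitz_on_diff[OF lipschitz_on_constant, of K S f 1] by simp

context switching begin

definition unit_valued :: "(nat \<Rightarrow> real^'d \<Rightarrow> real) \<Rightarrow> bool" where
  "unit_valued U \<longleftrightarrow> (\<forall>k\<in>{1..n0}. U k \<in> borel_measurable borel \<and> (\<forall>x. 0 \<le> U k x \<and> U k x \<le> 1))"

lemma unit_valuedD:
  assumes "unit_valued U" "k \<in> {1..n0}"
  shows "U k \<in> borel_measurable borel" "0 \<le> U k x" "U k x \<le> 1" "\<bar>U k x\<bar> \<le> 1"
  using assms by (auto simp: unit_valued_def)

lemma unit_valued_compl: "unit_valued U \<Longrightarrow> unit_valued (\<lambda>k x. 1 - U k x)"
  by (auto simp: unit_valued_def)

definition rate :: "real \<Rightarrow> real \<Rightarrow> real" where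
  "rate \<tau> r = (1 + real CARD('d)) / \<tau> + 2 * tail_bound C\<nu> r + 2 * (real n0 * qmax)"

lemma rate_nonneg: "0 < \<tau> \<Longrightarrow> 0 < r \<Longrightarrow> 0 \<le> rate \<tau> r"
  using Cnu_nonneg qmax_nonneg by (simp add: rate_def tail_bound_def)

lemma switch_part_compl: "switch_part (\<lambda>k x. 1 - U k x) y x k = - switch_part U y x k"
  unfolding switch_part_def by (simp add: sum_negf[symmetric] algebra_simps)

lemma approx_gen_compl: "approx_gen \<tau> r R (\<lambda>k x. 1 - U k x) y x k = - approx_gen \<tau> r R U y x k"
  unfolding approx_gen_def
  by (simp add: forward_quotient_compl central_quotient_compl jump_op_compl switch_part_compl sum_negf)

lemma switch_part_ge:
  assumes U_unit: "unit_valued U" and k_regime: "k \<in> {1..n0}"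
  shows "- (real n0 * qmax) * U k x \<le> switch_part U y x k"
proof -
  note U_bounds = unit_valuedD(2)[OF U_unit]
  have "(\<Sum>l\<in>{1..n0}. - qmax * U k x) \<le> switch_part U y x k"
    unfolding switch_part_def
  proof (rule sum_mono)
    fix l assume l_regime: "l \<in> {1..n0}"
    show "- qmax * U k x \<le> q y k l * (U l x - U k x)"
    proof (cases "l = k")
      case False
      then have q_bounds: "0 \<le> q y k l" "q y k l \<le> qmax"
        using q_nonneg[OF k_regime l_regime, of y] q_bound[OF k_regime l_regime, of y] by auto
      have "- qmax * U k x \<le> q y k l * (- U k x)" using q_bounds(2) U_bounds[OF k_regime, of x]
        by (simp add: mult_right_mono)
      also have "\<dots> \<le> q y k l * (U l x - U k x)" using U_bounds[OF l_regime] q_bounds(1) by (intro mult_left_mono) auto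
      finally show ?thesis .
    qed (use U_bounds[OF k_regime] qmax_nonneg in simp)
  qed
  then show ?thesis by simp
qed

lemma approx_gen_ge:
  assumes U_unit: "unit_valued U" and k_regime: "k \<in> {1..n0}" and \<tau>_pos: "0 < \<tau>" and r_pos: "0 < r"
  shows "- rate \<tau> r * U k x \<le> approx_gen \<tau> r R U y x k"
proof -
  note U_bounds = unit_valuedD[OF U_unit k_regime]
  interpret levy_measure "\<nu> y k" C\<nu> by (rule levy_measure_nu[OF k_regime])
  have "(\<Sum>j\<in>(UNIV::'d set). - (1 / \<tau>) * U k x)
      \<le> (\<Sum>j\<in>UNIV. central_quotient \<tau> (column j (diffusion R y k)) (U k) x)"
    by (intro sum_mono central_quotient_ge \<tau>_pos U_bounds)
  moreover have "(\<Sum>j\<in>(UNIV::'d set). - (1 / \<tau>) * U k x) = - (real CARD('d) / \<tau>) * U k x" by simp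
  moreover have "- rate \<tau> r * U k x
      \<le> - (1 / \<tau>) * U k x + - (real CARD('d) / \<tau>) * U k x + - tail_bound C\<nu> r * U k x + - (real n0 * qmax) * U k x"
    using U_bounds(2)[of x] tail_bound_nonneg[OF r_pos] qmax_nonneg
    by (simp add: rate_def algebra_simps add_divide_distrib)
  moreover note forward_quotient_ge[where f="U k" and v="drift r R y k" and x=x, OF \<tau>_pos U_bounds(2)]
    jump_op_ge[where x=x, OF r_pos U_bounds(1,2,3)] switch_part_ge[OF U_unit k_regime, of x y]
  ultimately show ?thesis unfolding approx_gen_def by linarith
qed

lemma approx_gen_le:
  assumes "unit_valued U" "k \<in> {1..n0}" "0 < \<tau>" "0 < r"
  shows "approx_gen \<tau> r R U y x k \<le> rate \<tau> r * (1 - U k x)"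
  using approx_gen_ge[OF unit_valued_compl[OF assms(1)] assms(2-), of x R y] unfolding approx_gen_compl by simp

lemma abs_approx_gen_le:
  assumes U_unit: "unit_valued U" and k_regime: "k \<in> {1..n0}" and \<tau>_pos: "0 < \<tau>" and r_pos: "0 < r"
  shows "\<bar>approx_gen \<tau> r R U y x k\<bar> \<le> rate \<tau> r"
proof -
  have "rate \<tau> r * (1 - U k x) \<le> rate \<tau> r * 1" "rate \<tau> r * U k x \<le> rate \<tau> r * 1"
    using unit_valuedD[OF U_unit k_regime] rate_nonneg[OF \<tau>_pos r_pos] by (intro mult_left_mono; simp)+
  then show ?thesis using approx_gen_ge[OF assms, of x R y] approx_gen_le[OF assms, of R y x] by simp
qed

lemma approx_gen_le_shifted:
  assumes U_unit: "unit_valued U" and k_regime: "k \<in> {1..n0}" and \<tau>_pos: "0 < \<tau>" and r_pos: "0 < r"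
    and close: "\<And>l v. l \<in> {1..n0} \<Longrightarrow> \<bar>U l (x + v) - U l (z + v)\<bar> \<le> e"
  shows "approx_gen \<tau> r R U y x k \<le> approx_gen \<tau> r R U y z k + rate \<tau> r * (2 * e)"
proof -
  note U_bounds = unit_valuedD[OF U_unit k_regime]
  interpret levy_measure "\<nu> y k" C\<nu> by (rule levy_measure_nu[OF k_regime])
  have "0 \<le> e" using close[OF k_regime, of 0] by linarith
  have "(\<Sum>j\<in>UNIV. central_quotient \<tau> (column j (diffusion R y k)) (U k) x)
      \<le> (\<Sum>j\<in>UNIV. central_quotient \<tau> (column j (diffusion R y k)) (U k) z + 1 / \<tau> * (2 * e))"
    by (intro sum_mono central_quotient_le_shifted \<tau>_pos close k_regime)
  then have central: "(\<Sum>j\<in>UNIV. central_quotient \<tau> (column j (diffusion R y k)) (U k) x)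
      \<le> (\<Sum>j\<in>UNIV. central_quotient \<tau> (column j (diffusion R y k)) (U k) z) + real CARD('d) / \<tau> * (2 * e)"
    by (simp add: sum.distrib)
  have "switch_part U y x k \<le> (\<Sum>l\<in>{1..n0}. q y k l * (U l z - U k z) + qmax * (2 * e))"
    unfolding switch_part_def
  proof (rule sum_mono)
    fix l assume l_regime: "l \<in> {1..n0}"
    have "q y k l * ((U l x - U k x) - (U l z - U k z)) \<le> \<bar>q y k l\<bar> * \<bar>(U l x - U k x) - (U l z - U k z)\<bar>"
      by (metis abs_ge_self abs_mult)
    also have "\<dots> \<le> qmax * (2 * e)"
      using q_bound[OF k_regime l_regime, of y] close[OF k_regime, of 0] close[OF l_regime, of 0] qmax_nonneg
      by (intro mult_mono) auto
    finally show "q y k l * (U l x - U k x) \<le> q y k l * (U l z - U k z) + qmax * (2 * e)"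
      by (simp add: algebra_simps)
  qed
  then have switch: "switch_part U y x k \<le> switch_part U y z k + real n0 * qmax * (2 * e)"
    by (simp add: sum.distrib switch_part_def)
  have "1 / \<tau> * (2 * e) + real CARD('d) / \<tau> * (2 * e) + tail_bound C\<nu> r * (2 * e) + real n0 * qmax * (2 * e)
      \<le> rate \<tau> r * (2 * e)"
    unfolding distrib_right[symmetric]
    using \<open>0 \<le> e\<close> tail_bound_nonneg[OF r_pos] qmax_nonneg
    by (intro mult_right_mono) (auto simp: rate_def add_divide_distrib)
  with central switch forward_quotient_le_shifted[where f="U k" and v="drift r R y k", OF \<tau>_pos close[OF k_regime]]
    jump_op_le_shifted[where x=x and z=z, OF r_pos U_bounds(1,4) close[OF k_regime]]
  show ?thesis unfolding approx_gen_def by linarith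
qed

end

locale scheme = switching \<rho> n0 \<epsilon>0 H C\<nu> qmax a \<sigma> b \<nu> q
  for \<rho> n0 \<epsilon>0 H C\<nu> qmax
    and a \<sigma> :: "real^'d::finite \<Rightarrow> nat \<Rightarrow> real^'d^'d" and b \<nu> q +
  fixes \<tau> r h \<epsilon> R :: real
  assumes tau_pos: "0 < \<tau>" and r_pos: "0 < r" and h_pos: "0 < h" and eps_pos: "0 < \<epsilon>"
    and cfl: "h * rate \<tau> r \<le> 1"
begin

abbreviation G :: "(nat \<Rightarrow> real^'d \<Rightarrow> real) \<Rightarrow> real^'d \<Rightarrow> real^'d \<Rightarrow> nat \<Rightarrow> real" where
  "G \<equiv> approx_gen \<tau> r (R + 3)"

definition step :: "(nat \<Rightarrow> real^'d \<Rightarrow> real) \<Rightarrow> real^'d \<Rightarrow> real^'d \<Rightarrow> nat \<Rightarrow> real" where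
  "step U y x k = U k x + h * G U y x k"

lemma step_compl: "step (\<lambda>k x. 1 - U k x) y x k = 1 - step U y x k"
  by (simp add: step_def approx_gen_compl)

lemma step_nonneg:
  assumes U_unit: "unit_valued U" and k_regime: "k \<in> {1..n0}" shows "0 \<le> step U y x k"
proof -
  have "h * (- rate \<tau> r * U k x) \<le> h * G U y x k" using approx_gen_ge[OF U_unit k_regime tau_pos r_pos] h_pos
    by (intro mult_left_mono) auto
  moreover have "h * rate \<tau> r * U k x \<le> 1 * U k x" using cfl unit_valuedD[OF U_unit k_regime]
    by (intro mult_right_mono) auto
  ultimately show ?thesis by (simp add: step_def)
qed

lemma step_le_1: "unit_valued U \<Longrightarrow> k \<in> {1..n0} \<Longrightarrow> step U y x k \<le> 1"
  using step_nonneg[OF unit_valued_compl, of U k y x] by (simp add: step_compl)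

lemma step_lipschitz:
  assumes U_unit: "unit_valued U" and U_lipschitz: "\<And>l. l \<in> {1..n0} \<Longrightarrow> K-lipschitz_on UNIV (U l)"
    and k_regime: "k \<in> {1..n0}"
  shows "step U y x k \<le> step U y z k + (K + 2 * h * rate \<tau> r * K) * norm (x - z)"
proof -
  have "G U y x k \<le> G U y z k + rate \<tau> r * (2 * (K * norm (x - z)))"
  proof (rule approx_gen_le_shifted[OF U_unit k_regime tau_pos r_pos])
    show "\<bar>U l (x + v) - U l (z + v)\<bar> \<le> K * norm (x - z)" if "l \<in> {1..n0}" for l v
      using lipschitz_on_UNIV_abs_diff_le[OF U_lipschitz[OF that], of "x + v" "z + v"] by simp
  qed
  then have "h * G U y x k \<le> h * (G U y z k + rate \<tau> r * (2 * (K * norm (x - z))))" using h_pos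
    by (intro mult_left_mono) auto
  then show ?thesis
    using lipschitz_on_UNIV_abs_diff_le[OF U_lipschitz[OF k_regime], of x z] unfolding step_def
    by (simp add: algebra_simps)
qed

definition cutoff :: "real^'d \<Rightarrow> real" where "cutoff x = min 1 (max 0 (norm x - R))"

lemma cutoff_nonneg: "0 \<le> cutoff x" and cutoff_le_1: "cutoff x \<le> 1"
  and cutoff_inside: "norm x \<le> R \<Longrightarrow> cutoff x = 0" and cutoff_outside: "R + 1 \<le> norm x \<Longrightarrow> cutoff x = 1"
  by (auto simp: cutoff_def)

lemma cutoff_le: "cutoff x \<le> cutoff z + norm (x - z)"
  using norm_triangle_ineq2[of x z] norm_ge_zero[of "x - z"] unfolding cutoff_def min_def max_def
  by (auto simp del: norm_ge_zero)

definition penalty :: "real^'d \<Rightarrow> real^'d \<Rightarrow> real" where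
  "penalty x y = max 0 (norm (x - y) / \<epsilon> - 1)"

lemma penalty_nonneg: "0 \<le> penalty x y"
  and penalty_near: "norm (x - y) \<le> \<epsilon> \<Longrightarrow> penalty x y = 0"
  and penalty_far: "2 * \<epsilon> \<le> norm (x - y) \<Longrightarrow> 1 \<le> penalty x y"
  using eps_pos by (auto simp: penalty_def divide_simps)

lemma penalty_le: "penalty z y \<le> penalty x y + norm (x - z) / \<epsilon>"
proof -
  have "norm (z - y) / \<epsilon> \<le> (norm (x - y) + norm (x - z)) / \<epsilon>"
    using norm_triangle_ineq4[of "x - y" "x - z"] eps_pos by (intro divide_right_mono) auto
  moreover have "0 \<le> norm (x - z) / \<epsilon>" using eps_pos by simp
  ultimately show ?thesis unfolding penalty_def add_divide_distrib by linarith
qed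

text \<open>One time step with the most favourable coefficients from points near \<open>x\<close> (Krylov's shaking of the
  coefficients); the penalty makes the supremum Lipschitz in \<open>x\<close>.\<close>
definition shaken :: "(nat \<Rightarrow> real^'d \<Rightarrow> real) \<Rightarrow> nat \<Rightarrow> real^'d \<Rightarrow> real" where
  "shaken U k x = max (cutoff x) (SUP y. step U y x k - penalty x y)"

lemma shaken_ge:
  assumes "unit_valued U" "k \<in> {1..n0}"
  shows "step U y x k - penalty x y \<le> shaken U k x"
proof -
  have "step U y x k - penalty x y \<le> (SUP y. step U y x k - penalty x y)"
    using step_le_1[OF assms] penalty_nonneg
    by (intro cSUP_upper bdd_aboveI2[of _ _ 1]) (auto simp: diff_le_eq add_increasing2)
  then show ?thesis by (simp add: shaken_def)
qed

lemma cutoff_le_shaken: "cutoff x \<le> shaken U k x"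
  by (simp add: shaken_def)

lemma shaken_le:
  assumes "cutoff x \<le> c" "\<And>y. step U y x k - penalty x y \<le> c"
  shows "shaken U k x \<le> c"
  unfolding shaken_def using assms by (auto intro!: cSUP_least)

lemma shaken_pair_le:
  assumes U_unit: "unit_valued U" and U'_unit: "unit_valued U'" and k_regime: "k \<in> {1..n0}"
    and cut: "cutoff x = 0" "cutoff z = 0" and c_nonneg: "0 \<le> c"
    and near: "\<And>y y'. norm (x - y) \<le> 2 * \<epsilon> \<Longrightarrow> norm (z - y') \<le> 2 * \<epsilon> \<Longrightarrow> step U y x k + step U' y' z k - 1 \<le> c"
  shows "shaken U k x + shaken U' k z - 1 \<le> c"
proof -
  have pair: "(step U y x k - penalty x y) + (step U' y' z k - penalty z y') \<le> c + 1" for y y'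
  proof -
    note bounds = step_le_1[OF U_unit k_regime, of y x] step_le_1[OF U'_unit k_regime, of y' z]
      penalty_nonneg[of x y] penalty_nonneg[of z y']
    consider "2 * \<epsilon> \<le> norm (x - y)" | "2 * \<epsilon> \<le> norm (z - y')" | "norm (x - y) \<le> 2 * \<epsilon>" "norm (z - y') \<le> 2 * \<epsilon>"
      by linarith
    then show ?thesis
    proof cases
      case 1
      then show ?thesis using penalty_far[OF 1] bounds c_nonneg by linarith
    next
      case 2
      then show ?thesis using penalty_far[OF 2] bounds c_nonneg by linarith
    next
      case 3
      then show ?thesis using near[OF 3] bounds by linarith
    qed
  qed
  have "shaken U' k z \<le> c + 1 - (step U y x k - penalty x y)" for y
  proof (rule shaken_le)
    show "cutoff z \<le> c + 1 - (step U y x k - penalty x y)"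
      using step_le_1[OF U_unit k_regime, of y x] penalty_nonneg[of x y] cut c_nonneg by linarith
    show "step U' y' z k - penalty z y' \<le> c + 1 - (step U y x k - penalty x y)" for y'
      using pair[of y y'] by linarith
  qed
  moreover have "shaken U' k z \<le> 1"
    using step_le_1[OF U'_unit k_regime] penalty_nonneg cut
    by (intro shaken_le) (auto simp: diff_le_eq add_increasing2)
  ultimately have "shaken U k x \<le> c + 1 - shaken U' k z"
    using cut c_nonneg by (intro shaken_le) (auto simp: algebra_simps)
  then show ?thesis by simp
qed

definition admissible :: "(nat \<Rightarrow> real^'d \<Rightarrow> real) \<Rightarrow> bool" where
  "admissible U \<longleftrightarrow> unit_valued U \<and> (\<exists>K. \<forall>k\<in>{1..n0}. K-lipschitz_on UNIV (U k)) \<and>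
    (\<forall>k\<in>{1..n0}. \<forall>x. cutoff x \<le> U k x)"

lemma admissibleD:
  assumes "admissible U"
  shows "unit_valued U" "k \<in> {1..n0} \<Longrightarrow> cutoff x \<le> U k x"
  using assms by (auto simp: admissible_def)

lemma admissibleI:
  assumes U_lipschitz: "\<And>k. k \<in> {1..n0} \<Longrightarrow> K-lipschitz_on UNIV (U k)"
    and "\<And>k x. k \<in> {1..n0} \<Longrightarrow> U k x \<le> 1" "\<And>k x. k \<in> {1..n0} \<Longrightarrow> cutoff x \<le> U k x"
  shows "admissible U"
  using assms cutoff_nonneg order.trans lipschitz_on_UNIV_measurable[OF U_lipschitz]
  unfolding admissible_def unit_valued_def by blast

lemma shaken_lipschitz:
  assumes U_unit: "unit_valued U" and U_lipschitz: "\<And>l. l \<in> {1..n0} \<Longrightarrow> K-lipschitz_on UNIV (U l)"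
    and k_regime: "k \<in> {1..n0}"
  shows "(1 + (K + 2 * h * rate \<tau> r * K) + 1 / \<epsilon>)-lipschitz_on UNIV (shaken U k)"
proof (rule lipschitz_on_UNIV_realI)
  have "0 \<le> K" using lipschitz_on_nonneg[OF U_lipschitz[OF k_regime]] .
  then have step_const_nonneg: "0 \<le> K + 2 * h * rate \<tau> r * K" using h_pos rate_nonneg[OF tau_pos r_pos] by simp
  then show "0 \<le> 1 + (K + 2 * h * rate \<tau> r * K) + 1 / \<epsilon>" using eps_pos by simp
  fix x z :: "real^'d"
  have expand: "(1 + (K + 2 * h * rate \<tau> r * K) + 1 / \<epsilon>) * norm (x - z)
      = norm (x - z) + (K + 2 * h * rate \<tau> r * K) * norm (x - z) + norm (x - z) / \<epsilon>"
    by (simp add: distrib_right)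
  have nonneg: "0 \<le> (K + 2 * h * rate \<tau> r * K) * norm (x - z)" "0 \<le> norm (x - z) / \<epsilon>" "0 \<le> norm (x - z)"
    using step_const_nonneg eps_pos by auto
  show "shaken U k x \<le> shaken U k z + (1 + (K + 2 * h * rate \<tau> r * K) + 1 / \<epsilon>) * norm (x - z)"
    unfolding expand
  proof (rule shaken_le)
    show "cutoff x \<le> shaken U k z + (norm (x - z) + (K + 2 * h * rate \<tau> r * K) * norm (x - z) + norm (x - z) / \<epsilon>)"
      using cutoff_le[of x z] cutoff_le_shaken[of z U k] nonneg by linarith
    show "step U y x k - penalty x y
        \<le> shaken U k z + (norm (x - z) + (K + 2 * h * rate \<tau> r * K) * norm (x - z) + norm (x - z) / \<epsilon>)" for y
      using step_lipschitz[OF U_unit U_lipschitz k_regime, of y x z] penalty_le[of z y x]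
        shaken_ge[OF U_unit k_regime, of y z] nonneg by linarith
  qed
qed

lemma admissible_shaken:
  assumes "admissible U" shows "admissible (shaken U)"
proof -
  obtain K where U_lipschitz: "\<And>k. k \<in> {1..n0} \<Longrightarrow> K-lipschitz_on UNIV (U k)"
    using assms unfolding admissible_def by blast
  note U_unit = admissibleD(1)[OF assms]
  show ?thesis
  proof (rule admissibleI)
    show "shaken U k x \<le> 1" if "k \<in> {1..n0}" for k x
      using step_le_1[OF U_unit that] penalty_nonneg
      by (intro shaken_le cutoff_le_1) (auto simp: diff_le_eq add_increasing2)
  qed (rule shaken_lipschitz[OF U_unit U_lipschitz] cutoff_le_shaken; assumption?)+
qed

lemma abs_shaken_diff_le:
  assumes "admissible U" and k_regime: "k \<in> {1..n0}"
  shows "\<bar>shaken U k x - U k x\<bar> \<le> h * rate \<tau> r"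
proof -
  note U_unit = admissibleD(1)[OF assms(1)]
  have hG_le: "\<bar>h * G U y x k\<bar> \<le> h * rate \<tau> r" for y
    using abs_approx_gen_le[OF U_unit k_regime tau_pos r_pos, of _ y x] h_pos by (simp add: abs_mult mult_left_mono)
  have "shaken U k x \<le> U k x + h * rate \<tau> r"
  proof (rule shaken_le)
    show "cutoff x \<le> U k x + h * rate \<tau> r"
      using admissibleD(2)[OF assms, of x] h_pos rate_nonneg[OF tau_pos r_pos] by (simp add: add_increasing2)
    show "step U y x k - penalty x y \<le> U k x + h * rate \<tau> r" for y
      using hG_le[of y] penalty_nonneg[of x y] unfolding step_def by linarith
  qed
  moreover have "U k x - h * rate \<tau> r \<le> shaken U k x"
    using shaken_ge[OF U_unit k_regime, of x x] hG_le[of x] penalty_near[of x x] eps_pos unfolding step_def by simp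
  ultimately show ?thesis by linarith
qed

definition iterate :: "(nat \<Rightarrow> real^'d \<Rightarrow> real) \<Rightarrow> nat \<Rightarrow> nat \<Rightarrow> real^'d \<Rightarrow> real" where
  "iterate g n = (shaken ^^ n) (\<lambda>k x. max (cutoff x) (g k x))"

lemma iterate_0: "iterate g 0 = (\<lambda>k x. max (cutoff x) (g k x))"
  and iterate_Suc: "iterate g (Suc n) = shaken (iterate g n)"
  by (simp_all add: iterate_def)

lemma admissible_iterate:
  assumes g_unit: "unit_valued g" and g_lipschitz: "\<And>k. k \<in> {1..n0} \<Longrightarrow> L-lipschitz_on UNIV (g k)"
  shows "admissible (iterate g n)"
proof (induction n)
  case 0
  show ?case
    unfolding iterate_0
  proof (rule admissibleI)
    fix k assume k_regime: "k \<in> {1..n0}"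
    have "0 \<le> L" using lipschitz_on_nonneg[OF g_lipschitz[OF k_regime]] .
    show "(1 + L)-lipschitz_on UNIV (\<lambda>x. max (cutoff x) (g k x))"
    proof (rule lipschitz_on_UNIV_realI)
      fix x z :: "real^'d"
      have "0 \<le> L * norm (x - z)" "0 \<le> norm (x - z)" using \<open>0 \<le> L\<close> by auto
      then show "max (cutoff x) (g k x) \<le> max (cutoff z) (g k z) + (1 + L) * norm (x - z)"
        using cutoff_le[of x z] lipschitz_on_UNIV_abs_diff_le[OF g_lipschitz[OF k_regime], of x z]
        unfolding distrib_right mult_1 max_def abs_le_iff by (auto simp del: norm_ge_zero)
    qed (use \<open>0 \<le> L\<close> in simp)
  qed (use unit_valuedD(3)[OF g_unit] cutoff_le_1 in auto)
qed (simp add: iterate_Suc admissible_shaken)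

end

section \<open>Mollified iterates as test functions\<close>

locale mollifier =
  fixes \<eta> :: "'a::euclidean_space \<Rightarrow> real" and \<epsilon> :: real
  assumes eta_nonneg: "0 \<le> \<eta> x" and eta_supp: "\<epsilon> \<le> norm x \<Longrightarrow> \<eta> x = 0"
    and eta_integrable: "integrable lborel \<eta>" and eta_integral: "(\<integral>x. \<eta> x \<partial>lborel) = 1"
begin

lemma eta_measurable: "\<eta> \<in> borel_measurable borel"
  using borel_measurable_integrable[OF eta_integrable] by simp

lemma conv_diff:
  assumes "f \<in> borel_measurable borel" "\<And>x. \<bar>f x\<bar> \<le> M" "g \<in> borel_measurable borel" "\<And>x. \<bar>g x\<bar> \<le> M'"
  shows "conv \<eta> (\<lambda>x. f x - g x) x = conv \<eta> f x - conv \<eta> g x"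
  using integrable_conv[OF eta_integrable assms(1,2), of x] integrable_conv[OF eta_integrable assms(3,4), of x]
  by (simp add: conv_def right_diff_distrib)

lemma conv_compl:
  assumes "f \<in> borel_measurable borel" "\<And>x. \<bar>f x\<bar> \<le> M"
  shows "conv \<eta> (\<lambda>x. 1 - f x) x = 1 - conv \<eta> f x"
  using conv_diff[of "\<lambda>_. 1" 1 f M x] assms eta_integral by (simp add: conv_def)

lemma conv_le_of_near:
  assumes f_bounded: "f \<in> borel_measurable borel" "\<And>x. \<bar>f x\<bar> \<le> M" and near: "\<And>y. norm (x - y) < \<epsilon> \<Longrightarrow> f y \<le> c"
  shows "conv \<eta> f x \<le> c"
proof -
  have "conv \<eta> f x \<le> (\<integral>w. \<eta> w * c \<partial>lborel)"
    unfolding conv_def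
  proof (rule integral_mono[OF integrable_conv[OF eta_integrable f_bounded] integrable_mult_left[OF eta_integrable]])
    show "\<eta> w * f (x - w) \<le> \<eta> w * c" for w
      using near[of "x - w"] eta_nonneg[of w] eta_supp[of w] by (cases "norm w < \<epsilon>") (auto intro: mult_left_mono)
  qed
  then show ?thesis by (simp add: eta_integral)
qed

end

locale mollified_scheme = scheme \<rho> n0 \<epsilon>0 H C\<nu> qmax a \<sigma> b \<nu> q \<tau> r h \<epsilon> R + mollifier \<eta> \<epsilon>
  for \<rho> n0 \<epsilon>0 H C\<nu> qmax
    and a \<sigma> :: "real^'d::finite \<Rightarrow> nat \<Rightarrow> real^'d^'d" and b \<nu> q \<tau> r h \<epsilon> R
    and \<eta> :: "real^'d \<Rightarrow> real" +
  fixes M\<eta> :: real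
  assumes eta_smooth: "smooth_bounded \<eta>" and eta_bound: "length is \<le> 3 \<Longrightarrow> \<bar>iter_partial is \<eta> x\<bar> \<le> M\<eta>"
    and eps_le_1: "\<epsilon> \<le> 1"
begin

definition moll_bound :: real where
  "moll_bound = M\<eta> * measure lborel (cball 0 (R + 1) :: (real^'d) set)"

lemma M_eta_nonneg: "0 \<le> M\<eta>"
  using eta_bound[of "[]" 0] by simp

lemma bounded_test_conv:
  assumes \<zeta>_bounded: "\<And>k. k \<in> {1..n0} \<Longrightarrow> \<zeta> k \<in> borel_measurable borel" "\<And>k x. k \<in> {1..n0} \<Longrightarrow> \<bar>\<zeta> k x\<bar> \<le> s"
    and supp: "\<And>k x. k \<in> {1..n0} \<Longrightarrow> x \<notin> cball 0 (R + 1) \<Longrightarrow> \<zeta> k x = 0"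
  shows "bounded_test (s * moll_bound) (R + 2) (\<lambda>k. conv \<eta> (\<zeta> k))"
  unfolding bounded_test_def
proof (intro ballI conjI allI impI)
  fix k assume k_regime: "k \<in> {1..n0}"
  have int: "integrable lborel (\<zeta> k)" "(\<integral>y. \<bar>\<zeta> k y\<bar> \<partial>lborel) \<le> s * measure lborel (cball 0 (R + 1) :: (real^'d) set)"
    using integrable_bounded_support[OF \<zeta>_bounded[OF k_regime]] supp[OF k_regime] by blast+
  have commute: "conv \<eta> (\<zeta> k) = conv (\<zeta> k) \<eta>" by (rule conv_commute[OF eta_measurable \<zeta>_bounded(1)[OF k_regime]])
  show "smooth_bounded (conv \<eta> (\<zeta> k))" unfolding commute by (rule smooth_bounded_conv[OF int(1) eta_smooth])
  show "\<bar>iter_partial is (conv \<eta> (\<zeta> k)) x\<bar> \<le> s * moll_bound" if "length is \<le> 3" for "is" x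
  proof -
    have "\<bar>iter_partial is (conv \<eta> (\<zeta> k)) x\<bar> \<le> (\<integral>y. \<bar>\<zeta> k y\<bar> \<partial>lborel) * M\<eta>"
      unfolding commute iter_partial_conv[OF int(1) eta_smooth]
      by (rule abs_conv_le[OF int(1) smooth_bounded_measurable[OF smooth_bounded_iter_partial[OF eta_smooth]]])
        (rule eta_bound[OF that])
    also have "\<dots> \<le> s * measure lborel (cball 0 (R + 1) :: (real^'d) set) * M\<eta>"
      by (intro mult_right_mono int(2) M_eta_nonneg)
    finally show ?thesis by (simp add: moll_bound_def mult_ac)
  qed
  show "conv \<eta> (\<zeta> k) x = 0" if "x \<notin> cball 0 (R + 2)" for x
  proof -
    have "\<eta> w * \<zeta> k (x - w) = 0" for w
    proof (cases "norm w < \<epsilon>")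
      case True
      then have "x - w \<notin> cball 0 (R + 1)" using that eps_le_1 norm_triangle_ineq2[of x w] by simp
      then show ?thesis by (simp add: supp[OF k_regime])
    qed (simp add: eta_supp)
    then show ?thesis by (simp only: conv_def Bochner_Integration.integral_zero)
  qed
qed

lemma G_conv:
  assumes U_unit: "unit_valued U" and k_regime: "k \<in> {1..n0}"
  shows "has_bochner_integral lborel (\<lambda>w. \<eta> w * G U y (x - w) k) (G (\<lambda>k. conv \<eta> (U k)) y x k)"
proof -
  note U_bounds = unit_valuedD(1,4)[OF U_unit]
  interpret levy_measure "\<nu> y k" C\<nu> by (rule levy_measure_nu[OF k_regime])
  have conv: "has_bochner_integral lborel (\<lambda>w. \<eta> w * U l (x - w)) (conv \<eta> (U l) x)" if "l \<in> {1..n0}" for l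
    using has_bochner_integral_conv_shift[OF eta_integrable U_bounds[OF that], of x 0] by simp
  have "has_bochner_integral lborel (\<lambda>w. \<Sum>l\<in>{1..n0}. q y k l * (\<eta> w * U l (x - w) - \<eta> w * U k (x - w)))
      (switch_part (\<lambda>k. conv \<eta> (U k)) y x k)"
    unfolding switch_part_def
    by (intro has_bochner_integral_sum has_bochner_integral_mult_right has_bochner_integral_diff conv k_regime)
  then have switch: "has_bochner_integral lborel (\<lambda>w. \<eta> w * switch_part U y (x - w) k)
      (switch_part (\<lambda>k. conv \<eta> (U k)) y x k)"
    by (simp add: switch_part_def sum_distrib_left algebra_simps)
  show ?thesis
    unfolding approx_gen_def distrib_left sum_distrib_left
    by (intro has_bochner_integral_add has_bochner_integral_sum switch
        forward_quotient_conv[OF eta_integrable U_bounds[OF k_regime]] central_quotient_conv[OF eta_integrable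
          U_bounds[OF k_regime]]
        jump_op_conv[OF r_pos eta_integrable U_bounds[OF k_regime]])
qed

text \<open>Shaking the coefficients by at most \<open>\<epsilon>\<close> makes the mollification at scale \<open>\<epsilon>\<close> a subsolution of the
  scheme with the unperturbed coefficients.\<close>
lemma conv_compl_shaken_le:
  assumes adm: "admissible U" and k_regime: "k \<in> {1..n0}"
  shows "conv \<eta> (\<lambda>x. 1 - shaken U k x) x
    \<le> conv \<eta> (\<lambda>x. 1 - U k x) x + h * G (\<lambda>k. conv \<eta> (\<lambda>x. 1 - U k x)) x x k"
proof -
  note U_unit = admissibleD(1)[OF adm]
  note U_bounds = unit_valuedD[OF unit_valued_compl[OF U_unit] k_regime] and
    shaken = unit_valuedD[OF unit_valued_compl[OF admissibleD(1)[OF admissible_shaken[OF adm]]] k_regime]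
  have right: "has_bochner_integral lborel
      (\<lambda>w. \<eta> w * (1 - U k (x - w)) + h * (\<eta> w * G (\<lambda>k x. 1 - U k x) x (x - w) k))
      (conv \<eta> (\<lambda>x. 1 - U k x) x + h * G (\<lambda>k. conv \<eta> (\<lambda>x. 1 - U k x)) x x k)"
    using has_bochner_integral_conv_shift[OF eta_integrable U_bounds(1,4), of x 0]
    by (intro has_bochner_integral_add has_bochner_integral_mult_right G_conv[OF unit_valued_compl[OF U_unit]
      k_regime]) simp
  have "conv \<eta> (\<lambda>x. 1 - shaken U k x) x
      \<le> (\<integral>w. \<eta> w * (1 - U k (x - w)) + h * (\<eta> w * G (\<lambda>k x. 1 - U k x) x (x - w) k) \<partial>lborel)"
    unfolding conv_def[of \<eta> "\<lambda>x. 1 - shaken U k x"]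
  proof (rule integral_mono[OF integrable_conv[OF eta_integrable shaken(1,4)] integrable.intros[OF right]])
    fix w
    show "\<eta> w * (1 - shaken U k (x - w))
        \<le> \<eta> w * (1 - U k (x - w)) + h * (\<eta> w * G (\<lambda>k x. 1 - U k x) x (x - w) k)"
    proof (cases "norm w < \<epsilon>")
      case True
      then have "step U x (x - w) k \<le> shaken U k (x - w)"
        using shaken_ge[OF U_unit k_regime, of x "x - w"] penalty_near[of "x - w" x] by simp
      then have "1 - shaken U k (x - w) \<le> 1 - U k (x - w) + h * G (\<lambda>k x. 1 - U k x) x (x - w) k"
        unfolding approx_gen_compl by (simp add: step_def)
      from mult_left_mono[OF this eta_nonneg[of w]] show ?thesis by (simp add: algebra_simps)
    qed (simp add: eta_supp)
  qed
  then show ?thesis unfolding has_bochner_integral_integral_eq[OF right] .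
qed

end

section \<open>Expectations of functions of the regime and the position\<close>

context switching begin

abbreviation solution :: "(real^'d) \<times> nat \<Rightarrow> (real \<Rightarrow> (real^'d) \<times> nat) measure \<Rightarrow> bool" where
  "solution \<equiv> mp_solution (UNIV \<times> {1..n0}) (test_A n0) (gen_A n0 a b \<nu> \<epsilon>0 q)"

definition mean :: "(real \<Rightarrow> (real^'d) \<times> nat) measure \<Rightarrow> real \<Rightarrow> (nat \<Rightarrow> real^'d \<Rightarrow> real) \<Rightarrow> real" where
  "mean P t g = (\<integral>\<omega>. joint g (\<omega> t) \<partial>P)"

definition bounded_by :: "real \<Rightarrow> (nat \<Rightarrow> real^'d \<Rightarrow> real) \<Rightarrow> bool" where
  "bounded_by M g \<longleftrightarrow> (\<forall>k\<in>{1..n0}. g k \<in> borel_measurable borel \<and> (\<forall>x. \<bar>g k x\<bar> \<le> M))"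

lemma unit_valued_bounded_by: "unit_valued U \<Longrightarrow> bounded_by 1 U"
  by (auto simp: unit_valued_def bounded_by_def)

lemma bounded_test_bounded_by: "bounded_test M R Z \<Longrightarrow> bounded_by M Z"
  using bounded_testD(1,4)[of M R Z] smooth_bounded_measurable unfolding bounded_by_def by blast

lemma bounded_by_affine:
  assumes "bounded_by M f" shows "bounded_by (\<bar>\<alpha>\<bar> * M + \<bar>c\<bar>) (\<lambda>k x. \<alpha> * f k x + c)"
  unfolding bounded_by_def
proof (intro ballI conjI allI)
  fix k x assume k_regime: "k \<in> {1..n0}"
  have [measurable]: "f k \<in> borel_measurable borel" using assms k_regime unfolding bounded_by_def by blast
  show "(\<lambda>x. \<alpha> * f k x + c) \<in> borel_measurable borel" by measurable
  have "\<bar>\<alpha>\<bar> * \<bar>f k x\<bar> \<le> \<bar>\<alpha>\<bar> * M" using assms k_regime by (intro mult_left_mono) (auto simp: bounded_by_def)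
  then show "\<bar>\<alpha> * f k x + c\<bar> \<le> \<bar>\<alpha>\<bar> * M + \<bar>c\<bar>"
    using abs_triangle_ineq[of "\<alpha> * f k x" c] by (simp add: abs_mult)
qed

lemma joint_cases:
  assumes "e \<in> UNIV \<times> {1..n0}"
  obtains x k where "e = (x, k)" "k \<in> {1..n0}" "\<And>g. joint g e = g k x"
  using assms joint_apply by (cases e) auto

lemma martingale_solution: "solution e P \<Longrightarrow> martingale_solution (UNIV \<times> {1..n0}) (test_A n0) (gen_A n0 a b \<nu> \<epsilon>0 q) e P"
  by (intro martingale_solution.intro measurable_evaluation_pair_nat)

lemma integrable_joint:
  assumes "solution e P" "0 \<le> t" "bounded_by M g"
  shows "integrable P (\<lambda>\<omega>. joint g (\<omega> t))"
proof (rule martingale_solution.integrable_coordinate[OF martingale_solution[OF assms(1)]])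
  show "joint g \<in> borel_measurable borel" using assms(3) by (intro joint_measurable) (simp add: bounded_by_def)
  show "\<bar>joint g e\<bar> \<le> M" if "e \<in> UNIV \<times> {1..n0}" for e
    by (rule joint_cases[OF that]) (use assms(3) in \<open>simp add: bounded_by_def\<close>)
qed (rule assms)

lemma mean_mono:
  assumes P_solution: "solution e P" and t_nonneg: "0 \<le> t" and bounded: "bounded_by M f" "bounded_by M' g"
    and f_le_g: "\<And>k x. k \<in> {1..n0} \<Longrightarrow> f k x \<le> g k x"
  shows "mean P t f \<le> mean P t g"
  unfolding mean_def
proof (rule integral_mono[OF integrable_joint[OF P_solution t_nonneg bounded(1)]
  integrable_joint[OF P_solution t_nonneg bounded(2)]])
  fix \<omega> assume "\<omega> \<in> space P"
  then have "\<omega> t \<in> UNIV \<times> {1..n0}" by (rule martingale_solution.value_in[OF martingale_solution[OF P_solution]])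
  then show "joint f (\<omega> t) \<le> joint g (\<omega> t)" by (rule joint_cases) (simp add: f_le_g)
qed

lemma mean_linear:
  assumes P_solution: "solution e P" and t_nonneg: "0 \<le> t" and bounded: "bounded_by M f" "bounded_by M' g"
  shows "mean P t (\<lambda>k x. \<alpha> * f k x + \<beta> * g k x + c) = \<alpha> * mean P t f + \<beta> * mean P t g + c"
proof -
  interpret martingale_solution "UNIV \<times> {1..n0}" "test_A n0" "gen_A n0 a b \<nu> \<epsilon>0 q" e P
    by (rule martingale_solution[OF P_solution])
  note int = integrable_joint[OF P_solution t_nonneg bounded(1)] integrable_joint[OF P_solution t_nonneg bounded(2)]
  have "mean P t (\<lambda>k x. \<alpha> * f k x + \<beta> * g k x + c) = (\<integral>\<omega>. \<alpha> * joint f (\<omega> t) + \<beta> * joint g (\<omega> t) + c \<partial>P)"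
    unfolding mean_def
  proof (rule Bochner_Integration.integral_cong[OF refl])
    fix \<omega> assume "\<omega> \<in> space P"
    then have "\<omega> t \<in> UNIV \<times> {1..n0}" by (rule value_in)
    then show "joint (\<lambda>k x. \<alpha> * f k x + \<beta> * g k x + c) (\<omega> t) = \<alpha> * joint f (\<omega> t) + \<beta> * joint g (\<omega> t) + c"
      by (rule joint_cases) simp
  qed
  also have "\<dots> = \<alpha> * mean P t f + \<beta> * mean P t g + c"
    using int by (simp add: mean_def prob_space)
  finally show ?thesis .
qed

lemma mean_affine:
  assumes "solution e P" "0 \<le> t" "bounded_by M f"
  shows "mean P t (\<lambda>k x. \<alpha> * f k x + c) = \<alpha> * mean P t f + c"
  using mean_linear[OF assms(1,2,3,3), of \<alpha> 0 c] by simp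

lemma mean_diff:
  assumes "solution e P" "0 \<le> t" "bounded_by M f" "bounded_by M' g"
  shows "mean P t (\<lambda>k x. f k x - g k x) = mean P t f - mean P t g"
  using mean_linear[OF assms, of 1 "-1" 0] by simp

lemma mean_start:
  assumes "solution (x, k) P" "k \<in> {1..n0}" "bounded_by M g"
  shows "mean P 0 g = g k x"
proof -
  have "joint g \<in> borel_measurable borel" using assms(3) by (intro joint_measurable) (simp add: bounded_by_def)
  from martingale_solution.expectation_start[OF martingale_solution[OF assms(1)] this] show ?thesis
    by (simp add: mean_def joint_apply[OF assms(2)])
qed

lemma martingale_test_joint:
  assumes P_solution: "solution e P" and Z_test: "bounded_test M R Z"
    and bound: "\<And>k x. k \<in> {1..n0} \<Longrightarrow> \<bar>gen Z k x\<bar> \<le> C"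
  shows "martingale_test (UNIV \<times> {1..n0}) (test_A n0) (gen_A n0 a b \<nu> \<epsilon>0 q) e P (joint Z) (joint (gen Z)) M C"
proof (intro martingale_test.intro martingale_test_axioms.intro martingale_solution[OF P_solution])
  note test = bounded_testD[OF Z_test]
  have "(\<lambda>y. joint Z (y, k)) = Z k" if "k \<in> {1..n0}" for k using joint_apply[OF that] by auto
  then show "joint Z \<in> test_A n0"
    unfolding test_A_def using smooth_bounded_imp_C_c_inf[OF test(1,3)] by simp
  show "joint Z \<in> borel_measurable borel" "joint (gen Z) \<in> borel_measurable borel"
    by (intro joint_measurable gen_measurable[OF Z_test] smooth_bounded_measurable test; assumption)+
  fix e :: "(real^'d) \<times> nat" assume e_in: "e \<in> UNIV \<times> {1..n0}"
  show "\<bar>joint Z e\<bar> \<le> M" by (rule joint_cases[OF e_in]) (simp add: test(4))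
  show "\<bar>joint (gen Z) e\<bar> \<le> C" by (rule joint_cases[OF e_in]) (simp add: bound)
  show "gen_A n0 a b \<nu> \<epsilon>0 q (joint Z) e = joint (gen Z) e" by (rule joint_cases[OF e_in]) (simp add: gen_def)
qed

end

text \<open>By the martingale property, the subsolutions \<open>Z n = conv \<eta> (1 - iterate g n)\<close> of the scheme grow in
  mean along the process, up to the consistency error of the scheme and the variation of \<open>Z\<close> in one time step.\<close>
locale mollified_iteration = mollified_scheme \<rho> n0 \<epsilon>0 H C\<nu> qmax a \<sigma> b \<nu> q \<tau> r h \<epsilon> R \<eta> M\<eta>
  for \<rho> n0 \<epsilon>0 H C\<nu> qmax
    and a \<sigma> :: "real^'d::finite \<Rightarrow> nat \<Rightarrow> real^'d^'d" and b \<nu> q \<tau> r h \<epsilon> R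
    and \<eta> :: "real^'d \<Rightarrow> real" and M\<eta> +
  fixes g :: "nat \<Rightarrow> real^'d \<Rightarrow> real" and L CA \<kappa> :: real
  assumes g_unit: "unit_valued g" and g_lipschitz: "k \<in> {1..n0} \<Longrightarrow> L-lipschitz_on UNIV (g k)"
    and gen_le: "bounded_test M (R + 2) Z \<Longrightarrow> k \<in> {1..n0} \<Longrightarrow> \<bar>gen Z k x\<bar> \<le> CA * M"
    and consistent: "bounded_test moll_bound (R + 2) Z \<Longrightarrow> k \<in> {1..n0} \<Longrightarrow> \<bar>gen Z k x - G Z x x k\<bar> \<le> \<kappa>"
begin

abbreviation U :: "nat \<Rightarrow> nat \<Rightarrow> real^'d \<Rightarrow> real" where "U \<equiv> iterate g"

definition Z :: "nat \<Rightarrow> nat \<Rightarrow> real^'d \<Rightarrow> real" where "Z n k = conv \<eta> (\<lambda>x. 1 - U n k x)"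

definition Z_diff :: "nat \<Rightarrow> nat \<Rightarrow> real^'d \<Rightarrow> real" where
  "Z_diff n k x = Z (Suc n) k x - Z n k x"

definition err :: real where "err = \<kappa> + CA * (h * rate \<tau> r * moll_bound)"

lemma U_admissible: "admissible (U n)"
  by (rule admissible_iterate[OF g_unit g_lipschitz])

lemmas U_unit = admissibleD(1)[OF U_admissible]

lemma U_outside:
  assumes "k \<in> {1..n0}" "x \<notin> cball 0 (R + 1)" shows "U n k x = 1"
proof -
  have "cutoff x = 1" using assms(2) by (intro cutoff_outside) simp
  then show ?thesis
    using admissibleD(2)[OF U_admissible assms(1), of x n] unit_valuedD(3)[OF U_unit assms(1), of n x] by simp
qed

lemma bounded_test_Z: "bounded_test moll_bound (R + 2) (Z n)"
proof -
  note U_bounds = unit_valuedD[OF unit_valued_compl[OF U_unit]]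
  have "bounded_test (1 * moll_bound) (R + 2) (\<lambda>k. conv \<eta> (\<lambda>x. 1 - U n k x))"
    by (rule bounded_test_conv) (use U_bounds U_outside in auto)
  then show ?thesis by (simp add: Z_def[abs_def])
qed

lemma bounded_test_Z_diff: "bounded_test (h * rate \<tau> r * moll_bound) (R + 2) (Z_diff n)"
proof -
  note U_bounds = unit_valuedD[OF unit_valued_compl[OF U_unit]]
  have bound: "\<bar>U n k x - U (Suc n) k x\<bar> \<le> h * rate \<tau> r" if "k \<in> {1..n0}" for k x
    using abs_shaken_diff_le[OF U_admissible that, of n x] by (simp add: iterate_Suc abs_minus_commute)
  have "bounded_test (h * rate \<tau> r * moll_bound) (R + 2) (\<lambda>k. conv \<eta> (\<lambda>x. U n k x - U (Suc n) k x))"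
    by (rule bounded_test_conv)
      (use bound U_outside unit_valuedD(1)[OF U_unit]
        in \<open>auto intro: borel_measurable_diff simp del: atLeastAtMost_iff\<close>)
  moreover have "conv \<eta> (\<lambda>x. U n k x - U (Suc n) k x) = Z_diff n k" if "k \<in> {1..n0}" for k
    using conv_diff[OF U_bounds(1,4)[OF that, of "Suc n"] U_bounds(1,4)[OF that, of n]]
    by (auto simp: Z_diff_def Z_def)
  ultimately show ?thesis by (simp add: bounded_test_def)
qed

lemma Z_diff_le_gen:
  assumes k_regime: "k \<in> {1..n0}" shows "Z_diff n k x / h - \<kappa> \<le> gen (Z n) k x"
proof -
  have "Z_diff n k x \<le> h * G (Z n) x x k"
    using conv_compl_shaken_le[OF U_admissible k_regime, of n x] by (simp add: Z_diff_def Z_def[abs_def] iterate_Suc)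
  then have "Z_diff n k x / h \<le> G (Z n) x x k" using h_pos by (simp add: divide_le_eq mult.commute)
  then show ?thesis using consistent[OF bounded_test_Z k_regime, of n x] by linarith
qed

lemma mean_Z_step:
  assumes P_solution: "solution e P" and t_nonneg: "0 \<le> t"
  shows "mean P t (Z (Suc n)) - h * err \<le> mean P (t + h) (Z n)"
proof -
  let ?D = "\<lambda>s. mean P s (Z_diff n)"
  interpret Z: martingale_test "UNIV \<times> {1..n0}" "test_A n0" "gen_A n0 a b \<nu> \<epsilon>0 q" e P
      "joint (Z n)" "joint (gen (Z n))" moll_bound "CA * moll_bound"
    by (intro martingale_test_joint[OF P_solution bounded_test_Z] gen_le[OF bounded_test_Z])
  interpret D: martingale_test "UNIV \<times> {1..n0}" "test_A n0" "gen_A n0 a b \<nu> \<epsilon>0 q" e P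
      "joint (Z_diff n)" "joint (gen (Z_diff n))" "h * rate \<tau> r * moll_bound" "CA * (h * rate \<tau> r * moll_bound)"
    by (intro martingale_test_joint[OF P_solution bounded_test_Z_diff] gen_le[OF bounded_test_Z_diff])
  note D_bounded = bounded_test_bounded_by[OF bounded_test_Z_diff[of n]]
  have gen_bounded: "bounded_by (CA * moll_bound) (gen (Z n))"
    unfolding bounded_by_def by (intro ballI conjI allI gen_measurable[OF bounded_test_Z] gen_le[OF bounded_test_Z])
  have growth: "?D t / h - err \<le> mean P s (gen (Z n))" if s_in: "t \<le> s" "s \<le> t + h" for s
  proof -
    have "\<bar>?D (t + (s - t)) - ?D t\<bar> \<le> CA * (h * rate \<tau> r * moll_bound) * (s - t)"
      unfolding mean_def by (rule D.abs_expectation_increment_le) (use s_in t_nonneg in auto)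
    also have "\<dots> \<le> CA * (h * rate \<tau> r * moll_bound) * h"
      using s_in D.abs_expectation_generator_le[OF t_nonneg] by (intro mult_left_mono) auto
    finally have "(?D t - CA * (h * rate \<tau> r * moll_bound) * h) / h \<le> ?D s / h"
      using h_pos by (intro divide_right_mono) (auto simp: abs_le_iff)
    then have "?D t / h - err \<le> 1 / h * ?D s + - \<kappa>" using h_pos by (simp add: diff_divide_distrib err_def)
    also have "\<dots> = mean P s (\<lambda>k x. 1 / h * Z_diff n k x + - \<kappa>)"
      using s_in t_nonneg by (intro mean_affine[OF P_solution _ D_bounded, symmetric]) auto
    also have "\<dots> \<le> mean P s (gen (Z n))"
      using s_in t_nonneg Z_diff_le_gen
      by (intro mean_mono[OF P_solution _ bounded_by_affine[OF D_bounded] gen_bounded]) auto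
    finally show ?thesis .
  qed
  have "(?D t / h - err) * h \<le> mean P (t + h) (Z n) - mean P t (Z n)"
    using Z.expectation_increment_ge[of t h "?D t / h - err"] t_nonneg h_pos growth by (simp add: mean_def)
  moreover have "(?D t / h - err) * h = ?D t - h * err" using h_pos by (simp add: left_diff_distrib)
  moreover have "?D t = mean P t (Z (Suc n)) - mean P t (Z n)"
    unfolding Z_diff_def
    by (rule mean_diff[OF P_solution t_nonneg bounded_test_bounded_by[OF bounded_test_Z]
      bounded_test_bounded_by[OF bounded_test_Z]])
  ultimately show ?thesis by linarith
qed

lemma mean_Z_chain:
  assumes "solution e P"
  shows "mean P 0 (Z (n + m)) - real m * (h * err) \<le> mean P (real m * h) (Z n)"
proof (induction m arbitrary: n)
  case (Suc m)
  have "mean P (real m * h) (Z (Suc n)) - h * err \<le> mean P (real m * h + h) (Z n)"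
    by (rule mean_Z_step[OF assms]) (use h_pos in simp)
  with Suc[of "Suc n"] show ?case by (simp add: algebra_simps)
qed simp

lemma Z_0_le:
  assumes k_regime: "k \<in> {1..n0}" shows "Z 0 k x \<le> 1 - g k x + L * \<epsilon>"
  unfolding Z_def
proof (rule conv_le_of_near[OF unit_valuedD(1,4)[OF unit_valued_compl[OF U_unit] k_regime]])
  fix y assume "norm (x - y) < \<epsilon>"
  then have "L * norm (x - y) \<le> L * \<epsilon>" using lipschitz_on_nonneg[OF g_lipschitz[OF k_regime]]
    by (intro mult_left_mono) auto
  then show "1 - U 0 k y \<le> 1 - g k x + L * \<epsilon>"
    using lipschitz_on_UNIV_abs_diff_le[OF g_lipschitz[OF k_regime], of x y] unfolding iterate_0 by linarith
qed

theorem mean_le_mollified_iterate: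
  assumes P_solution: "solution (x, k) P" and k_regime: "k \<in> {1..n0}"
  shows "mean P (real N * h) g \<le> conv \<eta> (U N k) x + L * \<epsilon> + real N * (h * err)"
proof -
  have time_nonneg: "0 \<le> real N * h" using h_pos by simp
  have "Z N k x - real N * (h * err) \<le> mean P (real N * h) (Z 0)"
    using mean_Z_chain[OF P_solution, of 0 N]
      mean_start[OF P_solution k_regime bounded_test_bounded_by[OF bounded_test_Z]] by simp
  also have "\<dots> \<le> mean P (real N * h) (\<lambda>k x. (-1) * g k x + (1 + L * \<epsilon>))"
    using Z_0_le by (intro mean_mono[OF P_solution time_nonneg bounded_test_bounded_by[OF bounded_test_Z]
          bounded_by_affine[OF unit_valued_bounded_by[OF g_unit]]]) (simp add: algebra_simps)
  also have "\<dots> = 1 - mean P (real N * h) g + L * \<epsilon>"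
    using mean_affine[OF P_solution time_nonneg unit_valued_bounded_by[OF g_unit], of "-1" "1 + L * \<epsilon>"] by simp
  finally show ?thesis
    using conv_compl[OF unit_valuedD(1,4)[OF U_unit k_regime], of N x] by (simp add: Z_def)
qed

end

section \<open>Coupling of two schemes\<close>

definition soft_norm :: "real \<Rightarrow> 'a::real_inner \<Rightarrow> real" where
  "soft_norm \<delta> v = sqrt ((norm v)\<^sup>2 + \<delta>\<^sup>2)"

lemma norm_le_soft_norm: "norm v \<le> soft_norm \<delta> v" and soft_norm_ge: "\<bar>\<delta>\<bar> \<le> soft_norm \<delta> v"
  and soft_norm_nonneg: "0 \<le> soft_norm \<delta> v"
  by (auto simp: soft_norm_def intro!: real_le_rsqrt abs_le_square_iff[THEN iffD1])

lemma soft_norm_pos: "0 < \<delta> \<Longrightarrow> 0 < soft_norm \<delta> v"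
  using soft_norm_ge[of \<delta> v] by linarith

lemma soft_norm_power2: "(soft_norm \<delta> v)\<^sup>2 = (norm v)\<^sup>2 + \<delta>\<^sup>2"
  by (simp add: soft_norm_def)

lemma soft_norm_le: "0 \<le> \<delta> \<Longrightarrow> soft_norm \<delta> v \<le> norm v + \<delta>"
  unfolding soft_norm_def by (rule real_le_lsqrt) (auto simp: power2_sum)

lemma soft_norm_quadratic_increments:
  assumes "0 < \<delta>" shows "quadratic_increments (soft_norm \<delta>) v (2 * soft_norm \<delta> v)"
  unfolding quadratic_increments_def
proof
  fix w
  let ?D = "soft_norm \<delta> v" and ?E = "soft_norm \<delta> (v + w)"
  have "0 < ?D" by (rule soft_norm_pos[OF assms])
  have "?E\<^sup>2 = ?D\<^sup>2 + (2 * (v \<bullet> w) + (norm w)\<^sup>2)"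
    by (simp add: soft_norm_power2 power2_norm_eq_inner inner_add_left inner_add_right inner_commute)
  moreover have "2 * ?D * ?E \<le> ?D\<^sup>2 + ?E\<^sup>2" by (rule sum_squares_bound)
  ultimately have "(?E - ?D) * (2 * ?D) \<le> 2 * (v \<bullet> w) + (norm w)\<^sup>2"
    by (simp add: power2_eq_square algebra_simps)
  then show "?E - ?D \<le> (2 * (v \<bullet> w) + (norm w)\<^sup>2) / (2 * ?D)"
    using \<open>0 < ?D\<close> by (simp add: pos_le_divide_eq)
qed

lemma soft_norm_add_le: "soft_norm \<delta> (v + w) \<le> soft_norm \<delta> v + norm w"
proof -
  have "v \<bullet> w \<le> norm v * norm w" by (rule norm_cauchy_schwarz)
  also have "\<dots> \<le> soft_norm \<delta> v * norm w" using norm_le_soft_norm by (intro mult_right_mono) auto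
  finally have "(soft_norm \<delta> (v + w))\<^sup>2 \<le> (soft_norm \<delta> v + norm w)\<^sup>2"
    by (simp add: soft_norm_power2 power2_sum)
      (simp add: power2_norm_eq_inner inner_add_left inner_add_right inner_commute)
  then show ?thesis using soft_norm_nonneg[of \<delta> v] by (simp add: power2_le_iff_abs_le)
qed

context scheme begin

definition majorant :: "(real^'d \<Rightarrow> real) \<Rightarrow> real \<Rightarrow> real \<Rightarrow> real \<Rightarrow> real^'d \<Rightarrow> real^'d \<Rightarrow> real" where
  "majorant V \<delta> A \<beta> x z = A * soft_norm \<delta> (x - z) + \<beta> + V x + V z"

definition dominated ::
  "(real^'d \<Rightarrow> real) \<Rightarrow> real \<Rightarrow> real \<Rightarrow> real \<Rightarrow> (nat \<Rightarrow> real^'d \<Rightarrow> real) \<Rightarrow> (nat \<Rightarrow> real^'d \<Rightarrow> real) \<Rightarrow> bool" where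
  "dominated V \<delta> A \<beta> U U' \<longleftrightarrow> (\<forall>k\<in>{1..n0}. \<forall>x z. U k x + U' k z - 1 \<le> majorant V \<delta> A \<beta> x z)"

lemma dominatedD: "dominated V \<delta> A \<beta> U U' \<Longrightarrow> k \<in> {1..n0} \<Longrightarrow> U k x + U' k z - 1 \<le> majorant V \<delta> A \<beta> x z"
  by (simp add: dominated_def)

definition pair_gen :: "real \<Rightarrow> real^'d \<Rightarrow> real^'d \<Rightarrow> real^'d \<Rightarrow> nat \<Rightarrow> real" where
  "pair_gen \<delta> v y y' k = forward_quotient \<tau> (drift r (R + 3) y k - drift r (R + 3) y' k) (soft_norm \<delta>) v
    + (\<Sum>j\<in>UNIV. central_quotient \<tau> (column j (diffusion (R + 3) y k - diffusion (R + 3) y' k)) (soft_norm \<delta>) v)"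

definition coupling_rate
  :: "(real^'d \<Rightarrow> real) \<Rightarrow> real \<Rightarrow> real \<Rightarrow> real^'d \<Rightarrow> real^'d \<Rightarrow> real^'d \<Rightarrow> real^'d \<Rightarrow> nat \<Rightarrow> real" where
  "coupling_rate V \<delta> A x z y y' k = A * (pair_gen \<delta> (x - z) y y' k + H * \<rho> (norm (y - y')))
    + G (\<lambda>_. V) y x k + G (\<lambda>_. V) y' z k + real n0 * (H * norm (y - y'))"

context
  fixes U U' :: "nat \<Rightarrow> real^'d \<Rightarrow> real" and V :: "real^'d \<Rightarrow> real" and A \<beta> \<delta> :: real
  assumes U_unit: "unit_valued U" and U'_unit: "unit_valued U'" and V_unit: "unit_valued (\<lambda>_. V)"
    and A_nonneg: "0 \<le> A" and dom: "dominated V \<delta> A \<beta> U U'"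
begin

private definition slack :: "nat \<Rightarrow> real^'d \<Rightarrow> real^'d \<Rightarrow> real" where
  "slack k x z = majorant V \<delta> A \<beta> x z - (U k x + U' k z - 1)"

private lemma slack_nonneg: "k \<in> {1..n0} \<Longrightarrow> 0 \<le> slack k x z"
  using dominatedD[OF dom, of k x z] by (simp add: slack_def)

private lemma increments:
  assumes "k \<in> {1..n0}" shows "increments_dominated A (soft_norm \<delta>) V (slack k x z) (U k) (U' k) x z"
  unfolding increments_dominated_def
proof (intro allI)
  show "(U k p - U k x) + (U' k p' - U' k z)
      \<le> A * (soft_norm \<delta> (p - p') - soft_norm \<delta> (x - z)) + (V p - V x) + (V p' - V z) + slack k x z" for p p'
    using dominatedD[OF dom assms, of p p'] by (simp add: slack_def majorant_def algebra_simps)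
qed

private lemma switch_coupling:
  assumes k_regime: "k \<in> {1..n0}"
  shows "switch_part U y x k + switch_part U' y' z k
    \<le> real n0 * (H * norm (y - y')) + 2 * (real n0 * qmax) * slack k x z"
proof -
  let ?e = "slack k x z"
  have "q y k l * (U l x - U k x) + q y' k l * (U' l z - U' k z) \<le> H * norm (y - y') + 2 * qmax * ?e"
    if l_regime: "l \<in> {1..n0}" for l
  proof (cases "l = k")
    case True
    then show ?thesis using H_pos qmax_nonneg slack_nonneg[OF k_regime] by simp
  next
    case False
    note U_bounds = unit_valuedD(2,3)[OF U_unit l_regime, of x] unit_valuedD(2,3)[OF U_unit k_regime, of x]
      unit_valuedD(2,3)[OF U'_unit l_regime, of z] unit_valuedD(2,3)[OF U'_unit k_regime, of z]
    have rates: "0 \<le> q y k l" "0 \<le> q y' k l" "q y k l + q y' k l \<le> 2 * qmax"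
      using q_nonneg[OF k_regime l_regime] q_bound[OF k_regime l_regime, of y]
        q_bound[OF k_regime l_regime, of y'] False by auto
    have "q y k l * (U l x - U k x) + q y' k l * (U' l z - U' k z)
        \<le> 1 * \<bar>q y k l - q y' k l\<bar> + q y k l * ?e + q y' k l * ?e"
      using rates U_bounds slack_nonneg[OF k_regime, of x z] dominatedD[OF dom l_regime, of x z]
      by (intro coupled_weights_le) (auto simp: slack_def)
    also have "\<dots> \<le> H * norm (y - y') + (q y k l + q y' k l) * ?e"
      using q_lipschitz[OF k_regime l_regime, of y y'] False by (simp add: distrib_right)
    also have "(q y k l + q y' k l) * ?e \<le> 2 * qmax * ?e"
      by (intro mult_right_mono rates slack_nonneg k_regime)
    finally show ?thesis by simp
  qed
  then have "switch_part U y x k + switch_part U' y' z k \<le> (\<Sum>l\<in>{1..n0}. H * norm (y - y') + 2 * qmax * ?e)"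
    unfolding switch_part_def sum.distrib[symmetric] by (intro sum_mono)
  then show ?thesis by (simp add: algebra_simps)
qed

private lemma gen_coupling:
  assumes k_regime: "k \<in> {1..n0}"
  shows "G U y x k + G U' y' z k \<le> coupling_rate V \<delta> A x z y y' k + rate \<tau> r * slack k x z"
proof -
  note U_bounds = unit_valuedD(1,4)[OF U_unit k_regime] and U'_bounds = unit_valuedD(1,4)[OF U'_unit k_regime]
    and V_bounds = unit_valuedD(1,4)[OF V_unit k_regime]
  let ?e = "slack k x z" and ?s = "\<lambda>y j. column j (diffusion (R + 3) y k)"
  let ?D = "\<lambda>j. central_quotient \<tau> (?s y j - ?s y' j) (soft_norm \<delta>) (x - z)"
  interpret levy_pair "\<nu> y k" "\<nu> y' k" C\<nu> "H * \<rho> (norm (y - y'))" by (rule levy_pair_nu[OF k_regime])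
  have "(\<Sum>j\<in>UNIV. central_quotient \<tau> (?s y j) (U k) x + central_quotient \<tau> (?s y' j) (U' k) z)
      \<le> (\<Sum>j\<in>UNIV. A * ?D j + central_quotient \<tau> (?s y j) V x + central_quotient \<tau> (?s y' j) V z + 1 / \<tau> * ?e)"
    by (intro sum_mono central_quotient_coupling[OF increments[OF k_regime] tau_pos])
  then have central: "(\<Sum>j\<in>UNIV. central_quotient \<tau> (?s y j) (U k) x) + (\<Sum>j\<in>UNIV. central_quotient \<tau> (?s y' j) (U' k) z)
      \<le> A * (\<Sum>j\<in>UNIV. ?D j) + (\<Sum>j\<in>UNIV. central_quotient \<tau> (?s y j) V x)
        + (\<Sum>j\<in>UNIV. central_quotient \<tau> (?s y' j) V z) + real CARD('d) / \<tau> * ?e"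
    by (simp add: sum.distrib sum_distrib_left)
  have rate: "rate \<tau> r * ?e = 1 / \<tau> * ?e + real CARD('d) / \<tau> * ?e + 2 * tail_bound C\<nu> r * ?e + 2 * (real n0 * qmax) * ?e"
    by (simp add: rate_def add_divide_distrib distrib_right)
  have no_switch: "switch_part (\<lambda>_. V) w p k = 0" for w p by (simp add: switch_part_def)
  show ?thesis
    unfolding coupling_rate_def approx_gen_def pair_gen_def no_switch column_diff rate distrib_left[of A]
    using forward_quotient_coupling[OF increments[OF k_regime] tau_pos, of "drift r (R + 3) y k" x
      "drift r (R + 3) y' k" z]
      central switch_coupling[OF k_regime, of y x y' z]
      jump_op_coupling[OF increments[OF k_regime] A_nonneg r_pos soft_norm_add_le U_bounds U'_bounds V_bounds, of x z]
    by linarith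
qed

text \<open>Both schemes use the same random-walk increments, the common part of the two jump measures and the common
  part of the two switching rates; the slack in the domination is absorbed by the CFL condition.\<close>
lemma step_coupling:
  assumes k_regime: "k \<in> {1..n0}"
  shows "step U y x k + step U' y' z k - 1 \<le> majorant V \<delta> A \<beta> x z + h * coupling_rate V \<delta> A x z y y' k"
proof -
  have "h * (G U y x k + G U' y' z k) \<le> h * (coupling_rate V \<delta> A x z y y' k + rate \<tau> r * slack k x z)"
    using gen_coupling[OF k_regime] h_pos by (intro mult_left_mono) auto
  moreover have "h * rate \<tau> r * slack k x z \<le> 1 * slack k x z" by (intro mult_right_mono cfl slack_nonneg k_regime)
  ultimately show ?thesis by (simp add: step_def slack_def algebra_simps)
qed

end

lemma pair_gen_quadratic_le:
  assumes \<delta>_pos: "0 < \<delta>"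
  shows "pair_gen \<delta> v y y' k \<le> (2 * (v \<bullet> (drift r (R + 3) y k - drift r (R + 3) y' k))
    + \<tau> * (norm (drift r (R + 3) y k - drift r (R + 3) y' k))\<^sup>2
    + (norm (diffusion (R + 3) y k - diffusion (R + 3) y' k))\<^sup>2) / (2 * soft_norm \<delta> v)"
proof -
  note quadratic = soft_norm_quadratic_increments[OF \<delta>_pos, of v]
  show ?thesis
    using forward_quotient_quadratic_le[OF quadratic tau_pos, of "drift r (R + 3) y k - drift r (R + 3) y' k"]
      sum_central_quotient_quadratic_le[OF quadratic tau_pos, of "diffusion (R + 3) y k - diffusion (R + 3) y' k"]
    unfolding pair_gen_def add_divide_distrib by linarith
qed

context
  fixes x z y y' :: "real^'d" and k :: nat and \<delta> B B\<beta> :: real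
  assumes k_regime: "k \<in> {1..n0}" and \<delta>_bounds: "0 < \<delta>" "4 * \<epsilon> \<le> \<delta>"
    and inside: "norm y \<le> R + 3" "norm y' \<le> R + 3"
    and near: "norm (x - y) \<le> 2 * \<epsilon>" "norm (z - y') \<le> 2 * \<epsilon>"
    and b_le: "norm (b y k) \<le> B" "norm (b y' k) \<le> B"
    and drift_norm_le: "norm (drift r (R + 3) y k) \<le> B\<beta>" "norm (drift r (R + 3) y' k) \<le> B\<beta>"
begin

private lemma norm_shift_diff: "norm ((x - z) - (y - y')) \<le> 4 * \<epsilon>"
  using norm_triangle_ineq4[of "x - y" "z - y'"] near by (simp add: algebra_simps)

lemma norm_near_pair_le: "norm (y - y') \<le> soft_norm \<delta> (x - z) + 4 * \<epsilon>"
  using norm_triangle_ineq4[of "x - z" "(x - z) - (y - y')"] norm_shift_diff norm_le_soft_norm[of "x - z" \<delta>] by simp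

private lemma norm_near_pair_le_double: "norm (y - y') \<le> 2 * soft_norm \<delta> (x - z)"
  using norm_near_pair_le soft_norm_ge[of \<delta> "x - z"] \<delta>_bounds by linarith

private lemma rho_near_pair_le: "\<rho> (norm (y - y')) \<le> 2 * \<rho> (soft_norm \<delta> (x - z))"
proof -
  have "\<rho> (norm (y - y')) \<le> \<rho> (2 * soft_norm \<delta> (x - z))" by (intro rho_le norm_near_pair_le_double) simp
  also have "\<dots> \<le> 2 * \<rho> (soft_norm \<delta> (x - z))" by (rule rho_double_le[OF soft_norm_pos[OF \<delta>_bounds(1)]])
  finally show ?thesis .
qed

private lemma one_sided_near_pair_le:
  "2 * ((x - z) \<bullet> (b y k - b y' k)) + (norm (\<sigma> y k - \<sigma> y' k))\<^sup>2
    \<le> 4 * soft_norm \<delta> (x - z) * (H * \<rho> (soft_norm \<delta> (x - z))) + 16 * \<epsilon> * B"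
proof -
  let ?D = "soft_norm \<delta> (x - z)" and ?b = "b y k - b y' k"
  have "((x - z) - (y - y')) \<bullet> ?b \<le> norm ((x - z) - (y - y')) * norm ?b" by (rule norm_cauchy_schwarz)
  also have "\<dots> \<le> 4 * \<epsilon> * (2 * B)"
    using norm_shift_diff norm_triangle_ineq4[of "b y k" "b y' k"] b_le eps_pos by (intro mult_mono) auto
  finally have shift: "(x - z) \<bullet> ?b \<le> (y - y') \<bullet> ?b + 8 * \<epsilon> * B" by (simp add: inner_diff_left)
  have "(norm (\<sigma> y k - \<sigma> y' k))\<^sup>2 + 2 * ((y - y') \<bullet> ?b) \<le> H * norm (y - y') * \<rho> (norm (y - y'))"
    by (rule one_sided[OF k_regime])
  also have "\<dots> \<le> H * (2 * ?D) * (2 * \<rho> ?D)"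
    using norm_near_pair_le_double rho_near_pair_le H_pos soft_norm_nonneg[of \<delta> "x - z"]
      rho_nonneg[of "norm (y - y')"]
    by (intro mult_mono mult_left_mono) auto
  finally show ?thesis using shift by (simp add: mult_ac)
qed

private lemma compensator_near_pair_ge:
  "- ((x - z) \<bullet> (compensator r \<epsilon>0 (\<nu> y k) - compensator r \<epsilon>0 (\<nu> y' k)))
    \<le> 2 * soft_norm \<delta> (x - z) * (H * \<rho> (soft_norm \<delta> (x - z)))"
proof -
  let ?D = "soft_norm \<delta> (x - z)" and ?c = "compensator r \<epsilon>0 (\<nu> y k) - compensator r \<epsilon>0 (\<nu> y' k)"
  interpret levy_pair "\<nu> y k" "\<nu> y' k" C\<nu> "H * \<rho> (norm (y - y'))" by (rule levy_pair_nu[OF k_regime])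
  have "- ((x - z) \<bullet> ?c) \<le> norm (x - z) * norm ?c" using Cauchy_Schwarz_ineq2[of "x - z" ?c] by linarith
  also have "\<dots> \<le> ?D * (H * \<rho> (norm (y - y')))"
    using norm_compensator_diff_le[OF r_pos, of \<epsilon>0] eps0_pos norm_le_soft_norm soft_norm_nonneg
    by (intro mult_mono) auto
  also have "\<dots> \<le> ?D * (H * (2 * \<rho> ?D))"
    using rho_near_pair_le H_pos soft_norm_nonneg by (intro mult_left_mono) auto
  finally show ?thesis by (simp add: mult_ac)
qed

lemma pair_gen_le:
  "pair_gen \<delta> (x - z) y y' k + H * \<rho> (norm (y - y'))
    \<le> 6 * H * \<rho> (soft_norm \<delta> (x - z)) + (8 * \<epsilon> * B + 2 * \<tau> * B\<beta>\<^sup>2) / \<delta>"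
proof -
  let ?\<beta> = "drift r (R + 3) y k - drift r (R + 3) y' k" and ?s = "diffusion (R + 3) y k - diffusion (R + 3) y' k"
  define D where "D = soft_norm \<delta> (x - z)"
  define p where "p = H * \<rho> D"
  define E where "E = 8 * \<epsilon> * B + 2 * \<tau> * B\<beta>\<^sup>2"
  have D_bounds: "0 < D" "\<delta> \<le> D" using soft_norm_pos[OF \<delta>_bounds(1)] soft_norm_ge[of \<delta> "x - z"] by (auto simp: D_def)
  have "0 \<le> B" using b_le(1) norm_ge_zero[of "b y k"] by linarith
  then have "0 \<le> E" using eps_pos tau_pos by (simp add: E_def)
  have "norm ?\<beta> \<le> 2 * B\<beta>" using norm_triangle_ineq4[of "drift r (R + 3) y k" "drift r (R + 3) y' k"]
    drift_norm_le by linarith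
  then have "\<tau> * (norm ?\<beta>)\<^sup>2 \<le> \<tau> * (2 * B\<beta>)\<^sup>2" using tau_pos by (intro mult_left_mono power_mono) auto
  then have "2 * ((x - z) \<bullet> ?\<beta>) + \<tau> * (norm ?\<beta>)\<^sup>2 + (norm ?s)\<^sup>2 \<le> 8 * D * p + 2 * E"
    using one_sided_near_pair_le compensator_near_pair_ge inside unfolding D_def[symmetric] p_def[symmetric]
    by (simp add: drift_def diffusion_def E_def inner_diff_right power_mult_distrib)
  then have "pair_gen \<delta> (x - z) y y' k \<le> (8 * D * p + 2 * E) / (2 * D)"
    using D_bounds by (intro order.trans[OF pair_gen_quadratic_le[OF \<delta>_bounds(1)]])
      (auto simp: D_def intro!: divide_right_mono)
  moreover have "(8 * D * p + 2 * E) / (2 * D) = 4 * p + E / D" using D_bounds by (simp add: add_divide_distrib)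
  moreover have "E / D \<le> E / \<delta>" using D_bounds \<delta>_bounds \<open>0 \<le> E\<close> by (intro divide_left_mono) auto
  moreover have "H * \<rho> (norm (y - y')) \<le> 2 * p"
    using mult_left_mono[OF rho_near_pair_le, of H] H_pos by (simp add: D_def p_def)
  ultimately show ?thesis unfolding D_def[symmetric] E_def[symmetric] by (simp add: p_def)
qed

end

end

section \<open>A Lyapunov function\<close>

lemma ln_norm_increment_le:
  fixes x v :: "'a::real_inner"
  shows "ln (1 + (norm (x + v))\<^sup>2) - ln (1 + (norm x)\<^sup>2) \<le> (2 * (x \<bullet> v) + (norm v)\<^sup>2) / (1 + (norm x)\<^sup>2)"
proof -
  define a c where "a = 1 + (norm x)\<^sup>2" and "c = 1 + (norm (x + v))\<^sup>2"
  have pos: "0 < a" "0 < c" by (auto simp: a_def c_def intro: add_pos_nonneg)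
  have "ln c - ln a \<le> (c - a) / a"
    using pos ln_le_minus_one[of "c / a"] by (simp add: ln_div diff_divide_distrib)
  also have "c - a = 2 * (x \<bullet> v) + (norm v)\<^sup>2"
    by (simp add: a_def c_def power2_norm_eq_inner inner_add_left inner_add_right inner_commute)
  finally show ?thesis by (simp add: a_def c_def)
qed

definition log_lyap :: "real \<Rightarrow> 'a::real_inner \<Rightarrow> real" where
  "log_lyap R x = min 1 (ln (1 + (norm x)\<^sup>2) / ln (1 + R\<^sup>2))"

lemma log_lyap_le: "log_lyap R x \<le> ln (1 + (norm x)\<^sup>2) / ln (1 + R\<^sup>2)"
  and log_lyap_le_1: "log_lyap R x \<le> 1"
  by (simp_all add: log_lyap_def)

lemma log_lyap_measurable: "log_lyap R \<in> borel_measurable borel"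
  unfolding log_lyap_def[abs_def] by measurable

lemma ln_1_plus_power2_pos: "0 < R \<Longrightarrow> 0 < ln (1 + R\<^sup>2 :: real)"
  by (intro ln_gt_zero) simp

lemma log_lyap_nonneg: "0 \<le> log_lyap R x"
  by (simp add: log_lyap_def)

lemma log_lyap_outside:
  assumes "0 < R" "R \<le> norm x" shows "log_lyap R x = 1"
proof -
  have "ln (1 + R\<^sup>2) \<le> ln (1 + (norm x)\<^sup>2)"
    using assms by (subst ln_le_cancel_iff) (auto intro: add_pos_nonneg)
  then show ?thesis using ln_1_plus_power2_pos[OF assms(1)] by (simp add: log_lyap_def min_def le_divide_eq)
qed

lemma log_lyap_inside:
  assumes "0 < R" "norm x \<le> R" shows "log_lyap R x = ln (1 + (norm x)\<^sup>2) / ln (1 + R\<^sup>2)"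
proof -
  have "ln (1 + (norm x)\<^sup>2) \<le> ln (1 + R\<^sup>2)"
    using assms by (subst ln_le_cancel_iff) (auto intro: add_pos_nonneg power_mono)
  then show ?thesis using ln_1_plus_power2_pos[OF assms(1)] by (simp add: log_lyap_def min_def divide_le_eq)
qed

lemma log_lyap_le_on_ball:
  assumes "0 < R" "norm x \<le> X" shows "log_lyap R x \<le> ln (1 + X\<^sup>2) / ln (1 + R\<^sup>2)"
proof -
  have "ln (1 + (norm x)\<^sup>2) \<le> ln (1 + X\<^sup>2)"
    using assms by (subst ln_le_cancel_iff) (auto intro: add_pos_nonneg power_mono)
  then have "ln (1 + (norm x)\<^sup>2) / ln (1 + R\<^sup>2) \<le> ln (1 + X\<^sup>2) / ln (1 + R\<^sup>2)"
    using ln_1_plus_power2_pos[OF assms(1)] by (intro divide_right_mono) auto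
  then show ?thesis using log_lyap_le[of R x] by linarith
qed

lemma log_lyap_quadratic_increments:
  assumes R_pos: "0 < R" and x_le: "norm x \<le> R"
  shows "quadratic_increments (log_lyap R) x ((1 + (norm x)\<^sup>2) * ln (1 + R\<^sup>2))"
  unfolding quadratic_increments_def
proof
  fix v
  have "log_lyap R (x + v) - log_lyap R x \<le> (ln (1 + (norm (x + v))\<^sup>2) - ln (1 + (norm x)\<^sup>2)) / ln (1 + R\<^sup>2)"
    using log_lyap_le[of R "x + v"] log_lyap_inside[OF R_pos x_le] by (simp add: diff_divide_distrib)
  also have "\<dots> \<le> (2 * (x \<bullet> v) + (norm v)\<^sup>2) / (1 + (norm x)\<^sup>2) / ln (1 + R\<^sup>2)"
    using ln_norm_increment_le[of x v] ln_1_plus_power2_pos[OF R_pos] by (intro divide_right_mono) auto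
  finally show "log_lyap R (x + v) - log_lyap R x \<le> (2 * (x \<bullet> v) + (norm v)\<^sup>2) / ((1 + (norm x)\<^sup>2) * ln (1 + R\<^sup>2))"
    by simp
qed

lemma power2_sum_le: "(s + t)\<^sup>2 \<le> 2 * s\<^sup>2 + 2 * (t\<^sup>2 :: real)"
  using sum_squares_bound[of s t] by (simp add: power2_sum)

lemma log_lyap_increment_le:
  assumes R_pos: "0 < R" and x_le: "norm x \<le> R" and u_le: "norm u \<le> K * (1 + norm x)"
  shows "log_lyap R (x + u) - log_lyap R x \<le> ln (3 + 4 * K\<^sup>2) / ln (1 + R\<^sup>2)"
proof -
  have pos: "0 < 1 + (norm y)\<^sup>2" "0 < 3 + 4 * K\<^sup>2" for y :: 'a by (auto intro: add_pos_nonneg)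
  have "(norm u)\<^sup>2 \<le> K\<^sup>2 * (1 + norm x)\<^sup>2"
    unfolding power_mult_distrib[symmetric] using u_le by (intro power_mono) auto
  also have "\<dots> \<le> K\<^sup>2 * (2 + 2 * (norm x)\<^sup>2)" using power2_sum_le[of 1 "norm x"] by (intro mult_left_mono) auto
  finally have u_sq_le: "(norm u)\<^sup>2 \<le> K\<^sup>2 * (2 + 2 * (norm x)\<^sup>2)" .
  have "(norm (x + u))\<^sup>2 \<le> (norm x + norm u)\<^sup>2" by (intro power_mono norm_triangle_ineq) auto
  also have "\<dots> \<le> 2 * (norm x)\<^sup>2 + 2 * (norm u)\<^sup>2" by (rule power2_sum_le)
  finally have "1 + (norm (x + u))\<^sup>2 \<le> (3 + 4 * K\<^sup>2) * (1 + (norm x)\<^sup>2)"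
    using u_sq_le zero_le_power2[of "norm x"] unfolding distrib_left distrib_right by linarith
  then have "ln (1 + (norm (x + u))\<^sup>2) \<le> ln ((3 + 4 * K\<^sup>2) * (1 + (norm x)\<^sup>2))"
    using pos by (subst ln_le_cancel_iff) (auto intro: mult_pos_pos)
  also have "\<dots> = ln (3 + 4 * K\<^sup>2) + ln (1 + (norm x)\<^sup>2)" by (rule ln_mult_pos[OF pos(2) pos(1)])
  finally have "(ln (1 + (norm (x + u))\<^sup>2) - ln (1 + (norm x)\<^sup>2)) / ln (1 + R\<^sup>2) \<le> ln (3 + 4 * K\<^sup>2) / ln (1 + R\<^sup>2)"
    using ln_1_plus_power2_pos[OF R_pos] by (intro divide_right_mono) auto
  then show ?thesis using log_lyap_le[of R "x + u"] log_lyap_inside[OF R_pos x_le] by (simp add: diff_divide_distrib)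
qed

lemma (in levy_measure) jump_op_quadratic_le:
  assumes f_unit: "f \<in> borel_measurable borel" "\<And>y. 0 \<le> f y" "\<And>y. f y \<le> 1"
    and quadratic: "quadratic_increments f x c" and c_pos: "0 < c" and r_bounds: "0 < r" "r \<le> \<epsilon>"
    and m_nonneg: "0 \<le> m" and L_pos: "0 < L" and near: "\<And>u. norm u < L \<Longrightarrow> f (x + u) - f x \<le> m"
  shows "jump_op r \<mu> f x
    \<le> (2 * (x \<bullet> compensator r \<epsilon> \<mu>) + small_jumps \<epsilon> \<mu>) / c + m * tail_mass \<epsilon> \<mu> + tail_mass L \<mu>"
proof -
  have \<epsilon>_pos: "0 < \<epsilon>" using r_bounds by simp
  let ?mid = "\<lambda>u::'a. indicator {u. r \<le> norm u \<and> norm u < \<epsilon>} u *\<^sub>R u"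
  let ?bound = "\<lambda>u. (2 * (x \<bullet> ?mid u) + indicator {u. norm u < \<epsilon>} u * (norm u)\<^sup>2) / c
    + m * indicator {u. \<epsilon> \<le> norm u} u + indicator {u. L \<le> norm u} u"
  have "has_bochner_integral \<mu> (\<lambda>u. x \<bullet> ?mid u) (x \<bullet> compensator r \<epsilon> \<mu>)"
    unfolding has_bochner_integral_iff compensator_def
    using compensator_integrable[OF r_bounds(1) less_imp_le[OF \<epsilon>_pos]] integrable_inner_right
      integral_inner_right by blast
  then have bound: "has_bochner_integral \<mu> ?bound
      ((2 * (x \<bullet> compensator r \<epsilon> \<mu>) + small_jumps \<epsilon> \<mu>) / c + m * tail_mass \<epsilon> \<mu> + tail_mass L \<mu>)"
    unfolding small_jumps_def tail_mass_def
    by (intro has_bochner_integral_add has_bochner_integral_divide_zero has_bochner_integral_mult_right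
        has_bochner_integral_integrable small_jumps_integrable tail_mass_integrable \<epsilon>_pos L_pos)
  have "jump_op r \<mu> f x \<le> (\<integral>u. ?bound u \<partial>\<mu>)"
    unfolding jump_op_def
  proof (rule integral_mono[OF jump_op_integrable[OF r_bounds(1) f_unit(1), of 1] integrable.intros[OF bound]])
    show "\<bar>f y\<bar> \<le> 1" for y using f_unit(2,3)[of y] by simp
    fix u
    have "f (x + u) - f x \<le> (2 * (x \<bullet> u) + (norm u)\<^sup>2) / c" using quadratic by (simp add: quadratic_increments_def)
    moreover have "0 \<le> (norm u)\<^sup>2 / c" using c_pos by simp
    ultimately show "indicator {u. r \<le> norm u} u * (f (x + u) - f x) \<le> ?bound u"
      using near[of u] f_unit(3)[of "x + u"] f_unit(2)[of x] r_bounds(2) m_nonneg by (auto simp: indicator_def)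
  qed
  then show ?thesis unfolding has_bochner_integral_integral_eq[OF bound] .
qed

lemma (in switching) tail_mass_nu_le:
  assumes k_regime: "k \<in> {1..n0}" and K_pos: "0 < K" and y_le: "norm y \<le> norm x + 1"
  shows "tail_mass (K * (1 + norm x)) (\<nu> y k) \<le> tail_mass K (\<nu> 0 k) + 2 * H * \<rho> 1 / K"
proof -
  interpret pair: levy_pair "\<nu> y k" "\<nu> 0 k" C\<nu> "H * \<rho> (norm y)" using levy_pair_nu[OF k_regime, of y 0] by simp
  define m where "m = 1 + norm x"
  have m_bounds: "1 \<le> m" "1 + norm y \<le> 2 * m" using y_le norm_ge_zero[of x] unfolding m_def
    by (auto simp del: norm_ge_zero)
  have "\<rho> (norm y) \<le> \<rho> 1 * (1 + norm y)" by (rule rho_linear_growth) simp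
  also have "\<dots> \<le> \<rho> 1 * (2 * m)" using m_bounds rho_nonneg[of 1] by (intro mult_left_mono) auto
  finally have "H * \<rho> (norm y) / (K * m) \<le> H * (\<rho> 1 * (2 * m)) / (K * m)"
    using m_bounds K_pos H_pos by (intro divide_right_mono mult_left_mono) auto
  also have "\<dots> = 2 * H * \<rho> 1 / K" using m_bounds by (simp add: mult_ac)
  finally have "H * \<rho> (norm y) / (K * m) \<le> 2 * H * \<rho> 1 / K" .
  moreover have "tail_mass (K * m) (\<nu> y k) \<le> tail_mass (K * m) (\<nu> 0 k) + H * \<rho> (norm y) / (K * m)"
    using m_bounds K_pos by (intro pair.tail_mass_diff_le) auto
  moreover have "tail_mass (K * m) (\<nu> 0 k) \<le> tail_mass K (\<nu> 0 k)"
    using m_bounds K_pos by (intro pair.second.tail_mass_antimono) auto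
  ultimately show ?thesis by (simp add: m_def)
qed

context switching begin

definition growth_bound :: "real \<Rightarrow> real \<Rightarrow> real" where
  "growth_bound C K = 3 * C + 2 + max 1 (\<epsilon>0\<^sup>2) * C\<nu> + ln (3 + 4 * K\<^sup>2) * tail_bound C\<nu> \<epsilon>0"

context
  fixes x y :: "real^'d" and k :: nat and C K R \<tau> r :: real
  assumes k_regime: "k \<in> {1..n0}" and R_pos: "0 < R" and x_le: "norm x \<le> R" and K_pos: "0 < K"
    and \<tau>_pos: "0 < \<tau>" and r_bounds: "0 < r" "r \<le> \<epsilon>0"
    and growth: "0 \<le> C" "2 * (y \<bullet> b y k) + (norm (\<sigma> y k))\<^sup>2 \<le> C * (1 + (norm y)\<^sup>2)"
    and near: "norm (x - y) \<le> 1" "2 * norm (x - y) * norm (b y k) \<le> 1"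
    and drift: "\<tau> * (norm (drift r (R + 3) y k))\<^sup>2 \<le> 1"
begin

private lemma norm_near_le: "norm y \<le> norm x + 1"
  using norm_triangle_ineq2[of y x] near(1) by (simp add: norm_minus_commute)

private lemma quadratic_form_le:
  "2 * (x \<bullet> b y k) + \<tau> * (norm (drift r (R + 3) y k))\<^sup>2 + (norm (\<sigma> y k))\<^sup>2 + small_jumps \<epsilon>0 (\<nu> y k)
    \<le> (3 * C + 2 + max 1 (\<epsilon>0\<^sup>2) * C\<nu>) * (1 + (norm x)\<^sup>2)"
proof -
  define a where "a = 1 + (norm x)\<^sup>2"
  interpret levy_measure "\<nu> y k" C\<nu> by (rule levy_measure_nu[OF k_regime])
  have "1 \<le> a" by (simp add: a_def)
  have "(x - y) \<bullet> b y k \<le> norm (x - y) * norm (b y k)" by (rule norm_cauchy_schwarz)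
  then have shift: "2 * (x \<bullet> b y k) \<le> 2 * (y \<bullet> b y k) + 1" using near(2) by (simp add: inner_diff_left)
  have "(norm y)\<^sup>2 \<le> (norm x + 1)\<^sup>2" using norm_near_le by (intro power_mono) auto
  also have "\<dots> \<le> 2 * a" using power2_sum_le[of "norm x" 1] by (simp add: a_def)
  finally have "1 + (norm y)\<^sup>2 \<le> 3 * a" using \<open>1 \<le> a\<close> by linarith
  then have "C * (1 + (norm y)\<^sup>2) \<le> C * (3 * a)" using growth(1) by (rule mult_left_mono)
  moreover have "(2 + max 1 (\<epsilon>0\<^sup>2) * C\<nu>) * 1 \<le> (2 + max 1 (\<epsilon>0\<^sup>2) * C\<nu>) * a"
    using C_nonneg \<open>1 \<le> a\<close> by (intro mult_left_mono) auto
  ultimately show ?thesis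
    using shift drift growth(2) small_jumps_le[of \<epsilon>0] unfolding a_def[symmetric] by (simp add: algebra_simps)
qed

lemma approx_gen_log_lyap_le:
  "approx_gen \<tau> r (R + 3) (\<lambda>_. log_lyap R) y x k
    \<le> growth_bound C K / ln (1 + R\<^sup>2) + tail_mass K (\<nu> 0 k) + 2 * H * \<rho> 1 / K"
proof -
  define ell where "ell = ln (1 + R\<^sup>2)"
  define a where "a = 1 + (norm x)\<^sup>2"
  let ?\<beta> = "drift r (R + 3) y k" and ?lnK = "ln (3 + 4 * K\<^sup>2)"
  interpret levy_measure "\<nu> y k" C\<nu> by (rule levy_measure_nu[OF k_regime])
  have ell: "0 < ell" using ln_1_plus_power2_pos[OF R_pos] by (simp add: ell_def)
  have a_ge_1: "1 \<le> a" by (simp add: a_def)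
  have lnK: "0 \<le> ?lnK" by (intro ln_ge_zero) (simp add: add_increasing2)
  have inside: "norm y \<le> R + 3" using norm_near_le x_le by simp
  note quadratic = log_lyap_quadratic_increments[OF R_pos x_le, folded a_def ell_def]
  have "jump_op r (\<nu> y k) (log_lyap R) x \<le> (2 * (x \<bullet> compensator r \<epsilon>0 (\<nu> y k)) + small_jumps \<epsilon>0 (\<nu> y k)) / (a * ell)
      + ?lnK / ell * tail_mass \<epsilon>0 (\<nu> y k) + tail_mass (K * (1 + norm x)) (\<nu> y k)"
    using a_ge_1 ell lnK K_pos r_bounds log_lyap_increment_le[OF R_pos x_le, of _ K]
    by (intro jump_op_quadratic_le quadratic log_lyap_measurable log_lyap_nonneg log_lyap_le_1 mult_pos_pos)
      (auto simp: ell_def intro: add_pos_nonneg)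
  also have "?lnK / ell * tail_mass \<epsilon>0 (\<nu> y k) \<le> ?lnK / ell * tail_bound C\<nu> \<epsilon>0"
    using tail_mass_le[OF eps0_pos] lnK ell by (intro mult_left_mono) auto
  finally have "approx_gen \<tau> r (R + 3) (\<lambda>_. log_lyap R) y x k
      \<le> (2 * (x \<bullet> ?\<beta>) + \<tau> * (norm ?\<beta>)\<^sup>2) / (a * ell) + (norm (\<sigma> y k))\<^sup>2 / (a * ell)
      + ((2 * (x \<bullet> compensator r \<epsilon>0 (\<nu> y k)) + small_jumps \<epsilon>0 (\<nu> y k)) / (a * ell)
      + ?lnK / ell * tail_bound C\<nu> \<epsilon>0 + (tail_mass K (\<nu> 0 k) + 2 * H * \<rho> 1 / K))"
    using forward_quotient_quadratic_le[OF quadratic \<tau>_pos, of ?\<beta>]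
      sum_central_quotient_quadratic_le[OF quadratic \<tau>_pos, of "\<sigma> y k"]
        tail_mass_nu_le[OF k_regime K_pos norm_near_le] inside
    unfolding approx_gen_def by (simp add: switch_part_def diffusion_def)
  also have "\<dots> = (2 * (x \<bullet> b y k) + \<tau> * (norm ?\<beta>)\<^sup>2 + (norm (\<sigma> y k))\<^sup>2 + small_jumps \<epsilon>0 (\<nu> y k)) / (a * ell)
      + ?lnK * tail_bound C\<nu> \<epsilon>0 / ell + (tail_mass K (\<nu> 0 k) + 2 * H * \<rho> 1 / K)"
    using inside by (simp add: drift_def inner_diff_right add_divide_distrib diff_divide_distrib)
  also have "(2 * (x \<bullet> b y k) + \<tau> * (norm ?\<beta>)\<^sup>2 + (norm (\<sigma> y k))\<^sup>2 + small_jumps \<epsilon>0 (\<nu> y k)) / (a * ell)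
      \<le> (3 * C + 2 + max 1 (\<epsilon>0\<^sup>2) * C\<nu>) * a / (a * ell)"
    using quadratic_form_le a_ge_1 ell by (intro divide_right_mono) (auto simp: a_def)
  finally show ?thesis using a_ge_1 by (simp add: growth_bound_def add_divide_distrib ell_def)
qed

end

lemma eventually_divide_ln_le:
  fixes c d :: real
  assumes "0 < d" shows "\<forall>\<^sub>F R in at_top. c / ln (1 + R\<^sup>2) \<le> d"
proof -
  have "filterlim (\<lambda>R::real. ln (1 + R\<^sup>2)) at_top at_top"
    by (intro filterlim_compose[OF ln_at_top] filterlim_tendsto_add_at_top[OF tendsto_const] filterlim_pow_at_top
        filterlim_ident) simp
  then have "((\<lambda>R. c / ln (1 + R\<^sup>2)) \<longlongrightarrow> 0) at_top" by (rule real_tendsto_divide_at_top[OF tendsto_const])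
  then have "\<forall>\<^sub>F R in at_top. c / ln (1 + R\<^sup>2) < d" by (rule order_tendstoD(2)[OF _ assms])
  then show ?thesis by (rule eventually_mono) simp
qed

definition lyap_controlled :: "real \<Rightarrow> real \<Rightarrow> bool" where
  "lyap_controlled \<theta> R \<longleftrightarrow> (\<forall>\<tau> r k x y. 0 < \<tau> \<longrightarrow> 0 < r \<longrightarrow> r \<le> \<epsilon>0 \<longrightarrow> k \<in> {1..n0} \<longrightarrow> norm x \<le> R \<longrightarrow>
    norm (x - y) \<le> 1 \<longrightarrow> 2 * norm (x - y) * norm (b y k) \<le> 1 \<longrightarrow> \<tau> * (norm (drift r (R + 3) y k))\<^sup>2 \<le> 1 \<longrightarrow>
    approx_gen \<tau> r (R + 3) (\<lambda>_. log_lyap R) y x k \<le> \<theta>)"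

lemma lyap_controlledD:
  assumes "lyap_controlled \<theta> R" "0 < \<tau>" "0 < r" "r \<le> \<epsilon>0" "k \<in> {1..n0}" "norm x \<le> R"
    "norm (x - y) \<le> 1" "2 * norm (x - y) * norm (b y k) \<le> 1" "\<tau> * (norm (drift r (R + 3) y k))\<^sup>2 \<le> 1"
  shows "approx_gen \<tau> r (R + 3) (\<lambda>_. log_lyap R) y x k \<le> \<theta>"
  using assms unfolding lyap_controlled_def by blast

lemma eventually_lyap_controlled:
  assumes \<theta>_pos: "0 < \<theta>" shows "\<forall>\<^sub>F R in at_top. lyap_controlled \<theta> R"
proof -
  obtain C where growth: "0 \<le> C" "\<And>k y. k \<in> {1..n0} \<Longrightarrow> 2 * (y \<bullet> b y k) + (norm (\<sigma> y k))\<^sup>2 \<le> C * (1 + (norm y)\<^sup>2)"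
    using coefficients_quadratic_growth by blast
  have "(\<lambda>n. 2 * H * \<rho> 1 * (1 / real (Suc n))) \<longlonglongrightarrow> 2 * H * \<rho> 1 * 0"
    by (intro tendsto_intros LIMSEQ_Suc[OF lim_1_over_n])
  then have "\<forall>\<^sub>F n in sequentially. 2 * H * \<rho> 1 * (1 / real (Suc n)) < \<theta> / 3"
    by (rule order_tendstoD(2)) (use \<theta>_pos in simp)
  moreover have "\<forall>\<^sub>F n in sequentially. \<forall>k\<in>{1..n0}. tail_mass (real (Suc n)) (\<nu> 0 k) < \<theta> / 3"
    using \<theta>_pos by (intro eventually_tail_mass_less) simp
  ultimately have "\<forall>\<^sub>F n in sequentially. 2 * H * \<rho> 1 * (1 / real (Suc n)) < \<theta> / 3 \<and>
      (\<forall>k\<in>{1..n0}. tail_mass (real (Suc n)) (\<nu> 0 k) < \<theta> / 3)" by (rule eventually_conj)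
  then obtain K where K_large: "0 < K" "2 * H * \<rho> 1 / K \<le> \<theta> / 3" "\<And>k. k \<in> {1..n0} \<Longrightarrow> tail_mass K (\<nu> 0 k) \<le> \<theta> / 3"
    using eventually_happens'[OF sequentially_bot] of_nat_0_less_iff zero_less_Suc
    by (metis (no_types, lifting) less_imp_le mult.right_neutral times_divide_eq_right)
  have "\<forall>\<^sub>F R in at_top. 0 < R \<and> growth_bound C K / ln (1 + R\<^sup>2) \<le> \<theta> / 3"
    using \<theta>_pos by (intro eventually_conj eventually_gt_at_top eventually_divide_ln_le) simp
  then show ?thesis
  proof (rule eventually_mono)
    fix R assume R_large: "0 < R \<and> growth_bound C K / ln (1 + R\<^sup>2) \<le> \<theta> / 3"
    show "lyap_controlled \<theta> R"
      unfolding lyap_controlled_def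
    proof (intro allI impI)
      fix \<tau> r :: real and k and x y :: "real^'d"
      assume "0 < \<tau>" "0 < r" "r \<le> \<epsilon>0" and k_regime: "k \<in> {1..n0}" and "norm x \<le> R" "norm (x - y) \<le> 1"
        "2 * norm (x - y) * norm (b y k) \<le> 1" "\<tau> * (norm (drift r (R + 3) y k))\<^sup>2 \<le> 1"
      then have "approx_gen \<tau> r (R + 3) (\<lambda>_. log_lyap R) y x k
          \<le> growth_bound C K / ln (1 + R\<^sup>2) + tail_mass K (\<nu> 0 k) + 2 * H * \<rho> 1 / K"
        using R_large K_large(1) by (intro approx_gen_log_lyap_le growth) auto
      then show "approx_gen \<tau> r (R + 3) (\<lambda>_. log_lyap R) y x k \<le> \<theta>"
        using R_large K_large(2) K_large(3)[OF k_regime] by linarith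
    qed
  qed
qed

end

section \<open>Comparison along the Euler sequence\<close>

definition (in switching) coupling_const :: real where
  "coupling_const = 6 * H + real n0 * H / \<rho> 1"

lemma (in switching) coupling_const_nonneg: "0 \<le> coupling_const"
  using H_pos rho_nonneg[of 1] by (simp add: coupling_const_def)

locale coupled_scheme = scheme \<rho> n0 \<epsilon>0 H C\<nu> qmax a \<sigma> b \<nu> q \<tau> r h \<epsilon> R
  for \<rho> n0 \<epsilon>0 H C\<nu> qmax
    and a \<sigma> :: "real^'d::finite \<Rightarrow> nat \<Rightarrow> real^'d^'d" and b \<nu> q \<tau> r h \<epsilon> R +
  fixes \<delta> Amax B B\<beta> \<theta> \<zeta> :: real
  assumes R_pos: "0 < R" and delta: "0 < \<delta>" "4 * \<epsilon> \<le> \<delta>" and eps_small: "2 * \<epsilon> \<le> 1"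
    and drift_le: "k \<in> {1..n0} \<Longrightarrow> norm y \<le> R + 3 \<Longrightarrow> norm (b y k) \<le> B"
      "k \<in> {1..n0} \<Longrightarrow> norm y \<le> R + 3 \<Longrightarrow> norm (drift r (R + 3) y k) \<le> B\<beta>"
    and lyap_le: "k \<in> {1..n0} \<Longrightarrow> norm x \<le> R \<Longrightarrow> norm (x - y) \<le> 2 * \<epsilon> \<Longrightarrow> G (\<lambda>_. log_lyap R) y x k \<le> \<theta>"
    and zeta_nonneg: "0 \<le> \<zeta>"
    and error_le: "Amax * ((8 * \<epsilon> * B + 2 * \<tau> * B\<beta>\<^sup>2) / \<delta>) + 2 * \<theta> + 4 * (real n0 * H) * \<epsilon> \<le> \<zeta>"
begin

abbreviation lyap :: "real^'d \<Rightarrow> real" where "lyap \<equiv> log_lyap R"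

abbreviation C :: real where "C \<equiv> coupling_const"

lemma lyap_unit: "unit_valued (\<lambda>_. lyap)"
  by (simp add: unit_valued_def log_lyap_measurable log_lyap_nonneg log_lyap_le_1)

lemma one_le_majorant:
  assumes "1 \<le> A" "0 \<le> \<beta>" "R \<le> norm x \<or> R \<le> norm z \<or> 1 \<le> soft_norm \<delta> (x - z)"
  shows "1 \<le> majorant lyap \<delta> A \<beta> x z"
proof -
  let ?D = "soft_norm \<delta> (x - z)"
  have "1 * ?D \<le> A * ?D" by (intro mult_right_mono assms soft_norm_nonneg)
  moreover have "lyap x = 1" if "R \<le> norm x" for x by (rule log_lyap_outside[OF R_pos that])
  ultimately show ?thesis
    using assms soft_norm_nonneg[of \<delta> "x - z"] log_lyap_nonneg[of R x] log_lyap_nonneg[of R z]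
    unfolding majorant_def by (smt (verit))
qed

lemma majorant_nonneg: "0 \<le> A \<Longrightarrow> 0 \<le> \<beta> \<Longrightarrow> 0 \<le> majorant lyap \<delta> A \<beta> x z"
  by (simp add: majorant_def log_lyap_nonneg soft_norm_nonneg)

lemma dominated_initial:
  assumes g_unit: "unit_valued g" and g_lipschitz: "\<And>k. k \<in> {1..n0} \<Longrightarrow> L-lipschitz_on UNIV (g k)"
    and A_bounds: "1 \<le> A" "L \<le> A"
  shows "dominated lyap \<delta> A 0 (iterate g 0) (iterate (\<lambda>k x. 1 - g k x) 0)"
  unfolding dominated_def
proof (intro ballI allI)
  fix k and x z :: "real^'d" assume k_regime: "k \<in> {1..n0}"
  show "iterate g 0 k x + iterate (\<lambda>k x. 1 - g k x) 0 k z - 1 \<le> majorant lyap \<delta> A 0 x z"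
  proof (cases "R \<le> norm x \<or> R \<le> norm z")
    case True
    have "iterate g 0 k x \<le> 1" "iterate (\<lambda>k x. 1 - g k x) 0 k z \<le> 1"
      using unit_valuedD(2,3)[OF g_unit k_regime] cutoff_le_1 by (simp_all add: iterate_0)
    moreover have "1 \<le> majorant lyap \<delta> A 0 x z" using A_bounds True by (intro one_le_majorant) auto
    ultimately show ?thesis by linarith
  next
    case False
    then have "cutoff x = 0" "cutoff z = 0" by (auto intro: cutoff_inside)
    then have "iterate g 0 k x + iterate (\<lambda>k x. 1 - g k x) 0 k z - 1 = g k x - g k z"
      using unit_valuedD(2,3)[OF g_unit k_regime] by (simp add: iterate_0 max_def)
    also have "\<dots> \<le> L * norm (x - z)" using lipschitz_on_UNIV_abs_diff_le[OF g_lipschitz[OF k_regime], of x z] by simp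
    also have "\<dots> \<le> A * soft_norm \<delta> (x - z)" using A_bounds norm_le_soft_norm by (intro mult_mono) auto
    finally show ?thesis using log_lyap_nonneg[of R x] log_lyap_nonneg[of R z] by (simp add: majorant_def)
  qed
qed

lemma coupling_rate_le:
  assumes k_regime: "k \<in> {1..n0}" and inside: "norm x \<le> R" "norm z \<le> R" and close: "soft_norm \<delta> (x - z) \<le> 1"
    and near: "norm (x - y) \<le> 2 * \<epsilon>" "norm (z - y') \<le> 2 * \<epsilon>" and A_bounds: "1 \<le> A" "A \<le> Amax"
  shows "coupling_rate lyap \<delta> A x z y y' k \<le> A * (C * \<rho> (soft_norm \<delta> (x - z))) + \<zeta>"
proof -
  define D where "D = soft_norm \<delta> (x - z)"
  define E where "E = (8 * \<epsilon> * B + 2 * \<tau> * B\<beta>\<^sup>2) / \<delta>"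
  have D_bounds: "0 < D" "D \<le> 1" using soft_norm_pos[OF delta(1)] close by (auto simp: D_def)
  have y_le: "norm y \<le> R + 3" "norm y' \<le> R + 3"
    using norm_triangle_ineq2[of y x] norm_triangle_ineq2[of y' z] near inside eps_small
    by (auto simp: norm_minus_commute)
  note b_le = drift_le(1)[OF k_regime y_le(1)] drift_le(1)[OF k_regime y_le(2)]
    and drift_norm_le = drift_le(2)[OF k_regime y_le(1)] drift_le(2)[OF k_regime y_le(2)]
  have "0 \<le> B" using b_le(1) norm_ge_zero[of "b y k"] by linarith
  then have "0 \<le> E" using eps_pos tau_pos delta by (simp add: E_def)
  have "A * (pair_gen \<delta> (x - z) y y' k + H * \<rho> (norm (y - y'))) \<le> A * (6 * H * \<rho> D + E)"
    using pair_gen_le[OF k_regime delta y_le near b_le drift_norm_le] A_bounds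
    by (intro mult_left_mono) (auto simp: D_def E_def)
  moreover have "A * E \<le> Amax * E" using A_bounds \<open>0 \<le> E\<close> by (intro mult_right_mono) auto
  moreover have "real n0 * (H * norm (y - y')) \<le> A * (real n0 * H / \<rho> 1 * \<rho> D) + 4 * (real n0 * H) * \<epsilon>"
  proof -
    have "\<rho> 1 \<le> 1 / D * \<rho> D" using D_bounds by (intro rho_le_slope) auto
    then have "D \<le> 1 * (\<rho> D / \<rho> 1)" using D_bounds rho_pos[of 1] by (simp add: field_simps)
    also have "\<dots> \<le> A * (\<rho> D / \<rho> 1)" using A_bounds rho_nonneg[of D] rho_nonneg[of 1] D_bounds
      by (intro mult_right_mono) auto
    finally have "norm (y - y') \<le> A * (\<rho> D / \<rho> 1) + 4 * \<epsilon>"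
      using norm_near_pair_le[OF k_regime delta y_le near b_le drift_norm_le] by (simp add: D_def)
    then have "real n0 * H * norm (y - y') \<le> real n0 * H * (A * (\<rho> D / \<rho> 1) + 4 * \<epsilon>)"
      using H_pos by (intro mult_left_mono) auto
    then show ?thesis by (simp add: algebra_simps)
  qed
  moreover have "G (\<lambda>_. lyap) y x k \<le> \<theta>" "G (\<lambda>_. lyap) y' z k \<le> \<theta>" using lyap_le[OF k_regime] inside near by auto
  ultimately show ?thesis
    using error_le unfolding coupling_rate_def coupling_const_def D_def[symmetric] E_def[symmetric]
    by (simp add: algebra_simps)
qed

text \<open>The supergradient inequality \<open>\<rho> D \<le> \<rho> t + p (D - t)\<close> keeps the majorant affine in the distance \<open>D\<close>.\<close>
lemma dominated_shaken:
  assumes adm: "admissible U" "admissible U'" and dom: "dominated lyap \<delta> A \<beta> U U'"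
    and A_bounds: "1 \<le> A" "A \<le> Amax" and \<beta>_nonneg: "0 \<le> \<beta>"
    and supergradient: "0 \<le> p" "0 \<le> \<rho> t - p * t" "\<And>s. 0 \<le> s \<Longrightarrow> \<rho> s \<le> \<rho> t + p * (s - t)"
  shows "dominated lyap \<delta> (A * (1 + h * C * p)) (\<beta> + h * (A * (C * (\<rho> t - p * t)) + \<zeta>)) (shaken U) (shaken U')"
  unfolding dominated_def
proof (intro ballI allI)
  fix k and x z :: "real^'d" assume k_regime: "k \<in> {1..n0}"
  let ?A' = "A * (1 + h * C * p)" and ?\<beta>' = "\<beta> + h * (A * (C * (\<rho> t - p * t)) + \<zeta>)" and ?D = "soft_norm \<delta> (x - z)"
  let ?\<Phi> = "majorant lyap \<delta> ?A' ?\<beta>' x z"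
  have hCp: "0 \<le> h * C * p" using h_pos coupling_const_nonneg supergradient(1) by simp
  have "1 * 1 \<le> ?A'" using A_bounds hCp by (intro mult_mono) auto
  then have A'_ge_1: "1 \<le> ?A'" by simp
  have \<beta>'_nonneg: "0 \<le> ?\<beta>'"
    using \<beta>_nonneg A_bounds supergradient(2) h_pos zeta_nonneg coupling_const_nonneg
    by (intro add_nonneg_nonneg mult_nonneg_nonneg) auto
  show "shaken U k x + shaken U' k z - 1 \<le> ?\<Phi>"
  proof (cases "R \<le> norm x \<or> R \<le> norm z \<or> 1 \<le> ?D")
    case True
    have "shaken U k x \<le> 1" "shaken U' k z \<le> 1"
      by (intro unit_valuedD(3)[OF _ k_regime] admissibleD(1) admissible_shaken adm)+
    then show ?thesis using one_le_majorant[OF A'_ge_1 \<beta>'_nonneg True] by linarith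
  next
    case False
    then have inside: "norm x \<le> R" "norm z \<le> R" "?D \<le> 1" by auto
    show ?thesis
    proof (rule shaken_pair_le[OF admissibleD(1)[OF adm(1)] admissibleD(1)[OF adm(2)] k_regime])
      fix y y' assume near: "norm (x - y) \<le> 2 * \<epsilon>" "norm (z - y') \<le> 2 * \<epsilon>"
      have "step U y x k + step U' y' z k - 1 \<le> majorant lyap \<delta> A \<beta> x z + h * coupling_rate lyap \<delta> A x z y y' k"
        using A_bounds
        by (intro step_coupling[OF admissibleD(1)[OF adm(1)] admissibleD(1)[OF adm(2)] lyap_unit _ dom
          k_regime]) simp
      also have "coupling_rate lyap \<delta> A x z y y' k \<le> A * (C * \<rho> ?D) + \<zeta>"
        by (rule coupling_rate_le[OF k_regime inside near A_bounds])
      also have "\<dots> \<le> A * (C * (\<rho> t + p * (?D - t))) + \<zeta>"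
        using A_bounds coupling_const_nonneg
        by (intro add_right_mono mult_left_mono supergradient(3) soft_norm_nonneg) auto
      finally have "step U y x k + step U' y' z k - 1
          \<le> majorant lyap \<delta> A \<beta> x z + h * (A * (C * (\<rho> t + p * (?D - t))) + \<zeta>)"
        using h_pos by simp
      also have "\<dots> = ?\<Phi>" by (simp add: majorant_def algebra_simps)
      finally show "step U y x k + step U' y' z k - 1 \<le> ?\<Phi>" .
    qed (use inside A'_ge_1 \<beta>'_nonneg in \<open>auto intro!: cutoff_inside majorant_nonneg\<close>)
  qed
qed

lemma dominated_euler_step:
  assumes adm: "admissible U" "admissible U'" and dom: "dominated lyap \<delta> A \<beta> U U'"
    and A_bounds: "1 \<le> A" "A \<le> Amax" and \<beta>_nonneg: "0 \<le> \<beta>" and s0_le: "0 < s0" "s0 \<le> t"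
  obtains A' \<beta>' where "A \<le> A'" "A' \<le> A * (1 + h * C * (\<rho> s0 / s0))" "0 \<le> \<beta>'"
    "A' * t + \<beta>' = A * (t + h * C * \<rho> t) + \<beta> + h * \<zeta>" "dominated lyap \<delta> A' \<beta>' (shaken U) (shaken U')"
proof -
  have "0 < t" using s0_le by simp
  then obtain p where supergradient: "0 \<le> p" "p \<le> \<rho> t / t" "\<And>s. 0 \<le> s \<Longrightarrow> \<rho> s \<le> \<rho> t + p * (s - t)"
    using rho_supergradient by blast
  have hC_nonneg: "0 \<le> h * C" using h_pos coupling_const_nonneg by simp
  have "\<rho> t / t \<le> t / s0 * \<rho> s0 / t" using rho_le_slope[OF s0_le] \<open>0 < t\<close> by (intro divide_right_mono) auto
  then have p_le: "p \<le> \<rho> s0 / s0" using supergradient(2) \<open>0 < t\<close> by simp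
  have tangent_nonneg: "0 \<le> \<rho> t - p * t" using supergradient(2) \<open>0 < t\<close> by (simp add: pos_le_divide_eq)
  show ?thesis
  proof (rule that)
    show "dominated lyap \<delta> (A * (1 + h * C * p)) (\<beta> + h * (A * (C * (\<rho> t - p * t)) + \<zeta>)) (shaken U) (shaken U')"
      by (rule dominated_shaken[OF adm dom A_bounds \<beta>_nonneg supergradient(1) tangent_nonneg supergradient(3)])
    have "A * 1 \<le> A * (1 + h * C * p)" using A_bounds hC_nonneg supergradient(1) by (intro mult_left_mono) auto
    then show "A \<le> A * (1 + h * C * p)" by simp
    show "A * (1 + h * C * p) \<le> A * (1 + h * C * (\<rho> s0 / s0))"
      using A_bounds hC_nonneg p_le by (intro mult_left_mono add_left_mono) auto
    show "0 \<le> \<beta> + h * (A * (C * (\<rho> t - p * t)) + \<zeta>)"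
      using \<beta>_nonneg A_bounds tangent_nonneg h_pos zeta_nonneg coupling_const_nonneg
      by (intro add_nonneg_nonneg mult_nonneg_nonneg) auto
  qed (simp add: algebra_simps)
qed

context
  fixes g :: "nat \<Rightarrow> real^'d \<Rightarrow> real" and L A0 s0 :: real and N :: nat
  assumes g_unit: "unit_valued g" and g_lipschitz: "\<And>k. k \<in> {1..n0} \<Longrightarrow> L-lipschitz_on UNIV (g k)"
    and A0_bounds: "1 \<le> A0" "L \<le> A0" and s0_pos: "0 < s0"
    and Amax: "A0 * exp (C * (\<rho> s0 / s0) * (real N * h)) \<le> Amax"
begin

private lemma growth_le_Amax:
  assumes "n \<le> N" shows "A0 * (1 + h * C * (\<rho> s0 / s0)) ^ n \<le> Amax"
proof -
  let ?c = "h * C * (\<rho> s0 / s0)"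
  have c_nonneg: "0 \<le> ?c" using h_pos coupling_const_nonneg s0_pos rho_nonneg[of s0] by simp
  have "(1 + ?c) ^ n \<le> exp ?c ^ n" using c_nonneg by (intro power_mono exp_ge_add_one_self) auto
  also have "\<dots> = exp (real n * ?c)" by (rule exp_of_nat_mult[symmetric])
  also have "\<dots> \<le> exp (real N * ?c)" unfolding exp_le_cancel_iff using c_nonneg assms by (intro mult_right_mono) auto
  finally have "A0 * (1 + ?c) ^ n \<le> A0 * exp (real N * ?c)" using A0_bounds by (intro mult_left_mono) auto
  then show ?thesis using Amax by (simp add: mult_ac)
qed

lemma dominated_iterate:
  assumes "n \<le> N"
  shows "\<exists>A \<beta>. A0 \<le> A \<and> A \<le> A0 * (1 + h * C * (\<rho> s0 / s0)) ^ n \<and> 0 \<le> \<beta> \<and>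
    A * euler_seq (h * C) s0 (N - n) + \<beta> \<le> A0 * euler_seq (h * C) s0 N + real n * (h * \<zeta>) \<and>
    dominated lyap \<delta> A \<beta> (iterate g n) (iterate (\<lambda>k x. 1 - g k x) n)"
  using assms
proof (induction n)
  case 0
  show ?case using dominated_initial[OF g_unit g_lipschitz A0_bounds] by (intro exI[of _ A0] exI[of _ 0]) simp
next
  case (Suc n)
  let ?s = "euler_seq (h * C) s0" and ?c = "1 + h * C * (\<rho> s0 / s0)"
  obtain A \<beta> where A_ge: "A0 \<le> A" "A \<le> A0 * ?c ^ n" and \<beta>_nonneg: "0 \<le> \<beta>"
    and sum: "A * ?s (N - n) + \<beta> \<le> A0 * ?s N + real n * (h * \<zeta>)"
    and dom: "dominated lyap \<delta> A \<beta> (iterate g n) (iterate (\<lambda>k x. 1 - g k x) n)"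
    using Suc by auto
  have adm: "admissible (iterate g n)" "admissible (iterate (\<lambda>k x. 1 - g k x) n)"
    by (rule admissible_iterate[OF g_unit g_lipschitz], assumption)
      (rule admissible_iterate[OF unit_valued_compl[OF g_unit] lipschitz_on_compl[OF g_lipschitz]])
  have hC_nonneg: "0 \<le> h * C" using h_pos coupling_const_nonneg by simp
  have "A \<le> Amax" using A_ge(2) growth_le_Amax[of n] Suc.prems by simp
  moreover have "1 \<le> A" using A0_bounds A_ge by simp
  ultimately obtain A' \<beta>' where step: "A \<le> A'" "A' \<le> A * ?c" "0 \<le> \<beta>'"
    "A' * ?s (N - Suc n) + \<beta>' = A * (?s (N - Suc n) + h * C * \<rho> (?s (N - Suc n))) + \<beta> + h * \<zeta>"
    "dominated lyap \<delta> A' \<beta>' (iterate g (Suc n)) (iterate (\<lambda>k x. 1 - g k x) (Suc n))"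
    using dominated_euler_step[OF adm dom _ _ \<beta>_nonneg s0_pos euler_seq_ge[OF hC_nonneg s0_pos]]
      unfolding iterate_Suc by metis
  have "N - n = Suc (N - Suc n)" using Suc.prems by simp
  then have "A' * ?s (N - Suc n) + \<beta>' \<le> A0 * ?s N + real (Suc n) * (h * \<zeta>)"
    using step(4) sum by (simp add: algebra_simps)
  moreover have "0 \<le> ?c" using hC_nonneg s0_pos rho_nonneg[of s0] by simp
  then have "A' \<le> A0 * ?c ^ Suc n"
    using mult_right_mono[OF A_ge(2), of ?c] step(2) by (simp add: mult_ac)
  ultimately show ?case using A_ge step by (intro exI[of _ A'] exI[of _ \<beta>']) auto
qed

theorem iterate_comparison:
  assumes k_regime: "k \<in> {1..n0}" and close: "soft_norm \<delta> (x - z) \<le> s0"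
  shows "iterate g N k x + iterate (\<lambda>k x. 1 - g k x) N k z - 1
    \<le> A0 * euler_seq (h * C) s0 N + real N * (h * \<zeta>) + lyap x + lyap z"
proof -
  obtain A \<beta> where A_ge: "A0 \<le> A" and sum: "A * s0 + \<beta> \<le> A0 * euler_seq (h * C) s0 N + real N * (h * \<zeta>)"
    and dom: "dominated lyap \<delta> A \<beta> (iterate g N) (iterate (\<lambda>k x. 1 - g k x) N)"
    using dominated_iterate[OF order.refl] by auto
  have "A * soft_norm \<delta> (x - z) \<le> A * s0" using close A_ge A0_bounds by (intro mult_left_mono) auto
  then show ?thesis using dominatedD[OF dom k_regime, of x z] sum by (simp add: majorant_def)
qed

end

end

section \<open>Continuity of the marginals\<close>

locale coupled_iteration =
  coupled_scheme \<rho> n0 \<epsilon>0 H C\<nu> qmax a \<sigma> b \<nu> q \<tau> r h \<epsilon> R \<delta> Amax B B\<beta> \<theta> \<zeta> +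
  mollified_iteration \<rho> n0 \<epsilon>0 H C\<nu> qmax a \<sigma> b \<nu> q \<tau> r h \<epsilon> R \<eta> M\<eta> g L CA \<kappa>
  for \<rho> n0 \<epsilon>0 H C\<nu> qmax
    and a \<sigma> :: "real^'d::finite \<Rightarrow> nat \<Rightarrow> real^'d^'d" and b \<nu> q \<tau> r h \<epsilon> R \<delta> Amax B B\<beta> \<theta> \<zeta> \<eta> M\<eta> g L CA \<kappa>
begin

lemma conv_iterates_le:
  assumes k_regime: "k \<in> {1..n0}"
    and near_le: "\<And>p p'. norm (x - p) < \<epsilon> \<Longrightarrow> norm (z - p') < \<epsilon> \<Longrightarrow>
      iterate g N k p + iterate (\<lambda>k x. 1 - g k x) N k p' - 1 \<le> c"
  shows "conv \<eta> (iterate g N k) x + conv \<eta> (iterate (\<lambda>k x. 1 - g k x) N k) z - 1 \<le> c"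
proof -
  let ?U' = "iterate (\<lambda>k x. 1 - g k x)"
  have "unit_valued (?U' N)"
    by (rule admissibleD(1)[OF admissible_iterate[OF unit_valued_compl[OF g_unit]
      lipschitz_on_compl[OF g_lipschitz]]])
  note U'_bounds = unit_valuedD(1,4)[OF this k_regime] and U_bounds = unit_valuedD(1,4)[OF U_unit k_regime]
  have "conv \<eta> (?U' N k) z \<le> c + 1 - conv \<eta> (U N k) x"
  proof (rule conv_le_of_near[OF U'_bounds])
    fix p' assume p'_near: "norm (z - p') < \<epsilon>"
    have "conv \<eta> (U N k) x \<le> c + 1 - ?U' N k p'"
      by (rule conv_le_of_near[OF U_bounds]) (use near_le p'_near in \<open>fastforce simp: algebra_simps\<close>)
    then show "?U' N k p' \<le> c + 1 - conv \<eta> (U N k) x" by linarith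
  qed
  then show ?thesis by linarith
qed

theorem mean_diff_le:
  assumes A0_bounds: "1 \<le> A0" "L \<le> A0" and s0_pos: "0 < s0"
    and Amax: "A0 * exp (C * (\<rho> s0 / s0) * (real N * h)) \<le> Amax"
    and k_regime: "k \<in> {1..n0}" and P_solution: "solution (x, k) P" and P'_solution: "solution (z, k) P'"
    and close: "norm (x - z) + 2 * \<epsilon> + \<delta> \<le> s0" and X_bounds: "norm x \<le> X" "norm z \<le> X"
  shows "mean P (real N * h) g - mean P' (real N * h) g \<le> A0 * euler_seq (h * C) s0 N + real N * (h * \<zeta>)
    + 2 * (ln (1 + (X + 1)\<^sup>2) / ln (1 + R\<^sup>2)) + 2 * (L * \<epsilon> + real N * (h * err))"
proof -
  let ?g' = "\<lambda>k x. 1 - g k x"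
  interpret compl: mollified_iteration \<rho> n0 \<epsilon>0 H C\<nu> qmax a \<sigma> b \<nu> q \<tau> r h \<epsilon> R \<eta> M\<eta> ?g' L CA \<kappa>
    by unfold_locales (intro unit_valued_compl g_unit lipschitz_on_compl g_lipschitz gen_le consistent; assumption)+
  have "conv \<eta> (iterate g N k) x + conv \<eta> (iterate ?g' N k) z - 1
      \<le> A0 * euler_seq (h * C) s0 N + real N * (h * \<zeta>) + 2 * (ln (1 + (X + 1)\<^sup>2) / ln (1 + R\<^sup>2))"
  proof (rule conv_iterates_le[OF k_regime])
    fix p p' assume p_near: "norm (x - p) < \<epsilon>" "norm (z - p') < \<epsilon>"
    have "norm (p - p') \<le> norm (x - z) + 2 * \<epsilon>"
      using norm_triangle_ineq4[of "x - z" "(x - p) - (z - p')"] norm_triangle_ineq4[of "x - p" "z - p'"] p_near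
      by (simp add: algebra_simps)
    then have "soft_norm \<delta> (p - p') \<le> s0" using soft_norm_le[of \<delta> "p - p'"] delta close by linarith
    then have "iterate g N k p + iterate ?g' N k p' - 1
        \<le> A0 * euler_seq (h * C) s0 N + real N * (h * \<zeta>) + lyap p + lyap p'"
      by (rule iterate_comparison[OF g_unit _ A0_bounds s0_pos Amax k_regime, rotated]) (rule g_lipschitz)
    moreover have "norm p \<le> X + 1" "norm p' \<le> X + 1"
      using norm_triangle_ineq2[of p x] norm_triangle_ineq2[of p' z] p_near X_bounds eps_le_1
      by (auto simp: norm_minus_commute)
    then have "lyap p \<le> ln (1 + (X + 1)\<^sup>2) / ln (1 + R\<^sup>2)" "lyap p' \<le> ln (1 + (X + 1)\<^sup>2) / ln (1 + R\<^sup>2)"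
      by (simp_all add: log_lyap_le_on_ball[OF R_pos])
    ultimately show "iterate g N k p + iterate ?g' N k p' - 1
        \<le> A0 * euler_seq (h * C) s0 N + real N * (h * \<zeta>) + 2 * (ln (1 + (X + 1)\<^sup>2) / ln (1 + R\<^sup>2))"
      by linarith
  qed
  moreover have "mean P' (real N * h) ?g' = 1 - mean P' (real N * h) g"
    using mean_affine[OF P'_solution _ unit_valued_bounded_by[OF g_unit], of "real N * h" "-1" 1] h_pos by simp
  moreover note mean_le_mollified_iterate[OF P_solution k_regime, of N]
    compl.mean_le_mollified_iterate[OF P'_solution k_regime, of N]
  ultimately show ?thesis unfolding distrib_left[of 2] by linarith
qed

end

lemma eventually_linear_le:
  fixes c d :: real
  assumes "0 < d" shows "\<forall>\<^sub>F t in at_right 0. c * t \<le> d"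
proof -
  have "((\<lambda>t. c * t) \<longlongrightarrow> c * 0) (at_right 0)" by (intro tendsto_intros tendsto_ident_at)
  then have "\<forall>\<^sub>F t in at_right 0. c * t < d" by (rule order_tendstoD(2)) (use assms in simp)
  then show ?thesis by (rule eventually_mono) simp
qed

lemma eventually_at_right_0_fraction:
  fixes T :: real
  assumes "\<forall>\<^sub>F h in at_right 0. Q h" "0 < T"
  obtains N h where "0 < h" "real N * h = T" "Q h"
proof -
  have "(\<lambda>n. T * (1 / real (Suc n))) \<longlonglongrightarrow> T * 0" by (intro tendsto_intros LIMSEQ_Suc[OF lim_1_over_n])
  then have "filterlim (\<lambda>n. T * (1 / real (Suc n))) (at_right 0) sequentially"
    using assms(2) by (auto simp: filterlim_at intro!: always_eventually)
  from eventually_happens'[OF sequentially_bot eventually_compose_filterlim[OF assms(1) this]]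
  obtain n where "Q (T * (1 / real (Suc n)))" by blast
  then show ?thesis using assms(2) by (intro that[of "T * (1 / real (Suc n))" "Suc n"]) auto
qed

context switching begin

lemma exists_discretization:
  assumes \<kappa>_pos: "0 < \<kappa>" and M_nonneg: "0 \<le> M" and T_pos: "0 < T" and B_nonneg: "0 \<le> B"
    and drift_le: "\<And>k y. k \<in> {1..n0} \<Longrightarrow> norm y \<le> R + 3 \<Longrightarrow> norm (b y k) \<le> B"
  obtains \<tau> r h N B\<beta> where "0 < \<tau>" "0 < r" "r \<le> \<epsilon>0" "0 < h" "real N * h = T"
    "h * rate \<tau> r \<le> 1" "CA * (h * rate \<tau> r * M) \<le> \<kappa>"
    "\<And>k y. k \<in> {1..n0} \<Longrightarrow> norm y \<le> R + 3 \<Longrightarrow> norm (drift r (R + 3) y k) \<le> B\<beta>"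
    "\<tau> * B\<beta>\<^sup>2 \<le> 1" "c * (\<tau> * B\<beta>\<^sup>2) \<le> \<kappa>"
    "\<And>Z k x. bounded_test M (R + 2) Z \<Longrightarrow> k \<in> {1..n0} \<Longrightarrow> \<bar>gen Z k x - approx_gen \<tau> r (R + 3) Z x x k\<bar> \<le> \<kappa>"
proof -
  let ?consistent = "\<lambda>r \<tau>. \<forall>Z k x. bounded_test M (R + 2) Z \<longrightarrow> k \<in> {1..n0} \<longrightarrow>
    \<bar>gen Z k x - approx_gen \<tau> r (R + 3) Z x x k\<bar> \<le> \<kappa>"
  have "\<forall>\<^sub>F r in at_right 0. 0 < r \<and> 1 * r \<le> \<epsilon>0 \<and> (\<forall>\<^sub>F \<tau> in at_right 0. ?consistent r \<tau>)"
    using approx_gen_consistent[OF \<kappa>_pos M_nonneg, of "R + 2"] eps0_pos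
    by (intro eventually_conj eventually_at_right_less eventually_linear_le) (auto simp: add.assoc)
  then obtain r where r_small: "0 < r" "1 * r \<le> \<epsilon>0" "\<forall>\<^sub>F \<tau> in at_right 0. ?consistent r \<tau>"
    using eventually_happens'[OF trivial_limit_at_right_real] by blast
  define B\<beta> where "B\<beta> = B + \<epsilon>0 * tail_bound C\<nu> r"
  have "\<forall>\<^sub>F \<tau> in at_right 0. 0 < \<tau> \<and> B\<beta>\<^sup>2 * \<tau> \<le> 1 \<and> c * B\<beta>\<^sup>2 * \<tau> \<le> \<kappa> \<and> ?consistent r \<tau>"
    using r_small(3) \<kappa>_pos by (intro eventually_conj eventually_at_right_less eventually_linear_le) auto
  then obtain \<tau> where \<tau>_small: "0 < \<tau>" "B\<beta>\<^sup>2 * \<tau> \<le> 1" "c * B\<beta>\<^sup>2 * \<tau> \<le> \<kappa>" "?consistent r \<tau>"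
    using eventually_happens'[OF trivial_limit_at_right_real] by blast
  have small: "\<forall>\<^sub>F h in at_right 0. rate \<tau> r * h \<le> 1 \<and> CA * (rate \<tau> r * M) * h \<le> \<kappa>"
    using \<kappa>_pos by (intro eventually_conj eventually_linear_le) auto
  obtain N h where h_small: "0 < h" "real N * h = T" "rate \<tau> r * h \<le> 1 \<and> CA * (rate \<tau> r * M) * h \<le> \<kappa>"
    by (rule eventually_at_right_0_fraction[OF small T_pos]) (rule that)
  show ?thesis
  proof (rule that[of \<tau> r h N B\<beta>])
    show "norm (drift r (R + 3) y k) \<le> B\<beta>" if "k \<in> {1..n0}" "norm y \<le> R + 3" for k y
      unfolding B\<beta>_def using drift_le that by (intro norm_drift_le r_small B_nonneg) auto
  qed (use r_small \<tau>_small h_small in \<open>auto simp: mult_ac\<close>)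
qed

lemma lyap_controlled_near:
  assumes lyap: "lyap_controlled \<theta> R" and \<tau>_pos: "0 < \<tau>" and r_bounds: "0 < r" "r \<le> \<epsilon>0"
    and \<epsilon>_small: "0 < \<epsilon>" "2 * \<epsilon> \<le> 1" "4 * B * \<epsilon> \<le> 1"
    and b_le: "\<And>y. norm y \<le> R + 3 \<Longrightarrow> norm (b y k) \<le> B"
    and drift_norm_le: "\<And>y. norm y \<le> R + 3 \<Longrightarrow> norm (drift r (R + 3) y k) \<le> B\<beta>" "\<tau> * B\<beta>\<^sup>2 \<le> 1"
    and k_regime: "k \<in> {1..n0}" and x_le: "norm x \<le> R" and near: "norm (x - y) \<le> 2 * \<epsilon>"
  shows "approx_gen \<tau> r (R + 3) (\<lambda>_. log_lyap R) y x k \<le> \<theta>"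
proof -
  have y_le: "norm y \<le> R + 3" using norm_triangle_ineq2[of y x] near \<epsilon>_small(2) x_le by (simp add: norm_minus_commute)
  have "2 * norm (x - y) * norm (b y k) \<le> 2 * (2 * \<epsilon>) * B"
    using near b_le[OF y_le] \<epsilon>_small(1) by (intro mult_mono) auto
  moreover have "\<tau> * (norm (drift r (R + 3) y k))\<^sup>2 \<le> \<tau> * B\<beta>\<^sup>2"
    using drift_norm_le(1)[OF y_le] \<tau>_pos by (intro mult_left_mono power_mono) auto
  ultimately show ?thesis
    using near \<epsilon>_small(2,3) drift_norm_le(2) by (intro lyap_controlledD[OF lyap \<tau>_pos r_bounds k_regime x_le])
      (auto simp: mult_ac)
qed

lemma exists_coupled_iteration:
  assumes \<theta>_pos: "0 < \<theta>" and T_pos: "0 < T" and \<delta>_pos: "0 < \<delta>" and R_large: "0 < R" "lyap_controlled \<theta> R"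
    and g_unit: "unit_valued g" and g_lipschitz: "\<And>k. k \<in> {1..n0} \<Longrightarrow> L-lipschitz_on UNIV (g k)" and m_pos: "0 < m"
  obtains \<tau> r h N \<epsilon> B B\<beta> \<eta> M\<eta> CA where
    "coupled_iteration \<rho> n0 \<epsilon>0 H C\<nu> qmax a \<sigma> b \<nu> q \<tau> r h \<epsilon> R \<delta> Amax B B\<beta> \<theta> (5 * \<theta>) \<eta> M\<eta> g L CA \<theta>"
    "real N * h = T" "L * \<epsilon> \<le> m"
    "CA * (h * rate \<tau> r * (M\<eta> * measure lborel (cball 0 (R + 1) :: (real^'d) set))) \<le> \<theta>"
proof -
  obtain B where coefficients_le: "0 \<le> B" "\<And>k y. k \<in> {1..n0} \<Longrightarrow> norm y \<le> R + 3 \<Longrightarrow> norm (b y k) \<le> B \<and> norm (\<sigma> y k) \<le> B"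
    using coefficients_locally_bounded by blast
  then have b_le: "norm (b y k) \<le> B" if "k \<in> {1..n0}" "norm y \<le> R + 3" for k y using that by blast
  have "\<forall>\<^sub>F \<epsilon> in at_right 0. 0 < \<epsilon> \<and> 4 * \<epsilon> \<le> \<delta> \<and> 2 * \<epsilon> \<le> 1 \<and> 4 * B * \<epsilon> \<le> 1 \<and>
      Amax * 8 * B / \<delta> * \<epsilon> \<le> \<theta> \<and> 4 * (real n0 * H) * \<epsilon> \<le> \<theta> \<and> L * \<epsilon> \<le> m"
    using \<delta>_pos \<theta>_pos m_pos by (intro eventually_conj eventually_linear_le eventually_at_right_less) auto
  then obtain \<epsilon> where \<epsilon>_small: "0 < \<epsilon>" "4 * \<epsilon> \<le> \<delta>" "2 * \<epsilon> \<le> 1" "4 * B * \<epsilon> \<le> 1"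
    "Amax * 8 * B / \<delta> * \<epsilon> \<le> \<theta>" "4 * (real n0 * H) * \<epsilon> \<le> \<theta>" "L * \<epsilon> \<le> m"
    using eventually_happens'[OF trivial_limit_at_right_real] by blast
  obtain \<eta> :: "real^'d \<Rightarrow> real" where \<eta>_mollifier: "smooth_bounded \<eta>" "\<And>x. 0 \<le> \<eta> x" "\<And>x. \<epsilon> \<le> norm x \<Longrightarrow> \<eta> x = 0"
    "integrable lborel \<eta>" "(\<integral>x. \<eta> x \<partial>lborel) = 1" using exists_mollifier[OF \<epsilon>_small(1)] by blast
  obtain M\<eta> where M\<eta>_bound: "0 \<le> M\<eta>" "\<And>is x. length is \<le> 3 \<Longrightarrow> \<bar>iter_partial is \<eta> x\<bar> \<le> M\<eta>"
    using smooth_bounded_uniform_bound[OF \<eta>_mollifier(1)] by blast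
  obtain CA where gen_le: "\<And>M Z k x. bounded_test M (R + 2) Z \<Longrightarrow> k \<in> {1..n0} \<Longrightarrow> \<bar>gen Z k x\<bar> \<le> CA * M"
    using gen_bounded by blast
  let ?M = "M\<eta> * measure lborel (cball 0 (R + 1) :: (real^'d) set)"
  have M_nonneg: "0 \<le> ?M" using M\<eta>_bound(1) by simp
  obtain \<tau> r h N B\<beta> where \<tau>_pos: "0 < \<tau>" and r_bounds: "0 < r" "r \<le> \<epsilon>0" and h_small: "0 < h" "real N * h = T"
    and rate: "h * rate \<tau> r \<le> 1" "CA * (h * rate \<tau> r * ?M) \<le> \<theta>"
    and drift_norm_le: "\<And>k y. k \<in> {1..n0} \<Longrightarrow> norm y \<le> R + 3 \<Longrightarrow> norm (drift r (R + 3) y k) \<le> B\<beta>"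
      "\<tau> * B\<beta>\<^sup>2 \<le> 1" "Amax * 2 / \<delta> * (\<tau> * B\<beta>\<^sup>2) \<le> \<theta>"
    and consistent: "\<And>Z k x. bounded_test ?M (R + 2) Z \<Longrightarrow> k \<in> {1..n0} \<Longrightarrow>
      \<bar>gen Z k x - approx_gen \<tau> r (R + 3) Z x x k\<bar> \<le> \<theta>"
    by (rule exists_discretization[OF \<theta>_pos M_nonneg T_pos coefficients_le(1) b_le, where c="Amax * 2 / \<delta>"
      and CA=CA]) (assumption, assumption, rule that)
  have lyap: "approx_gen \<tau> r (R + 3) (\<lambda>_. log_lyap R) y x k \<le> \<theta>"
    if "k \<in> {1..n0}" "norm x \<le> R" "norm (x - y) \<le> 2 * \<epsilon>" for k x y
    by (rule lyap_controlled_near[OF R_large(2) \<tau>_pos r_bounds \<epsilon>_small(1,3,4) b_le[OF that(1)]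
      drift_norm_le(1)[OF that(1)] drift_norm_le(2) that])
  have error: "Amax * ((8 * \<epsilon> * B + 2 * \<tau> * B\<beta>\<^sup>2) / \<delta>) + 2 * \<theta> + 4 * (real n0 * H) * \<epsilon> \<le> 5 * \<theta>"
    using \<epsilon>_small(5,6) drift_norm_le(3) by (simp add: add_divide_distrib distrib_left mult_ac)
  interpret mollified_scheme \<rho> n0 \<epsilon>0 H C\<nu> qmax a \<sigma> b \<nu> q \<tau> r h \<epsilon> R \<eta> M\<eta>
    using \<tau>_pos r_bounds h_small(1) \<epsilon>_small(1,3) rate(1) \<eta>_mollifier M\<eta>_bound(2) by unfold_locales auto
  have "coupled_iteration \<rho> n0 \<epsilon>0 H C\<nu> qmax a \<sigma> b \<nu> q \<tau> r h \<epsilon> R \<delta> Amax B B\<beta> \<theta> (5 * \<theta>) \<eta> M\<eta> g L CA \<theta>"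
    using R_large(1) \<delta>_pos \<epsilon>_small(2,3) b_le drift_norm_le(1) lyap \<theta>_pos error g_unit g_lipschitz gen_le
      consistent by unfold_locales (auto simp: moll_bound_def)
  then show ?thesis using that \<epsilon>_small(7) rate(2) \<open>real N * h = T\<close> by blast
qed

lemma mean_equicontinuous:
  assumes T_pos: "0 < T" and \<kappa>_pos: "0 < \<kappa>" and g_unit: "unit_valued g"
    and g_lipschitz: "\<And>k. k \<in> {1..n0} \<Longrightarrow> L-lipschitz_on UNIV (g k)"
  obtains s where "0 < s" "\<And>x z k P P'. norm x \<le> X \<Longrightarrow> norm z \<le> X \<Longrightarrow> norm (x - z) < s \<Longrightarrow> k \<in> {1..n0} \<Longrightarrow>
    solution (x, k) P \<Longrightarrow> solution (z, k) P' \<Longrightarrow> mean P T g - mean P' T g \<le> \<kappa>"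
proof -
  define A0 where "A0 = max 1 L"
  define \<theta> where "\<theta> = \<kappa> / (64 * T)"
  have \<theta>_choice: "0 < \<theta>" "T * \<theta> = \<kappa> / 64" using \<kappa>_pos T_pos by (simp_all add: \<theta>_def)
  have A0_bounds: "1 \<le> A0" "L \<le> A0" by (auto simp: A0_def)
  have "0 < \<kappa> / (8 * A0)" using \<kappa>_pos A0_bounds by simp
  then obtain s0 where s0_small: "0 < s0"
    "\<And>h n. 0 \<le> h \<Longrightarrow> real n * h \<le> coupling_const * T \<Longrightarrow> euler_seq h s0 n \<le> \<kappa> / (8 * A0)"
    by (rule euler_seq_small) (rule that)
  define Amax where "Amax = A0 * exp (coupling_const * (\<rho> s0 / s0) * T)"
  have "\<forall>\<^sub>F R in at_top. 0 < R \<and> lyap_controlled \<theta> R \<and> ln (1 + (X + 1)\<^sup>2) / ln (1 + R\<^sup>2) \<le> \<kappa> / 16"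
    using \<kappa>_pos \<theta>_choice(1)
    by (intro eventually_conj eventually_gt_at_top eventually_lyap_controlled eventually_divide_ln_le) auto
  then obtain R where R_large: "0 < R" "lyap_controlled \<theta> R" "ln (1 + (X + 1)\<^sup>2) / ln (1 + R\<^sup>2) \<le> \<kappa> / 16"
    using eventually_happens'[OF trivial_limit_at_top_linorder] by blast
  have pos: "0 < s0 / 4" "0 < \<kappa> / 64" using s0_small(1) \<kappa>_pos by auto
  obtain \<tau> r h N \<epsilon> B B\<beta> \<eta> M\<eta> CA where coupled:
      "coupled_iteration \<rho> n0 \<epsilon>0 H C\<nu> qmax a \<sigma> b \<nu> q \<tau> r h \<epsilon> R (s0 / 4) Amax B B\<beta> \<theta> (5 * \<theta>) \<eta> M\<eta> g L CA \<theta>"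
    and time_eq: "real N * h = T" and L\<epsilon>_le: "L * \<epsilon> \<le> \<kappa> / 64"
    and error_small: "CA * (h * rate \<tau> r * (M\<eta> * measure lborel (cball 0 (R + 1) :: (real^'d) set))) \<le> \<theta>"
    by (rule exists_coupled_iteration[OF \<theta>_choice(1) T_pos pos(1) R_large(1,2) g_unit g_lipschitz pos(2)])
      (assumption, rule that)
  interpret coupled_iteration \<rho> n0 \<epsilon>0 H C\<nu> qmax a \<sigma> b \<nu> q \<tau> r h \<epsilon> R "s0 / 4" Amax B B\<beta> \<theta> "5 * \<theta>" \<eta> M\<eta> g L CA \<theta>
    by (rule coupled)
  have "mean P T g - mean P' T g \<le> \<kappa>"
    if "norm x \<le> X" "norm z \<le> X" "norm (x - z) < s0 / 4" "k \<in> {1..n0}" "solution (x, k) P" "solution (z, k) P'"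
      for x z k P P'
  proof -
    have close: "norm (x - z) + 2 * \<epsilon> + s0 / 4 \<le> s0" using that(3) delta(2) s0_small(1) by linarith
    have "real N * (h * coupling_const) = coupling_const * T" unfolding time_eq[symmetric] by (simp only: mult_ac)
    then have "A0 * euler_seq (h * coupling_const) s0 N \<le> A0 * (\<kappa> / (8 * A0))"
      using h_pos coupling_const_nonneg A0_bounds by (intro mult_left_mono s0_small(2)) auto
    moreover have "A0 * (\<kappa> / (8 * A0)) = \<kappa> / 8" using A0_bounds by simp
    moreover have "T * err \<le> T * (2 * \<theta>)"
      using error_small T_pos by (intro mult_left_mono) (auto simp: err_def moll_bound_def)
    moreover have "mean P T g - mean P' T g \<le> A0 * euler_seq (h * coupling_const) s0 N + T * (5 * \<theta>)
        + 2 * (ln (1 + (X + 1)\<^sup>2) / ln (1 + R\<^sup>2)) + 2 * (L * \<epsilon> + T * err)"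
      using mean_diff_le[OF A0_bounds s0_small(1) _ that(4-6) close that(1,2), of N]
      by (simp add: Amax_def time_eq flip: mult.assoc)
    ultimately show ?thesis using R_large(3) L\<epsilon>_le \<theta>_choice(2) \<kappa>_pos unfolding distrib_left[of 2] by linarith
  qed
  then show ?thesis using s0_small(1) by (intro that[of "s0 / 4"]) auto
qed

end

section \<open>The Feller property\<close>

definition inf_conv :: "real \<Rightarrow> ('a::real_normed_vector \<Rightarrow> real) \<Rightarrow> 'a \<Rightarrow> real" where
  "inf_conv m f x = (INF y. f y + m * norm (x - y))"

context
  fixes f :: "'a::real_normed_vector \<Rightarrow> real" and m :: real
  assumes f_nonneg: "\<And>x. 0 \<le> f x" and m_nonneg: "0 \<le> m"
begin

lemma inf_conv_le: "inf_conv m f x \<le> f y + m * norm (x - y)"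
  unfolding inf_conv_def
  by (intro cINF_lower bdd_belowI2[of _ 0]) (auto intro!: add_nonneg_nonneg mult_nonneg_nonneg f_nonneg m_nonneg)

lemma inf_conv_ge: "(\<And>y. c \<le> f y + m * norm (x - y)) \<Longrightarrow> c \<le> inf_conv m f x"
  unfolding inf_conv_def by (intro cINF_greatest) auto

lemma inf_conv_nonneg: "0 \<le> inf_conv m f x"
  by (auto intro!: inf_conv_ge add_nonneg_nonneg mult_nonneg_nonneg f_nonneg m_nonneg)

lemma inf_conv_le_self: "inf_conv m f x \<le> f x"
  using inf_conv_le[of x x] by simp

lemma inf_conv_lipschitz: "m-lipschitz_on UNIV (inf_conv m f)"
proof (rule lipschitz_on_UNIV_realI[OF m_nonneg])
  fix x z
  have "inf_conv m f x - m * norm (x - z) \<le> inf_conv m f z"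
  proof (rule inf_conv_ge)
    fix y
    have "m * norm (x - y) \<le> m * (norm (x - z) + norm (z - y))"
      using norm_triangle_ineq[of "x - z" "z - y"] m_nonneg by (intro mult_left_mono) auto
    then show "inf_conv m f x - m * norm (x - z) \<le> f y + m * norm (z - y)"
      using inf_conv_le[of x y] by (simp add: distrib_left)
  qed
  then show "inf_conv m f x \<le> inf_conv m f z + m * norm (x - z)" by simp
qed

end

lemma inf_conv_tendsto:
  fixes f :: "'a::real_normed_vector \<Rightarrow> real"
  assumes f_bounds: "\<And>x. 0 \<le> f x" "\<And>x. f x \<le> M" and cont: "isCont f x"
  shows "(\<lambda>n. inf_conv (real n) f x) \<longlonglongrightarrow> f x"
proof (rule order_tendstoI)
  fix c assume "c < f x"
  then obtain c' where c'_between: "c < c'" "c' < f x" using dense by blast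
  have "(f \<longlongrightarrow> f x) (nhds x)" using cont by (simp add: isCont_def tendsto_at_iff_tendsto_nhds)
  then have "\<forall>\<^sub>F y in nhds x. c' < f y" by (rule order_tendstoD(1)[OF _ c'_between(2)])
  then obtain d where d_near: "0 < d" "\<And>y. dist y x < d \<Longrightarrow> c' < f y" unfolding eventually_nhds_metric by blast
  have "\<forall>\<^sub>F n in sequentially. M / d \<le> real n"
    using filterlim_real_sequentially unfolding filterlim_at_top by blast
  then show "\<forall>\<^sub>F n in sequentially. c < inf_conv (real n) f x"
  proof (rule eventually_mono)
    fix n assume n_large: "M / d \<le> real n"
    have "c' \<le> inf_conv (real n) f x"
    proof (rule inf_conv_ge)
      fix y
      show "c' \<le> f y + real n * norm (x - y)"
      proof (cases "dist y x < d")
        case True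
        then show ?thesis using d_near(2)[of y] by (simp add: add_increasing2)
      next
        case False
        then have "M \<le> real n * norm (x - y)"
          using n_large d_near(1) mult_left_mono[of d "norm (x - y)" "real n"]
          by (simp add: divide_le_eq dist_norm norm_minus_commute)
        then show ?thesis using c'_between(2) f_bounds(2)[of x] f_bounds(1)[of y] by linarith
      qed
    qed (simp_all add: f_bounds)
    then show "c < inf_conv (real n) f x" using c'_between(1) by linarith
  qed
next
  fix c assume "f x < c"
  then have "inf_conv (real n) f x < c" for n
    using inf_conv_le_self[of f "real n" x] f_bounds(1) by simp
  then show "\<forall>\<^sub>F n in sequentially. inf_conv (real n) f x < c" by simp
qed

lemma continuous_on_Times_discrete:
  fixes h :: "'a::topological_space \<times> 'b::discrete_topology \<Rightarrow> 'c::topological_space"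
  assumes "\<And>k. k \<in> K \<Longrightarrow> continuous_on UNIV (\<lambda>x. h (x, k))"
  shows "continuous_on (UNIV \<times> K) h"
proof -
  have "continuous_on (\<Union>k\<in>K. UNIV \<times> {k}) h"
  proof (rule continuous_on_open_UN)
    fix k assume "k \<in> K"
    show "open (UNIV \<times> {k} :: ('a \<times> 'b) set)" by (intro open_Times open_UNIV Topological_Spaces.open_discrete)
    have "continuous_on (UNIV \<times> {k}) (\<lambda>p. h (fst p, k))"
      by (rule continuous_on_compose2[OF assms[OF \<open>k \<in> K\<close>] continuous_on_fst[OF continuous_on_id]]) simp
    then show "continuous_on (UNIV \<times> {k}) h" by (rule continuous_on_eq) auto
  qed
  moreover have "(\<Union>k\<in>K. UNIV \<times> {k}) = (UNIV \<times> K :: ('a \<times> 'b) set)" by auto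
  ultimately show ?thesis by simp
qed

context switching begin

lemma integral_eq_mean:
  assumes P_solution: "solution e P" shows "(\<integral>\<omega>. f (\<omega> t) \<partial>P) = mean P t (\<lambda>k x. f (x, k))"
  unfolding mean_def
proof (rule Bochner_Integration.integral_cong[OF refl])
  fix \<omega> assume "\<omega> \<in> space P"
  then have "\<omega> t \<in> UNIV \<times> {1..n0}" by (rule martingale_solution.value_in[OF martingale_solution[OF P_solution]])
  then show "f (\<omega> t) = joint (\<lambda>k x. f (x, k)) (\<omega> t)" by (rule joint_cases) simp
qed

lemma mean_tendsto:
  assumes P_solution: "solution e P" and t_nonneg: "0 \<le> t" and bounded: "\<And>n. bounded_by M (f n)"
    and g_bounded: "bounded_by M g"
    and lim: "\<And>k x. k \<in> {1..n0} \<Longrightarrow> (\<lambda>n. f n k x) \<longlonglongrightarrow> g k x"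
  shows "(\<lambda>n. mean P t (f n)) \<longlonglongrightarrow> mean P t g"
  unfolding mean_def
proof (rule integral_dominated_convergence[where w="\<lambda>_. M"])
  interpret martingale_solution "UNIV \<times> {1..n0}" "test_A n0" "gen_A n0 a b \<nu> \<epsilon>0 q" e P
    by (rule martingale_solution[OF P_solution])
  show "(\<lambda>\<omega>. joint g (\<omega> t)) \<in> borel_measurable P" "(\<lambda>\<omega>. joint (f n) (\<omega> t)) \<in> borel_measurable P" for n
    using integrable_joint[OF P_solution t_nonneg g_bounded] integrable_joint[OF P_solution t_nonneg
      bounded[of n]] by auto
  show "integrable P (\<lambda>_. M)" by simp
  have "(\<lambda>n. joint (f n) (\<omega> t)) \<longlonglongrightarrow> joint g (\<omega> t)" if "\<omega> \<in> space P" for \<omega>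
    by (rule joint_cases[OF value_in[OF that, of t]]) (simp add: lim)
  then show "AE \<omega> in P. (\<lambda>n. joint (f n) (\<omega> t)) \<longlonglongrightarrow> joint g (\<omega> t)" by (rule AE_I2)
  have "\<bar>joint (f n) (\<omega> t)\<bar> \<le> M" if "\<omega> \<in> space P" for \<omega> n
    by (rule joint_cases[OF value_in[OF that, of t]]) (use bounded[of n] in \<open>simp add: bounded_by_def\<close>)
  then show "AE \<omega> in P. norm (joint (f n) (\<omega> t)) \<le> M" for n by (intro AE_I2) simp
qed

context
  fixes P :: "real^'d \<Rightarrow> nat \<Rightarrow> (real \<Rightarrow> (real^'d) \<times> nat) measure" and t :: real
  assumes P_solution: "\<And>x k. k \<in> {1..n0} \<Longrightarrow> solution (x, k) (P x k)" and t_pos: "0 < t"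
begin

lemma mean_lower_semicontinuous:
  assumes F_unit: "unit_valued F" and cont: "\<And>k x. k \<in> {1..n0} \<Longrightarrow> isCont (F k) x"
    and k_regime: "k \<in> {1..n0}" and e_pos: "0 < e"
  shows "\<forall>\<^sub>F z in at x. mean (P x k) t F - e < mean (P z k) t F"
proof -
  let ?F = "\<lambda>n l. inf_conv (real n) (F l)"
  have lipschitz: "(real n)-lipschitz_on UNIV (?F n l)" if "l \<in> {1..n0}" for n l
    using unit_valuedD(2)[OF F_unit that] by (intro inf_conv_lipschitz) auto
  have below: "0 \<le> ?F n l y" "?F n l y \<le> F l y" if "l \<in> {1..n0}" for n l y
    using unit_valuedD(2)[OF F_unit that] by (auto intro: inf_conv_nonneg inf_conv_le_self)
  have unit: "unit_valued (?F n)" for n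
    unfolding unit_valued_def
    using lipschitz_on_UNIV_measurable[OF lipschitz] below order.trans[OF below(2) unit_valuedD(3)[OF F_unit]]
    by blast
  have "(\<lambda>n. mean (P x k) t (?F n)) \<longlonglongrightarrow> mean (P x k) t F"
    by (rule mean_tendsto[OF P_solution[OF k_regime] less_imp_le[OF t_pos] unit_valued_bounded_by[OF unit]
      unit_valued_bounded_by[OF F_unit]])
      (rule inf_conv_tendsto[OF unit_valuedD(2,3)[OF F_unit] cont])
  then have "\<forall>\<^sub>F n in sequentially. mean (P x k) t F - e / 2 < mean (P x k) t (?F n)"
    by (rule order_tendstoD(1)) (use e_pos in simp)
  then obtain n where n_close: "mean (P x k) t F - e / 2 < mean (P x k) t (?F n)"
    using eventually_happens'[OF sequentially_bot] by blast
  have "0 < e / 2" using e_pos by simp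
  then obtain s where s_small: "0 < s" "\<And>x' z k P P'. norm x' \<le> norm x + 1 \<Longrightarrow> norm z \<le> norm x + 1 \<Longrightarrow> norm (x' - z) < s \<Longrightarrow>
      k \<in> {1..n0} \<Longrightarrow> solution (x', k) P \<Longrightarrow> solution (z, k) P' \<Longrightarrow> mean P t (?F n) - mean P' t (?F n) \<le> e / 2"
    by (rule mean_equicontinuous[OF t_pos _ unit lipschitz]) (assumption, rule that)
  have "mean (P x k) t F - e < mean (P z k) t F" if "dist z x < min s 1" for z
  proof -
    have "norm z \<le> norm x + 1" using that norm_triangle_ineq2[of z x] by (simp add: dist_norm)
    then have "mean (P x k) t (?F n) - mean (P z k) t (?F n) \<le> e / 2"
      using that by (intro s_small(2)[OF _ _ _ k_regime P_solution[OF k_regime] P_solution[OF k_regime]])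
        (auto simp: dist_norm norm_minus_commute)
    moreover have "mean (P z k) t (?F n) \<le> mean (P z k) t F"
      using t_pos below(2)
      by (intro mean_mono[OF P_solution[OF k_regime] _ unit_valued_bounded_by[OF unit]
        unit_valued_bounded_by[OF F_unit]]) auto
    ultimately show ?thesis using n_close by linarith
  qed
  then show ?thesis unfolding eventually_at using s_small(1) by (intro exI[of _ "min s 1"]) auto
qed

lemma mean_continuous_unit:
  assumes F_unit: "unit_valued F" and cont: "\<And>k x. k \<in> {1..n0} \<Longrightarrow> isCont (F k) x" and k_regime: "k \<in> {1..n0}"
  shows "isCont (\<lambda>x. mean (P x k) t F) x"
  unfolding isCont_def
proof (rule order_tendstoI)
  fix c assume "c < mean (P x k) t F"
  then show "\<forall>\<^sub>F z in at x. c < mean (P z k) t F"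
    using mean_lower_semicontinuous[OF F_unit cont k_regime, of "mean (P x k) t F - c" x] by simp
next
  fix c assume c_gt: "mean (P x k) t F < c"
  have compl: "mean (P z k) t (\<lambda>k x. 1 - F k x) = 1 - mean (P z k) t F" for z
    using mean_affine[OF P_solution[OF k_regime] _ unit_valued_bounded_by[OF F_unit], where \<alpha>="-1" and c=1]
      t_pos by simp
  show "\<forall>\<^sub>F z in at x. mean (P z k) t F < c"
    using mean_lower_semicontinuous[OF unit_valued_compl[OF F_unit] _ k_regime, of "c - mean (P x k) t F" x] c_gt cont
    unfolding compl by (simp add: continuous_diff)
qed

theorem feller:
  fixes f :: "(real^'d) \<times> nat \<Rightarrow> real"
  assumes f_continuous_bounded: "continuous_on (UNIV \<times> {1..n0}) f" "bounded (f ` (UNIV \<times> {1..n0}))"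
  shows "continuous_on (UNIV \<times> {1..n0}) (\<lambda>(x, k). \<integral>\<omega>. f (\<omega> t) \<partial>(P x k))"
proof (rule continuous_on_Times_discrete)
  fix k assume k_regime: "k \<in> {1..n0}"
  obtain M where f_le: "0 < M" "\<And>x k. k \<in> {1..n0} \<Longrightarrow> \<bar>f (x, k)\<bar> \<le> M"
    using f_continuous_bounded(2) unfolding bounded_pos by auto
  define F where "F k x = (f (x, k) + M) / (2 * M)" for k x
  have cont: "continuous_on UNIV (F k)" if "k \<in> {1..n0}" for k
  proof -
    have "continuous_on UNIV (\<lambda>x. f (x, k))"
      by (rule continuous_on_compose2[OF f_continuous_bounded(1)]) (use that in \<open>auto intro!: continuous_intros\<close>)
    then show ?thesis unfolding F_def using f_le(1) by (intro continuous_intros) auto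
  qed
  have unit: "unit_valued F"
    unfolding unit_valued_def
  proof (intro ballI conjI allI)
    fix k x assume k_regime: "k \<in> {1..n0}"
    show "F k \<in> borel_measurable borel" by (rule borel_measurable_continuous_onI[OF cont[OF k_regime]])
    show "0 \<le> F k x" "F k x \<le> 1" using f_le(1) f_le(2)[OF k_regime, of x]
      by (auto simp: F_def divide_le_eq intro!: divide_nonneg_pos)
  qed
  have "f (x, k) = 2 * M * F k x + - M" for x k using f_le(1) by (simp add: F_def)
  then have "(\<integral>\<omega>. f (\<omega> t) \<partial>P x k) = 2 * M * mean (P x k) t F + - M" for x
    using mean_affine[OF P_solution[OF k_regime] _ unit_valued_bounded_by[OF unit], where \<alpha>="2 * M" and c="- M"] t_pos
    by (simp add: integral_eq_mean[OF P_solution[OF k_regime]])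
  moreover have "isCont (\<lambda>x. mean (P x k) t F) x" for x
    using cont by (intro mean_continuous_unit unit k_regime) (simp add: continuous_on_eq_continuous_at)
  ultimately show "continuous_on UNIV (\<lambda>x. case (x, k) of (x, k) \<Rightarrow> \<integral>\<omega>. f (\<omega> t) \<partial>P x k)"
    by (auto intro!: continuous_at_imp_continuous_on continuous_intros)
qed

end

end

lemma abs_entry_le_neg_diagonal:
  fixes q :: "'a \<Rightarrow> 'a \<Rightarrow> real"
  assumes "finite K" "k \<in> K" "l \<in> K" and nonneg: "\<And>m. m \<in> K \<Longrightarrow> m \<noteq> k \<Longrightarrow> 0 \<le> q k m" and row: "(\<Sum>m\<in>K. q k m) = 0"
  shows "\<bar>q k l\<bar> \<le> - q k k"
proof -
  have diagonal: "(\<Sum>m\<in>K - {k}. q k m) = - q k k" using sum.remove[OF assms(1,2), of "q k"] row by simp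
  show ?thesis
  proof (cases "l = k")
    case True
    have "0 \<le> (\<Sum>m\<in>K - {k}. q k m)" using nonneg by (intro sum_nonneg) auto
    then show ?thesis using True diagonal by simp
  next
    case False
    then have "q k l \<le> (\<Sum>m\<in>K - {k}. q k m)" using assms by (intro member_le_sum) auto
    then show ?thesis using False nonneg[OF assms(3)] diagonal by simp
  qed
qed

lemma bounded_rates:
  fixes q :: "'x \<Rightarrow> 'a \<Rightarrow> 'a \<Rightarrow> real"
  assumes "finite K" and below: "\<And>k. k \<in> K \<Longrightarrow> \<exists>c. \<forall>x. c \<le> q x k k"
    and nonneg: "\<And>x k l. k \<in> K \<Longrightarrow> l \<in> K \<Longrightarrow> k \<noteq> l \<Longrightarrow> 0 \<le> q x k l"
    and rows: "\<And>x k. k \<in> K \<Longrightarrow> (\<Sum>l\<in>K. q x k l) = 0"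
  obtains qmax where "0 \<le> qmax" "\<And>x k l. k \<in> K \<Longrightarrow> l \<in> K \<Longrightarrow> \<bar>q x k l\<bar> \<le> qmax"
proof -
  obtain qmax where qmax: "0 \<le> qmax" "\<And>k. k \<in> K \<Longrightarrow> \<forall>x. - q x k k \<le> qmax"
  proof (rule finite_common_bound[OF assms(1)])
    show "\<exists>c. \<forall>x. - q x k k \<le> c" if "k \<in> K" for k using below[OF that] by (metis neg_le_iff_le)
    show "\<forall>x. - q x k k \<le> c'" if "\<forall>x. - q x k k \<le> c" "c \<le> c'" for k c c' using that by (meson order.trans)
  qed (rule that)
  have "\<bar>q x k l\<bar> \<le> qmax" if "k \<in> K" "l \<in> K" for x k l
    using abs_entry_le_neg_diagonal[of K k l "q x"] assms(1) that nonneg rows qmax(2)[OF that(1)]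
    by (metis order.trans)
  with qmax(1) show ?thesis by (rule that)
qed

theorem theorem4p4:
  fixes n0 :: nat and \<epsilon>0 H :: real
    and a :: "real^'d::finite \<Rightarrow> nat \<Rightarrow> real^'d^'d"
    and b :: "real^'d \<Rightarrow> nat \<Rightarrow> real^'d"
    and \<nu> :: "real^'d \<Rightarrow> nat \<Rightarrow> (real^'d) measure"
    and q :: "real^'d \<Rightarrow> nat \<Rightarrow> nat \<Rightarrow> real"
    and \<rho> :: "real \<Rightarrow> real"
    and P :: "real^'d \<Rightarrow> nat \<Rightarrow> (real \<Rightarrow> (real^'d) \<times> nat) measure"
  assumes n0: "n0 \<ge> 1" and eps0: "\<epsilon>0 > 0"
    and a_sym: "\<forall>x. \<forall>k\<in>{1..n0}. transpose (a x k) = a x k"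
    and a_psd: "\<forall>x. \<forall>k\<in>{1..n0}. \<forall>v. 0 \<le> v \<bullet> (a x k *v v)"
    and a_meas: "\<forall>k\<in>{1..n0}. (\<lambda>x. a x k) \<in> borel_measurable borel"
    and b_meas: "\<forall>k\<in>{1..n0}. (\<lambda>x. b x k) \<in> borel_measurable borel"
    and \<nu>_sets: "\<forall>x. \<forall>k\<in>{1..n0}. sets (\<nu> x k) = sets borel"
    and \<nu>_zero: "\<forall>x. \<forall>k\<in>{1..n0}. emeasure (\<nu> x k) {0} = 0"
    and \<nu>_sfin: "\<forall>x. \<forall>k\<in>{1..n0}. sigma_finite_measure (\<nu> x k)"
    and \<nu>_small: "\<forall>x. \<forall>k\<in>{1..n0}.
        (\<integral>\<^sup>+u. ennreal ((norm u)\<^sup>2) * indicator (ball 0 \<epsilon>0) u \<partial>(\<nu> x k)) < \<infinity>"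
    and \<nu>_large: "\<forall>x. \<forall>k\<in>{1..n0}. emeasure (\<nu> x k) (UNIV - ball 0 \<epsilon>0) < \<infinity>"
    and \<nu>_meas: "\<forall>k\<in>{1..n0}. \<forall>A\<in>sets borel. (\<lambda>x. emeasure (\<nu> x k) A) \<in> borel_measurable borel"
    and q_meas: "\<forall>k\<in>{1..n0}. \<forall>l\<in>{1..n0}. (\<lambda>x. q x k l) \<in> borel_measurable borel"
    and q_nonneg: "\<forall>x. \<forall>k\<in>{1..n0}. \<forall>l\<in>{1..n0}. k \<noteq> l \<longrightarrow> q x k l \<ge> 0"
    and q_rows: "\<forall>x. \<forall>k\<in>{1..n0}. (\<Sum>l\<in>{1..n0}. q x k l) = 0"
    and A_i: "\<forall>k\<in>{1..n0}. \<forall>x. \<exists>!Q. mp_solution UNIV C_c_inf (gen_L a b \<nu> \<epsilon>0 k) x Q"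
    and A_ii: "\<forall>k\<in>{1..n0}. \<exists>c. \<forall>x. c \<le> q x k k"
    and A_iii: "\<exists>C. \<forall>x. \<forall>k\<in>{1..n0}.
        (\<integral>\<^sup>+y. ennreal (min 1 ((norm y)\<^sup>2)) \<partial>(\<nu> x k)) \<le> ennreal C"
    and H_pos: "H > 0"
    and \<rho>_mono: "mono_on {0..} \<rho>" and \<rho>_concave: "concave_on {0..} \<rho>"
    and \<rho>_nonneg: "\<forall>r\<ge>0. \<rho> r \<ge> 0" and \<rho>_pos: "\<forall>r>0. \<rho> r > 0"
    and \<rho>_osgood: "\<forall>c>0. (\<integral>\<^sup>+r. indicator {0<..c} r * ennreal (1 / \<rho> r) \<partial>lborel) = \<infinity>"
    and F1_diff: "\<exists>\<sigma> :: real^'d \<Rightarrow> nat \<Rightarrow> real^'d^'d.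
        (\<forall>x. \<forall>k\<in>{1..n0}. \<sigma> x k ** transpose (\<sigma> x k) = a x k) \<and>
        (\<forall>k\<in>{1..n0}. \<forall>x z. (norm (\<sigma> x k - \<sigma> z k))\<^sup>2 + 2 * ((x - z) \<bullet> (b x k - b z k))
            \<le> H * norm (x - z) * \<rho> (norm (x - z)))"
    and F1_jump: "\<forall>k\<in>{1..n0}. \<forall>x z.
        tv_nn_integral (\<lambda>u. ennreal (norm u)) (\<nu> x k) (\<nu> z k) \<le> ennreal (H * \<rho> (norm (x - z)))"
    and F2: "\<forall>k\<in>{1..n0}. \<forall>l\<in>{1..n0}. k \<noteq> l \<longrightarrow>
        (\<forall>x z. \<bar>q x k l - q z k l\<bar> \<le> H * norm (x - z))"
    and P_sol: "\<forall>x. \<forall>k\<in>{1..n0}.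
        mp_solution (UNIV \<times> {1..n0}) (test_A n0) (gen_A n0 a b \<nu> \<epsilon>0 q) (x, k) (P x k)"
  shows "\<forall>t>0. \<forall>f :: (real^'d) \<times> nat \<Rightarrow> real.
           continuous_on (UNIV \<times> {1..n0}) f \<longrightarrow> bounded (f ` (UNIV \<times> {1..n0})) \<longrightarrow>
           continuous_on (UNIV \<times> {1..n0}) (\<lambda>(x, k). \<integral>\<omega>. f (\<omega> t) \<partial>(P x k))"
proof (intro allI impI)
  fix t :: real and f :: "(real^'d) \<times> nat \<Rightarrow> real"
  assume t_pos: "0 < t" and f_bounded_continuous: "continuous_on (UNIV \<times> {1..n0}) f" "bounded (f ` (UNIV \<times> {1..n0}))"
  obtain \<sigma> :: "real^'d \<Rightarrow> nat \<Rightarrow> real^'d^'d"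
    where \<sigma>_factor: "\<forall>x. \<forall>k\<in>{1..n0}. \<sigma> x k ** transpose (\<sigma> x k) = a x k"
      "\<forall>k\<in>{1..n0}. \<forall>x z. (norm (\<sigma> x k - \<sigma> z k))\<^sup>2 + 2 * ((x - z) \<bullet> (b x k - b z k))
        \<le> H * norm (x - z) * \<rho> (norm (x - z))"
    using F1_diff by blast
  obtain C where levy_bound: "\<forall>x. \<forall>k\<in>{1..n0}. (\<integral>\<^sup>+y. ennreal (min 1 ((norm y)\<^sup>2)) \<partial>(\<nu> x k)) \<le> ennreal C"
    using A_iii by blast
  have "ennreal C \<le> ennreal (max 0 C)" by (intro ennreal_leI) simp
  with levy_bound have levy_bound_nonneg: "(\<integral>\<^sup>+y. ennreal (min 1 ((norm y)\<^sup>2)) \<partial>(\<nu> x k)) \<le> ennreal (max 0 C)"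
    if "k \<in> {1..n0}" for x k
    using that order.trans by blast
  obtain qmax where qmax: "0 \<le> qmax" "\<And>x k l. k \<in> {1..n0} \<Longrightarrow> l \<in> {1..n0} \<Longrightarrow> \<bar>q x k l\<bar> \<le> qmax"
    using bounded_rates[of "{1..n0}" q] A_ii q_nonneg q_rows by blast
  interpret switching \<rho> n0 \<epsilon>0 H "max 0 C" qmax a \<sigma> b \<nu> q
    by (intro switching.intro switching_axioms.intro osgood_modulus.intro osgood_modulus_axioms.intro
      concave_modulus.intro)
      (simp_all only: eps0 H_pos \<rho>_mono \<rho>_concave \<rho>_nonneg \<rho>_pos \<rho>_osgood a_meas b_meas \<nu>_sets \<nu>_sfin \<nu>_meas
        q_meas q_nonneg qmax levy_bound_nonneg \<sigma>_factor F1_jump F2 max.cobounded1 not_False_eq_True simp_thms)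
  show "continuous_on (UNIV \<times> {1..n0}) (\<lambda>(x, k). \<integral>\<omega>. f (\<omega> t) \<partial>(P x k))"
    using P_sol t_pos f_bounded_continuous by (intro feller) auto
qed

end
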